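(* Let $(R,\mathfrak m)$ be a two-dimensional Noetherian complete local ring which satisfies Serre's condition $(R_0)$. If $\operatorname{e}(R)>1$, then there exists $\epsilon>0$ such that $\operatorname{e}(I)\le 2(\operatorname{e}(R)-\epsilon)\ell(R/I)$ for all $\mathfrak m$-primary ideals $I$ of $R$.
   Context: $\operatorname{e}(I)=\lim_{n\to\infty} d!\,\ell(R/I^n)/n^d$ is the Hilbert--Samuel multiplicity of an $\mathfrak m$-primary ideal $I$ in a local ring of dimension $d$, and $\operatorname{e}(R)=\operatorname{e}(\mathfrak m)$. $(R_0)$ means $R_P$ is regular (a field) for every minimal prime $P$. *)

theory Defs
  imports Complex_Main
begin

definition is_ideal :: "'a::comm_ring_1 set \<Rightarrow> bool" where
  "is_ideal I \<longleftrightarrow> 0 \<in> I \<and> (\<forall>x\<in>I. \<forall>y\<in>I. x + y \<in> I) \<and> (\<forall>r. \<forall>x\<in>I. r * x \<in> I)"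

definition prime_ideal :: "'a::comm_ring_1 set \<Rightarrow> bool" where
  "prime_ideal P \<longleftrightarrow> is_ideal P \<and> P \<noteq> UNIV \<and> (\<forall>a b. a * b \<in> P \<longrightarrow> a \<in> P \<or> b \<in> P)"

definition maximal_ideal :: "'a::comm_ring_1 set \<Rightarrow> bool" where
  "maximal_ideal M \<longleftrightarrow> is_ideal M \<and> M \<noteq> UNIV \<and>
     (\<forall>J. is_ideal J \<and> M \<subseteq> J \<longrightarrow> J = M \<or> J = UNIV)"

definition local_ring_max :: "'a::comm_ring_1 set \<Rightarrow> bool" where
  "local_ring_max m \<longleftrightarrow> maximal_ideal m \<and> (\<forall>J. maximal_ideal J \<longrightarrow> J = m)"

definition noetherian :: "'a::comm_ring_1 itself \<Rightarrow> bool" where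
  "noetherian _ \<longleftrightarrow> (\<forall>f :: nat \<Rightarrow> 'a set. (\<forall>n. is_ideal (f n)) \<and> (\<forall>n. f n \<subseteq> f (Suc n))
      \<longrightarrow> (\<exists>N. \<forall>n\<ge>N. f n = f N))"

definition has_prime_chain :: "'a::comm_ring_1 itself \<Rightarrow> nat \<Rightarrow> bool" where
  "has_prime_chain _ n \<longleftrightarrow> (\<exists>f :: nat \<Rightarrow> 'a set. (\<forall>i\<le>n. prime_ideal (f i)) \<and> (\<forall>i<n. f i \<subset> f (Suc i)))"

definition krull_dim_eq :: "'a::comm_ring_1 itself \<Rightarrow> nat \<Rightarrow> bool" where
  "krull_dim_eq T d \<longleftrightarrow> has_prime_chain T d \<and> \<not> has_prime_chain T (Suc d)"

definition ideal_gen :: "'a::comm_ring_1 set \<Rightarrow> 'a set" where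
  "ideal_gen S = \<Inter>{I. is_ideal I \<and> S \<subseteq> I}"

definition ideal_prod :: "'a::comm_ring_1 set \<Rightarrow> 'a set \<Rightarrow> 'a set" where
  "ideal_prod I J = ideal_gen {a * b | a b. a \<in> I \<and> b \<in> J}"

fun ideal_pow :: "'a::comm_ring_1 set \<Rightarrow> nat \<Rightarrow> 'a set" where
  "ideal_pow I 0 = UNIV"
| "ideal_pow I (Suc n) = ideal_prod I (ideal_pow I n)"

text \<open>Chains of ideals J = I_0 \<subset> ... \<subset> I_n = R, i.e. chains of R-submodules of R/J.\<close>
definition ideal_chain_from :: "'a::comm_ring_1 set \<Rightarrow> nat \<Rightarrow> bool" where
  "ideal_chain_from J n \<longleftrightarrow> (\<exists>f :: nat \<Rightarrow> 'a set. f 0 = J \<and> f n = UNIV \<and>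
      (\<forall>i\<le>n. is_ideal (f i)) \<and> (\<forall>i<n. f i \<subset> f (Suc i)))"

text \<open>Length of the R-module R/J (0 by convention if infinite; never used in that case).\<close>
definition quot_length :: "'a::comm_ring_1 set \<Rightarrow> nat" where
  "quot_length J = (if finite {n. ideal_chain_from J n} then Max {n. ideal_chain_from J n} else 0)"

definition radical :: "'a::comm_ring_1 set \<Rightarrow> 'a set" where
  "radical I = {x. \<exists>n. x ^ n \<in> I}"

definition m_primary :: "'a::comm_ring_1 set \<Rightarrow> 'a set \<Rightarrow> bool" where
  "m_primary m I \<longleftrightarrow> is_ideal I \<and> I \<noteq> UNIV \<and> radical I = m"

definition hs_mult :: "nat \<Rightarrow> 'a::comm_ring_1 set \<Rightarrow> real" where
  "hs_mult d I = lim (\<lambda>n. fact d * real (quot_length (ideal_pow I n)) / real n ^ d)"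

definition madic_complete :: "'a::comm_ring_1 set \<Rightarrow> bool" where
  "madic_complete m \<longleftrightarrow> (\<forall>x :: nat \<Rightarrow> 'a.
     (\<forall>k. \<exists>N. \<forall>i\<ge>N. \<forall>j\<ge>N. x i - x j \<in> ideal_pow m k) \<longrightarrow>
     (\<exists>y. \<forall>k. \<exists>N. \<forall>i\<ge>N. x i - y \<in> ideal_pow m k))"

definition minimal_prime :: "'a::comm_ring_1 set \<Rightarrow> bool" where
  "minimal_prime P \<longleftrightarrow> prime_ideal P \<and> (\<forall>Q. prime_ideal Q \<and> Q \<subseteq> P \<longrightarrow> Q = P)"

text \<open>Localization R_P as fractions a/s (s \<notin> P), with equality of fractions.\<close>
definition loc_eq :: "'a::comm_ring_1 set \<Rightarrow> 'a \<times> 'a \<Rightarrow> 'a \<times> 'a \<Rightarrow> bool" where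
  "loc_eq P x y \<longleftrightarrow> (\<exists>u. u \<notin> P \<and> u * (fst x * snd y - fst y * snd x) = 0)"

definition localization_is_field :: "'a::comm_ring_1 set \<Rightarrow> bool" where
  "localization_is_field P \<longleftrightarrow> \<not> loc_eq P (1, 1) (0, 1) \<and>
     (\<forall>a s. s \<notin> P \<and> \<not> loc_eq P (a, s) (0, 1) \<longrightarrow>
        (\<exists>b t. t \<notin> P \<and> loc_eq P (a * b, s * t) (1, 1)))"

definition serre_R0 :: "'a::comm_ring_1 itself \<Rightarrow> bool" where
  "serre_R0 _ \<longleftrightarrow> (\<forall>P :: 'a set. minimal_prime P \<longrightarrow> localization_is_field P)"

end

theory Submission
imports Defs "HOL-Library.Set_Algebras" "HOL-Library.Extended_Nat"
begin

text \<open>Fix generators of an \<open>m\<close>-primary ideal. Initial ideals for the degree-lexicographic order turn lengths into counts of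
monomials; the two-dimensional coordinate planes missing from the initial ideal carry the multiplicity, and comparing
areas gives Lech's inequality, with a gain unless all these planes are parallel. Summing over the minimal primes \<open>P\<close>
with \<open>dim R/P = 2\<close>, where by \<open>(R\<^sub>0)\<close> the prime \<open>P\<close> enters only once, reduces the claim to a single complete domain with
multiplicity at least 2. There one passes to finite birational extensions on which \<open>x, y\<close> is a regular sequence and
slices along \<open>z = x + yh\<close>: without a gain every slice is a discrete valuation ring in which \<open>x\<close> generates a reduction of
\<open>(x, h)\<close>, and then \<open>m = (x, y)\<close>, contradicting \<open>e(R) > 1\<close>.\<close>

text \<open>Counting gives e(I) \<le> 2 (e - 1) (l + C M) with l = l(R/I), for any M with m^M inside
  I: coordinate rays, conductors of birational extensions and sums of different primes each cost a
  multiple of M. As M can be as large as l, this alone is no gain. The error is paid for by the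
  second estimate \<open>lech_gain\<close>, r e(I) + K \<le> 2 r e l, where m^K lies in I and r
  counts the generators of m. If K is small against l the first estimate wins, otherwise the second;
  eliminating K gives \<epsilon> = 1 / (1 + D) with D = 2 (e - 1) C r. Hence lengths are only
  compared up to terms linear in n (\<open>mult_le\<close>), and the drop from e to e - 1 comes from
  multiplicities being integers that count planes or occurrences of a prime. (R0) matters because
  colengths are superadditive over distinct primes only: a repeated prime would count l(R/(I + P))
  several times, and the total need not be bounded by l(R/I). Completeness enters through
  Chevalley's theorem, which forces a descending chain of modules with zero intersection into high
  powers of m.\<close>

abbreviation (input) U where "U \<equiv> UNIV"

abbreviation (input) iffb (infixr "<->" 25) where "p <-> q \<equiv> p = (q::bool)"

section \<open>Subrings of an ambient ring and modules inside it\<close>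

definition sring :: "'b::comm_ring_1 set => bool" where
 "sring A <-> 1 : A & (ALL x:A. ALL y:A. x - y : A & x * y : A)"

text \<open>Modules are subsets of the ambient ring. Restriction of scalars is then inclusion
  (\<open>sm_sub\<close>), fractional ideals are allowed, and a quotient M / N is represented by the
  pair of sets.\<close>

definition smod :: "'b::comm_ring_1 set => 'b set => bool" where
 "smod A M <-> 0 : M & (ALL x:M. ALL y:M. x + y : M) & (ALL a:A. ALL x:M. a * x : M)"

lemma ideal_iff:"is_ideal I <-> smod U I" by(auto simp:is_ideal_def smod_def)

lemma sr_U [simp]:"sring U" by(simp add:sring_def)

lemma sr_1 [simp]:"sring A ==> 1 : A" and sr_mult:"sring A ==> x : A ==> y : A ==> x * y : A"
 and sr_diff:"sring A ==> x : A ==> y : A ==> x - y : A" by(auto simp:sring_def)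

lemma sr_0 [simp]:"sring A ==> 0 : A" by(metis sr_1 sr_diff diff_self)

lemma sr_uminus:"sring A ==> x : A ==> - x : A" by(metis sr_0 sr_diff diff_0)

lemma sr_add:"sring A ==> x : A ==> y : A ==> x + y : A" by(metis sr_diff sr_uminus diff_minus_eq_add)

lemma sr_power:"sring A ==> x : A ==> x ^ n : A" by(induction n) (auto intro:sr_mult)

lemma sm_0 [simp]:"smod A M ==> 0 : M" and sm_add:"smod A M ==> x : M ==> y : M ==> x + y : M"
 and sm_mult:"smod A M ==> a : A ==> x : M ==> a * x : M" by(auto simp:smod_def)

lemma sm_uminus:"sring A ==> smod A M ==> x : M ==> - x : M" by(metis mult_minus1 sm_mult sr_1 sr_uminus)

lemma sm_diff:"sring A ==> smod A M ==> x : M ==> y : M ==> x - y : M" by(metis add_uminus_conv_diff sm_add sm_uminus)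

lemma sm_self:"sring A ==> smod A A" by(simp add:smod_def sr_add sr_mult)

lemma sm_sub:"smod A M ==> B <= A ==> smod B M" by(auto simp:smod_def)

lemma sm_U [simp]:"smod A U" by(simp add:smod_def)

lemma sm_Int:"smod A M ==> smod A N ==> smod A (M Int N)" by(auto simp:smod_def)

lemma sm_Inter:"(!!M. M : MM ==> smod A M) ==> smod A (\<Inter>MM)" by(auto simp:smod_def)

lemma sm_plus: assumes "smod A M" "smod A N" shows "smod A (M + N)" unfolding smod_def proof(intro conjI ballI)
 show "0 : M + N" using assms by(metis add.right_neutral set_plus_intro sm_0)
next
 fix x y assume "x : M + N" "y : M + N"
 then obtain a b c d where "x = a + b" "y = c + d" "a : M" "b : N" "c : M" "d : N" by(auto elim!: set_plus_elim)
 moreover from this have "x + y = (a + c) + (b + d)" by(simp add:algebra_simps)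
 ultimately show "x + y : M + N" using assms by(metis set_plus_intro sm_add)
next
 fix r x assume "r : A" "x : M + N"
 thus "r * x : M + N" using assms by(elim set_plus_elim) (simp add:distrib_left set_plus_intro sm_mult)
qed

lemma sm_scaled: assumes "smod A M" shows "smod A (x *o M)" unfolding smod_def elt_set_times_def
proof(intro conjI ballI; clarsimp)
 show "EX b:M. x * b = 0" using assms by(metis mult_zero_right sm_0)
 show "EX c:M. x * a + x * b = x * c" if "a : M" "b : M" for a b using that assms by(metis distrib_left sm_add)
 show "EX c:M. r * (x * b) = x * c" if "r : A" "b : M" for r b using that assms by(metis mult.left_commute sm_mult)
qed

lemma sm_zero [simp]:"smod A {0}" by(simp add:smod_def)

lemma plus_ge1:"smod A N ==> M <= M + N" by(metis add.right_neutral set_plus_intro sm_0 subsetI)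

lemma plus_ge2:"smod A M ==> N <= M + N" by(metis add_0_left set_plus_intro sm_0 subsetI)

lemma plus_le:"smod A K ==> M <= K ==> N <= K ==> M + N <= K" by(auto elim!: set_plus_elim intro:sm_add)

lemma plus_mono:"M <= M' ==> N <= N' ==> M + N <= M' + (N' :: 'b::ab_semigroup_add set)" by(rule set_plus_mono2)

lemma plus_abs:"smod A N ==> smod A M ==> M <= N ==> M + N = N"
 by(meson dual_order.refl plus_le subset_antisym plus_ge2)

lemma plus_abs2:"smod A N ==> smod A M ==> M <= N ==> N + M = N" by(metis add.commute plus_abs)

lemma in_scaled:"z : x *o M <-> (EX m:M. z = x * m)" by(auto simp:elt_set_times_def)

lemma scaledI [intro]:"m : M ==> x * m : x *o M" by(auto simp:elt_set_times_def)

lemma scaled_mono:"M <= N ==> x *o M <= x *o N" by(auto simp:elt_set_times_def)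

lemma scaled2:"x *o (y *o M) = (x * y) *o (M :: 'b::comm_ring_1 set)" by(auto simp:elt_set_times_def mult.assoc)

lemma scaled_one [simp]:"1 *o (M :: 'b::comm_ring_1 set) = M" by(auto simp:elt_set_times_def)

lemma scaled_plus:"x *o (M + N) = x *o M + x *o (N :: 'b::comm_ring_1 set)" proof
 show "x *o (M + N) <= x *o M + x *o N"
 by(auto simp:in_scaled distrib_left elim!: set_plus_elim intro!: set_plus_intro scaledI)
 show "x *o M + x *o N <= x *o (M + N)"
 by(auto elim!: set_plus_elim simp:in_scaled) (metis distrib_left set_plus_intro)
qed

lemma scaled_le:"smod A M ==> x : A ==> x *o M <= M" by(auto simp:elt_set_times_def sm_mult)

definition span :: "'b::comm_ring_1 set => 'b set => 'b set" where "span A G = \<Inter>{M. smod A M & G <= M}"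

lemma sm_span:"smod A (span A G)" unfolding span_def by(rule sm_Inter) auto

lemma span_inc:"G <= span A G" by(auto simp:span_def)

lemma span_least:"smod A M ==> G <= M ==> span A G <= M" by(auto simp:span_def)

lemma span_mono:"G <= H ==> span A G <= span A H" by(meson order_trans span_least span_inc sm_span)

lemma ideal_gen_eq_span:"ideal_gen S = span U S" by(simp add:ideal_gen_def span_def ideal_iff)

lemma span_empty [simp]:"span A {} = {0}" proof
 show "span A {} <= {0}" by(rule span_least) auto
 show "{0} <= span A {}" using sm_0[OF sm_span] by auto
qed

lemma sm_cyclic:"sring A ==> smod A (g *o A)" by(simp add:sm_scaled sm_self)

lemma span_insert: assumes "sring A" shows "span A (insert g G) = g *o A + span A G" proof
 have "smod A (g *o A + span A G)" by(simp add:assms sm_cyclic sm_plus sm_span)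
 moreover have "g : g *o A + span A G"
 using assms by(metis add.right_neutral mult.right_neutral scaledI set_plus_intro sm_0 sm_span sr_1)
 moreover have "G <= g *o A + span A G" by(meson assms order_trans span_inc sm_cyclic plus_ge2)
 ultimately show "span A (insert g G) <= g *o A + span A G" by(simp add:span_least)
 have "g : span A (insert g G)" using span_inc by blast
 hence "g *o A <= span A (insert g G)" by(auto simp:in_scaled) (metis mult.commute sm_mult sm_span)
 thus "g *o A + span A G <= span A (insert g G)" by(meson plus_le span_mono sm_span subset_insertI)
qed

lemma span_image_scale:"span A ((*) x ` G) = x *o span A G" proof
 show "span A ((*) x ` G) <= x *o span A G"
 using span_inc by(intro span_least sm_scaled sm_span) (auto simp:in_scaled)
 have "smod A {u. x * u : span A ((*) x ` G)}" using sm_span[of A "(*) x ` G"]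
 by(auto simp:smod_def distrib_left) (metis mult.left_commute)
 moreover have "G <= {u. x * u : span A ((*) x ` G)}" using span_inc by blast
 ultimately have "span A G <= {u. x * u : span A ((*) x ` G)}" by(rule span_least)
 thus "x *o span A G <= span A ((*) x ` G)" by(auto simp:in_scaled)
qed

subsection \<open>Length\<close>

definition chain_in :: "'b::comm_ring_1 set => 'b set => 'b set => nat => (nat => 'b set) => bool" where
 "chain_in A M N n f <-> (ALL i<=n. smod A (f i) & N <= f i & f i <= M) & (ALL i<n. f i < f (Suc i))"

text \<open>The length of M / N. Chains need not start at N or end at M: this does not change the
  supremum, and it makes chains easy to push along maps.\<close>

definition len :: "'b::comm_ring_1 set => 'b set => 'b set => enat" where
 "len A M N = Sup {enat n | n. EX f. chain_in A M N n f}"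

lemma chain_le_len:"chain_in A M N n f ==> enat n <= len A M N" unfolding len_def by(rule Sup_upper) blast

lemma len_leI:"(!!n f. chain_in A M N n f ==> enat n <= k) ==> len A M N <= k"
 unfolding len_def by(rule Sup_least) blast

lemma len_finite_attained: assumes "len A M N = enat l" "smod A N" "N <= M" shows "EX f. chain_in A M N l f"
proof(rule ccontr)
 assume no:"\<nexists>f. chain_in A M N l f"
 have *:"n < l" if "chain_in A M N n f" for n f proof -
 have "enat n <= enat l" using chain_le_len[OF that] assms by simp
 moreover have "n ~= l" using no that by blast
 ultimately show ?thesis by simp
 qed
 \<comment> \<open>The constant chain gives l > 0, so that \<open>l - 1\<close> is a proper
   predecessor.\<close>
 have "chain_in A M N 0 (%_. N)" using assms by(simp add:chain_in_def)
 hence "l > 0" using * by blast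
 hence "len A M N <= enat (l - 1)"  by(intro len_leI) (use * in force)
 with assms `l > 0` show False by simp
qed

text \<open>Dropping repetitions from a weakly increasing sequence leaves a strict chain. This is
  the form needed when chains are intersected with a module or added to it.\<close>

lemma weak_chain_le_len:
 assumes "!!i. i <= n ==> smod A (F i) & N <= F i & F i <= M" "!!i. i < n ==> F i <= F (Suc i)"
 shows "enat (card {i. i < n & F i ~= F (Suc i)}) <= len A M N" proof -
 have "EX f. chain_in A M N (card {i. i < n & F i ~= F (Suc i)}) f & f (card {i. i < n & F i ~= F (Suc i)}) = F n"
 using assms proof(induction n)
 case 0
 thus ?case by(intro exI[of _ "%_. F 0"]) (auto simp:chain_in_def)
 next
 case (Suc n)
 define c where "c = card {i. i < n & F i ~= F (Suc i)}"
 have "EX f. chain_in A M N c f & f c = F n" unfolding c_def by(rule Suc.IH) (use Suc.prems in auto)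
 then obtain f where f:"chain_in A M N c f" "f c = F n" by blast
 show ?case proof(cases "F n = F (Suc n)")
 case True
 hence "{i. i < Suc n & F i ~= F (Suc i)} = {i. i < n & F i ~= F (Suc i)}" by(auto simp:less_Suc_eq)
 hence cc:"card {i. i < Suc n & F i ~= F (Suc i)} = c" by(simp only:c_def)
 have "f c = F (Suc n)" using f(2) True by(rule trans)
 thus ?thesis unfolding cc using f(1) by blast
 next
 case False
 hence "{i. i < Suc n & F i ~= F (Suc i)} = insert n {i. i < n & F i ~= F (Suc i)}" by(auto simp:less_Suc_eq)
 hence c:"card {i. i < Suc n & F i ~= F (Suc i)} = Suc c" by(simp add:c_def)
 have "F n < F (Suc n)" using Suc.prems(2)[of n] False by blast
 moreover have "smod A (F (Suc n)) & N <= F (Suc n) & F (Suc n) <= M" using Suc.prems(1) by blast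
 ultimately have "chain_in A M N (Suc c) (f(Suc c := F (Suc n)))"
 using f unfolding chain_in_def by(auto simp:le_Suc_eq less_Suc_eq)
 thus ?thesis using c by auto
 qed
 qed
 thus ?thesis using chain_le_len by blast
qed

lemma len_mono_interval:"N' <= N ==> M <= M' ==> len A M N <= len A M' N'" proof(rule len_leI)
 fix n f assume "N' <= N" "M <= M'" "chain_in A M N n f"
 hence "chain_in A M' N' n f" unfolding chain_in_def by(meson order_trans)
 thus "enat n <= len A M' N'" by(rule chain_le_len)
qed

text \<open>Since \<open>f i \<inter> P\<close> and \<open>f i + P\<close> cannot both be constant along a strict step (modular law),
  a chain splits into a chain below \<open>P\<close> and one above.\<close>

lemma len_add: assumes A:"sring A" and P:"smod A P" and NP:"N <= P" and PM:"P <= M" and M:"smod A M" and N:"smod A N"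
 shows "len A M N = len A M P + len A P N" proof(rule antisym)
 show "len A M N <= len A M P + len A P N" proof(rule len_leI)
 fix n f assume f:"chain_in A M N n f"
 let ?G = "%i. f i Int P" and ?H = "%i. f i + P"
 have sub:"!!i. i <= n ==> smod A (f i)" "!!i. i <= n ==> N <= f i" "!!i. i <= n ==> f i <= M"
 "!!i. i < n ==> f i < f (Suc i)" using f by(auto simp:chain_in_def)
 have 1:"enat (card {i. i < n & ?G i ~= ?G (Suc i)}) <= len A P N"
 using sub(1,2) sub(4)[THEN psubset_imp_subset] NP by(intro weak_chain_le_len) (auto simp:sm_Int P subset_iff)
 have 2:"enat (card {i. i < n & ?H i ~= ?H (Suc i)}) <= len A M P" proof(rule weak_chain_le_len)
 fix i assume "i <= n"
 thus "smod A (?H i) & P <= ?H i & ?H i <= M" using sub(1,3)[of i] P PM M plus_le sm_plus plus_ge2 by meson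
 qed (use sub(4) in \<open>blast intro:plus_mono[THEN subsetD] dest:psubset_imp_subset\<close>)
 have "{i. i < n} <= {i. i < n & ?G i ~= ?G (Suc i)} Un {i. i < n & ?H i ~= ?H (Suc i)}" proof
 fix i assume "i : {i. i < n}"
 hence i:"i < n" by simp
 have "~ (?G i = ?G (Suc i) & ?H i = ?H (Suc i))" proof
 assume eq:"?G i = ?G (Suc i) & ?H i = ?H (Suc i)"
 have "f (Suc i) <= f i" proof
 fix u assume u:"u : f (Suc i)"
 hence "u : ?H i" using eq P plus_ge1 by blast
 then obtain v p where v:"u = v + p" "v : f i" "p : P" by(rule set_plus_elim)
 hence p:"p = u - v" by simp
 have "v : f (Suc i)" using v sub(4)[OF i] by blast
 hence "p : ?G (Suc i)" unfolding p using u v(3) p sm_diff[OF A sub(1)[OF Suc_leI[OF i]]] by blast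
 hence "p : f i" using eq by blast
 thus "u : f i" using v sub(1)[of i] i by(simp add:sm_add)
 qed
 thus False using sub(4)[OF i] by blast
 qed
 thus "i : {i. i < n & ?G i ~= ?G (Suc i)} Un {i. i < n & ?H i ~= ?H (Suc i)}" using i by blast
 qed
 hence "card {i. i < n} <= card ({i. i < n & ?G i ~= ?G (Suc i)} Un {i. i < n & ?H i ~= ?H (Suc i)})"
 by(intro card_mono) auto
 also have "... <= card {i. i < n & ?G i ~= ?G (Suc i)} + card {i. i < n & ?H i ~= ?H (Suc i)}" by(rule card_Un_le)
 finally have "enat n <= enat (card {i. i < n & ?G i ~= ?G (Suc i)}) + enat (card {i. i < n & ?H i ~= ?H (Suc i)})"
 by simp
 also have "... <= len A P N + len A M P" by(rule add_mono[OF 1 2])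
 finally show "enat n <= len A M P + len A P N" by(simp add:add.commute)
 qed
 have *:"enat (a + b) <= len A M N" if f:"chain_in A P N a f" and g:"chain_in A M P b g" for a b f g proof -
 \<comment> \<open>The two chains are glued at index a. The passage from \<open>f a\<close> to
   \<open>g 0\<close> may be an equality, so of the a + b + 1 steps this one is given up.\<close>
 define F where "F i = (if i <= a then f i else g (i - Suc a))" for i
 have "enat (card {i. i < Suc (a + b) & F i ~= F (Suc i)}) <= len A M N" proof(rule weak_chain_le_len)
 fix i assume "i <= Suc (a + b)"
 thus "smod A (F i) & N <= F i & F i <= M" using f g NP PM unfolding F_def chain_in_def
 by(cases "i <= a") (auto, (metis (no_types, lifting) Suc_le_mono add.commute add_Suc diff_le_mono le_diff_conv not_less_eq_eq subset_iff)+)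
 next
 fix i assume i:"i < Suc (a + b)"
 consider "i < a" | "i = a" | "i > a" by linarith
 thus "F i <= F (Suc i)" proof cases
 case 1 thus ?thesis using f by(auto simp:F_def chain_in_def)
 next
 case 2 thus ?thesis using f g by(simp add:F_def chain_in_def) (meson le0 order.refl order_trans)
 next
 case 3
 hence "Suc i - Suc a = Suc (i - Suc a)" "i - Suc a < b" using i by auto
 thus ?thesis using g 3 by(auto simp:F_def chain_in_def)
 qed
 qed
 moreover have "{i. i < Suc (a + b)} - {a} <= {i. i < Suc (a + b) & F i ~= F (Suc i)}" proof
 fix i assume "i : {i. i < Suc (a + b)} - {a}"
 then consider "i < a" | "i > a" "i < Suc (a + b)" by fastforce
 thus "i : {i. i < Suc (a + b) & F i ~= F (Suc i)}" proof cases
 case 1 thus ?thesis using f by(auto simp:F_def chain_in_def)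
 next
 case 2
 hence e:"Suc i - Suc a = Suc (i - Suc a)" "i - Suc a < b" by auto
 hence "g (i - Suc a) < g (Suc (i - Suc a))" using g by(simp add:chain_in_def)
 hence "F i ~= F (Suc i)" using 2 unfolding F_def e by auto
 with 2 show ?thesis by simp
 qed
 qed
 hence "card ({i. i < Suc (a + b)} - {a}) <= card {i. i < Suc (a + b) & F i ~= F (Suc i)}"
 by(rule card_mono[rotated]) simp
 hence "a + b <= card {i. i < Suc (a + b) & F i ~= F (Suc i)}" by simp
 ultimately show ?thesis by(meson enat_ord_simps(1) order_trans)
 qed
 show "len A M P + len A P N <= len A M N" proof(cases "len A M N")
 case infinity thus ?thesis by simp
 next
 case (enat l)
 have "len A M P <= enat l" "len A P N <= enat l"
 using enat len_mono_interval[OF order.refl PM] len_mono_interval[OF NP order.refl] by metis+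
 then obtain p q where pq:"len A M P = enat p" "len A P N = enat q" by(metis enat_ile)
 obtain f g where "chain_in A P N q f" "chain_in A M P p g" using len_finite_attained pq assms by metis
 from *[OF this] show ?thesis using pq by(simp add:add.commute)
 qed
qed

lemma len_self [simp]:"len A M M = 0" proof -
 have "len A M M <= enat 0" proof(rule len_leI)
 fix n f assume f:"chain_in A M M n f"
 have "n = 0" proof(rule ccontr)
 assume "n ~= 0"
 hence "M <= f 0" "f (Suc 0) <= M" "f 0 < f (Suc 0)" using f unfolding chain_in_def by auto
 thus False by blast
 qed
 thus "enat n <= enat 0" by simp
 qed
 thus ?thesis by(simp add:zero_enat_def[symmetric])
qed

lemma len_ge_1:"smod A M ==> smod A N ==> N < M ==> 1 <= len A M N" proof -
 assume "smod A M" "smod A N" "N < M"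
 hence "chain_in A M N 1 (%i. if i = 0 then N else M)" by(auto simp:chain_in_def)
 from chain_le_len[OF this] show ?thesis by(simp add:one_enat_def)
qed

lemma len_eq_0_iff:"smod A M ==> smod A N ==> N <= M ==> len A M N = 0 <-> M = N"
 by(metis len_ge_1 len_self not_one_le_zero psubsetI)

text \<open>The isomorphism theorem for a map h that is linear along \<theta>: images and preimages
  carry strict chains to strict chains. It is used for multiplication by an element, with \<theta>
  the identity, and for the map \<open>frc\<close> to a fraction field.\<close>

lemma len_image: fixes h :: "'a::comm_ring_1 => 'b::comm_ring_1" and \<theta> :: "'a => 'b"
 assumes A:"sring A" and M:"smod A M" and N': "smod (\<theta> ` A) N'" and sr:"sring (\<theta> ` A)"
 and add:"!!u v. u : M ==> v : M ==> h (u + v) = h u + h v"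
 and scl:"!!a u. a : A ==> u : M ==> h (a * u) = \<theta> a * h u"
 shows "len (\<theta> ` A) (h ` M + N') N' = len A M {m:M. h m : N'}" proof -
 have h0:"h 0 = 0" using add[of 0 0] M by simp
 have him:"smod (\<theta> ` A) (h ` UU)" if "smod A UU" "UU <= M" for UU unfolding smod_def proof(intro conjI ballI)
 show "0 : h ` UU" using h0 that by(metis image_eqI sm_0)
 fix x y assume "x : h ` UU" "y : h ` UU"
 thus "x + y : h ` UU" using that add by(smt (verit) image_iff subset_iff sm_add)
 next
 fix a x assume "a : \<theta> ` A" "x : h ` UU"
 thus "a * x : h ` UU" using that scl by(smt (verit) image_iff subset_iff sm_mult)
 qed
 have pre:"smod A {m:M. h m : V}" if "smod (\<theta> ` A) V" for V unfolding smod_def using that h0 M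
 by(auto simp:add scl sm_add sm_mult)
 show ?thesis proof(rule antisym)
 show "len (\<theta> ` A) (h ` M + N') N' <= len A M {m:M. h m : N'}" proof(intro len_leI, goal_cases)
 case (1 n f)
 have "chain_in A M {m:M. h m : N'} n (%i. {m:M. h m : f i})" unfolding chain_in_def proof(intro conjI allI impI)
 fix i assume i:"i < n"
 have "f i < f (Suc i)" using 1 i by(simp add:chain_in_def)
 then obtain v where v:"v : f (Suc i)" "v ~: f i" by blast
 hence "v : h ` M + N'" using 1 i unfolding chain_in_def by(metis Suc_leI subset_iff)
 then obtain m w where w:"v = h m + w" "m : M" "w : N'" by(auto elim!: set_plus_elim)
 have "w : f i" "w : f (Suc i)" using 1 i w unfolding chain_in_def by(metis less_imp_le Suc_leI subset_iff)+
 hence "h m ~: f i" "h m : f (Suc i)" using v w 1 i unfolding chain_in_def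
 by(metis less_imp_le sm_add) (metis Suc_leI `w : f (Suc i)` add_diff_cancel_right' 1 chain_in_def i sr sm_diff v(1) w(1))
 thus "{m : M. h m : f i} < {m : M. h m : f (Suc i)}" using w `f i < f (Suc i)` by blast
 qed (use 1 pre in \<open>auto simp:chain_in_def\<close>)
 thus ?case by(rule chain_le_len)
 qed
 show "len A M {m:M. h m : N'} <= len (\<theta> ` A) (h ` M + N') N'" proof(intro len_leI, goal_cases)
 case (1 n f)
 have f:"!!i. i <= n ==> smod A (f i)" "!!i. i <= n ==> f i <= M" "!!i. i <= n ==> {m:M. h m : N'} <= f i"
 "!!i. i < n ==> f i < f (Suc i)" using 1 by(auto simp:chain_in_def)
 have "chain_in (\<theta> ` A) (h ` M + N') N' n (%i. h ` f i + N')" unfolding chain_in_def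
 proof(intro conjI allI impI)
 fix i assume i:"i < n"
 obtain m where m:"m : f (Suc i)" "m ~: f i" using f(4)[OF i] by blast
 have "h m ~: h ` f i + N'" proof
 assume "h m : h ` f i + N'"
 then obtain u w where u:"h m = h u + w" "u : f i" "w : N'" by(auto elim!: set_plus_elim)
 have uM:"u : M" "m : M" using u m f(2) i by(meson less_imp_le Suc_leI subset_iff)+
 have mu:"m - u : M" using uM A M sm_diff by blast
 have "h m = h (m - u) + h u" using add[OF mu uM(1)] by simp
 hence "h (m - u) = w" using u by simp
 hence "m - u : f i" using f(3)[of i] i u mu by auto
 hence "m : f i" using u f(1)[of i] i by(metis diff_add_cancel less_imp_le sm_add)
 thus False using m by blast
 qed
 moreover have "h m : h ` f (Suc i) + N'" using m N' by(meson image_eqI subset_iff plus_ge1)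
 moreover have "h ` f i + N' <= h ` f (Suc i) + N'" using f(4)[OF i] by(intro plus_mono image_mono) auto
 ultimately show "h ` f i + N' < h ` f (Suc i) + N'" by blast
 next
 fix i assume i:"i <= n"
 show "smod (\<theta> ` A) (h ` f i + N')" using f i by(simp add:N' him sm_plus)
 show "N' <= h ` f i + N'" using f i him plus_ge2 by meson
 show "h ` f i + N' <= h ` M + N'" using f i by(intro plus_mono image_mono) auto
 qed
 thus ?case by(rule chain_le_len)
 qed
 qed
qed

text \<open>Multiplication by x is onto (x M + N) / N, with kernel the elements carried into N. The
  lengths of cyclic steps in filtrations are always read off from this.\<close>

lemma len_scaled: assumes "sring A" "smod A M" "smod A N" shows "len A (x *o M + N) N = len A M {m:M. x * m : N}"
proof -
 have im:"(*) x ` M = x *o M" by(auto simp:elt_set_times_def)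
 have "len ((%a. a) ` A) ((*) x ` M + N) N = len A M {m:M. x * m : N}"
 by(rule len_image) (use assms in \<open>simp_all add:distrib_left mult.left_commute\<close>)
 thus ?thesis by(simp only:image_ident im)
qed

lemma len_plus_Int: assumes "sring A" "smod A M" "smod A N" shows "len A (M + N) N = len A M (M Int N)" proof -
 have "{m:M. 1 * m : N} = M Int N" by auto
 thus ?thesis using len_scaled[OF assms, of 1] by(simp only:scaled_one)
qed

lemma len_scaled_inj: fixes x :: "'b::idom" assumes "sring A" "smod A M" "smod A N" "N <= M" "x ~= 0"
 shows "len A (x *o M) (x *o N) = len A M N" proof -
 have "x *o M + x *o N = x *o M" using assms by(metis plus_abs2 scaled_mono sm_scaled)
 moreover have "{m:M. x * m : x *o N} = N" using assms by(auto simp:in_scaled)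
 ultimately show ?thesis using len_scaled[of A M "x *o N" x] assms by(simp add:sm_scaled)
qed

lemma len_mono:"N <= N' ==> len A M N' <= len A M N" by(simp add:len_mono_interval)

lemma len_mono_left:"M <= M' ==> len A M N <= len A M' N" by(simp add:len_mono_interval)

lemma len_plus_le: assumes "sring A" "smod A M" "smod A N" "smod A K" "N <= M"
 shows "len A (M + K) (N + K) <= len A M N" proof -
 have "M + K = M + (N + K)" using assms by(metis add.assoc plus_abs2)
 hence "len A (M + K) (N + K) = len A M (M Int (N + K))" using assms by(simp add:len_plus_Int sm_plus)
 also have "... <= len A M N" using assms by(intro len_mono) (meson Int_greatest plus_ge1)
 finally show ?thesis .
qed

section \<open>Noetherian and finitely generated modules\<close>

definition noeth :: "'b::comm_ring_1 set => 'b set => bool" where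
 "noeth A M <-> (ALL f::nat => 'b set. (ALL n. smod A (f n) & f n <= M) & (ALL n. f n <= f (Suc n)) --> (EX N. ALL n>=N. f n = f N))"

definition fg :: "'b::comm_ring_1 set => 'b set => bool" where "fg A M <-> (EX G. finite G & M = span A G)"

lemma noethD: assumes "noeth A M" "!!n. smod A (f n)" "!!n. f n <= M" "!!n. f n <= f (Suc n)"
 shows "EX N. ALL n>=N. f n = f N" using assms unfolding noeth_def by blast

lemma noeth_max: assumes "noeth A M" "US ~= {}" "!!UU. UU : US ==> smod A UU & UU <= M"
 shows "EX UU:US. ALL V:US. UU <= V --> V = UU" proof(rule ccontr)
 assume "~ ?thesis"
 hence st:"!!UU. UU : US ==> EX V. V : US & UU < V" by blast
 have "EX f::nat => 'a set. ALL n. f n : US & f n < f (Suc n)" proof(rule dependent_nat_choice)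
 show "EX x. x : US" using assms by blast
 qed (use st in blast)
 then obtain f :: "nat => 'a set" where f:"!!n. f n : US" "!!n. f n < f (Suc n)" by blast
 have s:"smod A (f n)" "f n <= M" "f n <= f (Suc n)" for n using assms(3)[OF f(1)[of n]] f(2)[of n] by auto
 obtain N where N:"ALL n>=N. f n = f N" using noethD[of A M f, OF assms(1) s(1) s(2) s(3)] by(rule exE)
 have "f (Suc N) = f N" by(rule N[rule_format]) simp
 thus False using f(2)[of N] by simp
qed

lemma noeth_fg: assumes "sring A" "noeth A M" "smod A N" "N <= M" shows "fg A N" proof -
 let ?UU = "{span A G | G. finite G & G <= N}"
 have sub:"span A G <= N" if "G <= N" for G using that assms by(simp add:span_least)
 have "EX UU:?UU. ALL V:?UU. UU <= V --> V = UU" proof(rule noeth_max[OF assms(2)])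
 have "span A {} : ?UU" by blast
 thus "?UU ~= {}" by blast
 fix UU assume "UU : ?UU"
 then obtain G where "UU = span A G" "G <= N" by blast
 thus "smod A UU & UU <= M" using sub[of G] assms(4) by(simp add:sm_span)
 qed
 then obtain UU where UU:"UU : ?UU" "ALL V:?UU. UU <= V --> V = UU" by(rule bexE)
 from UU(1) obtain G where G:"finite G" "G <= N" "UU = span A G" by blast
 have max:"span A H = span A G" if "finite H" "H <= N" "span A G <= span A H" for H proof -
 have H:"span A H : ?UU" using that by blast
 have "UU <= span A H --> span A H = UU" by(rule bspec[OF UU(2) H])
 thus ?thesis using that(3) G(3) by simp
 qed
 have "N <= span A G" proof
 fix u assume u:"u : N"
 have "span A (insert u G) = span A G" using G u by(intro max span_mono) auto
 thus "u : span A G" using span_inc by blast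
 qed
 hence "N = span A G" using sub[OF G(2)] by auto
 thus ?thesis using G by(auto simp:fg_def)
qed

text \<open>Within an ascending chain, a submodule of g A + M is determined by its trace on M and by
  the ideal of coefficients of g modulo M; both of these chains stabilize.\<close>

lemma noeth_cyclic_plus: assumes A:"sring A" "noeth A A" and M:"smod A M" "noeth A M" shows "noeth A (g *o A + M)"
 unfolding noeth_def proof(intro allI impI)
 fix f :: "nat => 'a set"
 assume "(ALL n. smod A (f n) & f n <= g *o A + M) & (ALL n. f n <= f (Suc n))"
 hence f:"!!n. smod A (f n)" "!!n. f n <= g *o A + M" "!!n. f n <= f (Suc n)" by auto
 have mono:"f i <= f j" if "i <= j" for i j using f(3) that lift_Suc_mono_le by blast
 obtain N1 where N1:"ALL n>=N1. f n Int M = f N1 Int M"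
 using noethD[of A M "%n. f n Int M", OF M(2) sm_Int[OF f(1) M(1)] Int_lower2 Int_mono[OF f(3) order.refl]]
 by(rule exE)
 define C where "C n = {a:A. a * g : f n + M}" for n
 have Cs:"smod A (C n)" for n using sm_plus[OF f(1)[of n] M(1)] A(1) unfolding C_def smod_def
 by(auto simp:sr_add sr_mult distrib_right mult.assoc)
 have "EX N. ALL n>=N. C n = C N" proof(rule noethD[OF A(2)])
 show "C n <= C (Suc n)" for n unfolding C_def using plus_mono[OF f(3)[of n] order.refl, of M] by blast
 qed (use Cs in \<open>auto simp:C_def\<close>)
 then obtain N2 where N2:"ALL n>=N2. C n = C N2" by(rule exE)
 define N where "N = max N1 N2"
 have "f n <= f N" if n:"n >= N" for n proof
 fix u assume u:"u : f n"
 hence "u : g *o A + M" using f(2)[of n] by blast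
 then obtain a v where av:"u = g * a + v" "a : A" "v : M" by(auto elim!: set_plus_elim simp:in_scaled)
 have "a * g = u + (- v)" using av by(simp add:algebra_simps)
 hence "a * g : f n + M" using u av sm_uminus[OF A(1) M(1)] by(metis set_plus_intro)
 hence "a : C n" using av by(simp add:C_def)
 hence "a : C N" using N2 n unfolding N_def by(metis max.bounded_iff max.cobounded2)
 then obtain w v' where w:"a * g = w + v'" "w : f N" "v' : M" by(auto simp:C_def elim!: set_plus_elim)
 have "u - w = v + v'" using av w by(simp add:algebra_simps)
 hence uM:"u - w : M" using av w M(1) sm_add by metis
 have "u - w : f n" using u w(2) mono[OF n] A(1) f(1) sm_diff by blast
 hence "u - w : f N" using uM N1 n unfolding N_def by(metis IntD1 IntI max.bounded_iff max.cobounded1)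
 hence "(u - w) + w : f N" using w(2) f(1) sm_add by blast
 thus "u : f N" by simp
 qed
 thus "EX N. ALL n>=N. f n = f N" using mono by blast
qed

lemma noeth_zero:"noeth A {0}"
 unfolding noeth_def by(metis bot.extremum_uniqueI insert_not_empty subset_singleton_iff sm_0 empty_iff)

lemma noeth_span:"finite G ==> sring A ==> noeth A A ==> noeth A (span A G)"
 by(induction G rule:finite_induct) (simp_all add:noeth_zero span_insert noeth_cyclic_plus sm_span)

lemma fg_noeth:"sring A ==> noeth A A ==> fg A M ==> noeth A M" by(auto simp:fg_def noeth_span)

lemma fg_smod:"fg A M ==> smod A M" by(auto simp:fg_def sm_span)

lemma fg_cyclic:"sring A ==> fg A (g *o A)" unfolding fg_def by(rule exI[of _ "{g}"]) (simp add:span_insert)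

lemma fg_self:"sring A ==> fg A A" using fg_cyclic[of A 1] by simp

lemma span_Un:"span A (G Un H) = span A G + span A H" proof
 show "span A (G Un H) <= span A G + span A H" proof(intro span_least sm_plus sm_span Un_least)
 show "G <= span A G + span A H" using span_inc plus_ge1[OF sm_span] by blast
 show "H <= span A G + span A H" using span_inc plus_ge2[OF sm_span] by blast
 qed
 show "span A G + span A H <= span A (G Un H)" by(rule plus_le[OF sm_span]) (auto intro:span_mono[THEN subsetD])
qed

lemma fg_plus:"fg A M ==> fg A N ==> fg A (M + N)" unfolding fg_def by(metis finite_UnI span_Un)

subsection \<open>Products and powers of ideals\<close>

definition mul :: "'b::comm_ring_1 set => 'b set => 'b set => 'b set" where
 "mul A I M = span A {i * u | i u. i : I & u : M}"

text \<open>\<open>ipow A I M n\<close> is I^n M. With the module as a parameter,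
  \<open>ipow R I S n\<close> also denotes I^n S over a smaller ring R, without extending I to
  S.\<close>

fun ipow :: "'b::comm_ring_1 set => 'b set => 'b set => nat => 'b set" where "ipow A I M 0 = M"
| "ipow A I M (Suc n) = mul A I (ipow A I M n)"

lemma ideal_pow_eq_ipow:"ideal_pow I n = ipow U I U n"
 by(induction n) (auto simp:ideal_prod_def mul_def ideal_gen_eq_span)

lemma sm_mprod:"smod A (mul A I M)" by(simp add:mul_def sm_span)

lemma mul_in:"i : I ==> u : M ==> i * u : mul A I M" unfolding mul_def by(rule span_inc[THEN subsetD]) blast

lemma mul_least:"smod A K ==> (!!i u. i : I ==> u : M ==> i * u : K) ==> mul A I M <= K"
 unfolding mul_def by(rule span_least) auto

lemma mul_mono:"I <= J ==> M <= N ==> mul A I M <= mul A J N" by(intro mul_least sm_mprod mul_in) auto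

lemma mul_subset:"smod A M ==> I <= A ==> mul A I M <= M" by(intro mul_least) (auto intro:sm_mult)

lemma mul_plus: assumes "smod A M" "smod A N" shows "mul A I (M + N) = mul A I M + mul A I N" proof
 show "mul A I (M + N) <= mul A I M + mul A I N"
 by(intro mul_least sm_plus sm_mprod) (auto elim!: set_plus_elim simp:distrib_left mul_in set_plus_intro)
 show "mul A I M + mul A I N <= mul A I (M + N)" by(rule plus_le[OF sm_mprod])
 (rule mul_mono[OF order.refl plus_ge1[OF assms(2)]], rule mul_mono[OF order.refl plus_ge2[OF assms(1)]])
qed

lemma mul_plus_left: assumes "smod A I" "smod A J" shows "mul A (I + J) M = mul A I M + mul A J M" proof
 show "mul A (I + J) M <= mul A I M + mul A J M"
 by(intro mul_least sm_plus sm_mprod) (auto elim!: set_plus_elim simp:distrib_right mul_in set_plus_intro)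
 show "mul A I M + mul A J M <= mul A (I + J) M" by(rule plus_le[OF sm_mprod])
 (rule mul_mono[OF plus_ge1[OF assms(2)] order.refl], rule mul_mono[OF plus_ge2[OF assms(1)] order.refl])
qed

lemma mul_cyclic: assumes "smod A M" "sring A" shows "mul A (g *o A) M = g *o M" proof
 show "mul A (g *o A) M <= g *o M" using assms by(intro mul_least sm_scaled) (auto simp:in_scaled mult.assoc sm_mult)
 show "g *o M <= mul A (g *o A) M"
 using mul_in[of "g * 1" "g *o A" _ M A] assms by(auto simp:in_scaled) (metis mult.right_neutral sr_1)
qed

lemma mul_cyclic_right: assumes "smod A I" "sring A" shows "mul A I (g *o A) = g *o I" proof
 show "mul A I (g *o A) <= g *o I" proof(intro mul_least sm_scaled assms)
 fix i u assume "i : I" "u : g *o A"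
 then obtain a where "u = g * a" "a : A" by(auto simp:in_scaled)
 hence "i * u = g * (a * i)" "a * i : I" using assms `i : I` by(simp_all add:mult_ac sm_mult)
 thus "i * u : g *o I" by(metis scaledI)
 qed
 show "g *o I <= mul A I (g *o A)" proof
 fix u assume "u : g *o I"
 then obtain i where "u = i * (g * 1)" "i : I" by(auto simp:in_scaled mult.commute)
 thus "u : mul A I (g *o A)" using assms by(metis mul_in scaledI sr_1)
 qed
qed

lemma sm_ipow:"smod A M ==> smod A (ipow A I M n)" by(induction n) (simp_all add:sm_mprod)

lemma ipow_mono:"I <= J ==> M <= N ==> ipow A I M n <= ipow A J N n" by(induction n) (simp_all add:mul_mono)

lemma ipow_add:"ipow A I M (n + k) = ipow A I (ipow A I M k) n" by(induction n) simp_all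

lemma ipow_subset:"smod A M ==> I <= A ==> ipow A I M n <= M"
 by(induction n) (simp, metis ipow.simps(2) mul_subset order_trans sm_ipow)

lemma ipow_antimono:"smod A M ==> I <= A ==> k <= n ==> ipow A I M n <= ipow A I M k"
 by(metis ipow_add ipow_subset le_Suc_ex sm_ipow add.commute)

lemma ipow_plus:"smod A M ==> smod A N ==> ipow A I (M + N) n = ipow A I M n + ipow A I N n"
 by(induction n) (simp_all add:mul_plus sm_ipow)

lemma ipow_power_in:"i : I ==> u : M ==> i ^ n * u : ipow A I M n" by(induction n) (simp_all add:mul_in mult.assoc)

lemma mul_scaled:"mul A I (x *o M) = x *o mul A I M" proof -
 have "{i * u |i u. i : I & u : x *o M} = (*) x ` {i * u |i u. i : I & u : M}" proof(intro equalityI subsetI)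
 fix w assume "w : {i * u |i u. i : I & u : x *o M}"
 then obtain i u where "w = i * (x * u)" "i : I" "u : M" by(auto simp:in_scaled)
 hence "w = x * (i * u)" "i : I" "u : M" by(simp_all add:mult.left_commute)
 thus "w : (*) x ` {i * u |i u. i : I & u : M}" by blast
 next
 fix w assume "w : (*) x ` {i * u |i u. i : I & u : M}"
 then obtain i u where "w = x * (i * u)" "i : I" "u : M" by blast
 hence "w = i * (x * u)" "i : I" "x * u : x *o M" by(auto simp:mult.left_commute)
 thus "w : {i * u |i u. i : I & u : x *o M}" by blast
 qed
 thus ?thesis by(simp add:mul_def span_image_scale)
qed

lemma ipow_scaled:"ipow A I (x *o M) n = x *o ipow A I M n" by(induction n) (simp_all add:mul_scaled)

lemma mul_assoc:"mul A (mul A I J) M <= mul A I (mul A J M)" proof(intro mul_least sm_mprod)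
 fix w u assume w:"w : mul A I J" and u:"u : M"
 have "mul A I J <= {w. w * u : mul A I (mul A J M)}" proof(rule mul_least)
 show "smod A {w. w * u : mul A I (mul A J M)}"
 using sm_mprod[of A I "mul A J M"] by(auto simp:smod_def distrib_right mult.assoc)
 fix i j assume "i : I" "j : J"
 thus "i * j : {w. w * u : mul A I (mul A J M)}" using u by(simp add:mult.assoc mul_in)
 qed
 thus "w * u : mul A I (mul A J M)" using w by blast
qed

lemma ipow_mult_subset:"smod A M ==> mul A (ipow A I A n) M <= ipow A I M n" proof(induction n)
 case (Suc n)
 have "mul A (ipow A I A (Suc n)) M <= mul A I (mul A (ipow A I A n) M)" using mul_assoc by simp
 also have "... <= ipow A I M (Suc n)" using Suc by(simp add:mul_mono)
 finally show ?case .
qed (simp add:mul_subset)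

lemma ipow_mult_in:"smod A M ==> a : ipow A I A n ==> u : M ==> a * u : ipow A I M n"
 using ipow_mult_subset mul_in by blast

text \<open>In a product of \<open>t + s\<close> factors from \<open>I + gA\<close> either \<open>t\<close> come from \<open>I\<close> or \<open>s\<close> equal \<open>g\<close>.\<close>

lemma ipow_pigeonhole: assumes "sring A" "smod A I" "smod A M" "I <= A" "g : A"
 shows "ipow A (g *o A + I) M (t + s) <= ipow A I M t + (g ^ s) *o M" proof(induction t arbitrary: s)
 case 0
 have "g *o A + I <= A" using assms by(intro plus_le[of A]) (auto simp:in_scaled sm_self sr_mult)
 thus ?case using assms ipow_subset plus_ge1 sm_scaled by(metis (no_types, lifting) add_0 ipow.simps(1) order_trans)
next
 case (Suc t)
 note IH = Suc.IH
 show ?case proof(induction s)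
 case 0
 have J:"g *o A + I <= A" using assms by(intro plus_le[of A]) (auto simp:in_scaled sm_self sr_mult)
 have "ipow A (g *o A + I) M (Suc t + 0) <= M" using J assms by(intro ipow_subset)
 also have "M <= ipow A I M (Suc t) + M" using assms by(intro plus_ge2[of A] sm_ipow)
 finally show ?case by simp
 next
 case (Suc s)
 let ?J = "g *o A + I"
 have 1:"mul A I (ipow A ?J M (t + Suc s)) <= ipow A I M (Suc t) + (g ^ Suc s) *o M" proof -
 have "mul A I (ipow A ?J M (t + Suc s)) <= mul A I (ipow A I M t + (g ^ Suc s) *o M)" by(intro mul_mono IH) auto
 also have "... = mul A I (ipow A I M t) + mul A I ((g ^ Suc s) *o M)"
 using assms by(intro mul_plus sm_ipow sm_scaled)
 also have "... <= ipow A I M (Suc t) + (g ^ Suc s) *o M" unfolding mul_scaled ipow.simps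
 by(intro plus_mono order.refl scaled_mono mul_subset assms(3,4))
 finally show ?thesis .
 qed
 have 2:"mul A (g *o A) (ipow A ?J M (Suc t + s)) <= ipow A I M (Suc t) + (g ^ Suc s) *o M" proof -
 have "mul A (g *o A) (ipow A ?J M (Suc t + s)) = g *o ipow A ?J M (Suc t + s)"
 using assms by(intro mul_cyclic sm_ipow)
 also have "... <= g *o (ipow A I M (Suc t) + (g ^ s) *o M)" using Suc by(intro scaled_mono)
 also have "... = g *o ipow A I M (Suc t) + (g ^ Suc s) *o M" by(simp add:scaled_plus scaled2)
 also have "... <= ipow A I M (Suc t) + (g ^ Suc s) *o M"
 by(rule plus_mono[OF scaled_le[OF sm_ipow[OF assms(3)] assms(5)] order.refl])
 finally show ?thesis .
 qed
 have "ipow A ?J M (Suc t + Suc s) = mul A (g *o A) (ipow A ?J M (Suc t + s)) + mul A I (ipow A ?J M (t + Suc s))"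
 using assms by(simp add:mul_plus_left sm_cyclic)
 also have "... <= ipow A I M (Suc t) + (g ^ Suc s) *o M"
 by(rule plus_le[OF sm_plus[OF sm_ipow[OF assms(3)] sm_scaled[OF assms(3)]] 2 1])
 finally show ?case .
 qed
qed

text \<open>Every generator is nilpotent modulo C, and \<open>ipow_pigeonhole\<close> adds up the
  exponents one generator at a time.\<close>

lemma ipow_subset_if_nilpotent: assumes "sring A" "smod A M" "smod A C" "finite G" "G <= A"
 and nil:"!!g. g : G ==> EX s. (g ^ s) *o M <= C" shows "EX t. ipow A (span A G) M t <= C" using assms(4,5) nil
proof(induction G rule:finite_induct)
 case empty
 have "ipow A (span A {}) M (Suc 0) <= C" using assms(3) by(simp, intro mul_least) auto
 thus ?case by blast
next
 case (insert g G)
 then obtain t where t:"ipow A (span A G) M t <= C" by auto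
 obtain s where s:"(g ^ s) *o M <= C" using insert by blast
 have "span A G <= A" using insert assms by(intro span_least sm_self) auto
 hence "ipow A (span A (insert g G)) M (t + s) <= ipow A (span A G) M t + (g ^ s) *o M"
 using assms insert by(simp add:span_insert ipow_pigeonhole sm_span)
 also have "... <= C" using t s assms by(intro plus_le)
 finally show ?case by blast
qed

text \<open>If \<open>\<cc>\<close> kills the generators of \<open>M\<close> modulo \<open>N\<close>, then \<open>M / N\<close> is a quotient of a sum of copies of \<open>A / \<cc>\<close>.\<close>

lemma len_span_le: assumes A:"sring A" and G:"finite G" and N:"smod A N" and c:"smod A \<cc>" "\<cc> <= A"
 and kill:"!!c g. c : \<cc> ==> g : G ==> c * g : N"
 shows "len A (span A G + N) N <= of_nat (card G) * len A A \<cc>" using G kill proof(induction G rule:finite_induct)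
 case empty
 thus ?case by(simp add:N)
next
 case (insert g G)
 let ?K = "span A G + N"
 have K:"smod A ?K" using N sm_span sm_plus by blast
 have eq:"span A (insert g G) + N = g *o A + ?K" by(simp add:span_insert A add.assoc)
 have "len A (g *o A + ?K) N = len A (g *o A + ?K) ?K + len A ?K N" proof(rule len_add[OF A K])
 show "N <= ?K" by(rule plus_ge2[OF sm_span])
 show "?K <= g *o A + ?K" by(rule plus_ge2[OF sm_cyclic[OF A]])
 qed (use N K in \<open>simp_all add:sm_plus sm_cyclic A\<close>)
 also have "len A (g *o A + ?K) ?K = len A A {a:A. g * a : ?K}" by(rule len_scaled[OF A sm_self[OF A] K])
 also have "... <= len A A \<cc>" proof(rule len_mono, rule subsetI)
 fix a assume a:"a : \<cc>"
 hence "g * a : N" using insert.prems by(metis insertI1 mult.commute)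
 hence "g * a : ?K" using plus_ge2[OF sm_span, of N A G] by(rule subsetD[rotated])
 thus "a : {a:A. g * a : ?K}" using a c by blast
 qed
 also have "len A ?K N <= of_nat (card G) * len A A \<cc>" using insert by simp
 finally show ?case using insert unfolding eq by(simp add:distrib_right add_mono)
qed

lemma len_finite_if_killed:
 assumes "sring A" "fg A M" "smod A N" "N <= M" "smod A \<cc>" "\<cc> <= A" "len A A \<cc> < \<infinity>"
 and kill:"!!c g. c : \<cc> ==> g : M ==> c * g : N" shows "len A M N < \<infinity>" proof -
 obtain G where G:"finite G" "M = span A G" using assms by(auto simp:fg_def)
 have sub:"G <= M" unfolding G by(rule span_inc)
 have "len A (span A G + N) N <= of_nat (card G) * len A A \<cc>" by(rule len_span_le) (use assms G sub kill in auto)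
 also have "span A G + N = M" using assms(4) G plus_abs2[OF sm_span[of A G] assms(3)] by simp
 also have "of_nat (card G) * len A A \<cc> < \<infinity>"
 using assms(7) by(cases "len A A \<cc>") (auto simp:of_nat_eq_enat)
 finally show ?thesis .
qed

section \<open>Local rings: Nakayama's lemma and Krull's intersection theorem\<close>

locale local_ring = fixes A m :: "'b::comm_ring_1 set" assumes sring:"sring A" and noeth_ring:"noeth A A"
 and sm_m:"smod A m" and m_le:"m <= A" and one_notin_m:"1 ~: m"
 and unit:"!!a. a : A ==> a ~: m ==> EX b:A. a * b = 1"
begin

text \<open>Induction on the generators: g = n + g \<mu> + v with \<mu> in m and v in the span of
  the others. As 1 - \<mu> is a unit, g is redundant modulo N.\<close>

lemma nakayama_span: assumes "finite G" "smod A N" "span A G <= N + mul A m (span A G)" shows "span A G <= N"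
 using assms proof(induction G rule:finite_induct)
 case empty
 thus ?case by simp
next
 case (insert g G)
 let ?M1 = "span A G" and ?M = "span A (insert g G)"
 have Meq:"?M = g *o A + ?M1" using span_insert sring by blast
 have mp:"mul A m ?M = g *o m + mul A m ?M1"
 unfolding Meq by(simp add:mul_plus sm_cyclic sring sm_span mul_cyclic_right sm_m)
 have "g : ?M" using span_inc by blast
 hence "g : N + (g *o m + mul A m ?M1)" using insert.prems mp by auto
 then obtain n \<mu> v where n:"n : N" "\<mu> : m" "v : mul A m ?M1" "g = n + (g * \<mu> + v)"
 by(elim set_plus_elim) (auto simp:in_scaled)
 have "v : ?M1" using n mul_subset[OF sm_span m_le] by blast
 have "1 - \<mu> ~: m" proof
 assume "1 - \<mu> : m"
 hence "1 - \<mu> + \<mu> : m" using n sm_m sm_add by blast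
 thus False using one_notin_m by simp
 qed
 moreover have "1 - \<mu> : A" using n m_le sring by(meson sr_1 sr_diff subsetD)
 ultimately obtain b where b:"b : A" "(1 - \<mu>) * b = 1" using unit by blast
 have "(1 - \<mu>) * g = n + v" using n(4) by(simp add:algebra_simps)
 hence "g = b * (n + v)" using b by(metis mult.assoc mult.commute mult.left_neutral)
 hence "g : N + ?M1" using b n `v : ?M1` insert.prems(1) sm_span by(metis set_plus_intro sm_plus sm_mult)
 hence gA:"g *o A <= N + ?M1"
 using sm_plus[OF insert.prems(1) sm_span] by(auto simp:in_scaled) (metis mult.commute sm_mult)
 have M:"?M <= N + ?M1" unfolding Meq using gA plus_ge2[OF insert.prems(1)]
 by(intro plus_le[OF sm_plus[OF insert.prems(1) sm_span]])
 have "mul A m ?M <= mul A m (N + ?M1)" using M by(intro mul_mono) auto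
 also have "... = mul A m N + mul A m ?M1" by(simp add:mul_plus insert.prems sm_span)
 also have "... <= N + mul A m ?M1" using mul_subset[OF insert.prems(1) m_le] by(intro plus_mono) auto
 finally have "N + mul A m ?M <= N + mul A m ?M1"
 by(intro plus_le[OF sm_plus[OF insert.prems(1) sm_mprod]] plus_ge1[OF sm_mprod])
 moreover have "?M1 <= ?M" by(rule span_mono) blast
 ultimately have "?M1 <= N + mul A m ?M1" using insert.prems(2) by blast
 hence "?M1 <= N" by(rule insert.IH[OF insert.prems(1)])
 hence "N + ?M1 = N" by(rule plus_abs2[OF insert.prems(1) sm_span])
 thus ?case using M by simp
qed

lemma nakayama:"fg A M ==> smod A N ==> M <= N + mul A m M ==> M <= N" unfolding fg_def using nakayama_span by metis

lemma scaled_subset_mprod:"y : m ==> y *o M <= mul A m M" by(auto simp:in_scaled mul_in)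

lemma nakayama_elem: assumes "fg A M" "smod A N" "y : m" "M <= N + y *o M" shows "M <= N"
 by(rule nakayama[OF assms(1,2)])
 (use assms(4) plus_mono[OF order.refl scaled_subset_mprod[OF assms(3)], of N M] in blast)

lemma len_residue:"len A A m = 1" proof(rule antisym)
 show "len A A m <= 1" unfolding one_enat_def proof(rule len_leI)
 fix n f assume f:"chain_in A A m n f"
 have *:"f i = m | f i = A" if "i <= n" for i proof(cases "f i <= m")
 case True thus ?thesis using f that by(auto simp:chain_in_def)
 next
 case False
 then obtain a where a:"a : f i" "a ~: m" by blast
 have s:"smod A (f i)" "f i <= A" using f that by(auto simp:chain_in_def)
 then obtain b where b:"b : A" "a * b = 1" using unit a by blast
 hence "1 : f i" using a s by(metis mult.commute sm_mult)
 hence "A <= f i" using s by(metis mult.right_neutral sm_mult subsetI)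
 thus ?thesis using s by blast
 qed
 have "n <= 1" proof(rule ccontr)
 assume "~ n <= 1"
 hence "f 0 < f 1" "f 1 < f 2" using f unfolding chain_in_def
 by(metis One_nat_def less_or_eq_imp_le not_le order_less_trans zero_less_one) 
 (metis `~ n <= 1` f chain_in_def Suc_1 linorder_not_le)
 moreover have "f 0 = m | f 0 = A" "f 1 = m | f 1 = A" "f 2 = m | f 2 = A" using * `~ n <= 1` by auto
 ultimately show False using m_le by blast
 qed
 thus "enat n <= enat 1" by simp
 qed
 show "1 <= len A A m" using m_le one_notin_m sring by(intro len_ge_1 sm_m sm_self) auto
qed

lemma len_mprod_finite: assumes "fg A M" shows "len A M (mul A m M) < \<infinity>"
proof(rule len_finite_if_killed[OF sring assms sm_mprod _ sm_m m_le])
 show "mul A m M <= M" by(rule mul_subset[OF fg_smod[OF assms] m_le])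
 show "len A A m < \<infinity>" by(simp add:len_residue one_enat_def)
qed (rule mul_in)

lemma fg_sub:"fg A M ==> smod A N ==> N <= M ==> fg A N" by(meson fg_noeth noeth_fg noeth_ring sring)

lemma fg_ipow:"fg A M ==> I <= A ==> fg A (ipow A I M n)"
 by(rule fg_sub) (auto intro:sm_ipow fg_smod ipow_subset[THEN subsetD])

lemma len_ipow_finite:"fg A M ==> len A M (ipow A m M n) < \<infinity>" proof(induction n)
 case 0
 thus ?case by simp
next
 case (Suc n)
 have s:"smod A (ipow A m M k)" for k by(rule sm_ipow[OF fg_smod[OF Suc.prems]])
 have "len A M (ipow A m M (Suc n)) = len A M (ipow A m M n) + len A (ipow A m M n) (ipow A m M (Suc n))"
 by(rule len_add[OF sring s ipow_antimono[OF fg_smod[OF Suc.prems] m_le le_SucI[OF order.refl]]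
 ipow_subset[OF fg_smod[OF Suc.prems] m_le] fg_smod[OF Suc.prems] s])
 moreover have "len A (ipow A m M n) (ipow A m M (Suc n)) < \<infinity>"
 using len_mprod_finite[OF fg_ipow[OF Suc.prems m_le]] by simp
 ultimately show ?case using Suc by(simp add:plus_eq_infty_iff_enat less_le)
qed

text \<open>Choose \<open>C\<close> maximal with \<open>C \<inter> X = N + mX\<close>: some \<open>m\<^sup>t M\<close> lies in \<open>C\<close>.\<close>

theorem krull: assumes M:"fg A M" and N:"smod A N" "N <= M" shows "(\<Inter>k. N + ipow A m M k) <= N" proof -
 have sM:"smod A M" by(rule fg_smod[OF M])
 define X where "X = (\<Inter>k. N + ipow A m M k)"
 have Xs:"smod A X" unfolding X_def by(rule sm_Inter) (auto intro:sm_plus N sm_ipow sM)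
 have XM:"X <= M" proof -
 have "X <= N + ipow A m M 0" unfolding X_def by blast
 also have "... <= M" using N sM by(simp add:plus_abs)
 finally show ?thesis .
 qed
 have NX:"N <= X" unfolding X_def using plus_ge1[OF sm_ipow[OF sM]] by blast
 let ?Y = "N + mul A m X"
 have YX:"?Y <= X" by(intro plus_le[OF Xs NX] mul_subset Xs m_le)
 have Ys:"smod A ?Y" by(intro sm_plus N sm_mprod)
 let ?UU = "{C. smod A C & C <= M & C Int X = ?Y}"
 have "EX C:?UU. ALL V:?UU. C <= V --> V = C" proof(rule noeth_max[OF fg_noeth[OF sring noeth_ring M]])
 have "?Y : ?UU" using Ys YX XM by auto
 thus "?UU ~= {}" by blast
 qed auto
 then obtain C where C:"C : ?UU" "ALL V:?UU. C <= V --> V = C" by(rule bexE)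
 have Cs:"smod A C" "C <= M" "C Int X = ?Y" using C(1) by auto
 \<comment> \<open>Once the modules \<open>D s\<close> of elements carried into C by x^s are stable,
   x^s M + C meets X only in \<open>?Y\<close>, and maximality of C gives x^s M inside C.\<close>
 have nil:"EX s. (x ^ s) *o M <= C" if x:"x : m" for x proof -
 have xA:"x ^ s : A" for s using x m_le sring sr_power by blast
 define D where "D s = {u:M. x ^ s * u : C}" for s
 have Ds:"smod A (D s)" for s
 using Cs(1) sM xA[of s] unfolding D_def smod_def by(auto simp:distrib_left mult.left_commute)
 have "EX s. ALL t>=s. D t = D s" proof(rule noethD[OF fg_noeth[OF sring noeth_ring M] Ds])
 fix s
 show "D s <= M" by(auto simp:D_def)
 have "x : A" using xA[of 1] by simp
 thus "D s <= D (Suc s)" using Cs(1) by(auto simp:D_def mult.assoc sm_mult)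
 qed
 then obtain s where s:"ALL t>=s. D t = D s" by(rule exE)
 have DS:"D (Suc s) = D s" by(rule s[rule_format]) simp
 let ?V = "(x ^ s) *o M + C"
 have Vs:"smod A ?V" by(intro sm_plus sm_scaled sM Cs)
 have "?V Int X <= ?Y" proof
 fix w assume w:"w : ?V Int X"
 then obtain u c where uc:"w = x ^ s * u + c" "u : M" "c : C" by(auto elim!: set_plus_elim simp:in_scaled)
 have "x * w : mul A m X" using w x by(intro mul_in) auto
 hence "x * w : C Int X" unfolding Cs(3) using plus_ge2[OF N(1)] by blast
 moreover have "x * c : C" using uc Cs(1) xA[of 1] by(simp add:sm_mult)
 ultimately have "x * w - x * c : C" using Cs(1) sring sm_diff by blast
 hence "u : D (Suc s)" using uc by(simp add:D_def algebra_simps)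
 hence "u : D s" using DS by simp
 hence "w : C" using uc Cs(1) by(simp add:D_def sm_add)
 thus "w : ?Y" using w Cs(3) by blast
 qed
 moreover have CV:"C <= ?V" by(rule plus_ge2[OF sm_scaled[OF sM]])
 ultimately have "?V Int X = ?Y" using Cs(3) by blast
 moreover have "?V <= M" using xA sM Cs by(intro plus_le[OF sM] scaled_le) auto
 ultimately have "?V : ?UU" using Vs by blast
 hence "?V = C" using C(2) CV by blast
 hence "(x ^ s) *o M <= C" using plus_ge1[OF Cs(1)] by metis
 thus ?thesis by blast
 qed
 obtain G where G:"finite G" "m = span A G" using fg_sub[OF fg_self[OF sring] sm_m m_le] by(auto simp:fg_def)
 have "G <= m" unfolding G(2) by(rule span_inc)
 have "EX t. ipow A m M t <= C" unfolding G(2) proof(rule ipow_subset_if_nilpotent[OF sring sM Cs(1) G(1)])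
 show "G <= A" using `G <= m` m_le by(rule order_trans)
 show "EX s. (g ^ s) *o M <= C" if "g : G" for g by(rule nil[OF subsetD[OF `G <= m` that]])
 qed
 then obtain t where t:"ipow A m M t <= C" by(rule exE)
 have "N <= C" using Cs(3) plus_ge1[OF sm_mprod, of N A m X] by blast
 hence "N + ipow A m M t <= C" using t by(intro plus_le[OF Cs(1)])
 moreover have "X <= N + ipow A m M t" unfolding X_def by(rule Inter_lower) (rule rangeI)
 ultimately have "X <= C" by(rule order_trans[rotated])
 hence "X <= ?Y" using Cs(3) by blast
 hence "X <= N" by(rule nakayama[OF fg_sub[OF M Xs XM] N(1)])
 thus ?thesis by(simp add:X_def)
qed

corollary krull_mem: assumes "fg A M" "smod A N" "N <= M" "!!k. u : N + ipow A m M k" shows "u : N"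
 using krull[OF assms(1-3)] assms(4) by blast

corollary krull_elem: assumes "fg A M" "smod A N" "N <= M" "y : m" "!!k. u : N + (y ^ k) *o M" shows "u : N"
proof(rule krull_mem[OF assms(1-3)])
 fix k
 have "(y ^ k) *o M <= ipow A m M k" using assms(4) ipow_power_in by(auto simp:in_scaled)
 thus "u : N + ipow A m M k" using assms(5)[of k] plus_mono[OF order.refl] by blast
qed

end

section \<open>Completeness and Chevalley's theorem\<close>

text \<open>Convergence with prescribed speed: the j-th term is already correct modulo m^j M. In
  this form completeness passes to finitely generated modules without choosing subsequences.\<close>

definition complete_at :: "'b::comm_ring_1 set => 'b set => 'b set => bool" where
 "complete_at A m M <-> (ALL t::nat => 'b. (ALL j. t j : M & t (Suc j) - t j : ipow A m M j)
 --> (EX u:M. ALL j. u - t j : ipow A m M j))"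

lemma descending_stable: assumes A:"sring A" and M:"smod A M" "smod A P" "P <= M" "len A M P < \<infinity>"
 and D:"!!n. smod A (D n)" "!!n. P <= D n" "!!n. D n <= M" "!!n::nat. D (Suc n) <= D n"
 shows "EX N. ALL n>=N. D n = D N" proof -
 obtain l where l:"len A M P = enat l" using M(4) by(cases "len A M P") auto
 have le:"len A M (D n) <= enat l" for n using len_mono[OF D(2)] l by metis
 define L where "L n = the_enat (len A M (D n))" for n
 have L:"len A M (D n) = enat (L n)" for n using le[of n] unfolding L_def by(cases "len A M (D n)") auto
 have "L n <= l" for n using le[of n] L[of n] by simp
 then obtain N where N:"!!n. L n <= L N"
 using ex_has_greatest_nat[of "%_. True" 0 L "Suc l"] by(metis le_imp_less_Suc)
 have mono:"D n <= D k" if "k <= n" for k n using D(4) that by(rule lift_Suc_antimono_le)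
 have "D n = D N" if n:"n >= N" for n proof -
 have "len A M (D n) = len A M (D N) + len A (D N) (D n)" using mono[OF n] D M A by(intro len_add) auto
 hence "len A (D N) (D n) = 0" using N[of n] unfolding L by(cases "len A (D N) (D n)") (auto simp:zero_enat_def)
 thus ?thesis using len_eq_0_iff[OF D(1) D(1) mono[OF n]] by simp
 qed
 thus ?thesis by blast
qed

locale complete_local_ring = local_ring A m for A m :: "'b::comm_ring_1 set" + assumes complete:"complete_at A m A"
begin

text \<open>Split each difference t (j + 1) - t j into a part in g m^j and a part in m^j times the
  remaining span, and sum the two parts separately.\<close>

lemma complete_span:"finite G ==> complete_at A m (span A G)" proof(induction G rule:finite_induct)
 case empty
 have "0 : ipow A m {0} j" for j by(rule sm_0[OF sm_ipow[OF sm_zero]])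
 thus ?case unfolding complete_at_def by auto
next
 case (insert g G)
 let ?M1 = "span A G"
 have eq:"span A (insert g G) = g *o A + ?M1" using span_insert sring by blast
 have M1:"smod A ?M1" by(rule sm_span)
 show ?case unfolding complete_at_def eq proof(intro allI impI)
 fix t :: "nat => 'b"
 assume t:"ALL j. t j : g *o A + ?M1 & t (Suc j) - t j : ipow A m (g *o A + ?M1) j"
 have ip:"ipow A m (g *o A + ?M1) j = g *o ipow A m A j + ipow A m ?M1 j" for j
 by(simp add:ipow_plus sm_cyclic sring M1 ipow_scaled)
 have "ALL j. EX a v. t (Suc j) - t j = g * a + v & a : ipow A m A j & v : ipow A m ?M1 j" proof
 fix j
 have "t (Suc j) - t j : g *o ipow A m A j + ipow A m ?M1 j" using t ip by blast
 thus "EX a v. t (Suc j) - t j = g * a + v & a : ipow A m A j & v : ipow A m ?M1 j"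
 by(elim set_plus_elim) (auto simp:in_scaled)
 qed
 then obtain a v where av:"!!j. t (Suc j) - t j = g * a j + v j" "!!j. a j : ipow A m A j" "!!j. v j : ipow A m ?M1 j"
 by metis
 have "t 0 : g *o A + ?M1" using t by blast
 then obtain a0 v0 where 0:"t 0 = g * a0 + v0" "a0 : A" "v0 : ?M1" by(elim set_plus_elim) (auto simp:in_scaled)
 define al where "al j = a0 + (SUM i<j. a i)" for j
 define be where "be j = v0 + (SUM i<j. v i)" for j
 have tj:"t j = g * al j + be j" for j proof(induction j)
 case (Suc j)
 have "t (Suc j) = t j + (g * a j + v j)" using av(1)[of j] by(simp add:algebra_simps)
 thus ?case using Suc by(simp add:al_def be_def algebra_simps)
 qed (simp add:0 al_def be_def)
 have al:"al j : A" for j proof(induction j)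
 case (Suc j)
 have "a j : A" using av(2)[of j] ipow_subset[OF sm_self[OF sring] m_le] by blast
 thus ?case using Suc sr_add[OF sring] by(simp add:al_def flip: add.assoc)
 qed (simp add:al_def 0)
 have be:"be j : ?M1" for j proof(induction j)
 case (Suc j)
 have "v j : ?M1" using av(3)[of j] ipow_subset[OF M1 m_le] by blast
 thus ?case using Suc sm_add[OF M1] by(simp add:be_def flip: add.assoc)
 qed (simp add:be_def 0)
 have "EX u:A. ALL j. u - al j : ipow A m A j"
 using complete[unfolded complete_at_def, rule_format, of al] al av(2) by(simp add:al_def)
 then obtain u where u:"u : A" "!!j. u - al j : ipow A m A j" by blast
 have "EX w:?M1. ALL j. w - be j : ipow A m ?M1 j"
 using insert.IH[unfolded complete_at_def, rule_format, of be] be av(3) by(simp add:be_def)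
 then obtain w where w:"w : ?M1" "!!j. w - be j : ipow A m ?M1 j" by blast
 show "EX u:g *o A + ?M1. ALL j. u - t j : ipow A m (g *o A + ?M1) j" proof(intro bexI allI)
 show "g * u + w : g *o A + ?M1" using u w by(intro set_plus_intro scaledI)
 fix j
 have "g * u + w - t j = g * (u - al j) + (w - be j)" by(simp add:tj algebra_simps)
 thus "g * u + w - t j : ipow A m (g *o A + ?M1) j"
 unfolding ip using set_plus_intro[OF scaledI[OF u(2)[of j]] w(2)[of j]] by(simp only:)
 qed
 qed
qed

lemma complete_fg:"fg A M ==> complete_at A m M" by(auto simp:fg_def complete_span)

text \<open>Modulo each m^j M the chain becomes stationary, by finite length. So an element of a
  late member can be corrected step by step into later members, with corrections in growing powers
  of m; the limit lies in the intersection by Krull's theorem.\<close>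

theorem chevalley: assumes M:"fg A M" and F:"!!n. smod A (F n)" "!!n. F n <= M" "!!n::nat. F (Suc n) <= F n"
 shows "EX N. F N <= (\<Inter>n. F n) + ipow A m M k" proof -
 define X where "X = (\<Inter>n. F n)"
 let ?P = "ipow A m M"
 have sM:"smod A M" by(rule fg_smod[OF M])
 have sP:"smod A (?P j)" for j by(rule sm_ipow[OF sM])
 have PM:"?P j <= M" for j by(rule ipow_subset[OF sM m_le])
 have mono:"F n <= F k" if "k <= n" for k n using F(3) that by(rule lift_Suc_antimono_le)
 have "ALL j. EX N. ALL n>=N. F n + ?P j = F N + ?P j" proof
 fix j
 show "EX N. ALL n>=N. F n + ?P j = F N + ?P j"
 proof(rule descending_stable[OF sring sM sP PM len_ipow_finite[OF M]])
 fix n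
 show "smod A (F n + ?P j)" by(rule sm_plus[OF F(1) sP])
 show "?P j <= F n + ?P j" by(rule plus_ge2[OF F(1)])
 show "F n + ?P j <= M" by(rule plus_le[OF sM F(2) PM])
 show "F (Suc n) + ?P j <= F n + ?P j" by(rule plus_mono[OF F(3) order.refl])
 qed
 qed
 then obtain K where K:"!!j n. n >= K j ==> F n + ?P j = F (K j) + ?P j" by metis
 \<comment> \<open>The sum dominates all thresholds up to j, and the summand j forces N j \<ge> j,
   so that the sequence constructed below eventually enters every F n.\<close>
 define N where "N j = j + (SUM i<=j. K i)" for j
 have NK:"K j <= N j'" if "j <= j'" for j j' proof -
 have "K j <= (SUM i<=j'. K i)" using that by(intro member_le_sum) auto
 thus ?thesis by(simp add:N_def)
 qed
 have "F (N k) <= X + ?P k" proof(rule ccontr)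
 assume "~ F (N k) <= X + ?P k"
 then obtain a where a:"a : F (N k)" "a ~: X + ?P k" by blast
 have "EX s::nat => 'b. s 0 = a & (ALL i. s i : F (N (k + i)) & s (Suc i) - s i : ?P (k + i))" proof -
 have "EX s::nat => 'b. ALL i. (s i : F (N (k + i)) & (i = 0 --> s i = a)) & s (Suc i) - s i : ?P (k + i)"
 proof(rule dependent_nat_choice)
 show "EX x. x : F (N (k + 0)) & (0 = (0::nat) --> x = a)" using a by auto
 fix x i assume "x : F (N (k + i)) & (i = 0 --> x = a)"
 hence "x : F (N (k + i)) + ?P (k + i)" using plus_ge1[OF sP] by blast
 also have "... = F (N (k + Suc i)) + ?P (k + i)"
 using K[OF NK[of "k + i" "k + i"]] K[OF NK[of "k + i" "k + Suc i"]] by simp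
 finally obtain y p where yp:"x = y + p" "y : F (N (k + Suc i))" "p : ?P (k + i)" by(rule set_plus_elim)
 have "y - x : ?P (k + i)" using yp sm_uminus[OF sring sP yp(3)] by simp
 thus "EX y. (y : F (N (k + Suc i)) & (Suc i = 0 --> y = a)) & y - x : ?P (k + i)" using yp by blast
 qed
 thus ?thesis by blast
 qed
 then obtain s where s:"s 0 = a" "!!i. s i : F (N (k + i))" "!!i. s (Suc i) - s i : ?P (k + i)" by blast
 define t where "t j = s (j - k)" for j
 have "EX u:M. ALL j. u - t j : ?P j" proof(rule complete_fg[OF M, unfolded complete_at_def, rule_format])
 fix j
 have "t (Suc j) - t j : ?P j" proof(cases "k <= j")
 case True thus ?thesis using s(3)[of "j - k"] by(simp add:t_def Suc_diff_le)
 next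
 case False thus ?thesis using sm_0[OF sP] by(simp add:t_def)
 qed
 moreover have "t j : M" using s(2)[of "j - k"] F(2) unfolding t_def by blast
 ultimately show "t j : M & t (Suc j) - t j : ?P j" by blast
 qed
 then obtain u where u:"!!j. u - t j : ?P j" by blast
 have "u : F n" for n proof(rule krull_mem[OF M F(1) F(2)])
 fix j
 let ?i = "n + j"
 have "n <= N (k + ?i)" by(simp add:N_def)
 hence 1:"s ?i : F n" using s(2)[of ?i] mono by blast
 have "u - s ?i : ?P (k + ?i)" using u[of "k + ?i"] by(simp add:t_def)
 hence 2:"u - s ?i : ?P j" using ipow_antimono[OF sM m_le, of j "k + ?i"] by auto
 have "s ?i + (u - s ?i) : F n + ?P j" using 1 2 by(rule set_plus_intro)
 thus "u : F n + ?P j" by simp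
 qed
 hence uX:"u : X" by(simp add:X_def)
 have "u - a : ?P k" using u[of k] s(1) by(simp add:t_def)
 hence "- (u - a) : ?P k" by(rule sm_uminus[OF sring sP])
 hence "u + - (u - a) : X + ?P k" using uX by(intro set_plus_intro)
 thus False using a(2) by simp
 qed
 thus ?thesis unfolding X_def by blast
qed

end

subsection \<open>Prime filtrations\<close>

definition prime_in :: "'b::comm_ring_1 set => 'b set => bool" where
 "prime_in S P <-> smod S P & P <= S & 1 ~: P & (ALL a:S. ALL b:S. a * b : P --> a : P | b : P)"

text \<open>Each step adds a cyclic module isomorphic to S / P. The primes are listed with the
  latest step first; repetitions are kept because they are the multiplicities.\<close>

inductive pfilt :: "'b::comm_ring_1 set => 'b set => 'b set => 'b set list => bool" for S Z where
 base:"pfilt S Z Z []"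
| step:"pfilt S Z Z' ps ==> a : S ==> P = {s:S. s * a : Z'} ==> prime_in S P ==> pfilt S Z (Z' + a *o S) (P # ps)"

lemma prime_inD:"prime_in S P ==> a * b : P ==> a : S ==> b : S ==> a : P | b : P" by(simp add:prime_in_def)

lemma prime_in_power: assumes "sring S" "prime_in S P" "x : S" "x ^ n : P" shows "x : P" using assms(4)
proof(induction n)
 case 0
 thus ?case using assms(2) by(simp add:prime_in_def)
next
 case (Suc n)
 thus ?case using prime_inD[OF assms(2), of x "x ^ n"] sr_power[OF assms(1,3)] assms(3) by auto
qed

lemma pfilt_facts: assumes "pfilt S Z Z' ps" "sring S" "smod S Z" "Z <= S" shows "smod S Z' & Z <= Z' & Z' <= S"
 using assms proof(induction rule:pfilt.induct)
 case (step Z' ps a P)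
 hence IH:"smod S Z'" "Z <= Z'" "Z' <= S" by auto
 have "Z' + a *o S <= S"
 by(rule plus_le[OF sm_self[OF step.prems(1)] IH(3) scaled_le[OF sm_self[OF step.prems(1)] step.hyps(2)]])
 thus ?case using IH step.prems plus_ge1[OF sm_cyclic[OF step.prems(1)], of Z' a] by(auto intro!: sm_plus sm_cyclic)
qed auto

lemma pfilt_primes: assumes "pfilt S Z Z' ps" "sring S" "smod S Z" "Z <= S" "P : set ps" shows "prime_in S P & Z <= P"
 using assms proof(induction rule:pfilt.induct)
 case (step Z' ps a P')
 have f:"Z <= Z'" "smod S Z'" "Z' <= S" using pfilt_facts[OF step.hyps(1) step.prems(1-3)] by auto
 have "Z <= P'" using f step.hyps(2,3) step.prems(3) by(auto simp:mult.commute[of _ a] sm_mult)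
 thus ?case using step by auto
qed auto

text \<open>A maximal one among the annihilators of nonzero elements of S / C is prime, so a
  filtration that cannot be prolonged has reached S.\<close>

lemma pfilt_ex: assumes S:"sring S" "noeth S S" and Z:"smod S Z" "Z <= S" shows "EX ps. pfilt S Z S ps" proof -
 let ?UU = "{Z'. EX ps. pfilt S Z Z' ps}"
 have "EX C:?UU. ALL V:?UU. C <= V --> V = C" proof(rule noeth_max[OF S(2)])
 have "Z : ?UU" using pfilt.base by blast
 thus "?UU ~= {}" by blast
 qed (use pfilt_facts[OF _ S(1) Z] in blast)
 then obtain C where C:"C : ?UU" "ALL V:?UU. C <= V --> V = C" by(rule bexE)
 then obtain ps where ps:"pfilt S Z C ps" by blast
 have f:"smod S C" "C <= S" using pfilt_facts[OF ps S(1) Z] by auto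
 have "C = S" proof(rule ccontr)
 assume "C ~= S"
 then obtain a0 where a0:"a0 : S" "a0 ~: C" using f by blast
 let ?V = "{{s:S. s * a : C} | a. a : S & a ~: C}"
 have sub:"smod S {s:S. s * a : C}" if "a : S" for a
 using f(1) S(1) unfolding smod_def by(auto simp:distrib_right mult.assoc sr_add sr_mult)
 have "EX P:?V. ALL W:?V. P <= W --> W = P" proof(rule noeth_max[OF S(2)])
 show "?V ~= {}" using a0 by blast
 qed (use sub in blast)
 then obtain P where P:"P : ?V" "ALL W:?V. P <= W --> W = P" by(rule bexE)
 from P(1) obtain a where a:"a : S" "a ~: C" "P = {s:S. s * a : C}" by blast
 have "prime_in S P" unfolding prime_in_def proof(intro conjI ballI impI)
 show "smod S P" using sub[OF a(1)] a(3) by simp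
 show "P <= S" "1 ~: P" using a by auto
 fix b c assume bc:"b : S" "c : S" "b * c : P"
 show "b : P | c : P" proof(rule disjCI)
 assume "c ~: P"
 hence ca:"c * a ~: C" using a bc by simp
 let ?W = "{s:S. s * (c * a) : C}"
 have "?W : ?V" using ca bc a S(1) sr_mult by blast
 moreover have "P <= ?W" using a(3) bc f(1) by(auto simp:mult.left_commute[of _ c] sm_mult)
 ultimately have "?W = P" using P(2) by blast
 moreover have "b : ?W" using bc a(3) by(simp add:mult.assoc)
 ultimately show "b : P" by blast
 qed
 qed
 hence "pfilt S Z (C + a *o S) (P # ps)" using pfilt.step[OF ps a(1) a(3)] by blast
 hence "C + a *o S = C" using C(2) plus_ge1[OF sm_cyclic[OF S(1)]] by blast
 moreover have "0 + a * 1 : C + a *o S" by(intro set_plus_intro scaledI sm_0[OF f(1)] sr_1[OF S(1)])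
 ultimately show False using a by simp
 qed
 thus ?thesis using ps by blast
qed

text \<open>The step by a contributes a quotient of S / (P + bB), because a carries P into Z' and bB
  into itself.\<close>

lemma pfilt_len_le: assumes "pfilt S Z Z' ps" and S:"sring S" and R:"sring R" "R <= S" and Z:"smod S Z" "Z <= S"
 and b:"smod S bB" "bB <= S" shows "len R (Z' + bB) (Z + bB) <= (SUM P<-ps. len R S (P + bB))" using assms(1)
proof(induction rule:pfilt.induct)
 case base
 thus ?case by simp
next
 case (step Z' ps a P)
 have f:"smod S Z'" "Z <= Z'" "Z' <= S" using pfilt_facts[OF step.hyps(1) S Z] by auto
 have R': "smod R M" if "smod S M" for M using that R(2) by(rule sm_sub)
 let ?K = "Z' + bB"
 have K:"smod S ?K" using f b sm_plus by blast
 have eq:"Z' + a *o S + bB = a *o S + ?K" by(simp add:ac_simps)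
 have "len R (a *o S + ?K) (Z + bB) = len R (a *o S + ?K) ?K + len R ?K (Z + bB)"
 by(rule len_add[OF R(1) R'[OF K] plus_mono[OF f(2) order.refl] plus_ge2[OF sm_cyclic[OF S]]
 R'[OF sm_plus[OF sm_cyclic[OF S] K]] R'[OF sm_plus[OF Z(1) b(1)]]])
 also have "len R (a *o S + ?K) ?K = len R S {s:S. a * s : ?K}" by(intro len_scaled R(1) R' sm_self S K)
 also have "... <= len R S (P + bB)" proof(rule len_mono, rule subsetI)
 fix w assume "w : P + bB"
 then obtain p c where pc:"w = p + c" "p : P" "c : bB" by(rule set_plus_elim)
 have "a * p : Z'" using pc(2) step.hyps(3) by(simp add:mult.commute)
 moreover have "a * c : bB" using pc(3) b(1) step.hyps(2) by(simp add:sm_mult)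
 ultimately have "a * w : ?K" unfolding pc(1) distrib_left by(rule set_plus_intro)
 moreover have "w : S" unfolding pc(1) using pc step.hyps(3) b(2) S by(auto intro:sr_add)
 ultimately show "w : {s:S. a * s : ?K}" by blast
 qed
 also have "len R ?K (Z + bB) <= (SUM P<-ps. len R S (P + bB))" by(rule step.IH)
 finally show ?case unfolding eq by(simp add:add_mono)
qed

text \<open>Since a (P + bB) lies in Z' + bB, the exponents that work for the single primes add up
  along the filtration.\<close>

lemma pfilt_ipow: assumes "pfilt S Z Z' ps" and S:"sring S" and Z:"smod S Z" "Z <= S"
 and b:"smod S bB" "bB <= S" and I:"I <= S" and "!!P. P : set ps ==> EX n. ipow S I S n <= P + bB"
 shows "EX n. ipow S I Z' n <= Z + bB" using assms(1) assms(8) proof(induction rule:pfilt.induct)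
 case base
 have "ipow S I Z 0 <= Z + bB" using plus_ge1[OF b(1)] by simp
 thus ?case by blast
next
 case (step Z' ps a P)
 have f:"smod S Z'" "Z <= Z'" "Z' <= S" using pfilt_facts[OF step.hyps(1) S Z] by auto
 obtain n1 where n1:"ipow S I Z' n1 <= Z + bB" using step by auto
 obtain n2 where n2:"ipow S I S n2 <= P + bB" using step.prems[of P] by auto
 have "a *o (P + bB) <= Z' + bB" proof
 fix w assume "w : a *o (P + bB)"
 then obtain p c where pc:"w = a * p + a * c" "p : P" "c : bB"
 by(auto simp:in_scaled distrib_left elim!: set_plus_elim)
 have "a * p : Z'" using pc(2) step.hyps(3) by(simp add:mult.commute)
 moreover have "a * c : bB" using pc(3) b(1) step.hyps(2) by(simp add:sm_mult)
 ultimately show "w : Z' + bB" unfolding pc(1) by(rule set_plus_intro)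
 qed
 hence "ipow S I (a *o S) n2 <= Z' + bB" unfolding ipow_scaled using scaled_mono[OF n2, of a] by blast
 moreover have "ipow S I Z' n2 <= Z' + bB" using ipow_subset[OF f(1) I, of n2] plus_ge1[OF b(1), of Z'] by blast
 ultimately have "ipow S I (Z' + a *o S) n2 <= Z' + bB"
 using f(1) b(1) S by(simp add:ipow_plus sm_cyclic plus_le[OF sm_plus])
 hence "ipow S I (Z' + a *o S) (n1 + n2) <= ipow S I (Z' + bB) n1" unfolding ipow_add by(intro ipow_mono order.refl)
 also have "... = ipow S I Z' n1 + ipow S I bB n1" by(rule ipow_plus[OF f(1) b(1)])
 also have "... <= Z + bB" by(rule plus_le[OF sm_plus[OF Z(1) b(1)] n1])
 (rule order_trans[OF ipow_subset[OF b(1) I] plus_ge2[OF Z(1)]])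
 finally show ?case by blast
qed

text \<open>At the first step that leaves T the new generator a is outside T, while P a lies in Z'
  and hence in T.\<close>

lemma pfilt_below: assumes "pfilt S Z Z' ps" "prime_in S T" "Z <= T" "sring S" "smod S Z" "Z <= S" "~ Z' <= T"
 shows "EX P:set ps. P <= T" using assms proof(induction rule:pfilt.induct)
 case (step Z' ps a P)
 show ?case proof(cases "Z' <= T")
 case True
 have T:"smod S T" using step.prems by(simp add:prime_in_def)
 have "a ~: T" proof
 assume "a : T"
 hence "a *o S <= T" using T by(auto simp:in_scaled mult.commute[of a] sm_mult)
 thus False using step.prems(6) plus_le[OF T True] by blast
 qed
 hence "P <= T" using step.hyps(2,3) True step.prems(1) by(auto simp:prime_in_def)
 thus ?thesis by simp
 qed (use step in auto)
qed auto

text \<open>Multiplication by x^n makes each factor between x^n M and x^(n+1) M a quotient of M / x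
  M, and K is carried along.\<close>

lemma len_power_le: assumes A:"sring A" and M:"smod A M" and K:"smod A K" "K <= M" and x:"x *o M <= M" "x *o K <= K"
 shows "len A M ((x ^ n) *o M + K) <= of_nat n * len A M (x *o M + K)" proof(induction n)
 case 0
 have "M + K = M" by(rule plus_abs2[OF M K])
 thus ?case by simp
next
 case (Suc n)
 let ?L = "%n. (x ^ n) *o M + K"
 have s:"smod A (?L n)" for n by(intro sm_plus sm_scaled M K)
 have xn:"(x ^ n) *o M <= M" for n proof(induction n)
 case (Suc n)
 have "(x ^ Suc n) *o M = x *o ((x ^ n) *o M)" by(simp add:scaled2)
 also have "... <= x *o M" by(rule scaled_mono[OF Suc])
 finally show ?case using x(1) by blast
 qed simp
 have xK:"(x ^ n) *o K <= K" for n proof(induction n)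
 case (Suc n)
 have "(x ^ Suc n) *o K = x *o ((x ^ n) *o K)" by(simp add:scaled2)
 also have "... <= x *o K" by(rule scaled_mono[OF Suc])
 finally show ?case using x(2) by blast
 qed simp
 have "(x ^ Suc n) *o M = (x ^ n) *o (x *o M)" by(simp add:scaled2 mult.commute)
 also have "... <= (x ^ n) *o M" by(rule scaled_mono[OF x(1)])
 finally have down:"?L (Suc n) <= ?L n" by(rule plus_mono) simp
 have "len A M (?L (Suc n)) = len A M (?L n) + len A (?L n) (?L (Suc n))"
 by(rule len_add[OF A s down plus_le[OF M xn K(2)] M s])
 also have "len A (?L n) (?L (Suc n)) <= len A M (x *o M + K)" proof -
 have "(x ^ n) *o M + ?L (Suc n) = (x ^ n) *o M + (x ^ Suc n) *o M + K" by(simp only:add.assoc)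
 also have "(x ^ n) *o M + (x ^ Suc n) *o M = (x ^ n) *o M"
 using `(x ^ Suc n) *o M = (x ^ n) *o (x *o M)` `(x ^ n) *o (x *o M) <= (x ^ n) *o M`
 by(intro plus_abs2[of A] sm_scaled M) simp
 finally have "len A (?L n) (?L (Suc n)) = len A ((x ^ n) *o M + ?L (Suc n)) (?L (Suc n))" by simp
 also have "... = len A M {u:M. x ^ n * u : ?L (Suc n)}" by(rule len_scaled[OF A M s])
 also have "... <= len A M (x *o M + K)" proof(rule len_mono, rule subsetI)
 fix w assume "w : x *o M + K"
 then obtain u k where uk:"w = x * u + k" "u : M" "k : K" by(auto simp:in_scaled elim!: set_plus_elim)
 have "w : M" unfolding uk(1) using uk x(1) K(2) M by(intro sm_add[OF M]) auto
 moreover have "x ^ n * w = x ^ Suc n * u + x ^ n * k" by(simp add:uk(1) algebra_simps)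
 moreover have "x ^ n * k : K" using xK[of n] uk(3) by blast
 ultimately show "w : {u:M. x ^ n * u : ?L (Suc n)}" using uk(2) by(auto intro!: set_plus_intro scaledI)
 qed
 finally show ?thesis .
 qed
 also have "len A M (?L n) <= of_nat n * len A M (x *o M + K)" by(rule Suc)
 finally show ?case by(simp add:distrib_right add.commute add_mono)
qed

section \<open>The notions of the statement in terms of modules\<close>

text \<open>A chain with the maximal number of steps starts at J and ends at the whole ring, since
  otherwise it could be prolonged. So the fixed end points in \<open>ideal_chain_from\<close> agree
  with the free ones in \<open>len\<close>.\<close>

lemma quot_length_eq_len: assumes J:"is_ideal J" and fin:"len U U J < \<infinity>"
 shows "enat (quot_length J) = len U U J" proof -
 have sJ:"smod U J" using J by(simp add:ideal_iff)
 obtain l where l:"len U U J = enat l" using fin by(cases "len U U J") auto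
 have le:"n <= l" if "ideal_chain_from J n" for n proof -
 obtain f where f:"f 0 = J" "ALL i<=n. is_ideal (f i)" "ALL i<n. f i < f (Suc i)"
 using `ideal_chain_from J n` unfolding ideal_chain_from_def by blast
 have "J <= f i" if "i <= n" for i using that proof(induction i)
 case (Suc i) thus ?case using f(3) by(meson Suc_le_lessD less_imp_le order_trans psubset_imp_subset)
 qed (simp add:f)
 hence "chain_in U U J n f" using f by(simp add:chain_in_def ideal_iff)
 from chain_le_len[OF this] show "n <= l" using l by simp
 qed
 obtain f where f:"chain_in U U J l f" using len_finite_attained[OF l sJ] by auto
 have no:"~ chain_in U U J (Suc l) g" for g using chain_le_len[of U U J "Suc l" g] l by auto
 have f0:"f 0 = J" proof(rule ccontr)
 assume "f 0 ~= J"
 hence "chain_in U U J (Suc l) (%i. case i of 0 => J | Suc i => f i)"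
 using f sJ unfolding chain_in_def by(auto split:nat.splits simp:less_Suc_eq_0_disj)
 thus False using no by blast
 qed
 have fl:"f l = U" proof(rule ccontr)
 assume "f l ~= U"
 hence "chain_in U U J (Suc l) (f(Suc l := U))" using f sJ unfolding chain_in_def by(auto simp:le_Suc_eq less_Suc_eq)
 thus False using no by blast
 qed
 have "ideal_chain_from J l" unfolding ideal_chain_from_def using f f0 fl by(auto simp:chain_in_def ideal_iff)
 hence "finite {n. ideal_chain_from J n}" "Max {n. ideal_chain_from J n} = l"
 using le by(auto intro!: Max_eqI finite_subset[of _ "{..l}"])
 thus ?thesis by(simp add:quot_length_def l)
qed

lemma prime_ideal_iff:"prime_ideal P <-> prime_in U P" proof -
 have "is_ideal P ==> P ~= U <-> 1 ~: P" unfolding is_ideal_def by(metis UNIV_I mult.right_neutral UNIV_eq_I)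
 thus ?thesis unfolding prime_ideal_def prime_in_def ideal_iff by auto
qed

lemma noetherian_iff:"noetherian TYPE('a::comm_ring_1) <-> noeth (U :: 'a set) U"
 by(simp add:noetherian_def noeth_def ideal_iff)

lemma local_ring_if_local_ring_max: fixes m :: "'a::comm_ring_1 set" assumes "noetherian TYPE('a)" "local_ring_max m"
 shows "local_ring U m" proof
 have m:"is_ideal m" "m ~= U" "!!J. maximal_ideal J ==> J = m"
 using assms(2) by(auto simp:local_ring_max_def maximal_ideal_def)
 show n:"noeth (U :: 'a set) U" using assms(1) by(simp add:noetherian_iff)
 show "smod U m" using m by(simp add:ideal_iff)
 thus "1 ~: m" using m(2) by(metis UNIV_I UNIV_eq_I mult.right_neutral sm_mult)
 fix a :: 'a assume a:"a ~: m"
 show "EX b:U. a * b = 1" proof(rule ccontr)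
 assume no:"~ (EX b:U. a * b = 1)"
 let ?UU = "{J. smod U J & a : J & 1 ~: J}"
 have "EX C:?UU. ALL V:?UU. C <= V --> V = C" proof(rule noeth_max[OF n])
 have "a *o U : ?UU" using no by(auto simp:in_scaled sm_scaled intro:exI[of _ 1])
 thus "?UU ~= {}" by blast
 qed auto
 then obtain C where C:"C : ?UU" "ALL V:?UU. C <= V --> V = C" by(rule bexE)
 have "maximal_ideal C" unfolding maximal_ideal_def ideal_iff proof(intro conjI allI impI)
 show "smod U C" "C ~= U" using C(1) by auto
 fix J assume J:"smod U J & C <= J"
 show "J = C | J = U" proof(cases "1 : J")
 case True
 hence "J = U" using J by(metis UNIV_I UNIV_eq_I mult.right_neutral sm_mult)
 thus ?thesis by blast
 qed (use J C in blast)
 qed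
 hence "C = m" by(rule m(3))
 thus False using C(1) a by blast
 qed
qed auto

text \<open>\<open>madic_complete\<close> gives a limit without a rate. The rate is recovered from t
  i - t j being in m^j for all i \<ge> j.\<close>

lemma complete_at_if_madic_complete: assumes "madic_complete m" "smod U m" shows "complete_at U m U"
 unfolding complete_at_def proof(intro allI impI)
 fix t :: "nat => 'a" assume t:"ALL j. t j : U & t (Suc j) - t j : ipow U m U j"
 have s:"smod U (ipow U m U k)" for k by(simp add:sm_ipow)
 have anti:"k <= n ==> ipow U m U n <= ipow U m U k" for k n by(simp add:ipow_antimono)
 have d:"t (k + i) - t k : ipow U m U k" for k i proof(induction i)
 case (Suc i)
 have "t (Suc (k + i)) - t (k + i) : ipow U m U k" using t anti[of k "k + i"] by auto
 from sm_add[OF s this Suc] show ?case by simp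
 qed (simp add:sm_0[OF s])
 have "EX N. ALL i>=N. ALL j>=N. t i - t j : ideal_pow m k" for k proof(intro exI allI impI)
 fix i j assume ij:"k <= i" "k <= j"
 have "t i - t k : ipow U m U k" "t j - t k : ipow U m U k" using d[of k "i - k"] d[of k "j - k"] ij by auto
 from sm_diff[OF sr_U s this] show "t i - t j : ideal_pow m k" by(simp add:ideal_pow_eq_ipow)
 qed
 then obtain y where y:"ALL k. EX N. ALL i>=N. t i - y : ideal_pow m k"
 using assms(1) unfolding madic_complete_def by blast
 have "y - t j : ipow U m U j" for j proof -
 obtain N where "ALL i>=N. t i - y : ipow U m U j" using y unfolding ideal_pow_eq_ipow by blast
 hence 1:"t (j + N) - y : ipow U m U j" by simp
 from sm_diff[OF sr_U s d[of j N] 1] show ?thesis by simp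
 qed
 thus "EX u:U. ALL j. u - t j : ipow U m U j" by blast
qed

section \<open>Prime avoidance, parameters and quadratic growth\<close>

locale local_type = local_ring U m for m :: "'a::comm_ring_1 set"
begin

abbreviation mpow :: "nat => 'a set" where "mpow n == ipow U m U n"

lemma sm_mpow [simp]:"smod U (mpow n)" by(simp add:sm_ipow)

lemma mpow_antimono:"k <= n ==> mpow n <= mpow k" by(simp add:ipow_antimono)

lemma mpow_1 [simp]:"mpow (Suc 0) = m" proof -
 have "mul U m (1 *o U) = 1 *o m" by(rule mul_cyclic_right) (simp_all add:sm_m)
 thus ?thesis by simp
qed

lemma prime_subset_m:"prime_in U P ==> P <= m"
 unfolding prime_in_def by(metis UNIV_I mult.commute subsetI sm_mult unit)

lemma prime_m:"prime_in U m" unfolding prime_in_def proof(intro conjI ballI impI)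
 fix a b assume ab:"a * b : m"
 show "a : m | b : m" proof(rule disjCI)
 assume "b ~: m"
 then obtain c where "b * c = 1" using unit by blast
 hence "a = c * (a * b)" by(metis mult.commute mult.left_commute mult.right_neutral)
 thus "a : m" using ab sm_m by(metis UNIV_I sm_mult)
 qed
qed (use sm_m one_notin_m in auto)

lemma mpow_subset_if_m_primary: assumes "m_primary m I" shows "EX M. mpow M <= I" proof -
 have I:"smod U I" "!!x. x : m ==> EX n. x ^ n : I" using assms by(auto simp:m_primary_def radical_def ideal_iff)
 obtain G where G:"finite G" "m = span U G" using fg_sub[OF fg_self sm_m] by(auto simp:fg_def)
 have "EX t. mpow t <= I" unfolding G(2) proof(rule ipow_subset_if_nilpotent[OF sr_U sm_U I(1) G(1)])
 fix g assume "g : G"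
 hence "g : m" unfolding G(2) using span_inc by blast
 then obtain s where "g ^ s : I" using I by blast
 hence "(g ^ s) *o U <= I" using I(1) by(auto simp:in_scaled mult.commute[of "g ^ s"] sm_mult)
 thus "EX s. (g ^ s) *o U <= I" by blast
 qed simp
 thus ?thesis .
qed

lemma len_finite:"mpow M <= J ==> len U U J < \<infinity>"
 using len_mono[of "mpow M" J U U] len_ipow_finite[OF fg_self[OF sr_U], of M] by(meson le_less_trans)

text \<open>Prime avoidance inside x + m^2; staying in this coset later allows generators of m to be
  changed without losing generation. Split off a minimal P: some w lies in m^2 and in all other
  primes but not in P, and adding it repairs P without disturbing the rest.\<close>

lemma coset_avoidance: assumes "finite QQ" "!!P. P : QQ ==> prime_in U P & P ~= m" "x : m"
 shows "EX h:mpow 2. ALL P:QQ. x + h ~: P" using assms(1,2) proof(induction "card QQ" arbitrary: QQ)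
 case 0
 thus ?case using sm_0[OF sm_mpow, of 2] by auto
next
 case (Suc n)
 hence "QQ ~= {}" by auto
 then obtain P where P:"P : QQ" "!!P'. P' : QQ ==> P' <= P ==> P' = P"
 using finite_has_minimal[OF Suc.prems(1)] by blast
 have pP:"prime_in U P" "P ~= m" using Suc.prems(2) P by auto
 let ?Q = "QQ - {P}"
 have "n = card ?Q" using Suc.hyps(2) Suc.prems(1) P by simp
 then obtain h where h:"h : mpow 2" "ALL P:?Q. x + h ~: P" using Suc.hyps(1)[of ?Q] Suc.prems by auto
 show ?case proof(cases "x + h : P")
 case False
 thus ?thesis using h by blast
 next
 case True
 obtain v where v:"v : m" "v ~: P" using pP prime_subset_m by blast
 have "ALL P':?Q. EX u. u : P' & u ~: P" using P(2) by blast
 then obtain u where u:"!!P'. P' : ?Q ==> u P' : P' & u P' ~: P" by metis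
 \<comment> \<open>The two factors v put w into m^2. The u P' exist because no other prime of the
   set lies inside the minimal P.\<close>
 define w where "w = v * v * (PROD P':?Q. u P')"
 have prodP:"(PROD P':Q'. u P') ~: P" if "finite Q'" "Q' <= ?Q" for Q' using that
 proof(induction Q' rule:finite_induct)
 case empty thus ?case using pP by(simp add:prime_in_def)
 next
 case (insert a Q') thus ?case using u[of a] prime_inD[OF pP(1)] by auto
 qed
 have wP:"w ~: P" unfolding w_def using v prodP[of ?Q] Suc.prems(1) prime_inD[OF pP(1)] by auto
 have wQ:"w : P'" if "P' : ?Q" for P' proof -
 have "(PROD P':?Q. u P') = u P' * (PROD P':?Q - {P'}. u P')" using that Suc.prems(1) by(intro prod.remove) auto
 hence "w = (v * v * (PROD P':?Q - {P'}. u P')) * u P'" by(simp add:w_def mult_ac)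
 moreover have "smod U P'" using Suc.prems(2) that by(simp add:prime_in_def)
 ultimately show ?thesis using u[OF that] by(metis UNIV_I sm_mult)
 qed
 have "v * (v * 1) : mpow 2" unfolding numeral_2_eq_2 ipow.simps using v(1) by(intro mul_in) auto
 hence "w : mpow 2" unfolding w_def
 using sm_mult[OF sm_mpow, of "PROD P':?Q. u P'" "v * (v * 1)" 2] by(simp add:mult_ac)
 hence "h + w : mpow 2" using h(1) by(simp add:sm_add[OF sm_mpow])
 moreover have "x + (h + w) ~: P'" if "P' : QQ" for P' proof(cases "P' = P")
 case True
 have "x + (h + w) - (x + h) = w" by simp
 thus ?thesis using wP `x + h : P` pP(1) True sm_diff[OF sr_U] unfolding prime_in_def by metis
 next
 case False
 hence "P' : ?Q" using that by blast
 hence "x + (h + w) - w ~: P'" "w : P'" "smod U P'" using h(2) wQ Suc.prems(2) by(auto simp:prime_in_def)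
 thus ?thesis using sm_diff[OF sr_U] by blast
 qed
 ultimately show ?thesis by blast
 qed
qed

lemma m_primary_sum_if: assumes Z:"smod U Z" and ps:"pfilt U Z U ps"
 and "!!P. P : set ps ==> P ~= m ==> EX n. mpow n <= P + y *o U" shows "EX n. mpow n <= Z + y *o U"
proof(rule pfilt_ipow[OF ps])
 fix P assume P:"P : set ps"
 show "EX n. mpow n <= P + y *o U" proof(cases "P = m")
 case True
 have "mpow (Suc 0) <= m + y *o U" unfolding mpow_1 by(rule plus_ge1[OF sm_scaled[OF sm_U]])
 thus ?thesis using True by blast
 qed (use assms(3) P in blast)
qed (use Z in \<open>auto intro!: sm_scaled\<close>)

lemma mpow_subset_if_primes_eq_m: assumes Z:"smod U Z" and ps:"pfilt U Z U ps" and "!!P. P : set ps ==> P = m"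
 shows "EX n. mpow n <= Z" proof -
 have "0 *o (U :: 'a set) = {0}" by(auto simp:in_scaled)
 thus ?thesis using m_primary_sum_if[OF Z ps, of 0] assms(3) by simp
qed

text \<open>x avoids the primes of a filtration over 0 and y those over x, apart from m. A prime P''
  other than m over such a P' and y would complete a chain P < P' < P'' < m.\<close>

lemma parameters: assumes "krull_dim_eq TYPE('a) 2" shows "EX x:m. EX y:m. EX N. mpow N <= x *o U + y *o U" proof -
 have no: False if "prime_in U P" "prime_in U P'" "prime_in U P''" "P < P'" "P' < P''" "P'' < m" for P P' P'' proof -
 have "has_prime_chain TYPE('a) (Suc 2)" unfolding has_prime_chain_def using that prime_m
 by(intro exI[of _ "%i. if i = 0 then P else if i = 1 then P' else if i = 2 then P'' else m"])
 (auto simp:prime_ideal_iff less_Suc_eq)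
 thus False using assms by(simp add:krull_dim_eq_def)
 qed
 have av:"EX x:m. ALL P:set ps. P ~= m --> x ~: P" if "pfilt U Z U ps" "smod U Z" for Z ps proof -
 have "EX h:mpow 2. ALL P:{P:set ps. P ~= m}. 0 + h ~: P"
 using pfilt_primes[OF that(1) sr_U that(2)] by(intro coset_avoidance) (auto intro:sm_0[OF sm_m])
 moreover have "mpow 2 <= m" using mpow_antimono[of "Suc 0" 2] mpow_1 by simp
 ultimately show ?thesis by auto
 qed
 obtain ps0 where ps0:"pfilt (U :: 'a set) {0} U ps0" using pfilt_ex[OF sr_U noeth_ring, of "{0}"] by auto
 obtain x where x:"x : m" "ALL P:set ps0. P ~= m --> x ~: P" using av[OF ps0] by auto
 have sx:"smod U (x *o U)" by(simp add:sm_scaled)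
 obtain ps1 where ps1:"pfilt U (x *o U) U ps1" using pfilt_ex[OF sr_U noeth_ring sx] by auto
 obtain y where y:"y : m" "ALL P:set ps1. P ~= m --> y ~: P" using av[OF ps1 sx] by auto
 have "EX n. mpow n <= x *o U + y *o U" proof(rule m_primary_sum_if[OF sx ps1])
 fix P' assume P': "P' : set ps1" "P' ~= m"
 have pP': "prime_in U P'" "x *o U <= P'" using pfilt_primes[OF ps1 sr_U sx _ P'(1)] by auto
 have "0 : P'" "~ U <= P'" using pP'(1) by(auto simp:prime_in_def)
 then obtain P where P:"P : set ps0" "P <= P'" using pfilt_below[OF ps0 pP'(1)] by auto
 have pP:"prime_in U P" using pfilt_primes[OF ps0 sr_U _ _ P(1)] by auto
 have "P ~= m" using P(2) P'(2) prime_subset_m[OF pP'(1)] by blast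
 hence "x ~: P" using x P by blast
 moreover have "x : P'" using pP'(2) scaledI[of 1 U x] by auto
 ultimately have PP': "P < P'" using P by blast
 let ?Z = "P' + y *o U"
 have sP': "smod U P'" using pP'(1) by(simp add:prime_in_def)
 have sZ:"smod U ?Z" by(intro sm_plus sm_scaled sP' sm_U)
 obtain ps2 where ps2:"pfilt U ?Z U ps2" using pfilt_ex[OF sr_U noeth_ring sZ] by auto
 show "EX n. mpow n <= ?Z" proof(rule mpow_subset_if_primes_eq_m[OF sZ ps2])
 fix P'' assume P'': "P'' : set ps2"
 have pP'': "prime_in U P''" "?Z <= P''" using pfilt_primes[OF ps2 sr_U sZ _ P''] by auto
 have "P' <= ?Z" by(rule plus_ge1[OF sm_scaled[OF sm_U]])
 hence "P' <= P''" using pP''(2) by blast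
 moreover have "y : P''" using pP''(2) plus_ge2[OF sP', of "y *o U"] scaledI[of 1 U y] by auto
 moreover have "y ~: P'" using y P' by blast
 ultimately have "P' < P''" by blast
 thus "P'' = m" using no[OF pP pP'(1) pP''(1) PP'] prime_subset_m[OF pP''(1)] by blast
 qed
 qed
 thus ?thesis using x y by blast
qed

lemma quadratic_growth: assumes "krull_dim_eq TYPE('a) 2" shows "EX a. ALL n. len U U (mpow n) <= enat (a * n ^ 2)"
proof -
 obtain x y N where xy:"x : m" "y : m" "mpow N <= x *o U + y *o U" using parameters[OF assms] by blast
 obtain a where a:"len U U (x *o U + y *o U) = enat a"
 using len_finite[OF xy(3)] by(cases "len U U (x *o U + y *o U)") auto
 have "len U U (mpow n) <= enat (a * n ^ 2)" for n proof -
 have s:"smod U (z *o U)" for z :: 'a by(simp add:sm_scaled)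
 have st:"z *o (w *o (U :: 'a set)) <= w *o U" for z w :: 'a
 unfolding scaled2 by(auto simp:in_scaled mult.commute[of z] mult.assoc)
 have in_m:"(z ^ n) *o U <= mpow n" if "z : m" for z using ipow_power_in[OF that, of _ U n] by(auto simp:in_scaled)
 have "(x ^ n) *o U + (y ^ n) *o U <= mpow n" by(rule plus_le[OF sm_mpow in_m[OF xy(1)] in_m[OF xy(2)]])
 hence "len U U (mpow n) <= len U U ((x ^ n) *o U + (y ^ n) *o U)" by(rule len_mono)
 also have "... <= of_nat n * len U U (x *o U + (y ^ n) *o U)" by(rule len_power_le) (simp_all add:s st)
 also have "... = of_nat n * len U U ((y ^ n) *o U + x *o U)" by(simp only:add.commute)
 also have "... <= of_nat n * (of_nat n * len U U (y *o U + x *o U))"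
 by(intro mult_left_mono len_power_le) (simp_all add:s st)
 also have "... = enat (a * n ^ 2)" using a by(simp add:add.commute of_nat_eq_enat power2_eq_square mult_ac)
 finally show ?thesis .
 qed
 thus ?thesis by blast
qed

end

section \<open>Sets of exponents and their coordinate planes\<close>

definition exps :: "nat => (nat => nat) set" where "exps r = {al. ALL i>=r. al i = 0}"

definition deg :: "nat => (nat => nat) => nat" where "deg r al = (SUM i<r. al i)"

definition down_closed :: "(nat => nat) set => bool" where "down_closed D <-> (ALL al:D. ALL be<=al. be : D)"

lemma exps_le:"al : exps r ==> be <= al ==> be : exps r"
 unfolding exps_def le_fun_def by(auto intro:le_antisym) (metis le_zero_eq)

lemma exps_upd:"al : exps r ==> i < r ==> al(i := p) : exps r" by(auto simp:exps_def)

lemma le_deg:"i < r ==> al i <= deg r al" unfolding deg_def by(rule member_le_sum) auto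

lemma deg_upd2: assumes "i < r" "j < r" "i ~= j" "ga i = 0" "ga j = 0"
 shows "deg r (ga(i := p, j := q)) = deg r ga + p + q" proof -
 have "deg r (ga(i := p, j := q)) = (SUM l<r. ga l + (if l = i then p else 0) + (if l = j then q else 0))"
 unfolding deg_def using assms by(intro sum.cong) auto
 also have "... = deg r ga + p + q" using assms by(simp add:sum.distrib deg_def)
 finally show ?thesis .
qed

lemma finite_box:"finite {al : exps r. ALL i. al i <= B}" proof -
 have "finite {f::nat => nat. ALL x. (x : {..<r} --> f x : {..B}) & (x ~: {..<r} --> f x = 0)}"
 by(rule finite_set_of_finite_funs) auto
 thus ?thesis by(rule finite_subset[rotated]) (auto simp:exps_def)
qed

lemma finite_deg:"finite {al : exps r. deg r al <= n}" proof(rule finite_subset[OF _ finite_box])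
 show "{al : exps r. deg r al <= n} <= {al : exps r. ALL i. al i <= n}" proof clarify
 fix al i assume a:"al : exps r" "deg r al <= n"
 show "al i <= n" using a le_deg[of i r al] by(cases "i < r") (auto simp:exps_def)
 qed
qed

lemma finite_deg_less:"finite {al : exps r. deg r al < n}" by(rule finite_subset[OF _ finite_deg[of r n]]) auto

lemma nat_incseq_subseq:"EX g::nat => nat. strict_mono g & incseq (%n. f (g n) :: nat)" proof -
 obtain g :: "nat => nat" where g:"strict_mono g" "monoseq (%n. f (g n))" using seq_monosub[of f] by blast
 show ?thesis proof(cases "incseq (%n. f (g n))")
 case False
 hence dec:"decseq (%n. f (g n))" using g(2) by(auto simp:monoseq_iff)
 obtain N where N:"!!n. f (g N) <= f (g n)" using ex_has_least_nat[of "%_. True" 0 "%n. f (g n)"] by auto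
 have c:"f (g (N + n)) = f (g N)" for n
 using N[of "N + n"] dec[unfolded decseq_def, rule_format, of N "N + n"] by simp
 have "strict_mono (%n. g (N + n))" using g(1) by(auto simp:strict_mono_def)
 moreover have "incseq (%n. f (g (N + n)))" by(simp add:c incseq_def)
 ultimately show ?thesis by blast
 qed (use g in blast)
qed

lemma incseq_subseq_family: fixes s :: "nat => nat => nat"
 shows "EX g::nat => nat. strict_mono g & (ALL i<k. incseq (%n. s (g n) i))" proof(induction k)
 case 0
 show ?case by(rule exI[of _ id]) (auto simp:strict_mono_def)
next
 case (Suc k)
 then obtain g :: "nat => nat" where g:"strict_mono g" "!!i. i < k ==> incseq (%n. s (g n) i)" by blast
 obtain h :: "nat => nat" where h:"strict_mono h" "incseq (%n. s (g (h n)) k)"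
 using nat_incseq_subseq[of "%n. s (g n) k"] by blast
 have "incseq (%n. s (g (h n)) i)" if "i < Suc k" for i proof(cases "i = k")
 case False
 hence "incseq (%n. s (g n) i)" using g that by simp
 thus ?thesis using strict_mono_mono[OF h(1)] unfolding incseq_def mono_def by blast
 qed (use h in simp)
 moreover have "strict_mono (%n. g (h n))" using g(1) h(1) by(auto simp:strict_mono_def)
 ultimately show ?case by blast
qed

text \<open>Dickson's lemma in the form that membership in an up-closed set only depends on bounded exponents.\<close>

lemma truncation: assumes UU:"!!al be. al : UU ==> al <= be ==> be : exps r ==> be : UU" and UX:"UU <= exps r"
 shows "EX B. ALL al:UU. (%i. min (al i) B) : UU" proof(rule ccontr)
 assume "\<nexists>B. ALL al:UU. (%i. min (al i) B) : UU"
 hence "ALL B. EX al. al : UU & (%i. min (al i) B) ~: UU" by blast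
 then obtain s where s:"!!B. s B : UU" "!!B. (%i. min (s B i) B) ~: UU" by metis
 obtain g :: "nat => nat" where g:"strict_mono g" "ALL i<r. incseq (%n. s (g n) i)"
 using incseq_subseq_family[of r s] by blast
 let ?n = "Suc (deg r (s (g 0)))"
 have gn:"?n <= g ?n" using g(1) by(rule strict_mono_imp_increasing)
 have X:"s B : exps r" for B using s(1) UX by blast
 have "s (g 0) <= (%i. min (s (g ?n) i) (g ?n))" proof(rule le_funI)
 fix i
 show "s (g 0) i <= min (s (g ?n) i) (g ?n)" proof(cases "i < r")
 case True
 hence "s (g 0) i <= s (g ?n) i" using g(2) by(simp add:incseq_def)
 moreover have "s (g 0) i <= g ?n" using le_deg[OF True, of "s (g 0)"] gn by simp
 ultimately show ?thesis by simp
 qed (use X in \<open>simp add:exps_def\<close>)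
 qed
 moreover have "(%i. min (s (g ?n) i) (g ?n)) : exps r" using X by(simp add:exps_def)
 ultimately have "(%i. min (s (g ?n) i) (g ?n)) : UU" using UU s(1) by blast
 thus False using s(2) by blast
qed

text \<open>The coordinate planes contained in \<open>D\<close>; when \<open>D\<close> has quadratic growth they carry all of it.\<close>

definition planes :: "nat => (nat => nat) set => (nat \<times> nat \<times> (nat => nat)) set" where
 "planes r D = {(i, j, ga). i < j & j < r & ga : exps r & ga i = 0 & ga j = 0 & (ALL p q. ga(i := p, j := q) : D)}"

lemma sum_diff_nat_eq:"2 * (SUM p<k. k - p) = k * (k + 1 :: nat)"
 by(induction k) (simp_all add:sum.lessThan_Suc_shift del:sum.lessThan_Suc)

lemma card_triangle:"2 * card {(p, q). p + q < (k::nat)} = k * (k + 1)" proof -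
 have "{(p, q). p + q < k} = (SIGMA p:{..<k}. {..<k - p})" by auto
 hence "card {(p, q). p + q < k} = (SUM p<k. k - p)" by simp
 also have "2 * ... = k * (k + 1)" by(rule sum_diff_nat_eq)
 finally show ?thesis .
qed

lemma sum_lessThan_add:"(SUM p<k + n. f p) = (SUM p<k. f p) + (SUM s<n. f (k + s :: nat))"
 by(induction n) (simp_all add:add.assoc)

text \<open>This covers the complement of an initial ideal in dimension at most two and, for general
  I, the level sets of the length function in \<open>hs_mult_tendsto\<close>.\<close>

locale planar = fixes r :: nat and D :: "(nat => nat) set" and a :: nat
 assumes DX:"D <= exps r" and down:"down_closed D" and growth:"!!n. card {al:D. deg r al < n} <= a * n ^ 2"
begin

lemma downD:"al : D ==> be <= al ==> be : D" using down by(auto simp:down_closed_def)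

lemma planar_truncation: "EX B>=1. ALL al:exps r. (%i. min (al i) B) : D --> al : D" proof -
 have "EX B. ALL al:exps r - D. (%i. min (al i) B) : exps r - D" by(rule truncation) (auto dest:downD)
 then obtain B where B:"ALL al:exps r - D. (%i. min (al i) B) : exps r - D" by blast
 have "al : D" if "al : exps r" "(%i. min (al i) (Suc B)) : D" for al proof(rule ccontr)
 assume "al ~: D"
 moreover have "(%i. min (al i) B) : D" by(rule downD[OF that(2)]) (auto simp:le_fun_def)
 ultimately show False using B that by blast
 qed
 thus ?thesis by(intro exI[of _ "Suc B"]) auto
qed

text \<open>Three coordinates that are \<ge> B could grow independently without leaving D, which
  would give cubically many elements.\<close>

lemma no_3: assumes B:"!!al. al : exps r ==> (%i. min (al i) B) : D ==> al : D"
 and al:"al : D" "i < r" "j < r" "k < r" "i ~= j" "i ~= k" "j ~= k" "B <= al i" "B <= al j" "B <= al k" shows False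
proof -
 have in_D:"(%_. 0)(i := p, j := q, k := s) : D" for p q s proof -
 let ?be = "al(i := B + p, j := B + q, k := B + s)"
 have "(%l. min (?be l) B) <= al" using al by(auto simp:le_fun_def)
 moreover have "?be : exps r" using al DX by(intro exps_upd) auto
 ultimately have "?be : D" using B downD[OF al(1)] by blast
 thus ?thesis by(rule downD) (auto simp:le_fun_def)
 qed
 \<comment> \<open>For this n the n^3 exponents of degree < 3 n outnumber a (3 n)^2 = 9 a
   n^2.\<close>
 define n where "n = 9 * a + 1"
 let ?f = "%(p, q, s). (%_. 0::nat)(i := p, j := q, k := s)"
 have inj:"inj_on ?f ({..<n} \<times> {..<n} \<times> {..<n})" proof(rule inj_onI)
 fix x y assume "?f x = ?f y"
 obtain p q s p' q' s' where xy:"x = (p, q, s)" "y = (p', q', s')" by(metis prod_cases3)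
 have e:"(%_. 0::nat)(i := p, j := q, k := s) = (%_. 0)(i := p', j := q', k := s')" using `?f x = ?f y` xy by simp
 show "x = y" using fun_cong[OF e, of i] fun_cong[OF e, of j] fun_cong[OF e, of k] al xy by auto
 qed
 have "?f ` ({..<n} \<times> {..<n} \<times> {..<n}) <= {al:D. deg r al < 3 * n}" proof
 fix x assume "x : ?f ` ({..<n} \<times> {..<n} \<times> {..<n})"
 then obtain p q s where pqs:"p < n" "q < n" "s < n" and x:"x = (%_. 0)(i := p, j := q, k := s)" by auto
 have "deg r ((%_. 0)(i := p, j := q, k := s)) = (SUM l<r. (if l = i then p else 0) + (if l = j then q else 0) + (if l = k then s else 0))"
 unfolding deg_def using al by(intro sum.cong) auto
 also have "... = p + q + s" using al by(simp add:sum.distrib)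
 finally show "x : {al:D. deg r al < 3 * n}" using in_D pqs unfolding x by simp
 qed
 moreover have "finite {al:D. deg r al < 3 * n}"
 by(rule finite_subset[OF _ finite_deg_less[of r "3 * n"]]) (use DX in auto)
 ultimately have "card (?f ` ({..<n} \<times> {..<n} \<times> {..<n})) <= card {al:D. deg r al < 3 * n}" by(intro card_mono)
 hence "n * (n * n) <= card {al:D. deg r al < 3 * n}" by(simp add:card_image[OF inj] card_cartesian_product)
 also have "... <= a * (3 * n) ^ 2" by(rule growth)
 finally have "n * (n * n) <= (9 * a) * (n * n)" by(simp add:power2_eq_square algebra_simps)
 hence "n <= 9 * a" by(metis mult_le_cancel2 n_def add_gr_0 less_one nat_0_less_mult_iff)
 thus False by(simp add:n_def)
qed

lemma plane_coord_less: assumes B:"!!al. al : exps r ==> (%i. min (al i) B) : D ==> al : D" "B >= 1"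
 and P:"(i, j, ga) : planes r D" shows "ga k < B" proof(rule ccontr)
 assume k:"~ ga k < B"
 have ij:"i < j" "j < r" "ga : exps r" "ga i = 0" "ga j = 0" "ga(i := B, j := B) : D" using P by(auto simp:planes_def)
 have "k < r" using k ij(3) B(2) by(cases "k < r") (auto simp:exps_def)
 moreover have "k ~= i" "k ~= j" using k ij B(2) by auto
 ultimately show False using no_3[where B = B and i = i and j = j and k = k, OF B(1) ij(6)] ij k by auto
qed

lemma finite_planes:"finite (planes r D)" proof -
 obtain B where B:"B >= 1" "!!al. al : exps r ==> (%i. min (al i) B) : D ==> al : D" using planar_truncation by blast
 have "planes r D <= {..<r} \<times> {..<r} \<times> {ga : exps r. ALL i. ga i <= B}" proof
 fix x assume x:"x : planes r D"
 obtain i j ga where xe:"x = (i, j, ga)" by(metis prod_cases3)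
 have P:"(i, j, ga) : planes r D" using x xe by simp
 have "ga l <= B" for l using plane_coord_less[OF B(2) B(1) P, of l] by simp
 thus "x : {..<r} \<times> {..<r} \<times> {ga : exps r. ALL i. ga i <= B}" using P xe by(auto simp:planes_def)
 qed
 thus ?thesis by(rule finite_subset) (simp add:finite_box)
qed

text \<open>Sort D by the number of coordinates \<ge> B: two of them put the exponent on a plane,
  one on finitely many lines, none into a finite box. The constant must not depend on Q, because Q
  will be nonmembership in the initial ideals of a whole sequence of ideals.\<close>

lemma upper_count: "EX C. ALL N Q. card {al:D. deg r al < N & Q al}
 <= (SUM (i, j, ga):planes r D. card {(p, q). p < N & q < N & Q (ga(i := p, j := q))}) + C * (N + 1)" proof -
 obtain B where B:"B >= 1" "!!al. al : exps r ==> (%i. min (al i) B) : D ==> al : D" using planar_truncation by blast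
 let ?box = "{ga : exps r. ALL i. ga i <= B}"
 define C where "C = card ?box * (r + 1)"
 have "card {al:D. deg r al < N & Q al}
 <= (SUM (i, j, ga):planes r D. card {(p, q). p < N & q < N & Q (ga(i := p, j := q))}) + C * (N + 1)" for N Q proof -
 let ?S = "%(i, j, ga). {(p, q). p < N & q < N & Q (ga(i := p, j := q))}"
 let ?im = "%(i, j, ga). (%(p, q). ga(i := p, j := q)) ` ?S (i, j, ga)"
 let ?O = "(%(i, p, ga). ga(i := p)) ` ({..<r} \<times> {..<N} \<times> ?box)"
 have fS:"finite (?S t)" for t proof -
 have "?S t <= {..<N} \<times> {..<N}" by(cases t) auto
 thus ?thesis by(rule finite_subset) simp
 qed
 have cover:"{al:D. deg r al < N & Q al} <= (UN t:planes r D. ?im t) Un (?O Un ?box)" proof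
 fix al assume "al : {al:D. deg r al < N & Q al}"
 hence al:"al : D" "deg r al < N" "Q al" "al : exps r" using DX by auto
 show "al : (UN t:planes r D. ?im t) Un (?O Un ?box)" proof(cases "EX i j. i < j & j < r & B <= al i & B <= al j")
 case True
 then obtain i j where ij:"i < j" "j < r" "B <= al i" "B <= al j" by blast
 let ?ga = "al(i := 0, j := 0)"
 have "?ga(i := p, j := q) : D" for p q proof -
 let ?be = "al(i := B + p, j := B + q)"
 have "(%l. min (?be l) B) <= al" using ij by(auto simp:le_fun_def)
 moreover have "?be : exps r" using al ij by(intro exps_upd) auto
 ultimately have "?be : D" using B downD[OF al(1)] by blast
 thus ?thesis by(rule downD) (auto simp:le_fun_def)
 qed
 hence P:"(i, j, ?ga) : planes r D" using ij al by(auto simp:planes_def intro!: exps_upd)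
 have eq:"?ga(i := al i, j := al j) = al" by auto
 have "al i < N" "al j < N" using le_deg[of i r al] le_deg[of j r al] ij al by auto
 hence "(al i, al j) : ?S (i, j, ?ga)" using al(3) eq by simp
 hence "(%(p, q). ?ga(i := p, j := q)) (al i, al j) : (%(p, q). ?ga(i := p, j := q)) ` ?S (i, j, ?ga)" by(rule imageI)
 moreover have "(%(p, q). ?ga(i := p, j := q)) (al i, al j) = al" using eq by(simp only:prod.case)
 ultimately have "al : (%(p, q). ?ga(i := p, j := q)) ` ?S (i, j, ?ga)" by(simp only:)
 hence "al : ?im (i, j, ?ga)" by(simp only:prod.case)
 thus ?thesis by(intro UnI1 UN_I[where B = ?im, OF P])
 next
 case False
 hence le:"!!i j. i < r ==> j < r ==> i ~= j ==> B <= al i ==> al j < B" by(metis linorder_neqE_nat not_le)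
 show ?thesis proof(cases "EX i<r. B <= al i")
 case True
 then obtain i where i:"i < r" "B <= al i" by blast
 have "al l <= B" if "l ~= i" for l
 using le[OF i(1) _ _ i(2), of l] that al(4) by(cases "l < r") (auto simp:exps_def)
 hence "al(i := 0) : ?box" using i al(4) by(auto simp:exps_def)
 moreover have "al i < N" using le_deg[OF i(1), of al] al by simp
 ultimately have "(i, al i, al(i := 0)) : {..<r} \<times> {..<N} \<times> ?box" using i by blast
 hence "(%(i, p, ga). ga(i := p)) (i, al i, al(i := 0)) : ?O" by(rule imageI)
 thus ?thesis by simp
 next
 case False
 hence "al l <= B" for l using al(4) by(cases "l < r") (auto simp:exps_def)
 thus ?thesis using al(4) by blast
 qed
 qed
 qed
 have fO:"finite (?O Un ?box)" by(simp add:finite_box)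
 have "card {al:D. deg r al < N & Q al} <= card ((UN t:planes r D. ?im t) Un (?O Un ?box))"
 proof(rule card_mono[OF _ cover])
 have "finite (UN t:planes r D. ?im t)"
 using fS by(intro finite_UN_I finite_planes) (auto simp del:case_prod_conv simp:case_prod_beta intro!: finite_imageI)
 thus "finite ((UN t:planes r D. ?im t) Un (?O Un ?box))" using fO by(rule finite_UnI)
 qed
 also have "... <= card (UN t:planes r D. ?im t) + card (?O Un ?box)" by(rule card_Un_le)
 also have "card (UN t:planes r D. ?im t) <= (SUM t:planes r D. card (?im t))" by(rule card_UN_le[OF finite_planes])
 also have "... <= (SUM t:planes r D. card (?S t))" proof(rule sum_mono)
 fix t show "card (?im t) <= card (?S t)" using fS[of t] by(cases t) (simp only:case_prod_conv, rule card_image_le)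
 qed
 also have "card (?O Un ?box) <= card ?O + card ?box" by(rule card_Un_le)
 also have "card ?O <= card ({..<r} \<times> {..<N} \<times> ?box)" by(rule card_image_le) (simp add:finite_box)
 also have "... = r * N * card ?box" by(simp add:card_cartesian_product)
 also have "r * N * card ?box + card ?box <= C * (N + 1)" by(simp add:C_def algebra_simps)
 also have "(SUM t:planes r D. card (?S t)) = (SUM (i, j, ga):planes r D. card {(p, q). p < N & q < N & Q (ga(i := p, j := q))})"
 by(rule sum.cong) (auto split:prod.split)
 finally show ?thesis by simp
 qed
 thus ?thesis by blast
qed

lemma count_upper:"EX C. ALL n. 2 * card {al:D. deg r al < n} <= card (planes r D) * n ^ 2 + C * (n + 1)" proof -
 obtain C where C:"!!N Q. card {al:D. deg r al < N & Q al}
 <= (SUM (i, j, ga):planes r D. card {(p, q). p < N & q < N & Q (ga(i := p, j := q))}) + C * (N + 1)"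
 using upper_count by blast
 have "2 * card {al:D. deg r al < n} <= card (planes r D) * n ^ 2 + (card (planes r D) + 2 * C) * (n + 1)" for n
 proof -
 have "(SUM (i, j, ga):planes r D. card {(p, q). p < n & q < n & deg r (ga(i := p, j := q)) < n})
 <= (SUM t:planes r D. card {(p, q). p + q < n})" proof(rule sum_mono, clarify)
 fix i j ga assume "(i, j, ga) : planes r D"
 hence d:"deg r (ga(i := p, j := q)) = deg r ga + p + q" for p q by(intro deg_upd2) (auto simp:planes_def)
 have "{(p, q). p + q < n} <= {..<n} \<times> {..<n}" by auto
 hence "finite {(p, q). p + q < n}" by(rule finite_subset) simp
 thus "card {(p, q). p < n & q < n & deg r (ga(i := p, j := q)) < n} <= card {(p, q). p + q < n}"
 by(rule card_mono) (auto simp:d)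
 qed
 hence "2 * card {al:D. deg r al < n} <= 2 * (card (planes r D) * card {(p, q). p + q < n}) + 2 * (C * (n + 1))"
 using C[of n "%al. deg r al < n"] by simp
 also have "2 * (card (planes r D) * card {(p, q). p + q < n}) = card (planes r D) * (n * (n + 1))"
 unfolding card_triangle[of n, symmetric] by simp
 finally show ?thesis by(simp add:power2_eq_square algebra_simps)
 qed
 thus ?thesis by blast
qed

text \<open>The planes become disjoint once both free coordinates are \<ge> B: all fixed coordinates
  are < B, so an exponent reveals its plane.\<close>

lemma count_lower:"EX C. ALL n. card (planes r D) * n ^ 2 <= 2 * card {al:D. deg r al < n} + C * n" proof -
 obtain B where B:"B >= 1" "!!al. al : exps r ==> (%i. min (al i) B) : D ==> al : D" using planar_truncation by blast
 define g where "g = (SUM (i, j, ga):planes r D. deg r ga) + 2 * B"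
 have g:"deg r ga + 2 * B <= g" if "(i, j, ga) : planes r D" for i j ga
 using member_le_sum[OF that, of "%(i, j, ga). deg r ga"] finite_planes by(simp add:g_def)
 have "card (planes r D) * n ^ 2 <= 2 * card {al:D. deg r al < n} + (2 * g * card (planes r D)) * n" for n proof -
 let ?T = "{(p, q). p + q < n - g}"
 have fT:"finite ?T" by(rule finite_subset[of _ "{..<n} \<times> {..<n}"]) auto
 let ?f = "%((i, j, ga), (p, q)). ga(i := B + p, j := B + q)"
 have sub:"?f ` (planes r D \<times> ?T) <= {al:D. deg r al < n}" proof
 fix x assume "x : ?f ` (planes r D \<times> ?T)"
 then obtain i j ga p q where P:"(i, j, ga) : planes r D" and pq:"p + q < n - g"
 and x:"x = ga(i := B + p, j := B + q)" by auto
 have "deg r (ga(i := B + p, j := B + q)) = deg r ga + (B + p) + (B + q)"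
 using P by(intro deg_upd2) (auto simp:planes_def)
 thus "x : {al:D. deg r al < n}" unfolding x using P pq g[OF P] by(auto simp:planes_def)
 qed
 have inj:"inj_on ?f (planes r D \<times> ?T)" proof(rule inj_onI)
 fix x y assume x:"x : planes r D \<times> ?T" and y:"y : planes r D \<times> ?T" and "?f x = ?f y"
 obtain i j ga p q where xe:"x = ((i, j, ga), (p, q))" by(metis prod_cases3 surj_pair)
 obtain i' j' ga' p' q' where ye:"y = ((i', j', ga'), (p', q'))" by(metis prod_cases3 surj_pair)
 have P:"(i, j, ga) : planes r D" and P': "(i', j', ga') : planes r D"
 and e:"ga(i := B + p, j := B + q) = ga'(i' := B + p', j' := B + q')" using x y `?f x = ?f y` xe ye by auto
 have pl:"i < j" "ga i = 0" "ga j = 0" "i' < j'" "ga' i' = 0" "ga' j' = 0" using P P' by(auto simp:planes_def)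
 have lt:"ga l < B" "ga' l < B" for l
 using plane_coord_less[OF B(2) B(1) P, of l] plane_coord_less[OF B(2) B(1) P', of l] by auto
 have big:"B <= (ga(i := B + p, j := B + q)) l <-> l = i | l = j" for l using lt[of l] by auto
 have big': "B <= (ga'(i' := B + p', j' := B + q')) l <-> l = i' | l = j'" for l using lt[of l] by auto
 have "l = i | l = j <-> l = i' | l = j'" for l using big[of l] big'[of l] unfolding e by blast
 hence ij:"i = i'" "j = j'" using pl by(metis order_less_asym)+
 have "ga l = ga' l" for l using fun_cong[OF e, of l] pl ij by(auto split:if_splits)
 moreover have "p = p'" "q = q'" using fun_cong[OF e, of i] fun_cong[OF e, of j] pl ij by(auto split:if_splits)
 ultimately show "x = y" using ij xe ye by auto
 qed
 have "card (planes r D \<times> ?T) = card (?f ` (planes r D \<times> ?T))" using inj by(rule card_image[symmetric])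
 also have "... <= card {al:D. deg r al < n}"
 by(rule card_mono[OF finite_subset[OF _ finite_deg_less[of r n]] sub]) (use DX in auto)
 finally have "card (planes r D) * (2 * card ?T) <= 2 * card {al:D. deg r al < n}"
 by(simp add:card_cartesian_product)
 hence 1:"card (planes r D) * ((n - g) * (n - g + 1)) <= 2 * card {al:D. deg r al < n}" by(simp only:card_triangle)
 have "n ^ 2 <= (n - g) * (n - g + 1) + 2 * g * n" proof(cases "g <= n")
 case True
 then obtain d where "n = g + d" by(metis le_Suc_ex)
 thus ?thesis by(simp add:power2_eq_square algebra_simps)
 next
 case False
 hence "n * n <= 2 * g * n" by simp
 thus ?thesis unfolding power2_eq_square by linarith
 qed
 hence "card (planes r D) * n ^ 2 <= card (planes r D) * ((n - g) * (n - g + 1) + 2 * g * n)" by(rule mult_left_mono) simp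
 also have "... = card (planes r D) * ((n - g) * (n - g + 1)) + (2 * g * card (planes r D)) * n" by(simp add:algebra_simps)
 finally show ?thesis using 1 by linarith
 qed
 thus ?thesis by blast
qed

end

text \<open>The Newton polygon lies below the trapezoids through consecutive corners of the staircase.\<close>

lemma staircase: fixes F Fn :: "(nat \<times> nat) set"
 assumes up:"!!u v u' v'. (u, v) : F ==> u <= u' ==> v <= v' ==> (u', v') : F"
 and cof:"!!u v. M <= u + v ==> (u, v) : F"
 and Fn:"!!s u v u' v' p q. s <= n ==> (u, v) : F ==> (u', v') : F ==> (n - s) * u + s * u' <= p ==>
 (n - s) * v + s * v' <= q ==> (p, q) : Fn" and n:"n >= 1"
 shows "finite (- Fn)" "2 * card (- Fn) + n ^ 2 * card {v. (0, v) ~: F} <= 2 * n ^ 2 * card (- F) + n * card {v. (0, v) ~: F}"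
proof -
 define a where "a c = (LEAST v. (c, v) : F)" for c
 have ex:"(c, M) : F" for c using cof by simp
 have aF:"(c, a c) : F" for c unfolding a_def by(rule LeastI[of _ M]) (rule ex)
 have a_iff:"(c, v) : F <-> a c <= v" for c v
 using aF[of c] up[of c "a c" c v] unfolding a_def by(auto intro:Least_le)
 have aM:"a c = 0" if "M <= c" for c using a_iff[of c 0] cof[of c 0] that by simp
 have E:"- F = (SIGMA c:{..<M}. {..<a c})" proof(intro equalityI subsetI)
 fix x assume "x : - F"
 then obtain c v where x:"x = (c, v)" "v < a c" using a_iff by(cases x) auto
 hence "c < M" using aM[of c] by(cases "c < M") auto
 thus "x : (SIGMA c:{..<M}. {..<a c})" using x by auto
 qed (auto simp:a_iff)
 have cE:"card (- F) = (SUM c<M. a c)" unfolding E by simp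
 have ray:"{v. (0, v) ~: F} = {..<a 0}" by(auto simp:a_iff)
 \<comment> \<open>The chord from n (c, a c) to n (c + 1, a (c + 1)), evaluated in column n c +
   s.\<close>
 let ?h = "%c s. (n - s) * a c + s * a (Suc c)"
 let ?T = "SIGMA p:{..<n * M}. {..<?h (p div n) (p mod n)}"
 have sub:"- Fn <= ?T" proof
 fix x assume x:"x : - Fn"
 obtain p q where pq:"x = (p, q)" by(cases x)
 let ?c = "p div n" and ?s = "p mod n"
 have s:"?s <= n" using n by(simp add:less_imp_le)
 have "(n - ?s) * ?c + ?s * Suc ?c = n * ?c + ?s" using s by(simp add:algebra_simps diff_mult_distrib)
 hence le:"(n - ?s) * ?c + ?s * Suc ?c <= p" by simp
 have q:"q < ?h ?c ?s" proof(rule ccontr)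
 assume "~ q < ?h ?c ?s"
 hence "(p, q) : Fn" using Fn[OF s aF[of ?c] aF[of "Suc ?c"] le] by simp
 thus False using x pq by simp
 qed
 have "p < n * M" proof(rule ccontr)
 assume "~ p < n * M"
 hence "M <= ?c" using n by(metis div_le_mono div_mult_self1_is_m not_less One_nat_def Suc_le_lessD)
 thus False using q aM[of ?c] aM[of "Suc ?c"] by simp
 qed
 thus "x : ?T" using pq q by simp
 qed
 have fT:"finite ?T" by simp
 thus "finite (- Fn)" using sub by(rule finite_subset[rotated])
 have "card (- Fn) <= card ?T" using sub fT by(rule card_mono[rotated])
 also have "card ?T = (SUM p<n * M. ?h (p div n) (p mod n))" by simp
 also have "... = (SUM c<M. SUM s<n. ?h c s)" proof(induction M)
 case (Suc M)
 have "(SUM p<n * Suc M. ?h (p div n) (p mod n)) = (SUM p<n * M + n. ?h (p div n) (p mod n))" by(simp add:add.commute)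
 also have "... = (SUM p<n * M. ?h (p div n) (p mod n)) + (SUM s<n. ?h ((n * M + s) div n) ((n * M + s) mod n))"
 by(rule sum_lessThan_add)
 also have "(SUM s<n. ?h ((n * M + s) div n) ((n * M + s) mod n)) = (SUM s<n. ?h M s)" by(rule sum.cong) auto
 finally show ?case using Suc by simp
 qed simp
 finally have 1:"card (- Fn) <= (SUM c<M. SUM s<n. ?h c s)" .
 have inner:"2 * (SUM s<n. (n - s) * A + s * B') + n * B' = n ^ 2 * (A + B') + n * A" for A B' :: nat proof -
 have g:"2 * (SUM s<n. s) + n = n * n" by(induction n) auto
 have "2 * (SUM s<n. n - s) = n * n + n" using sum_diff_nat_eq[of n] by simp
 hence "2 * (SUM s<n. n - s) * A + (2 * (SUM s<n. s) + n) * B' = (n * n + n) * A + (n * n) * B'" using g by simp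
 moreover have "(SUM s<n. (n - s) * A + s * B') = (SUM s<n. n - s) * A + (SUM s<n. s) * B'"
 by(simp only:sum.distrib sum_distrib_right)
 ultimately show ?thesis by(simp add:power2_eq_square distrib_left distrib_right mult.assoc)
 qed
 \<comment> \<open>In the doubled area of the trapezoids every inner height counts twice but
   \<open>a 0\<close> only once. This saves n^2 times \<open>a 0\<close>; at the far end M the
   height is 0.\<close>
 have "2 * (SUM c<k. SUM s<n. ?h c s) + n ^ 2 * a 0 + n * a k = 2 * n ^ 2 * (SUM c<k. a c) + n ^ 2 * a k + n * a 0" for k
 proof(induction k)
 case (Suc k)
 show ?case using Suc inner[of "a k" "a (Suc k)"] by(simp add:algebra_simps)
 qed simp
 from this[of M] have "2 * (SUM c<M. SUM s<n. ?h c s) + n ^ 2 * a 0 = 2 * n ^ 2 * card (- F) + n * a 0"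
 by(simp add:aM cE)
 thus "2 * card (- Fn) + n ^ 2 * card {v. (0, v) ~: F} <= 2 * n ^ 2 * card (- F) + n * card {v. (0, v) ~: F}"
 using 1 by(simp add:ray)
qed

section \<open>Monomial filtrations and initial ideals\<close>

definition lexlt :: "(nat => nat) => (nat => nat) => bool" where
 "lexlt al be <-> (EX i. al i < be i & (ALL j<i. al j = be j))"

lemma lexlt_total:"al ~= be ==> lexlt al be | lexlt be al" proof -
 assume "al ~= be"
 hence ex:"EX i. al i ~= be i" by auto
 define i where "i = (LEAST i. al i ~= be i)"
 have "al i ~= be i" unfolding i_def using ex by(rule LeastI_ex)
 moreover have "al j = be j" if "j < i" for j using that not_less_Least unfolding i_def by blast
 ultimately show ?thesis unfolding lexlt_def by(metis linorder_neqE_nat)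
qed

lemma lexlt_irrefl:"~ lexlt al al" by(auto simp:lexlt_def)

lemma lexlt_trans:"lexlt al be ==> lexlt be ga ==> lexlt al ga" proof -
 assume "lexlt al be" "lexlt be ga"
 then obtain i j where i:"al i < be i" "ALL l<i. al l = be l" and j:"be j < ga j" "ALL l<j. be l = ga l"
 by(auto simp:lexlt_def)
 have "al (min i j) < ga (min i j)" using i j by(cases i j rule:linorder_cases) (auto simp:min_def)
 moreover have "ALL l<min i j. al l = ga l" using i j by simp
 ultimately show ?thesis unfolding lexlt_def by blast
qed

lemma lexlt_add:"lexlt al be ==> lexlt (%i. al i + ga i) (%i. be i + ga i)" by(auto simp:lexlt_def)

lemma finite_lex_min: assumes "finite S" "S ~= {}" shows "EX al:S. ALL be:S. be = al | lexlt al be" using assms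
proof(induction S rule:finite_ne_induct)
 case (insert a S)
 then obtain al where al:"al : S" "ALL be:S. be = al | lexlt al be" by blast
 show ?case proof(cases "lexlt a al")
 case True
 have "ALL be:insert a S. be = a | lexlt a be" using al(2) True lexlt_trans[OF True] by auto
 thus ?thesis by blast
 next
 case False
 hence "a = al | lexlt al a" using lexlt_total by blast
 thus ?thesis using al by(intro bexI[of _ al]) auto
 qed
qed simp

lemma mul_span:"mul U (span U G) (span U H) = span U {g * h | g h. g : G & h : H}" proof
 let ?K = "span U {g * h | g h. g : G & h : H}"
 have sub:"smod U {i. i * u : ?K}" "smod U {i. u * i : ?K}" for u using sm_span[of U "{g * h | g h. g : G & h : H}"]
 by(auto simp:smod_def distrib_right distrib_left mult.assoc mult.left_commute)
 have 1:"span U G <= {i. i * h : ?K}" if "h : H" for h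
 using that span_inc[of "{g * h | g h. g : G & h : H}"] by(intro span_least sub) blast
 have 2:"span U H <= {u. i * u : ?K}" if "i : span U G" for i using that 1 by(intro span_least sub) blast
 show "mul U (span U G) (span U H) <= ?K" using 2 by(intro mul_least sm_span) blast
 show "?K <= mul U (span U G) (span U H)"
 using span_inc[of G] span_inc[of H] by(intro span_least sm_mprod) (auto intro!: mul_in)
qed

locale gens = fixes x :: "nat => 'a::comm_ring_1" and r :: nat and I :: "'a set"
 assumes I_eq:"I = span U (x ` {..<r})"
begin

definition mon :: "(nat => nat) => 'a" where "mon al = (PROD i<r. x i ^ al i)"

abbreviation pw :: "nat => 'a set" where "pw n == ipow U I U n"

text \<open>All that comes strictly after the monomial of \<open>al\<close>. Lower degree comes
  first, so an initial monomial is the first one that occurs, as for power series.\<close>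

definition gtW :: "(nat => nat) => 'a set" where
 "gtW al = span U (mon ` {be : exps r. deg r be = deg r al & lexlt al be}) + pw (Suc (deg r al))"

text \<open>The ideal of leading coefficients at \<open>al\<close> of elements of J.\<close>

definition coeffs :: "'a set => (nat => nat) => 'a set" where "coeffs J al = {s. mon al * s : gtW al + J}"

lemma sm_pw [simp]:"smod U (pw n)" by(simp add:sm_ipow)

lemma sm_gtW [simp]:"smod U (gtW al)" unfolding gtW_def by(rule sm_plus[OF sm_span sm_pw])

lemma sm_coeffs:"smod U J ==> smod U (coeffs J al)" using sm_plus[OF sm_gtW[of al], of J]
 by(auto simp:coeffs_def smod_def distrib_left mult.left_commute)

lemma mon_add:"mon (%i. al i + be i) = mon al * mon be" by(simp add:mon_def power_add prod.distrib)

lemma mon_0 [simp]:"mon (%_. 0) = 1" by(simp add:mon_def)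

lemma mon_upd:"i < r ==> mon (al(i := Suc (al i))) = x i * mon al" proof -
 assume i:"i < r"
 have "al(i := Suc (al i)) = (%j. (if j = i then 1 else 0) + al j)" by auto
 hence "mon (al(i := Suc (al i))) = mon (%j. if j = i then 1 else 0) * mon al" by(simp only:mon_add)
 also have "mon (%j. if j = i then 1 else 0) = (PROD j<r. if j = i then x j else 1)"
 unfolding mon_def by(rule prod.cong) auto
 also have "... = x i" using i by simp
 finally show ?thesis .
qed

lemma deg_add:"deg r (%i. al i + be i) = deg r al + deg r be" by(simp add:deg_def sum.distrib)

lemma deg_upd:"i < r ==> deg r (al(i := Suc (al i))) = Suc (deg r al)" proof -
 assume i:"i < r"
 have "al(i := Suc (al i)) = (%j. (if j = i then 1 else 0) + al j)" by auto
 hence "deg r (al(i := Suc (al i))) = deg r (%j. if j = i then 1 else 0) + deg r al" by(simp only:deg_add)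
 also have "deg r (%j. if j = i then 1 else 0) = 1" using i by(simp add:deg_def)
 finally show ?thesis by(simp only:plus_1_eq_Suc)
qed

lemma exps_add:"al : exps r ==> be : exps r ==> (%i. al i + be i) : exps r" by(simp add:exps_def)

lemma pw_eq_span:"pw n = span U (mon ` {be : exps r. deg r be = n})" proof(induction n)
 case 0
 have "(%_. 0) : {be : exps r. deg r be = 0}" by(simp add:exps_def deg_def)
 hence "mon (%_. 0) : mon ` {be : exps r. deg r be = 0}" by(rule imageI)
 hence "1 : mon ` {be : exps r. deg r be = 0}" by(simp only:mon_0)
 hence "1 : span U (mon ` {be : exps r. deg r be = 0})" by(rule subsetD[OF span_inc])
 hence "u : span U (mon ` {be : exps r. deg r be = 0})" for u using sm_mult[OF sm_span, of u U 1] by simp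
 thus ?case by auto
next
 case (Suc n)
 have "{g * h | g h. g : x ` {..<r} & h : mon ` {be : exps r. deg r be = n}} = mon ` {be : exps r. deg r be = Suc n}"
 proof(intro equalityI subsetI)
 fix u assume "u : {g * h | g h. g : x ` {..<r} & h : mon ` {be : exps r. deg r be = n}}"
 then obtain i be where i:"i < r" "be : exps r" "deg r be = n" "u = x i * mon be" by auto
 hence "u = mon (be(i := Suc (be i)))" "be(i := Suc (be i)) : exps r" "deg r (be(i := Suc (be i))) = Suc n"
 by(simp_all add:mon_upd deg_upd exps_upd)
 thus "u : mon ` {be : exps r. deg r be = Suc n}" by blast
 next
 fix u assume "u : mon ` {be : exps r. deg r be = Suc n}"
 then obtain be where be:"be : exps r" "deg r be = Suc n" "u = mon be" by auto
 have "EX i<r. be i ~= 0" proof(rule ccontr)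
 assume "~ (EX i<r. be i ~= 0)"
 hence "deg r be = 0" by(simp add:deg_def)
 thus False using be by simp
 qed
 then obtain i where i:"i < r" "be i ~= 0" by blast
 define ga where "ga = be(i := be i - 1)"
 have bega:"be = ga(i := Suc (ga i))" using i by(auto simp:ga_def)
 have "ga : exps r" using be(1) i by(auto simp:ga_def exps_upd)
 moreover have "deg r ga = n" using be(2) deg_upd[OF i(1), of ga] bega by simp
 moreover have "u = x i * mon ga" using be(3) mon_upd[OF i(1), of ga] bega by simp
 ultimately show "u : {g * h | g h. g : x ` {..<r} & h : mon ` {be : exps r. deg r be = n}}" using i(1) by blast
 qed
 thus ?case using Suc mul_span[of "x ` {..<r}" "mon ` {be : exps r. deg r be = n}"] by(simp add:I_eq)
qed

lemma mon_in_pw:"al : exps r ==> mon al : pw (deg r al)" unfolding pw_eq_span by(rule subsetD[OF span_inc]) blast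

lemma pw_mult:"a : pw n ==> b : pw k ==> a * b : pw (n + k)" using ipow_mult_in[OF sm_pw] by(simp add:ipow_add)

lemma mon_mult_gtW: assumes "u : gtW al" "ga : exps r" shows "mon ga * u : gtW (%i. al i + ga i)" proof -
 let ?S = "{be : exps r. deg r be = deg r al & lexlt al be}"
 obtain v w where vw:"u = v + w" "v : span U (mon ` ?S)" "w : pw (Suc (deg r al))"
 using assms(1) unfolding gtW_def by(rule set_plus_elim)
 let ?T = "{be : exps r. deg r be = deg r (%i. al i + ga i) & lexlt (%i. al i + ga i) be}"
 have "mon ga * v : span U (mon ` ?T)" proof -
 have "span U (mon ` ?S) <= {v. mon ga * v : span U (mon ` ?T)}" proof(rule span_least)
 show "smod U {v. mon ga * v : span U (mon ` ?T)}"
 using sm_span[of U "mon ` ?T"] by(auto simp:smod_def distrib_left mult.left_commute)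
 show "mon ` ?S <= {v. mon ga * v : span U (mon ` ?T)}" proof clarsimp
 fix be assume be:"be : exps r" "deg r be = deg r al" "lexlt al be"
 have "mon ga * mon be = mon (%i. be i + ga i)" by(simp add:mon_add mult.commute)
 moreover have "(%i. be i + ga i) : ?T" using be assms(2) by(simp add:deg_add exps_add lexlt_add)
 ultimately have "mon ga * mon be : mon ` ?T" by(simp only:imageI)
 thus "mon ga * mon be : span U (mon ` ?T)" by(rule subsetD[OF span_inc])
 qed
 qed
 thus ?thesis using vw by blast
 qed
 moreover have "mon ga * w : pw (Suc (deg r (%i. al i + ga i)))"
 using pw_mult[OF mon_in_pw[OF assms(2)] vw(3)] by(simp only:deg_add add_Suc_right add.commute)
 ultimately show ?thesis unfolding gtW_def vw(1) distrib_left by(rule set_plus_intro)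
qed

text \<open>Multiplying by the missing monomial preserves the leading coefficient, because the order
  is compatible with addition of exponents.\<close>

lemma coeffs_mono: assumes J:"smod U J" and le:"al <= be" "be : exps r" shows "coeffs J al <= coeffs J be" proof
 fix s assume "s : coeffs J al"
 then obtain w j where wj:"mon al * s = w + j" "w : gtW al" "j : J" by(auto simp:coeffs_def elim!: set_plus_elim)
 define ga where "ga i = be i - al i" for i
 have be:"be = (%i. al i + ga i)" using le by(auto simp:ga_def le_fun_def)
 have ga:"ga : exps r" using le by(auto simp:ga_def exps_def)
 have "mon be = mon al * mon ga" using arg_cong[OF be, of mon] by(simp only:mon_add)
 hence "mon be * s = mon ga * (mon al * s)" by(simp only:mult_ac)
 hence "mon be * s = mon ga * w + mon ga * j" by(simp only:wj(1) distrib_left)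
 moreover have "gtW be = gtW (%i. al i + ga i)" by(rule arg_cong[OF be])
 hence "mon ga * w : gtW be" using mon_mult_gtW[OF wj(2) ga] by(simp only:)
 moreover have "mon ga * j : J" using J wj(3) by(simp add:sm_mult)
 ultimately show "s : coeffs J be" by(simp add:coeffs_def set_plus_intro)
qed

lemma I_subset_coeffs:  assumes "smod U J" "al : exps r" shows "I <= coeffs J al" proof
 fix i assume i:"i : I"
 have "i * mon al : pw (Suc (deg r al))" using i mon_in_pw[OF assms(2)] by(simp add:mul_in)
 hence "mon al * i : gtW al" unfolding gtW_def using plus_ge2[OF sm_span] by(subst mult.commute) blast
 thus "i : coeffs J al" unfolding coeffs_def using plus_ge1[OF assms(1)] by blast
qed

lemma span_lex_insert: assumes S:"S <= {be : exps r. deg r be = n}" and al:"al : S" "ALL be:S. be = al | lexlt al be"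
 and up:"!!be ga. be : S ==> lexlt be ga ==> ga : exps r ==> deg r ga = n ==> ga : S"
 shows "span U (mon ` (S - {al})) + pw (Suc n) = gtW al"
 and "span U (mon ` S) = mon al *o U + span U (mon ` (S - {al}))" proof -
 have "S - {al} = {be : exps r. deg r be = deg r al & lexlt al be}" using assms lexlt_irrefl by blast
 moreover have "deg r al = n" using S al by blast
 ultimately show "span U (mon ` (S - {al})) + pw (Suc n) = gtW al" by(simp add:gtW_def)
 have "mon ` S = insert (mon al) (mon ` (S - {al}))" using al by blast
 thus "span U (mon ` S) = mon al *o U + span U (mon ` (S - {al}))" by(simp add:span_insert)
qed

text \<open>The monomials of one degree are adjoined in decreasing order. By
  \<open>len_scaled\<close> the cyclic factor at \<open>al\<close> is the ring modulo
  \<open>coeffs J al\<close>; the closure condition keeps S a final segment.\<close>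

lemma len_graded_part: assumes J:"smod U J" and S:"S <= {be : exps r. deg r be = n}"
 and up:"!!be ga. be : S ==> lexlt be ga ==> ga : exps r ==> deg r ga = n ==> ga : S"
 shows "len U (span U (mon ` S) + pw (Suc n) + J) (pw (Suc n) + J) = (SUM al:S. len U U (coeffs J al))" using S up
proof(induction "card S" arbitrary: S)
 case 0
 have "finite S" by(rule finite_subset[OF 0(2) finite_subset[OF _ finite_deg[of r n]]]) auto
 hence "S = {}" using 0 by simp
 moreover have "{0} + pw (Suc n) + J = pw (Suc n) + J" by(simp only:set_add_0)
 ultimately show ?case by simp
next
 case (Suc k)
 have fin:"finite S" by(rule finite_subset[OF Suc(3) finite_subset[OF _ finite_deg[of r n]]]) auto
 then obtain al where al:"al : S" "ALL be:S. be = al | lexlt al be" using finite_lex_min[OF fin] Suc(2) by fastforce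
 have ins:"span U (mon ` (S - {al})) + pw (Suc n) = gtW al"
 "span U (mon ` S) = mon al *o U + span U (mon ` (S - {al}))"
 by(rule span_lex_insert[OF Suc.prems(1) al], use Suc.prems(2) in blast)+
 let ?S = "S - {al}"
 let ?V = "span U (mon ` ?S) + pw (Suc n) + J"
 have sV:"smod U ?V" by(intro sm_plus sm_span sm_pw J)
 have V:"?V = gtW al + J" using ins(1) by simp
 have IH:"len U ?V (pw (Suc n) + J) = (SUM al:?S. len U U (coeffs J al))" proof(rule Suc.hyps(1))
 show "k = card ?S" using Suc(2) al fin by simp
 show "?S <= {be : exps r. deg r be = n}" using Suc.prems(1) by blast
 fix be ga assume b:"be : ?S" "lexlt be ga" "ga : exps r" "deg r ga = n"
 hence "ga : S" using Suc.prems(2) by blast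
 moreover have "ga ~= al" using b al(2) lexlt_trans lexlt_irrefl by blast
 ultimately show "ga : ?S" by blast
 qed
 have eq:"span U (mon ` S) + pw (Suc n) + J = mon al *o U + ?V" by(simp only:ins(2) add.assoc)
 have sc:"smod U (mon al *o U)" by(simp add:sm_scaled)
 have "len U (mon al *o U + ?V) (pw (Suc n) + J) = len U (mon al *o U + ?V) ?V + len U ?V (pw (Suc n) + J)"
 proof(rule len_add[OF sr_U sV])
 show "pw (Suc n) + J <= ?V" unfolding add.assoc by(rule plus_ge2[OF sm_span])
 show "?V <= mon al *o U + ?V" by(rule plus_ge2[OF sc])
 show "smod U (mon al *o U + ?V)" by(rule sm_plus[OF sc sV])
 show "smod U (pw (Suc n) + J)" by(rule sm_plus[OF sm_pw J])
 qed
 also have "len U (mon al *o U + ?V) ?V = len U U {s:U. mon al * s : ?V}" by(rule len_scaled[OF sr_U sm_U sV])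
 also have "{s:U. mon al * s : ?V} = coeffs J al" unfolding V coeffs_def by simp
 finally show ?case unfolding eq IH using al(1) fin by(simp add:sum.remove)
qed

lemma len_eq_sum_coeffs: assumes J:"smod U J"
 shows "len U U (pw N + J) = (SUM al | al : exps r & deg r al < N. len U U (coeffs J al))" proof(induction N)
 case 0
 have "U + J = U" by(rule plus_abs2[OF sm_U J]) simp
 thus ?case by simp
next
 case (Suc N)
 have s:"smod U (pw n + J)" for n by(rule sm_plus[OF sm_pw J])
 have "pw (Suc N) <= pw N" by(rule ipow_antimono) auto
 hence "pw (Suc N) + J <= pw N + J" by(rule plus_mono) simp
 hence "len U U (pw (Suc N) + J) = len U U (pw N + J) + len U (pw N + J) (pw (Suc N) + J)" by(intro len_add s) auto
 also have "pw N + J = span U (mon ` {be : exps r. deg r be = N}) + pw (Suc N) + J"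
 using `pw (Suc N) <= pw N` pw_eq_span[of N] plus_abs2[OF sm_pw[of N] sm_pw[of "Suc N"]] by simp
 also have "len U ... (pw (Suc N) + J) = (SUM al | al : exps r & deg r al = N. len U U (coeffs J al))"
 by(rule len_graded_part[OF J]) auto
 also have "len U U (span U (mon ` {be : exps r. deg r be = N}) + pw (Suc N) + J)
 = (SUM al | al : exps r & deg r al < N. len U U (coeffs J al))" using Suc calculation(1) `pw N + J = _` by metis
 also have "... + (SUM al | al : exps r & deg r al = N. len U U (coeffs J al))
 = (SUM al:{al. al : exps r & deg r al < N} Un {al. al : exps r & deg r al = N}. len U U (coeffs J al))"
 by(rule sum.union_disjoint[symmetric]) (auto intro:finite_subset[OF _ finite_deg[of r N]])
 also have "{al. al : exps r & deg r al < N} Un {al. al : exps r & deg r al = N} = {al. al : exps r & deg r al < Suc N}"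
 by auto
 finally show ?case .
qed

end

locale local_gens = local_type m + gens x r m for m :: "'a::comm_ring_1 set" and x r
begin

text \<open>Leading coefficient 1 suffices as a test: when the generators generate m, every
  coefficient ideal contains m and so is m or the whole ring (\<open>coeffs_cases\<close>).\<close>

definition ini :: "'a set => (nat => nat) set" where "ini J = {al : exps r. mon al : gtW al + J}"

lemma coeffs_cases: assumes J:"smod U J" and al:"al : exps r"
 shows "len U U (coeffs J al) = (if al : ini J then 0 else 1)" proof(cases "al : ini J")
 case True
 hence "1 : coeffs J al" by(simp add:ini_def coeffs_def)
 hence "coeffs J al = U" using sm_coeffs[OF J, of al] by(metis UNIV_I UNIV_eq_I mult.right_neutral sm_mult)
 thus ?thesis using True by simp
next
 case False
 hence 1:"1 ~: coeffs J al" using al by(simp add:ini_def coeffs_def)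
 have "coeffs J al <= m" proof
 fix a assume a:"a : coeffs J al"
 show "a : m" proof(rule ccontr)
 assume "a ~: m"
 then obtain b where "a * b = 1" using unit by blast
 thus False using 1 a sm_coeffs[OF J, of al] by(metis UNIV_I mult.commute sm_mult)
 qed
 qed
 hence "coeffs J al = m" using I_subset_coeffs[OF J al] by blast
 thus ?thesis using False len_residue by simp
qed

lemma len_eq_card: assumes J:"smod U J"
 shows "len U U (mpow N + J) = enat (card {al : exps r. deg r al < N & al ~: ini J})" proof -
 have "len U U (mpow N + J) = (SUM al | al : exps r & deg r al < N. if al : ini J then 0 else 1)"
 unfolding len_eq_sum_coeffs[OF J] by(rule sum.cong) (auto simp:coeffs_cases[OF J])
 also have "... = (SUM al | al : exps r & deg r al < N & al ~: ini J. 1)"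
 by(rule sum.mono_neutral_cong_right) (auto simp:finite_deg_less[simplified])
 also have "... = enat (card {al : exps r. deg r al < N & al ~: ini J})" by(simp add:of_nat_eq_enat)
 finally show ?thesis .
qed

lemma ini_up:"smod U J ==> al : ini J ==> al <= be ==> be : exps r ==> be : ini J"
 using coeffs_mono[of J al be] by(auto simp:ini_def coeffs_def dest:subsetD[where c = 1])

lemma ini_mono:"J <= J' ==> ini J <= ini J'" unfolding ini_def using plus_mono[of "gtW _" "gtW _" J J'] by blast

text \<open>Write the two monomials as w + j and w' + j'. Their product minus j j' is a combination
  of products with w or w', all of which come after the product monomial. Iterated in
  \<open>ini_comb\<close>, this is the convexity behind Lech's inequality.\<close>

lemma ini_mult: assumes K:"smod U K" and JK:"!!j j'. j : J ==> j' : J' ==> j * j' : K"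
 and al:"al : ini J" and be:"be : ini J'" shows "(%i. al i + be i) : ini K" proof -
 obtain w j where w:"mon al = w + j" "w : gtW al" "j : J" "al : exps r"
 using al by(auto simp:ini_def elim!: set_plus_elim)
 obtain w' j' where w': "mon be = w' + j'" "w' : gtW be" "j' : J'" "be : exps r"
 using be by(auto simp:ini_def elim!: set_plus_elim)
 have "gtW al <= mpow (deg r al)" for al proof -
 have "span U (mon ` {be : exps r. deg r be = deg r al & lexlt al be}) <= mpow (deg r al)"
 unfolding pw_eq_span by(rule span_mono) auto
 thus ?thesis unfolding gtW_def by(rule plus_le[OF sm_pw]) (rule mpow_antimono, simp)
 qed
 define S where "S = span U (mon ` {be' : exps r. deg r be' = deg r be & lexlt be be'})"
 obtain v u where vu:"w' = v + u" "v : S" "u : mpow (Suc (deg r be))"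
 using w'(2) unfolding gtW_def S_def by(rule set_plus_elim)
 let ?ga = "%i. al i + be i"
 have "mon ?ga - j * j' = mon al * w' + mon be * w - w * w'" unfolding mon_add w(1) w'(1) by(simp add:algebra_simps)
 have 1:"mon al * w' : gtW ?ga" using mon_mult_gtW[OF w'(2) w(4)] by(simp add:add.commute)
 have 2:"mon be * w : gtW ?ga" by(rule mon_mult_gtW[OF w(2) w'(4)])
 have 3:"w * w' : gtW ?ga" proof -
 have "w * v : gtW ?ga" proof -
 have "S <= {v. w * v : gtW ?ga}" unfolding S_def proof(rule span_least)
 show "smod U {v. w * v : gtW ?ga}" using sm_gtW[of ?ga] by(auto simp:smod_def distrib_left mult.left_commute)
 show "mon ` {be' : exps r. deg r be' = deg r be & lexlt be be'} <= {v. w * v : gtW ?ga}" proof clarsimp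
 fix be' assume b:"be' : exps r" "deg r be' = deg r be" "lexlt be be'"
 have "mon be' * w : gtW (%i. al i + be' i)" by(rule mon_mult_gtW[OF w(2) b(1)])
 moreover have "gtW (%i. al i + be' i) <= gtW ?ga" proof -
 have "lexlt ?ga (%i. al i + be' i)" using lexlt_add[OF b(3), of al] by(simp add:add.commute)
 thus ?thesis unfolding gtW_def deg_add b(2)
 by(intro plus_mono span_mono image_mono order.refl) (auto dest:lexlt_trans)
 qed
 ultimately show "w * mon be' : gtW ?ga" by(subst mult.commute) blast
 qed
 qed
 thus ?thesis using vu by blast
 qed
 moreover have "w * u : gtW ?ga" proof -
 have "w * u : mpow (deg r al + Suc (deg r be))"
 using w(2) `!!al. gtW al <= mpow (deg r al)` vu(3) by(intro pw_mult) auto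
 thus ?thesis unfolding gtW_def deg_add using plus_ge2[OF sm_span] by auto
 qed
 ultimately show ?thesis unfolding vu(1) distrib_left by(intro sm_add[OF sm_gtW])
 qed
 have "mon ?ga = (mon al * w' + mon be * w - w * w') + j * j'" using `mon ?ga - j * j' = _` by(simp add:algebra_simps)
 moreover have "mon al * w' + mon be * w - w * w' : gtW ?ga"
 using 1 2 3 by(intro sm_diff[OF sr_U sm_gtW] sm_add[OF sm_gtW])
 moreover have "j * j' : K" using JK w(3) w'(3) by blast
 ultimately show ?thesis unfolding ini_def using exps_add[OF w(4) w'(4)] by(simp add:set_plus_intro)
qed

lemma ini_UNIV:"ini U = exps r" proof -
 have "gtW al + U = U" for al by(rule plus_abs[OF sm_U sm_gtW]) simp
 thus ?thesis by(auto simp:ini_def)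
qed

lemma pow_mod_mult: assumes "smod U Z" "a : ipow U I U n + Z" "b : ipow U I U k + Z"
 shows "a * b : ipow U I U (n + k) + Z" proof -
 obtain u z where u:"a = u + z" "u : ipow U I U n" "z : Z" using assms(2) by(rule set_plus_elim)
 obtain v w where v:"b = v + w" "v : ipow U I U k" "w : Z" using assms(3) by(rule set_plus_elim)
 have "a * b = u * v + (b * z + u * w)" by(simp add:u(1) v(1) algebra_simps)
 moreover have "u * v : ipow U I U (n + k)" unfolding ipow_add using u v by(intro ipow_mult_in sm_ipow sm_U)
 moreover have "b * z + u * w : Z" using assms(1) u v by(simp add:sm_add sm_mult)
 ultimately show ?thesis by(simp add:set_plus_intro)
qed

lemma ini_pow: assumes Z:"smod U Z" and al:"al : ini (I + Z)" and I:"smod U I"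
 shows "(%i. k * al i) : ini (ipow U I U k + Z)" proof(induction k)
 case 0
 have "U + Z = U" by(rule plus_abs2[OF sm_U Z]) simp
 thus ?case by(simp add:ini_UNIV exps_def)
next
 case (Suc k)
 have I1:"ipow U I U (Suc 0) = I" using mul_cyclic_right[OF I sr_U, of 1] by simp
 have "(%i. al i + k * al i) : ini (ipow U I U (1 + k) + Z)" proof(rule ini_mult[OF _ _ al Suc])
 show "smod U (ipow U I U (1 + k) + Z)" by(intro sm_plus sm_ipow sm_U Z)
 fix j j' assume "j : I + Z" "j' : ipow U I U k + Z"
 thus "j * j' : ipow U I U (1 + k) + Z" using pow_mod_mult[OF Z, of j I 1 j' k] I1 by simp
 qed
 thus ?case by simp
qed

lemma ini_comb: assumes Z:"smod U Z" and I:"smod U I" and al:"al : ini (I + Z)" "be : ini (I + Z)"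
 shows "(%i. k * al i + l * be i) : ini (ipow U I U (k + l) + Z)"
 by(rule ini_mult[OF sm_plus[OF sm_ipow[OF sm_U] Z] pow_mod_mult[OF Z] ini_pow[OF Z al(1) I] ini_pow[OF Z al(2) I]])

end

section \<open>Lech's inequality by counting on planes\<close>

text \<open>X bounds the multiplicity of I on the quotient by Z; the factor 2 is 2!. A linear error
  term in place of a limit makes such bounds additive along filtrations and blind to one-dimensional
  quotients.\<close>

definition mult_le :: "'a::comm_ring_1 set => 'a set => nat => bool" where
 "mult_le Z I X <-> (EX C. ALL n. 2 * len U U (ipow U I U n + Z) <= enat (X * n ^ 2 + C * n))"

lemma mult_le_mono:"mult_le Z I X ==> X <= Y ==> mult_le Z I Y" proof -
 assume "mult_le Z I X" "X <= Y"
 then obtain C where C:"!!n. 2 * len U U (ipow U I U n + Z) <= enat (X * n ^ 2 + C * n)" by(auto simp:mult_le_def)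
 have "enat (X * n ^ 2 + C * n) <= enat (Y * n ^ 2 + C * n)" for n using `X <= Y` by(simp add:mult_right_mono)
 thus ?thesis unfolding mult_le_def using C order_trans by blast
qed

lemma ipow_subset_mprod: assumes A:"sring A" and K:"smod A K" and m:"m <= A"
 shows "ipow A m K k <= mul A (ipow A m A k) K" proof(induction k)
 case 0
 show ?case using mul_in[of 1 A _ K A] A by auto
next
 case (Suc k)
 have "mul A m (mul A (ipow A m A k) K) <= mul A (mul A m (ipow A m A k)) K" proof(rule mul_least[OF sm_mprod])
 fix i u assume i:"i : m" and u:"u : mul A (ipow A m A k) K"
 have "mul A (ipow A m A k) K <= {u. i * u : mul A (mul A m (ipow A m A k)) K}" proof(rule mul_least)
 show "smod A {u. i * u : mul A (mul A m (ipow A m A k)) K}"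
 using sm_mprod[of A "mul A m (ipow A m A k)" K] by(auto simp:smod_def distrib_left mult.left_commute)
 fix w v assume "w : ipow A m A k" "v : K"
 hence "i * w * v : mul A (mul A m (ipow A m A k)) K" using i by(intro mul_in)
 thus "w * v : {u. i * u : mul A (mul A m (ipow A m A k)) K}" by(simp add:mult.assoc)
 qed
 thus "i * u : mul A (mul A m (ipow A m A k)) K" using u by blast
 qed
 thus ?case using mul_mono[OF order.refl Suc, of A m] by simp
qed

lemma ipow_ipow_subset: assumes A:"sring A" and m:"m <= A" and MI:"ipow A m A M <= I"
 shows "ipow A m A (n * M) <= ipow A I A n" proof(induction n)
 case (Suc n)
 have "ipow A m A (Suc n * M) = ipow A m (ipow A m A (n * M)) M" by(simp add:ipow_add)
 also have "... <= ipow A m (ipow A I A n) M" by(rule ipow_mono[OF order.refl Suc])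
 also have "... <= mul A (ipow A m A M) (ipow A I A n)" by(rule ipow_subset_mprod[OF A sm_ipow[OF sm_self[OF A]] m])
 also have "... <= mul A I (ipow A I A n)" by(rule mul_mono[OF MI order.refl])
 finally show ?case by simp
qed simp

lemma sm_saturation: assumes A:"sring A" and y:"y : A" and Z:"smod A Z" shows "smod A {s:A. EX k. y ^ k * s : Z}"
 unfolding smod_def proof(intro conjI ballI)
 show "0 : {s:A. EX k. y ^ k * s : Z}" using A Z by auto
 fix s t assume "s : {s:A. EX k. y ^ k * s : Z}" "t : {s:A. EX k. y ^ k * s : Z}"
 then obtain k l where kl:"y ^ k * s : Z" "y ^ l * t : Z" "s : A" "t : A" by auto
 have "y ^ l * (y ^ k * s) + y ^ k * (y ^ l * t) : Z" by(intro sm_add[OF Z] sm_mult[OF Z] sr_power[OF A y] kl)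
 hence "y ^ (k + l) * (s + t) : Z" by(simp add:power_add algebra_simps)
 thus "s + t : {s:A. EX k. y ^ k * s : Z}" using kl sr_add[OF A] by auto
next
 fix b s assume "b : A" "s : {s:A. EX k. y ^ k * s : Z}"
 then obtain k where k:"y ^ k * s : Z" "s : A" "b : A" by auto
 have "b * (y ^ k * s) : Z" by(rule sm_mult[OF Z k(3,1)])
 hence "y ^ k * (b * s) : Z" by(simp add:mult_ac)
 thus "b * s : {s:A. EX k. y ^ k * s : Z}" using k sr_mult[OF A] by auto
qed

context local_type
begin

lemma mpow_ipow_subset:"mpow M <= I ==> mpow (n * M) <= ipow U I U n" by(rule ipow_ipow_subset[OF sr_U subset_UNIV])

end

context local_gens
begin

definition sd :: "'a set => (nat => nat) set" where "sd Z = {al : exps r. al ~: ini Z}"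

abbreviation zexp :: "nat => nat" where "zexp == (%_. 0)"

lemma down_closed_sd:"smod U Z ==> down_closed (sd Z)" unfolding down_closed_def sd_def using ini_up exps_le by blast

lemma planar_sd: assumes Z:"smod U Z" and growth:"!!n. len U U (mpow n + Z) <= enat (a * n ^ 2)"
 shows "planar r (sd Z) a" proof
 show "sd Z <= exps r" by(auto simp:sd_def)
 show "down_closed (sd Z)" by(rule down_closed_sd[OF Z])
 fix n
 have "{al : sd Z. deg r al < n} = {al : exps r. deg r al < n & al ~: ini Z}" by(auto simp:sd_def)
 thus "card {al : sd Z. deg r al < n} <= a * n ^ 2" using growth[of n] unfolding len_eq_card[OF Z] by simp
qed

lemma len_sd:"smod U Z ==> len U U (mpow n + Z) = enat (card {al : sd Z. deg r al < n})"
 unfolding len_eq_card sd_def by(simp add:Collect_conj_eq Int_ac conj_ac)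

context fixes Z :: "'a set" and a :: nat
 assumes Z:"smod U Z" and growth:"!!n. len U U (mpow n + Z) <= enat (a * n ^ 2)"
begin

interpretation planar r "sd Z" a by(rule planar_sd[OF Z growth])

lemma finite_planes_sd:"finite (planes r (sd Z))" by(rule finite_planes)

text \<open>Together with \<open>mult_ge_m\<close> this identifies the multiplicity of the quotient
  by Z with the number of planes.\<close>

lemma mult_le_m:"mult_le Z m (card (planes r (sd Z)))" proof -
 obtain C where C:"!!n. 2 * card {al:sd Z. deg r al < n} <= card (planes r (sd Z)) * n ^ 2 + C * (n + 1)"
 using count_upper by blast
 have "2 * len U U (mpow n + Z) <= enat (card (planes r (sd Z)) * n ^ 2 + (2 * C) * n)" for n proof(cases "n = 0")
 case True
 have "U + Z = U" by(rule plus_abs2[OF sm_U Z]) simp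
 thus ?thesis using True by(simp add:zero_enat_def[symmetric])
 next
 case False
 hence "C * (n + 1) <= (2 * C) * n" by simp
 hence "2 * card {al:sd Z. deg r al < n} <= card (planes r (sd Z)) * n ^ 2 + (2 * C) * n" using C[of n] by linarith
 thus ?thesis unfolding len_sd[OF Z] by(simp add:numeral_eq_enat)
 qed
 thus ?thesis unfolding mult_le_def by blast
qed

lemma mult_ge_m:"EX C. ALL n. enat (card (planes r (sd Z)) * n ^ 2) <= 2 * len U U (mpow n + Z) + enat (C * n)"
proof -
 obtain C where C:"!!n. card (planes r (sd Z)) * n ^ 2 <= 2 * card {al:sd Z. deg r al < n} + C * n"
 using count_lower by blast
 thus ?thesis unfolding len_sd[OF Z] by(intro exI[of _ C]) (simp add:numeral_eq_enat)
qed

context fixes I :: "'a set" and M :: nat assumes I:"smod U I" and MI:"mpow M <= I"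
begin

text \<open>The initial ideal meets the i-th axis in a ray; this is the exponent at which the ray
  begins.\<close>

definition ray :: "nat => nat" where "ray i = card {c. zexp(i := c) ~: ini (I + Z)}"

definition sect :: "nat => nat => (nat \<times> nat) set" where
 "sect i j = {(u, v). zexp(i := u, j := v) ~: ini (I + Z)}"

abbreviation Jn :: "nat => 'a set" where "Jn n == ipow U I U n + Z"

lemma sm_Jn:"smod U (Jn n)" by(intro sm_plus sm_ipow sm_U Z)

lemma mpow_Jn:"mpow (n * M) <= Jn n" proof -
 have "mpow (n * M) <= ipow U I U n" by(rule mpow_ipow_subset[OF MI])
 thus ?thesis using plus_ge1[OF Z] by blast
qed

lemma I1:"Jn 1 = I + Z" using mul_cyclic_right[OF I sr_U, of 1] by simp

lemma sm_IZ:"smod U (I + Z)" by(rule sm_plus[OF I Z])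

lemma mpow_IZ:"mpow M <= I + Z" using MI plus_ge1[OF Z] by blast

lemma in_ini_if_deg: assumes "mpow K <= J" "al : exps r" "K <= deg r al" "smod U J" shows "al : ini J" proof -
 have "mon al : mpow (deg r al)" by(rule mon_in_pw[OF assms(2)])
 hence "mon al : J" using mpow_antimono[OF assms(3)] assms(1) by blast
 thus ?thesis using assms(2) plus_ge2[OF sm_gtW] by(auto simp:ini_def)
qed

lemma zero_exp_upd2:"i < r ==> j < r ==> zexp(i := u, j := v) : exps r" by(auto simp:exps_def)

lemma zero_exp_upd1:"i < r ==> zexp(i := u) : exps r" by(auto simp:exps_def)

lemma zero_exp_deg:"i < r ==> deg r (zexp(i := u)) = u" by(simp add:deg_def)

text \<open>By upward closure the plane through \<open>ga\<close> meets the initial ideal of I^n + Z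
  at least where the coordinate plane (i, j) does, and there \<open>ini_comb\<close> supplies the
  combinations required by \<open>staircase\<close>.\<close>

lemma plane_bound: assumes ij:"i < r" "j < r" "i ~= j" and ga:"ga : exps r" "ga i = 0" "ga j = 0" and n:"n >= 1"
 shows "finite {(u, v). ga(i := u, j := v) ~: ini (Jn n)}"
 "2 * card {(u, v). ga(i := u, j := v) ~: ini (Jn n)} + n ^ 2 * ray j <= 2 * n ^ 2 * card (sect i j) + n * ray j"
proof -
 let ?F = "{(u, v). zexp(i := u, j := v) : ini (I + Z)}"
 let ?Fn = "{(u, v). ga(i := u, j := v) : ini (Jn n)}"
 have 1:"!!u v u' v'. (u, v) : ?F ==> u <= u' ==> v <= v' ==> (u', v') : ?F"
 using ini_up[OF sm_IZ] zero_exp_upd2[OF ij(1,2)] by(auto simp:le_fun_def elim!: ini_up[OF sm_IZ])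
 have 2:"(u, v) : ?F" if "M <= u + v" for u v
 using in_ini_if_deg[OF mpow_IZ zero_exp_upd2[OF ij(1,2)] _ sm_IZ] deg_upd2[OF ij, of zexp u v] that
 by(simp add:deg_def)
 have 3:"(p, q) : ?Fn" if s:"s <= n" and F:"(u, v) : ?F" "(u', v') : ?F"
 and le:"(n - s) * u + s * u' <= p" "(n - s) * v + s * v' <= q" for s u v u' v' p q proof -
 have "(%l. (n - s) * (zexp(i := u, j := v)) l + s * (zexp(i := u', j := v')) l) : ini (Jn (n - s + s))"
 using ini_comb[OF Z I, of "zexp(i := u, j := v)" "zexp(i := u', j := v')" "n - s" s] F by simp
 hence "(%l. (n - s) * (zexp(i := u, j := v)) l + s * (zexp(i := u', j := v')) l) : ini (Jn n)" using s by simp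
 moreover have "(%l. (n - s) * (zexp(i := u, j := v)) l + s * (zexp(i := u', j := v')) l) <= ga(i := p, j := q)"
 using le ij(3) by(auto simp:le_fun_def)
 moreover have "ga(i := p, j := q) : exps r" using ga(1) ij by(intro exps_upd)
 ultimately have "ga(i := p, j := q) : ini (Jn n)" by(rule ini_up[OF sm_Jn])
 thus ?thesis by simp
 qed
 have st:"finite (- ?Fn)" "2 * card (- ?Fn) + n ^ 2 * card {v. (0, v) ~: ?F} <= 2 * n ^ 2 * card (- ?F) + n * card {v. (0, v) ~: ?F}"
 by(rule staircase[of ?F M n ?Fn, OF 1 2 3 n]; assumption)+
 have c:"- ?Fn = {(u, v). ga(i := u, j := v) ~: ini (Jn n)}" "- ?F = sect i j" by(auto simp:sect_def)
 have "zexp(i := 0, j := v) = zexp(j := v)" for v by auto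
 hence "{v. (0, v) ~: ?F} = {v. zexp(j := v) ~: ini (I + Z)}" by simp
 hence ra:"card {v. (0, v) ~: ?F} = ray j" unfolding ray_def by(rule arg_cong)
 show "finite {(u, v). ga(i := u, j := v) ~: ini (Jn n)}" using st(1) unfolding c .
 show "2 * card {(u, v). ga(i := u, j := v) ~: ini (Jn n)} + n ^ 2 * ray j <= 2 * n ^ 2 * card (sect i j) + n * ray j"
 using st(2) unfolding c ra .
qed

lemma card_swap:"card {(u, v). P u v} = card {(v, u). P u v}" proof -
 have "{(v, u). P u v} = prod.swap ` {(u, v). P u v}" by(auto simp:image_iff)
 thus ?thesis by(simp add:card_image)
qed

lemma sect_swap:"i ~= j ==> card (sect j i) = card (sect i j)"
 unfolding sect_def using card_swap[of "%u v. zexp(i := u, j := v) ~: ini (I + Z)"] by(simp add:fun_upd_twist)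

text \<open>Exchanging the two coordinates allows either ray to be subtracted.\<close>

lemma plane_bound_max: assumes ij:"i < r" "j < r" "i ~= j" and ga:"ga : exps r" "ga i = 0" "ga j = 0" and n:"n >= 1"
 shows "2 * card {(u, v). ga(i := u, j := v) ~: ini (Jn n)} + n ^ 2 * max (ray i) (ray j)
 <= 2 * n ^ 2 * card (sect i j) + n * max (ray i) (ray j)" proof -
 have 1:"2 * card {(u, v). ga(i := u, j := v) ~: ini (Jn n)} + n ^ 2 * ray j <= 2 * n ^ 2 * card (sect i j) + n * ray j"
 by(rule plane_bound(2)[OF assms])
 have "2 * card {(v, u). ga(j := v, i := u) ~: ini (Jn n)} + n ^ 2 * ray i <= 2 * n ^ 2 * card (sect j i) + n * ray i"
 by(rule plane_bound(2)) (use assms in auto)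
 moreover have "card {(v, u). ga(j := v, i := u) ~: ini (Jn n)} = card {(u, v). ga(i := u, j := v) ~: ini (Jn n)}"
 using card_swap[of "%u v. ga(i := u, j := v) ~: ini (Jn n)"] ij(3) by(simp add:fun_upd_twist)
 ultimately have 2:"2 * card {(u, v). ga(i := u, j := v) ~: ini (Jn n)} + n ^ 2 * ray i <= 2 * n ^ 2 * card (sect i j) + n * ray i"
 using sect_swap[OF ij(3)] by simp
 show ?thesis using 1 2 by(cases "ray i <= ray j") (simp_all add:max_def)
qed

lemma card_IZ:"len U U (I + Z) = enat (card {al : exps r. al ~: ini (I + Z)})" proof -
 have "mpow M + (I + Z) = I + Z" by(rule plus_abs[OF sm_IZ sm_mpow mpow_IZ])
 hence "len U U (I + Z) = enat (card {al : exps r. deg r al < M & al ~: ini (I + Z)})"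
 using len_eq_card[OF sm_IZ, of M] by simp
 also have "{al : exps r. deg r al < M & al ~: ini (I + Z)} = {al : exps r. al ~: ini (I + Z)}"
 using in_ini_if_deg[OF mpow_IZ _ _ sm_IZ] by(auto simp:not_less[symmetric])
 finally show ?thesis .
qed

lemma finite_E:"finite {al : exps r. al ~: ini (I + Z)}"
 by(rule finite_subset[OF _ finite_deg[of r M]]) (use in_ini_if_deg[OF mpow_IZ _ _ sm_IZ] nat_le_linear in blast)

lemma inj_sector:"i ~= j ==> inj_on (%(u, v). zexp(i := u, j := v)) S" proof(rule inj_onI)
 fix p q assume ij:"i ~= j" and e:"(%(u, v). zexp(i := u, j := v)) p = (%(u, v). zexp(i := u, j := v)) q"
 have "zexp(i := fst p, j := snd p) = zexp(i := fst q, j := snd q)" using e by(simp add:case_prod_beta)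
 from fun_cong[OF this, of i] fun_cong[OF this, of j] ij show "p = q" by(auto simp:prod_eq_iff)
qed

lemma sect_image:"i < r ==> j < r ==> (%(u, v). zexp(i := u, j := v)) ` sect i j <= {al : exps r. al ~: ini (I + Z)}"
 by(auto simp:sect_def zero_exp_upd2)

lemma card_sector_le:"i < r ==> j < r ==> i ~= j ==> card (sect i j) <= card {al : exps r. al ~: ini (I + Z)}"
 using card_inj_on_le[OF inj_sector sect_image finite_E] by blast

lemma finite_sector:"i < r ==> j < r ==> i ~= j ==> finite (sect i j)"
 using finite_subset[OF sect_image finite_E] finite_imageD[OF _ inj_sector] by blast

text \<open>Sum \<open>plane_bound_max\<close> over the planes. As m^(n M) lies in I^n, only degrees
  below n M matter, so the exponents off the planes add a linear term.\<close>

theorem lech_planes: "mult_le Z I (SUM (i, j, ga):planes r (sd Z). 2 * card (sect i j) - max (ray i) (ray j))" proof -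
 obtain C where C:"!!N Q. card {al:sd Z. deg r al < N & Q al}
 <= (SUM (i, j, ga):planes r (sd Z). card {(p, q). p < N & q < N & Q (ga(i := p, j := q))}) + C * (N + 1)"
 using upper_count by blast
 define X where "X = (SUM (i, j, ga):planes r (sd Z). 2 * card (sect i j) - max (ray i) (ray j))"
 define L where "L = (SUM (i, j, ga):planes r (sd Z). max (ray i) (ray j))"
 have "2 * len U U (Jn n) <= enat (X * n ^ 2 + (L + 2 * C * (M + 1)) * n)" for n proof(cases "n = 0")
 case True
 have "U + Z = U" by(rule plus_abs2[OF sm_U Z]) simp
 thus ?thesis using True by(simp add:zero_enat_def[symmetric])
 next
 case False
 hence n:"n >= 1" by simp
 let ?N = "n * M"
 have "mpow ?N + Jn n = Jn n" by(rule plus_abs[OF sm_Jn sm_mpow mpow_Jn])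
 hence "len U U (Jn n) = enat (card {al : exps r. deg r al < ?N & al ~: ini (Jn n)})"
 using len_eq_card[OF sm_Jn, of ?N n] by simp
 moreover have "{al : exps r. deg r al < ?N & al ~: ini (Jn n)} = {al:sd Z. deg r al < ?N & al ~: ini (Jn n)}"
 proof -
 have "Z <= Jn n" by(rule plus_ge2[OF sm_ipow[OF sm_U]])
 hence "ini Z <= ini (Jn n)" by(rule ini_mono)
 thus ?thesis by(auto simp:sd_def)
 qed
 ultimately have len:"len U U (Jn n) = enat (card {al:sd Z. deg r al < ?N & al ~: ini (Jn n)})" by simp
 have "2 * (SUM (i, j, ga):planes r (sd Z). card {(p, q). p < ?N & q < ?N & ga(i := p, j := q) ~: ini (Jn n)}) <= X * n ^ 2 + L * n"
 unfolding sum_distrib_left X_def L_def sum_distrib_right sum.distrib[symmetric] proof(rule sum_mono)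
 fix t assume t:"t : planes r (sd Z)"
 obtain i j ga where te:"t = (i, j, ga)" by(metis prod_cases3)
 have pl:"i < r" "j < r" "i ~= j" "ga : exps r" "ga i = 0" "ga j = 0" using t te by(auto simp:planes_def)
 let ?mx = "max (ray i) (ray j)"
 have "card {(p, q). p < ?N & q < ?N & ga(i := p, j := q) ~: ini (Jn n)} <= card {(u, v). ga(i := u, j := v) ~: ini (Jn n)}"
 by(rule card_mono[OF plane_bound(1)[OF pl n]]) auto
 hence K:"2 * card {(p, q). p < ?N & q < ?N & ga(i := p, j := q) ~: ini (Jn n)} + n ^ 2 * ?mx <= n ^ 2 * (2 * card (sect i j)) + n * ?mx"
 using plane_bound_max[OF pl n] by(simp add:mult_ac)
 have "2 * card {(p, q). p < ?N & q < ?N & ga(i := p, j := q) ~: ini (Jn n)} <= (2 * card (sect i j) - ?mx) * n ^ 2 + ?mx * n"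
 if "2 * card {(p, q). p < ?N & q < ?N & ga(i := p, j := q) ~: ini (Jn n)} + n ^ 2 * ?mx <= n ^ 2 * (2 * card (sect i j)) + n * ?mx"
 proof -
 have "(2 * card (sect i j) - ?mx) * n ^ 2 = n ^ 2 * (2 * card (sect i j)) - n ^ 2 * ?mx"
 by(simp only:diff_mult_distrib2 mult.commute)
 moreover have "?mx * n = n * ?mx" by(rule mult.commute)
 ultimately show ?thesis using that by linarith
 qed
 from this[OF K] show "2 * (case t of (i, j, ga) => card {(p, q). p < ?N & q < ?N & ga(i := p, j := q) ~: ini (Jn n)})
 <= (case t of (i, j, ga) => 2 * card (sect i j) - max (ray i) (ray j)) * n ^ 2 + (case t of (i, j, ga) => max (ray i) (ray j)) * n"
 by(simp add:te)
 qed
 moreover have "card {al:sd Z. deg r al < ?N & al ~: ini (Jn n)}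
 <= (SUM (i, j, ga):planes r (sd Z). card {(p, q). p < ?N & q < ?N & ga(i := p, j := q) ~: ini (Jn n)}) + C * (?N + 1)"
 by(rule C)
 moreover have "?N + 1 <= (M + 1) * n" using n by(simp add:mult.commute)
 hence "C * (?N + 1) <= C * ((M + 1) * n)" by(rule mult_left_mono) simp
 ultimately have "2 * card {al:sd Z. deg r al < ?N & al ~: ini (Jn n)} <= X * n ^ 2 + L * n + 2 * (C * ((M + 1) * n))" by linarith
 also have "... = X * n ^ 2 + (L + 2 * C * (M + 1)) * n" by(simp add:algebra_simps)
 finally show ?thesis unfolding len by(simp add:numeral_eq_enat)
 qed
 thus ?thesis unfolding mult_le_def X_def by blast
qed

text \<open>Each plane costs at most 2 l, and the longest ray, that of i1, has to be saved once. If
  a plane contains the axis i1, its own subtracted maximum does this. Otherwise the section of any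
  plane misses the ray(i1) - 1 noninitial points other than 0 on that axis, and so falls short of
  l.\<close>

theorem lech_gain: assumes ne:"planes r (sd Z) ~= {}"
 shows "EX X l K. mult_le Z I X & len U U (I + Z) = enat l & mpow K <= I + Z & r * X + K <= 2 * r * card (planes r (sd Z)) * l"
proof -
 let ?E = "{al : exps r. al ~: ini (I + Z)}"
 \<comment> \<open>A monomial of degree at least K reaches the ray in one of its coordinates and is
   therefore initial; this puts m^K into I + Z.\<close>
 define K where "K = (SUM i<r. ray i)"
 obtain i0 j0 ga0 where p0:"(i0, j0, ga0) : planes r (sd Z)" using ne by auto
 hence "r > 0" by(auto simp:planes_def)
 have rayset:"{c. zexp(i := c) ~: ini (I + Z)} = {..<ray i}" if i:"i < r" for i proof -
 let ?P = "%c. zexp(i := c) : ini (I + Z)"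
 have "?P M" using in_ini_if_deg[OF mpow_IZ zero_exp_upd1[OF i] _ sm_IZ] zero_exp_deg[OF i] by simp
 define L0 where "L0 = (LEAST c. ?P c)"
 have L:"?P L0" unfolding L0_def by(rule LeastI[of ?P M]) (rule `?P M`)
 have iff:"?P c <-> L0 <= c" for c proof
 assume "L0 <= c"
 hence "zexp(i := L0) <= zexp(i := c)" by(auto simp:le_fun_def)
 thus "?P c" using ini_up[OF sm_IZ L] zero_exp_upd1[OF i] by blast
 next
 assume "?P c" thus "L0 <= c" unfolding L0_def by(rule Least_le)
 qed
 have "{c. zexp(i := c) ~: ini (I + Z)} = {..<L0}" using iff by(auto simp:not_le)
 thus ?thesis unfolding ray_def by simp
 qed
 have big:"al : ini (I + Z)" if al:"al : exps r" "K <= deg r al" for al proof -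
 have "EX i<r. ray i <= al i" proof(rule ccontr)
 assume "~ (EX i<r. ray i <= al i)"
 hence "deg r al < K" unfolding K_def deg_def using `r > 0` by(intro sum_strict_mono) (auto simp:not_le)
 thus False using al by simp
 qed
 then obtain i where i:"i < r" "ray i <= al i" by blast
 hence "al i ~: {..<ray i}" by simp
 hence "zexp(i := al i) : ini (I + Z)" unfolding rayset[OF i(1), symmetric] mem_Collect_eq by blast
 moreover have "zexp(i := al i) <= al" by(auto simp:le_fun_def)
 ultimately show ?thesis using ini_up[OF sm_IZ] al(1) by blast
 qed
 have K:"mpow K <= I + Z" proof -
 have s:"smod U (mpow k + (I + Z))" for k by(rule sm_plus[OF sm_mpow sm_IZ])
 have "len U U (mpow K + (I + Z)) = len U U (I + Z)" proof -
 have "{al : exps r. deg r al < K & al ~: ini (I + Z)} = ?E" using big by(auto simp:not_less[symmetric])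
 thus ?thesis using len_eq_card[OF sm_IZ, of K] card_IZ by simp
 qed
 moreover have "len U U (I + Z) = len U U (mpow K + (I + Z)) + len U (mpow K + (I + Z)) (I + Z)"
 by(rule len_add[OF sr_U s plus_ge2[OF sm_mpow] _ sm_U sm_IZ]) auto
 ultimately have "len U (mpow K + (I + Z)) (I + Z) = 0"
 unfolding card_IZ by(cases "len U (mpow K + (I + Z)) (I + Z)") (auto simp:zero_enat_def)
 hence "mpow K + (I + Z) = I + Z" using len_eq_0_iff[OF s sm_IZ plus_ge2[OF sm_mpow]] by blast
 thus ?thesis using plus_ge1[OF sm_IZ] by blast
 qed
 define X where "X = (SUM (i, j, ga):planes r (sd Z). 2 * card (sect i j) - max (ray i) (ray j))"
 have "r * X + K <= 2 * r * card (planes r (sd Z)) * card ?E" proof(cases "zexp : ini (I + Z)")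
 case True
 have "ray i = 0" if "i < r" for i proof -
 have "zexp(i := 0) : ini (I + Z)" using True by(simp add:fun_upd_idem)
 hence "0 ~: {c. zexp(i := c) ~: ini (I + Z)}" by simp
 thus ?thesis unfolding rayset[OF that] by simp
 qed
 hence "K = 0" by(simp add:K_def)
 have "X <= (SUM t:planes r (sd Z). 2 * card ?E)" unfolding X_def proof(rule sum_mono)
 fix t assume t:"t : planes r (sd Z)"
 obtain i j ga where te:"t = (i, j, ga)" by(metis prod_cases3)
 show "(case t of (i, j, ga) => 2 * card (sect i j) - max (ray i) (ray j)) <= 2 * card ?E"
 using card_sector_le[of i j] t te by(auto simp:planes_def)
 qed
 hence "X <= 2 * card (planes r (sd Z)) * card ?E" by simp
 hence "r * X <= r * (2 * card (planes r (sd Z)) * card ?E)" by(rule mult_left_mono) simp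
 thus ?thesis using `K = 0` by(simp add:mult_ac)
 next
 case False0: False
 note False = False0
 have "finite {..<r}" "{..<r} ~= {}" using `r > 0` by auto
 hence mx:"Max (ray ` {..<r}) : ray ` {..<r}" by(intro Max_in) auto
 obtain i1 where i1:"i1 < r" "!!i. i < r ==> ray i <= ray i1" proof -
 obtain i1 where "i1 < r" "Max (ray ` {..<r}) = ray i1" using mx by auto
 moreover have "ray i <= Max (ray ` {..<r})" if "i < r" for i using that by(intro Max_ge) auto
 ultimately show ?thesis using that by simp
 qed
 have K1:"K <= r * ray i1" unfolding K_def using sum_mono[of "{..<r}" ray "%_. ray i1"] i1 by simp
 have ray1:"ray i >= 1" if "i < r" for i proof -
 have "zexp(i := 0) ~: ini (I + Z)" using False by(simp add:fun_upd_idem)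
 hence "0 : {..<ray i}" using rayset[OF that] by blast
 thus ?thesis by simp
 qed
 have each:"2 * card (sect i j) - max (ray i) (ray j) <= 2 * card ?E" if "(i, j, ga) : planes r (sd Z)" for i j ga
 using card_sector_le[of i j] that by(auto simp:planes_def)
 have "EX t0:planes r (sd Z). (case t0 of (i, j, ga) => 2 * card (sect i j) - max (ray i) (ray j)) + ray i1 <= 2 * card ?E"
 proof(cases "EX i j ga. (i, j, ga) : planes r (sd Z) & (i = i1 | j = i1)")
 case True
 then obtain i j ga where p:"(i, j, ga) : planes r (sd Z)" "i = i1 | j = i1" by blast
 have ij:"i < r" "j < r" "i ~= j" using p by(auto simp:planes_def)
 have "ray i1 <= max (ray i) (ray j)" using p by auto
 moreover have "max (ray i) (ray j) <= 2 * card (sect i j)" proof -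
 have r_le:"ray j <= card (sect i j)" if "i < r" "j < r" "i ~= j" for i j proof -
 have e:"zexp(i := 0, j := v) = zexp(j := v)" for v by auto
 have "(%v. (0, v)) ` {v. zexp(j := v) ~: ini (I + Z)} <= sect i j" unfolding sect_def by(auto simp:e)
 hence "card ((%v. (0::nat, v)) ` {v. zexp(j := v) ~: ini (I + Z)}) <= card (sect i j)"
 by(rule card_mono[OF finite_sector[OF that]])
 thus ?thesis by(simp add:ray_def card_image inj_on_def)
 qed
 show ?thesis using r_le[of i j] r_le[of j i] sect_swap[of i j] ij by auto
 qed
 ultimately have "2 * card (sect i j) - max (ray i) (ray j) + ray i1 <= 2 * card ?E"
 using card_sector_le[OF ij] by linarith
 thus ?thesis using p(1) by(intro bexI[of _ "(i, j, ga)"]) auto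
 next
 case False
 have ij:"i0 < r" "j0 < r" "i0 ~= j0" using p0 by(auto simp:planes_def)
 have ne:"i0 ~= i1" "j0 ~= i1" using p0 False by blast+
 let ?S = "(%(u, v). zexp(i0 := u, j0 := v)) ` sect i0 j0"
 let ?R = "(%c. zexp(i1 := c)) ` ({..<ray i1} - {0})"
 have "?S Int ?R = {}" proof(rule ccontr)
 assume "?S Int ?R ~= {}"
 then obtain u v c where e:"zexp(i0 := u, j0 := v) = zexp(i1 := c)" "c ~= 0" by auto
 have "(zexp(i0 := u, j0 := v)) i1 = 0" using ne[symmetric] by simp
 moreover have "(zexp(i1 := c)) i1 = c" by simp
 ultimately show False using e by simp
 qed
 moreover have "?R <= ?E" using rayset[OF i1(1)] zero_exp_upd1[OF i1(1)] by auto
 moreover have S:"?S <= ?E" by(rule sect_image[OF ij(1,2)])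
 ultimately have "card ?S + card ?R <= card ?E"
 using card_Un_disjoint[of ?S ?R] card_mono[OF finite_E, of "?S Un ?R"] finite_subset[OF S finite_E] by auto
 moreover have "card ?S = card (sect i0 j0)" by(rule card_image[OF inj_sector[OF ij(3)]])
 moreover have "card ?R = ray i1 - 1" proof -
 have "inj_on (%c. zexp(i1 := c)) ({..<ray i1} - {0})" by(rule inj_onI) (metis fun_upd_eqD)
 hence "card ?R = card ({..<ray i1} - {0})" by(rule card_image)
 also have "... = ray i1 - 1" using ray1[OF i1(1)] by(subst card_Diff_singleton) auto
 finally show ?thesis .
 qed
 ultimately have "card (sect i0 j0) + ray i1 <= card ?E + 1" using ray1[OF i1(1)] by linarith
 hence "2 * card (sect i0 j0) - max (ray i0) (ray j0) + ray i1 <= 2 * card ?E" proof -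
 have "zexp(i0 := 0, j0 := 0) = zexp" by auto
 hence "(0, 0) : sect i0 j0" using False0 unfolding sect_def by simp
 hence "1 <= card (sect i0 j0)" using card_gt_0_iff[of "sect i0 j0"] finite_sector[OF ij] by(auto simp:Suc_le_eq)
 moreover have "1 <= max (ray i0) (ray j0)" using ray1[OF ij(1)] by simp
 ultimately show ?thesis using ray1[OF i1(1)] `card (sect i0 j0) + ray i1 <= card ?E + 1` by arith
 qed
 thus ?thesis using p0 by(intro bexI[of _ "(i0, j0, ga0)"]) auto
 qed
 then obtain t0 where t0:"t0 : planes r (sd Z)"
 "(case t0 of (i, j, ga) => 2 * card (sect i j) - max (ray i) (ray j)) + ray i1 <= 2 * card ?E" by blast
 have "X + ray i1 = ((case t0 of (i, j, ga) => 2 * card (sect i j) - max (ray i) (ray j)) + ray i1)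
 + (SUM (i, j, ga):planes r (sd Z) - {t0}. 2 * card (sect i j) - max (ray i) (ray j))"
 unfolding X_def using sum.remove[OF finite_planes t0(1)] by simp
 also have "... <= 2 * card ?E + (SUM t:planes r (sd Z) - {t0}. 2 * card ?E)" proof(rule add_mono[OF t0(2) sum_mono])
 fix t assume "t : planes r (sd Z) - {t0}"
 thus "(case t of (i, j, ga) => 2 * card (sect i j) - max (ray i) (ray j)) <= 2 * card ?E"
 using each by(cases t) auto
 qed
 also have "... = (SUM t:planes r (sd Z). 2 * card ?E)" using sum.remove[OF finite_planes t0(1), of "%_. 2 * card ?E"] by(rule sym)
 finally have "X + ray i1 <= 2 * card (planes r (sd Z)) * card ?E" by simp
 hence "r * (X + ray i1) <= r * (2 * card (planes r (sd Z)) * card ?E)" by(rule mult_left_mono) simp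
 thus ?thesis using K1 by(simp add:algebra_simps)
 qed
 thus ?thesis using lech_planes card_IZ K unfolding X_def by blast
qed

corollary lech:"EX X l. mult_le Z I X & len U U (I + Z) = enat l & X <= 2 * card (planes r (sd Z)) * l" proof -
 let ?E = "{al : exps r. al ~: ini (I + Z)}"
 have "(SUM (i, j, ga):planes r (sd Z). 2 * card (sect i j) - max (ray i) (ray j)) <= (SUM t:planes r (sd Z). 2 * card ?E)"
 proof(rule sum_mono)
 fix t assume t:"t : planes r (sd Z)"
 obtain i j ga where te:"t = (i, j, ga)" by(metis prod_cases3)
 show "(case t of (i, j, ga) => 2 * card (sect i j) - max (ray i) (ray j)) <= 2 * card ?E"
 using card_sector_le[of i j] t te by(auto simp:planes_def)
 qed
 hence "(SUM (i, j, ga):planes r (sd Z). 2 * card (sect i j) - max (ray i) (ray j)) <= 2 * card (planes r (sd Z)) * card ?E" by simp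
 thus ?thesis using lech_planes card_IZ by blast
qed

text \<open>Sectors of different coordinate planes only meet in coordinate rays.\<close>

theorem lech_not_parallel: assumes t:"!!i j. card {ga. (i, j, ga) : planes r (sd Z)} <= t"
 shows "EX X l. mult_le Z I X & len U U (I + Z) = enat l & X <= 2 * t * (l + 2 * r ^ 2 * M)" proof -
 let ?E = "{al : exps r. al ~: ini (I + Z)}"
 let ?H = "{(i, j). i < j & j < r}"
 have fH:"finite ?H" by(rule finite_subset[of _ "{..<r} \<times> {..<r}"]) auto
 have cH:"card ?H <= r ^ 2" proof -
 have "?H <= {..<r} \<times> {..<r}" by auto
 hence "card ?H <= card ({..<r} \<times> {..<r})" by(rule card_mono[rotated]) simp
 thus ?thesis by(simp add:power2_eq_square card_cartesian_product)
 qed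
 \<comment> \<open>The sections without their two axes. The axes cost at most M points each, and the
   open sectors for different pairs are disjoint inside \<open>?E\<close>.\<close>
 let ?S = "%(i, j). {(u, v) : sect i j. u ~= 0 & v ~= 0}"
 let ?im = "%(i, j). (%(u, v). zexp(i := u, j := v)) ` ?S (i, j)"
 have le_M:"u < M" "v < M" if "(u, v) : sect i j" "i < r" "j < r" "i ~= j" for u v i j proof -
 have "~ M <= u + v"
 using in_ini_if_deg[OF mpow_IZ zero_exp_upd2[OF that(2,3)] _ sm_IZ] deg_upd2[OF that(2,3,4), of zexp u v] that(1)
 by(auto simp:sect_def deg_def)
 thus "u < M" "v < M" by auto
 qed
 have sec:"card (sect i j) <= card (?im (i, j)) + 2 * M" if h:"(i, j) : ?H" for i j proof -
 have ij:"i < r" "j < r" "i ~= j" using h by auto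
 have "sect i j <= ?S (i, j) Un ((%u. (u, 0)) ` {..<M} Un (%v. (0, v)) ` {..<M})" using le_M[OF _ ij] by force
 hence "card (sect i j) <= card (?S (i, j) Un ((%u. (u, 0)) ` {..<M} Un (%v. (0, v)) ` {..<M}))"
 by(rule card_mono[rotated]) (use finite_subset[OF _ finite_sector[OF ij], of "?S (i, j)"] in auto)
 also have "... <= card (?S (i, j)) + (card ((%u. (u, 0::nat)) ` {..<M}) + card ((%v. (0::nat, v)) ` {..<M}))"
 by(meson add_left_mono card_Un_le order_trans)
 also have "... <= card (?S (i, j)) + 2 * M" by(simp add:card_image inj_on_def)
 also have "card (?S (i, j)) = card (?im (i, j))" by(simp only:prod.case card_image[OF inj_sector[OF ij(3)]])
 finally show ?thesis .
 qed
 have disj:"(SUM h:?H. card (?im h)) <= card ?E" proof -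
 have im_sub:"?im (i, j) <= ?E" if "(i, j) : ?H" for i j using that sect_image[of i j] by auto
 have "(SUM h:?H. card (?im h)) = card (UN h:?H. ?im h)" proof(rule card_UN_disjoint[symmetric, OF fH])
 show "ALL h:?H. finite (?im h)" using im_sub finite_subset[OF _ finite_E] by fastforce
 show "ALL h:?H. ALL h':?H. h ~= h' --> ?im h Int ?im h' = {}" proof(intro ballI impI, rule ccontr)
 fix h h' assume h:"h : ?H" "h' : ?H" "h ~= h'" "?im h Int ?im h' ~= {}"
 obtain i j i' j' where he:"h = (i, j)" "h' = (i', j')" by(metis surj_pair)
 obtain u v u' v' where e:"zexp(i := u, j := v) = zexp(i' := u', j' := v')" "u ~= 0" "v ~= 0" "u' ~= 0" "v' ~= 0"
 using h(4) he by auto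
 have l:"l = i | l = j <-> l = i' | l = j'" for l using fun_cong[OF e(1), of l] e(2-) by(auto split:if_splits)
 have "i = i' | i = j'" "j = i' | j = j'" using l[of i] l[of j] by simp_all
 moreover have "i < j" "i' < j'" using h he by auto
 ultimately have "i = i'" "j = j'" by auto
 thus False using h he by simp
 qed
 qed
 also have "... <= card ?E" by(rule card_mono[OF finite_E]) (use im_sub in fastforce)
 finally show ?thesis .
 qed
 have "(SUM (i, j, ga):planes r (sd Z). 2 * card (sect i j) - max (ray i) (ray j)) <= (SUM (i, j, ga):planes r (sd Z). 2 * card (sect i j))"
 by(rule sum_mono) auto
 also have "... = (SUM h:?H. SUM p | p : planes r (sd Z) & (fst p, fst (snd p)) = h. 2 * card (sect (fst p) (fst (snd p))))"
 by(subst sum.group[OF finite_planes fH]) (auto simp:planes_def case_prod_beta intro!: sum.cong)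
 also have "... <= (SUM h:?H. t * (2 * card (sect (fst h) (snd h))))" proof(rule sum_mono)
 fix h assume "h : ?H"
 obtain i j where h:"h = (i, j)" by(metis surj_pair)
 have "{p. p : planes r (sd Z) & (fst p, fst (snd p)) = h} = (%ga. (i, j, ga)) ` {ga. (i, j, ga) : planes r (sd Z)}"
 unfolding h by force
 hence "card {p. p : planes r (sd Z) & (fst p, fst (snd p)) = h} <= t"
 using t[of i j] by(simp add:card_image inj_on_def)
 moreover have "(SUM p | p : planes r (sd Z) & (fst p, fst (snd p)) = h. 2 * card (sect (fst p) (fst (snd p))))
 = (SUM p | p : planes r (sd Z) & (fst p, fst (snd p)) = h. 2 * card (sect (fst h) (snd h)))" by(rule sum.cong) auto
 ultimately show "(SUM p | p : planes r (sd Z) & (fst p, fst (snd p)) = h. 2 * card (sect (fst p) (fst (snd p)))) <= t * (2 * card (sect (fst h) (snd h)))"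
 by simp
 qed
 also have "... = 2 * t * (SUM h:?H. card (sect (fst h) (snd h)))" by(simp add:sum_distrib_left mult_ac)
 also have "(SUM h:?H. card (sect (fst h) (snd h))) <= (SUM h:?H. card (?im h) + 2 * M)" proof(rule sum_mono)
 fix h assume h:"h : ?H"
 thus "card (sect (fst h) (snd h)) <= card (?im h) + 2 * M" using sec[of "fst h" "snd h"] by(simp only:prod.collapse)
 qed
 also have "... <= card ?E + r ^ 2 * (2 * M)" using disj cH by(simp add:sum.distrib add_mono mult_right_mono)
 finally have "(SUM (i, j, ga):planes r (sd Z). 2 * card (sect i j) - max (ray i) (ray j)) <= 2 * t * (card ?E + 2 * r ^ 2 * M)"
 by(simp add:mult_left_mono mult_ac)
 thus ?thesis using lech_planes card_IZ by blast
qed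

text \<open>Every section shrinks to at most the origin, so a plane contributes at most 2 - 1 = 1.
  Thus any m-primary I containing the two generators has at most the multiplicity of m modulo
  Z.\<close>

theorem lech_parallel: assumes par:"!!i j ga. (i, j, ga) : planes r (sd Z) ==> i = i0 & j = j0"
 and xI:"x i0 : I" "x j0 : I" shows "mult_le Z I (card (planes r (sd Z)))" proof(rule mult_le_mono[OF lech_planes])
 have "(SUM (i, j, ga):planes r (sd Z). 2 * card (sect i j) - max (ray i) (ray j)) <= (SUM t:planes r (sd Z). 1)"
 proof(rule sum_mono)
 fix t assume t:"t : planes r (sd Z)"
 obtain i j ga where te:"t = (i, j, ga)" by(metis prod_cases3)
 have ij:"i = i0" "j = j0" "i < r" "j < r" "i ~= j" using t te par[of i j ga] by(auto simp:planes_def)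
 have x1:"zexp(l := 1) : ini (I + Z)" if "l < r" "x l : I" for l proof -
 have "mon (zexp(l := Suc (zexp l))) = x l * mon zexp" by(rule mon_upd[OF that(1)])
 hence "mon (zexp(l := 1)) = x l" by simp
 hence "mon (zexp(l := 1)) : gtW (zexp(l := 1)) + (I + Z)"
 using that(2) plus_ge2[OF sm_gtW] plus_ge1[OF Z] by fastforce
 thus ?thesis using zero_exp_upd1[OF that(1)] by(simp add:ini_def)
 qed
 have "(u, v) = (0, 0)" if uv:"(u, v) : sect i j" for u v proof(rule ccontr)
 assume "(u, v) ~= (0, 0)"
 hence "zexp(i := 1) <= zexp(i := u, j := v) | zexp(j := 1) <= zexp(i := u, j := v)"
 using ij(5) by(auto simp:le_fun_def)
 thus False using x1[of i] x1[of j] ij xI ini_up[OF sm_IZ] zero_exp_upd2[OF ij(3,4)] uv unfolding sect_def by blast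
 qed
 hence sub:"sect i j <= {(0, 0)}" by auto
 have "2 * card (sect i j) - max (ray i) (ray j) <= 1" proof(cases "sect i j = {}")
 case False
 hence "(0, 0) : sect i j" using sub by auto
 hence "zexp(i := 0) ~: ini (I + Z)" unfolding sect_def using ij(5) by(simp add:fun_upd_idem)
 moreover have "{c. zexp(i := c) ~: ini (I + Z)} <= {..<M}"
 using in_ini_if_deg[OF mpow_IZ zero_exp_upd1[OF ij(3)] _ sm_IZ] zero_exp_deg[OF ij(3)] by(auto simp:not_le[symmetric])
 hence "finite {c. zexp(i := c) ~: ini (I + Z)}" by(rule finite_subset) simp
 ultimately have "ray i >= 1" unfolding ray_def by(metis (mono_tags) One_nat_def Suc_leI card_gt_0_iff empty_iff mem_Collect_eq)
 moreover have "card (sect i j) <= 1" using card_mono[OF _ sub] by simp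
 ultimately show ?thesis by simp
 qed simp
 thus "(case t of (i, j, ga) => 2 * card (sect i j) - max (ray i) (ray j)) <= 1" by(simp add:te)
 qed
 thus "(SUM (i, j, ga):planes r (sd Z). 2 * card (sect i j) - max (ray i) (ray j)) <= card (planes r (sd Z))" by simp
qed

end

end

end

section \<open>Primes with two-dimensional quotient\<close>

context local_type
begin

text \<open>Dimension at most one of the quotient by Z, expressed through growth.\<close>

definition lin :: "'a set => bool" where "lin Z <-> (EX C. ALL n. len U U (mpow n + Z) <= enat (C * n))"

lemma plus_UNIV:"smod U Z ==> U + Z = (U :: 'a set)" by(rule plus_abs2[OF sm_U]) auto

lemma lin_if_primary_plus: assumes Z:"smod U Z" and n:"mpow n <= Z + y *o U" and y:"y : m" shows "lin Z" proof -
 have sy:"smod U (z *o (U :: 'a set))" for z by(simp add:sm_scaled)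
 obtain c where c:"len U U (y *o U + Z) = enat c"
 using len_finite[OF n] by(cases "len U U (y *o U + Z)") (auto simp:add.commute)
 have "len U U (mpow k + Z) <= enat (c * k)" for k proof -
 have "(y ^ k) *o U <= mpow k" using ipow_power_in[OF y, of _ U k] by(auto simp:in_scaled)
 hence "len U U (mpow k + Z) <= len U U ((y ^ k) *o U + Z)" by(intro len_mono plus_mono) auto
 also have "... <= of_nat k * len U U (y *o U + Z)"
 by(rule len_power_le) (use Z sm_mult[OF Z UNIV_I] in \<open>auto simp:in_scaled\<close>)
 also have "... = enat (c * k)" by(simp add:c of_nat_eq_enat mult.commute)
 finally show ?thesis .
 qed
 thus ?thesis unfolding lin_def by blast
qed

lemma lin_m:"lin m" proof -
 have "len U U (mpow n + m) <= enat (1 * n)" for n proof(cases n)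
 case 0
 thus ?thesis by(simp add:plus_UNIV[OF sm_m])
 next
 case (Suc k)
 have "len U U (mpow n + m) <= len U U m" by(rule len_mono) (rule plus_ge2[OF sm_mpow])
 also have "... = 1" by(rule len_residue)
 also have "... <= enat (1 * n)" using Suc by(simp add:one_enat_def)
 finally show ?thesis .
 qed
 thus ?thesis unfolding lin_def by blast
qed

lemma lin_if_filtration: assumes J:"smod U J" and ps:"pfilt U J U ps" and l:"!!P. P : set ps ==> lin P" shows "lin J"
proof -
 have "ALL P:set ps. EX C. ALL n. len U U (mpow n + P) <= enat (C * n)" using l by(auto simp:lin_def)
 then obtain C where C:"!!P n. P : set ps ==> len U U (mpow n + P) <= enat (C P * n)" by metis
 have "len U U (mpow n + J) <= enat ((SUM P<-ps. C P) * n)" for n proof -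
 have "len U (U + mpow n) (J + mpow n) <= (SUM P<-ps. len U U (P + mpow n))"
 by(rule pfilt_len_le[OF ps sr_U sr_U]) (use J in auto)
 also have "... <= (SUM P<-ps. enat (C P * n))"
 by(rule sum_list_mono) (use C in \<open>auto simp:add.commute[of _ "mpow n"]\<close>)
 also have "... = enat ((SUM P<-ps. C P) * n)" by(induction ps) (auto simp:zero_enat_def distrib_right)
 finally show ?thesis by(simp add:plus_UNIV add.commute)
 qed
 thus ?thesis unfolding lin_def by blast
qed

lemma nakayama_gens: fixes g x :: "nat => 'a"
 assumes g:"m = span U (g ` {..<r})" and x:"!!i. i < r ==> x i - g i : mpow 2" shows "m = span U (x ` {..<r})" proof
 have m2:"mpow 2 <= m" using mpow_antimono[of "Suc 0" 2] mpow_1 by simp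
 have gm:"g i : m" if "i < r" for i unfolding g using that span_inc[of "g ` {..<r}" U] by auto
 have xm:"x i : m" if "i < r" for i using sm_add[OF sm_m gm[OF that], of "x i - g i"] x[OF that] m2 by auto
 show "span U (x ` {..<r}) <= m" by(rule span_least[OF sm_m]) (use xm in auto)
 have sx:"smod U (span U (x ` {..<r}))" by(rule sm_span)
 have "mpow (Suc (Suc 0)) = mul U m (mpow (Suc 0))" by(rule ipow.simps(2))
 hence e:"mpow 2 = mul U m m" by(simp only:mpow_1 numeral_2_eq_2)
 show "m <= span U (x ` {..<r})" proof(rule nakayama[OF _ sx])
 show "fg U m" unfolding fg_def by(rule exI[of _ "g ` {..<r}"], rule conjI[OF _ g]) simp
 have sp:"smod U (span U (x ` {..<r}) + mul U m m)" by(rule sm_plus[OF sx sm_mprod])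
 have "g i : span U (x ` {..<r}) + mul U m m" if "i < r" for i proof -
 have "g i = x i + (- (x i - g i))" by simp
 moreover have "x i : span U (x ` {..<r})" using that by(intro subsetD[OF span_inc]) auto
 moreover have "- (x i - g i) : mul U m m" using x[OF that] unfolding e by(rule sm_uminus[OF sr_U sm_mprod])
 ultimately show ?thesis by(metis set_plus_intro)
 qed
 hence "span U (g ` {..<r}) <= span U (x ` {..<r}) + mul U m m" by(intro span_least[OF sp]) auto
 thus "m <= span U (x ` {..<r}) + mul U m m" using g by simp
 qed
qed

lemma gens_ex:"smod U I ==> EX (x :: nat => 'a) r. I = span U (x ` {..<r})" proof -
 assume "smod U I"
 hence "fg U I" using noeth_fg[OF sr_U noeth_ring] by blast
 then obtain G where G:"finite G" "I = span U G" by(auto simp:fg_def)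
 obtain f :: "nat => 'a" and n where "G = f ` {i. i < n}" using finite_imp_nat_seg_image_inj_on[OF G(1)] by blast
 hence "I = span U (f ` {..<n})" using G(2) by(simp add:lessThan_def)
 thus ?thesis by blast
qed

end

locale local_type2 = local_type m for m :: "'a::comm_ring_1 set" + assumes dim:"krull_dim_eq TYPE('a) 2"
begin

lemma no_chain: assumes "prime_in U P" "prime_in U P'" "prime_in U P''" "P < P'" "P' < P''" shows "P'' = m"
proof(rule ccontr)
 assume "P'' ~= m"
 hence "P'' < m" using prime_subset_m[OF assms(3)] by blast
 hence "has_prime_chain TYPE('a) (Suc 2)" unfolding has_prime_chain_def using assms prime_m
 by(intro exI[of _ "%i. if i = 0 then P else if i = 1 then P' else if i = 2 then P'' else m"])
 (auto simp:prime_ideal_iff less_Suc_eq)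
 thus False using dim by(simp add:krull_dim_eq_def)
qed

text \<open>A prime of a filtration over Q + (y) lies strictly above Q, which lies strictly above P;
  in dimension two it must be m.\<close>

lemma primary_above: assumes P:"prime_in U P" and Q:"prime_in U Q" and PQ:"P < Q" and y:"y ~: Q"
 shows "EX n. mpow n <= Q + y *o U" proof -
 have sQ:"smod U Q" using Q by(simp add:prime_in_def)
 have sZ:"smod U (Q + y *o U)" by(intro sm_plus sm_scaled sQ sm_U)
 obtain ps where ps:"pfilt U (Q + y *o U) U ps" using pfilt_ex[OF sr_U noeth_ring sZ] by auto
 show ?thesis proof(rule mpow_subset_if_primes_eq_m[OF sZ ps])
 fix P' assume P': "P' : set ps"
 have pP': "prime_in U P'" "Q + y *o U <= P'" using pfilt_primes[OF ps sr_U sZ _ P'] by auto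
 have "Q <= Q + y *o U" by(rule plus_ge1[OF sm_scaled[OF sm_U]])
 moreover have "y : Q + y *o U" using plus_ge2[OF sQ, of "y *o U"] scaledI[of 1 U y] by auto
 ultimately have "Q < P'" using pP'(2) y by blast
 thus "P' = m" using no_chain[OF P Q pP'(1) PQ] by blast
 qed
qed

lemma lin_prime: assumes P:"prime_in U P" and Q:"prime_in U Q" and PQ:"P < Q" shows "lin Q" proof(cases "Q = m")
 case False
 then obtain y where y:"y : m" "y ~: Q" using prime_subset_m[OF Q] by blast
 obtain n where "mpow n <= Q + y *o U" using primary_above[OF P Q PQ y(2)] by blast
 thus ?thesis using Q y by(intro lin_if_primary_plus) (auto simp:prime_in_def)
qed (simp add:lin_m)

lemma lin_above: assumes P:"prime_in U P" and J:"smod U J" "P < J" shows "lin J" proof -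
 obtain ps where ps:"pfilt U J U ps" using pfilt_ex[OF sr_U noeth_ring J(1)] by auto
 show ?thesis proof(rule lin_if_filtration[OF J(1) ps])
 fix Q assume "Q : set ps"
 hence "prime_in U Q & J <= Q" by(intro pfilt_primes[OF ps sr_U J(1)]) auto
 thus "lin Q" using lin_prime[OF P] J(2) by blast
 qed
qed

text \<open>Generators of m are changed one by one by elements of m^2 until any two are parameters
  modulo P. When all planes are parallel, this is what makes the two distinguished generators
  m-primary modulo P in \<open>one_prime\<close>.\<close>

lemma generic_gens: assumes P:"prime_in U P" "P ~= m"
 shows "EX (x :: nat => 'a) r. m = span U (x ` {..<r}) & (ALL i<r. x i : m) &
 (ALL i<r. ALL j<r. i < j --> (EX n. mpow n <= (P + x i *o U) + x j *o U))" proof -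
 obtain g :: "nat => 'a" and r where g:"m = span U (g ` {..<r})" using gens_ex[OF sm_m] by blast
 have gm:"g i : m" if "i < r" for i unfolding g using that span_inc[of "g ` {..<r}" U] by auto
 have m2:"mpow 2 <= m" using mpow_antimono[of "Suc 0" 2] mpow_1 by simp
 have sP:"smod U P" using P by(simp add:prime_in_def)
 let ?ok = "%k x. (ALL i<k. x i - g i : mpow 2 & x i : m & x i ~: P) &
 (ALL i<k. ALL j<k. i < j --> (EX n. mpow n <= (P + x i *o U) + x j *o U))"
 have "EX x. ?ok k x" if "k <= r" for k using that proof(induction k)
 case (Suc k)
 then obtain x where x:"?ok k x" by auto
 have sZ:"smod U (P + x i *o U)" for i by(intro sm_plus sm_scaled sP sm_U)
 have "ALL i. EX ps. pfilt U (P + x i *o U) U ps" using pfilt_ex[OF sr_U noeth_ring sZ] by auto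
 then obtain ps where ps:"!!i. pfilt U (P + x i *o U) U (ps i)" by metis
 let ?Q = "insert P (\<Union>i<k. {Q : set (ps i). Q ~= m})"
 have "EX h:mpow 2. ALL Q:?Q. g k + h ~: Q" proof(rule coset_avoidance)
 show "finite ?Q" by auto
 show "prime_in U Q & Q ~= m" if "Q : ?Q" for Q using that P pfilt_primes[OF ps sr_U sZ] by auto
 show "g k : m" using gm Suc.prems by simp
 qed
 then obtain h where h:"h : mpow 2" "ALL Q:?Q. g k + h ~: Q" by(rule bexE)
 let ?x = "x(k := g k + h)"
 have xk:"g k + h : m" using gm[of k] h(1) m2 Suc.prems by(auto intro:sm_add[OF sm_m])
 have pair:"EX n. mpow n <= (P + x i *o U) + (g k + h) *o U" if i:"i < k" for i
 proof(rule m_primary_sum_if[OF sZ ps])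
 fix Q assume Q:"Q : set (ps i)" "Q ~= m"
 have pQ:"prime_in U Q" "P + x i *o U <= Q" using pfilt_primes[OF ps sr_U sZ _ Q(1)] by auto
 have "P <= P + x i *o U" by(rule plus_ge1[OF sm_scaled[OF sm_U]])
 moreover have "x i : P + x i *o U" using plus_ge2[OF sP, of "x i *o U"] scaledI[of 1 U "x i"] by auto
 moreover have "x i ~: P" using x i by blast
 ultimately have "P < Q" using pQ(2) by blast
 moreover have "g k + h ~: Q" by(rule bspec[OF h(2)]) (use Q i in auto)
 ultimately show "EX n. mpow n <= Q + (g k + h) *o U" using primary_above[OF P(1) pQ(1)] by blast
 qed
 have "?ok (Suc k) ?x" proof(intro conjI allI impI)
 fix i assume "i < Suc k"
 thus "?x i - g i : mpow 2" "?x i : m" "?x i ~: P" using x h(1) bspec[OF h(2), of P] xk by(auto simp:less_Suc_eq)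
 next
 fix i j assume "i < Suc k" "j < Suc k" "i < j"
 thus "EX n. mpow n <= (P + ?x i *o U) + ?x j *o U" using x pair by(cases "j = k") auto
 qed
 thus ?case by blast
 qed simp
 then obtain x where x:"?ok r x" by blast
 hence "m = span U (x ` {..<r})" using nakayama_gens[OF g] by blast
 thus ?thesis using x by blast
qed

text \<open>The condition on u says that P vanishes modulo Z after localization at P. It forces a to
  be outside P when P occurs, so afterwards Z' contains some b outside P. A second occurrence would
  put this b into the annihilator P, because b a lies in Z'.\<close>

lemma count_generic:
 assumes "pfilt U Z Z' ps" and P:"prime_in U P" and u:"!!p. p : P ==> EX u. u ~: P & u * p : Z" and Z:"smod U Z"
 shows "count_list ps P <= 1 & (P : set ps --> ~ Z' <= P)" using assms(1) proof(induction rule:pfilt.induct)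
 case (step Z' ps a Q)
 have f:"smod U Z'" "Z <= Z'" using pfilt_facts[OF step.hyps(1) sr_U Z] by auto
 have sub:"Z' <= Z' + a *o U" by(rule plus_ge1[OF sm_scaled[OF sm_U]])
 show ?case proof(cases "Q = P")
 case True
 have "P ~: set ps" proof
 assume "P : set ps"
 then obtain b where b:"b : Z'" "b ~: P" using step.IH by blast
 have "b * a : Z'" using sm_mult[OF f(1), of a b] b by(simp add:mult.commute)
 hence "b : Q" using step.hyps(3) by simp
 thus False using b True by simp
 qed
 moreover have "a ~: P" proof
 assume "a : P"
 then obtain u where "u ~: P" "u * a : Z" using u by blast
 thus False using f(2) step.hyps(3) True by auto
 qed
 moreover have "a : Z' + a *o U" using plus_ge2[OF f(1), of "a *o U"] scaledI[of 1 U a] by auto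
 ultimately show ?thesis using True by(auto simp:count_list_0_iff)
 qed (use step.IH sub in auto)
qed simp

text \<open>Multiplicity is additive over a prime filtration, and the primes with \<open>lin\<close>
  only enter the linear term.\<close>

lemma mult_le_filt: assumes ps:"pfilt U {0} U ps" and I:"smod U I" "mpow M <= I"
 and big:"!!P. P : set ps ==> ~ lin P ==> mult_le P I (X P) & count_list ps P <= 1"
 shows "mult_le {0} I (SUM P | P : set ps & ~ lin P. X P)" proof -
 define Y where "Y P = (if lin P then 0 else X P)" for P
 have "EX C. ALL n. 2 * len U U (ipow U I U n + P) <= enat (Y P * n ^ 2 + C * n)" if P:"P : set ps" for P
 proof(cases "lin P")
 case True
 then obtain C where C:"!!n. len U U (mpow n + P) <= enat (C * n)" by(auto simp:lin_def)
 have "2 * len U U (ipow U I U n + P) <= enat (Y P * n ^ 2 + (2 * C * M) * n)" for n proof -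
 have "len U U (ipow U I U n + P) <= len U U (mpow (n * M) + P)"
 by(intro len_mono plus_mono mpow_ipow_subset[OF I(2)] order.refl)
 also have "... <= enat (C * (n * M))" by(rule C)
 finally have "2 * len U U (ipow U I U n + P) <= 2 * enat (C * (n * M))" by(rule mult_left_mono) simp
 thus ?thesis using True by(simp add:Y_def numeral_eq_enat mult_ac)
 qed
 thus ?thesis by blast
 next
 case False
 thus ?thesis using big[OF P] unfolding mult_le_def Y_def by auto
 qed
 then obtain C where C:"!!P n. P : set ps ==> 2 * len U U (ipow U I U n + P) <= enat (Y P * n ^ 2 + C P * n)" by metis
 have Ysum:"(SUM P<-ps. Y P) <= (SUM P | P : set ps & ~ lin P. X P)" proof -
 have "(SUM P<-ps. Y P) = (SUM P:set ps. count_list ps P * Y P)" by(simp add:sum_list_map_eq_sum_count)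
 also have "... <= (SUM P:set ps. Y P)"
 by(rule sum_mono) (use big in \<open>auto simp:Y_def intro:order_trans[OF mult_right_mono[of _ 1]]\<close>)
 also have "... = (SUM P | P : set ps & ~ lin P. X P)" unfolding Y_def by(rule sum.mono_neutral_cong_right) auto
 finally show ?thesis .
 qed
 have "2 * len U U (ipow U I U n + {0}) <= enat ((SUM P | P : set ps & ~ lin P. X P) * n ^ 2 + (SUM P<-ps. C P) * n)" for n
 proof -
 let ?In = "ipow U I U n"
 have sI:"smod U ?In" by(simp add:sm_ipow)
 have "len U (U + ?In) ({0} + ?In) <= (SUM P<-ps. len U U (P + ?In))"
 by(rule pfilt_len_le[OF ps sr_U sr_U]) (use sI in auto)
 hence "2 * len U U (?In + {0}) <= 2 * (SUM P<-ps. len U U (P + ?In))"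
 by(intro mult_left_mono) (simp_all add:plus_UNIV[OF sI] add.commute)
 also have "... = (SUM P<-ps. 2 * len U U (P + ?In))" by(induction ps) (auto simp:distrib_left)
 also have "... <= (SUM P<-ps. enat (Y P * n ^ 2 + C P * n))"
 by(rule sum_list_mono) (use C in \<open>auto simp:add.commute[of _ ?In]\<close>)
 also have "... = enat ((SUM P<-ps. Y P) * n ^ 2 + (SUM P<-ps. C P) * n)"
 by(induction ps) (auto simp:zero_enat_def distrib_right)
 also have "... <= enat ((SUM P | P : set ps & ~ lin P. X P) * n ^ 2 + (SUM P<-ps. C P) * n)"
 using mult_right_mono[OF Ysum, of "n ^ 2"] by simp
 finally show ?thesis .
 qed
 thus ?thesis unfolding mult_le_def by blast
qed

end

lemma Inter_not_subset_prime: assumes S:"sring S" and Q:"prime_in S Q" and fin:"finite QQ"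
 and "!!P. P : QQ ==> smod S P & P <= S & ~ P <= Q" shows "EX p:S. p : \<Inter>QQ & p ~: Q" using fin assms(4)
proof(induction QQ rule:finite_induct)
 case empty
 thus ?case using S Q by(auto simp:prime_in_def intro!: bexI[of _ 1])
next
 case (insert P QQ)
 have P:"smod S P" "P <= S" "~ P <= Q" using insert.prems by auto
 obtain p where p:"p : S" "p : \<Inter>QQ" "p ~: Q" using insert.IH insert.prems by blast
 obtain q where q:"q : P" "q ~: Q" using P by blast
 have "p * q ~: Q" using prime_inD[OF Q, of p q] p q P by blast
 moreover have "p * q : P" using sm_mult[OF P(1) p(1) q(1)] .
 moreover have "p * q : T" if "T : QQ" for T proof -
 have "smod S T" "p : T" using insert.prems that p by auto
 thus ?thesis using sm_mult[of S T q p] q P(2) by(auto simp:mult.commute)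
 qed
 moreover have "p * q : S" using p q P S by(blast intro:sr_mult)
 ultimately show ?case by(intro bexI[of _ "p * q"]) auto
qed

text \<open>The length of \<open>S/(J + \<Inter>QQ)\<close> is superadditive in the primes \<open>Q\<close>, up to ideals that strictly contain one of them.\<close>

lemma sum_len_primes_le: assumes R:"sring R" "R <= S" and S:"sring S" and fin:"finite QQ"
 and pr:"!!Q. Q : QQ ==> prime_in S Q" and inc:"!!Q Q'. Q : QQ ==> Q' : QQ ==> Q <= Q' ==> Q = Q'"
 shows "EX B. (ALL Q:QQ. smod S (B Q) & Q < B Q & B Q <= S) &
 (ALL J. smod S J --> J <= S --> (SUM Q:QQ. len R S (J + Q)) <= len R S (J + (S Int \<Inter>QQ)) + (SUM Q:QQ. len R S (J + B Q)))"
 using fin pr inc proof(induction QQ rule:finite_induct)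
 case (insert Q QQ)
 have "EX B. (ALL Q:QQ. smod S (B Q) & Q < B Q & B Q <= S) &
 (ALL J. smod S J --> J <= S --> (SUM Q:QQ. len R S (J + Q)) <= len R S (J + (S Int \<Inter>QQ)) + (SUM Q:QQ. len R S (J + B Q)))"
 by(rule insert.IH) (use insert.prems in blast)+
 then obtain B where B0:"(ALL Q:QQ. smod S (B Q) & Q < B Q & B Q <= S) &
 (ALL J. smod S J --> J <= S --> (SUM Q:QQ. len R S (J + Q)) <= len R S (J + (S Int \<Inter>QQ)) + (SUM Q:QQ. len R S (J + B Q)))"
 by(rule exE)
 have B:"!!Q. Q : QQ ==> smod S (B Q) & Q < B Q & B Q <= S"
 "!!J. smod S J ==> J <= S ==> (SUM Q:QQ. len R S (J + Q)) <= len R S (J + (S Int \<Inter>QQ)) + (SUM Q:QQ. len R S (J + B Q))"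
 using B0 by simp_all
 let ?K = "S Int \<Inter>QQ"
 have Q:"prime_in S Q" "smod S Q" "Q <= S" using insert.prems(1) by(auto simp:prime_in_def)
 have sK:"smod S ?K" proof(intro sm_Int sm_self[OF S] sm_Inter)
 fix P assume "P : QQ"
 hence "prime_in S P" using insert.prems(1) by blast
 thus "smod S P" by(simp add:prime_in_def)
 qed
 have "EX p:S. p : \<Inter>QQ & p ~: Q" proof(rule Inter_not_subset_prime[OF S Q(1) insert.hyps(1)])
 fix P assume P:"P : QQ"
 hence "prime_in S P" using insert.prems(1) by blast
 moreover have "~ P <= Q" using insert.prems(2)[of P Q] P insert.hyps(2) by auto
 ultimately show "smod S P & P <= S & ~ P <= Q" by(simp add:prime_in_def)
 qed
 hence nK:"~ ?K <= Q" by blast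
 \<comment> \<open>The colengths of Q and of the intersection \<open>?K\<close> of the others add up
   to that of their intersection, except for a correction by Q + \<open>?K\<close>. This strictly
   contains Q since the primes are incomparable.\<close>
 define B' where "B' = B(Q := Q + ?K)"
 have QK:"Q < Q + ?K" using nK plus_ge1[OF sK, of Q] plus_ge2[OF Q(2), of ?K] by blast
 have sQK:"smod S (Q + ?K)" "Q + ?K <= S" by(rule sm_plus[OF Q(2) sK], rule plus_le[OF sm_self[OF S]]) (use Q in auto)
 have 1:"smod S (B' P) & P < B' P & B' P <= S" if "P : insert Q QQ" for P
 using that B(1)[of P] QK sQK unfolding B'_def by auto
 have 2:"(SUM Q:insert Q QQ. len R S (J + Q)) <= len R S (J + (S Int \<Inter>(insert Q QQ))) + (SUM Q:insert Q QQ. len R S (J + B' Q))"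
 if J:"smod S J" "J <= S" for J proof -
 have e:"S Int \<Inter>(insert Q QQ) = Q Int ?K" using Q(3) by auto
 note sR = sm_sub[OF _ R(2)]
 have sS:"smod R S" by(rule sR[OF sm_self[OF S]])
 have s:"smod R (J + Q)" "smod R (J + Q Int ?K)" "smod R (J + ?K)" "smod R (J + (Q + ?K))" "smod R J"
 by(intro sR sm_plus sm_Int J Q sK)+
 have i1:"J + Q Int ?K <= J + Q" by(rule plus_mono) auto
 have i2:"J + Q <= S" by(rule plus_le[OF sm_self[OF S] J(2) Q(3)])
 have i3:"J + ?K <= J + (Q + ?K)" by(rule plus_mono[OF order.refl plus_ge2[OF Q(2)]])
 have i4:"J + (Q + ?K) <= S" by(rule plus_le[OF sm_self[OF S] J(2) sQK(2)])
 have a:"len R S (J + Q Int ?K) = len R S (J + Q) + len R (J + Q) (J + Q Int ?K)"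
 by(rule len_add[OF R(1) s(1) i1 i2 sS s(2)])
 have b:"len R S (J + ?K) = len R S (J + (Q + ?K)) + len R (J + (Q + ?K)) (J + ?K)"
 by(rule len_add[OF R(1) s(4) i3 i4 sS s(3)])
 have JJ:"J + J = J" by(rule plus_abs[OF J(1) J(1)]) simp
 have e1:"(J + Q) + (J + ?K) = J + (Q + ?K)" proof -
 have "(J + Q) + (J + ?K) = (J + J) + (Q + ?K)" by(simp only:add_ac)
 thus ?thesis by(simp only:JJ)
 qed
 have e2:"(J + Q Int ?K) + (J + ?K) = J + ?K" proof -
 have "(J + Q Int ?K) + (J + ?K) = (J + J) + (Q Int ?K + ?K)" by(simp only:add_ac)
 moreover have "Q Int ?K + ?K = ?K" by(rule plus_abs[OF sK sm_Int[OF Q(2) sK]]) auto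
 ultimately show ?thesis by(simp only:JJ)
 qed
 have "len R ((J + Q) + (J + ?K)) ((J + Q Int ?K) + (J + ?K)) <= len R (J + Q) (J + Q Int ?K)"
 by(rule len_plus_le[OF R(1) s(1) s(2) s(3) i1])
 hence c:"len R (J + (Q + ?K)) (J + ?K) <= len R (J + Q) (J + Q Int ?K)" by(simp only:e1 e2)
 have "(SUM Q:insert Q QQ. len R S (J + Q)) = len R S (J + Q) + (SUM Q:QQ. len R S (J + Q))"
 by(rule sum.insert[OF insert.hyps])
 also have "... <= len R S (J + Q) + (len R S (J + ?K) + (SUM Q:QQ. len R S (J + B Q)))"
 by(rule add_left_mono[OF B(2)[OF J]])
 also have "... = (len R S (J + Q) + len R (J + (Q + ?K)) (J + ?K)) + (len R S (J + (Q + ?K)) + (SUM Q:QQ. len R S (J + B Q)))"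
 unfolding b by(simp only:add_ac)
 also have "... <= (len R S (J + Q) + len R (J + Q) (J + Q Int ?K)) + (len R S (J + (Q + ?K)) + (SUM Q:QQ. len R S (J + B Q)))"
 by(intro add_right_mono add_left_mono c)
 also have "... = len R S (J + Q Int ?K) + (len R S (J + (Q + ?K)) + (SUM Q:QQ. len R S (J + B Q)))" by(simp only:a)
 also have "(SUM Q:QQ. len R S (J + B Q)) = (SUM Q:QQ. len R S (J + B' Q))"
 by(rule sum.cong) (use insert.hyps in \<open>auto simp:B'_def\<close>)
 also have "len R S (J + (Q + ?K)) = len R S (J + B' Q)" by(simp add:B'_def)
 also have "len R S (J + B' Q) + (SUM Q:QQ. len R S (J + B' Q)) = (SUM Q:insert Q QQ. len R S (J + B' Q))"
 by(rule sum.insert[OF insert.hyps, symmetric])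
 finally show ?thesis unfolding e .
 qed
 show ?case by(rule exI[of _ B'], rule conjI, rule ballI, rule 1, assumption, intro allI impI, rule 2)
qed auto

section \<open>Existence of the multiplicity as a limit\<close>

text \<open>At n = C + 1 the linear term is smaller than n^2.\<close>

lemma quad_le: fixes e e' C :: nat assumes "!!n. e * n ^ 2 <= e' * n ^ 2 + C * n" shows "e <= e'" proof(rule ccontr)
 assume "~ e <= e'"
 hence "Suc e' <= e" by simp
 hence "Suc e' * Suc C ^ 2 <= e * Suc C ^ 2" by(rule mult_right_mono) simp
 also have "... <= e' * Suc C ^ 2 + C * Suc C" by(rule assms)
 finally show False by(simp add:power2_eq_square)
qed

lemma quad_div_ge: fixes p C c :: real
 assumes "n >= (1 :: nat)" "p * real n ^ 2 <= c + C * real n" shows "p - C / real n <= c / real n ^ 2" proof -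
 have "p - C / real n = (p * real n ^ 2 - C * real n) / real n ^ 2" using assms(1) by(simp add:field_simps power2_eq_square)
 also have "... <= c / real n ^ 2" using assms(2) by(intro divide_right_mono) simp_all
 finally show ?thesis .
qed

lemma quad_div_le: fixes p C c :: real
 assumes "n >= (1 :: nat)" "c <= p * real n ^ 2 + C * real n" shows "c / real n ^ 2 <= p + C / real n" proof -
 have "c / real n ^ 2 <= (p * real n ^ 2 + C * real n) / real n ^ 2" using assms(2) by(intro divide_right_mono) simp_all
 also have "... = p + C / real n" using assms(1) by(simp add:field_simps power2_eq_square)
 finally show ?thesis .
qed

context planar
begin

lemma count_tendsto:"(%n. 2 * real (card {al:D. deg r al < n}) / real n ^ 2) \<longlonglongrightarrow> real (card (planes r D))"
proof -
 let ?p = "card (planes r D)"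
 obtain C where C:"!!n. 2 * card {al:D. deg r al < n} <= ?p * n ^ 2 + C * (n + 1)" using count_upper by blast
 obtain C' where C': "!!n. ?p * n ^ 2 <= 2 * card {al:D. deg r al < n} + C' * n" using count_lower by blast
 have l:"real ?p - real C' / real n <= 2 * real (card {al:D. deg r al < n}) / real n ^ 2" if n:"n >= 1" for n proof -
 have "real (?p * n ^ 2) <= real (2 * card {al:D. deg r al < n} + C' * n)" using C'[of n] by(simp only:of_nat_le_iff)
 thus ?thesis by(intro quad_div_ge[OF n]) simp
 qed
 have u:"2 * real (card {al:D. deg r al < n}) / real n ^ 2 <= real ?p + real (2 * C) / real n" if n:"n >= 1" for n
 proof -
 have "C * (n + 1) <= 2 * C * n" using n by simp
 hence "2 * card {al:D. deg r al < n} <= ?p * n ^ 2 + 2 * C * n" using C[of n] by linarith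
 hence "real (2 * card {al:D. deg r al < n}) <= real (?p * n ^ 2 + 2 * C * n)" by(simp only:of_nat_le_iff)
 thus ?thesis by(intro quad_div_le[OF n]) simp
 qed
 have t1:"(%n. real ?p - real C' / real n) \<longlonglongrightarrow> real ?p - 0" by(intro tendsto_diff tendsto_const lim_const_over_n)
 have t2:"(%n. real ?p + real (2 * C) / real n) \<longlonglongrightarrow> real ?p + 0" by(intro tendsto_add tendsto_const lim_const_over_n)
 have e1:"eventually (%n. real ?p - real C' / real n <= 2 * real (card {al:D. deg r al < n}) / real n ^ 2) sequentially"
 using eventually_ge_at_top[of 1] by eventually_elim (rule l)
 have e2:"eventually (%n. 2 * real (card {al:D. deg r al < n}) / real n ^ 2 <= real ?p + real (2 * C) / real n) sequentially"
 using eventually_ge_at_top[of 1] by eventually_elim (rule u)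
 show ?thesis using tendsto_sandwich[OF e1 e2, of "real ?p"] t1 t2 by simp
qed

end

text \<open>Summation over level sets, which reduces sums of lengths to the counting of
  exponents.\<close>

lemma sum_layers: assumes "finite A" "!!al. al : A ==> f al <= (L :: nat)"
 shows "(SUM al:A. f al) = (SUM j=1..L. card {al:A. j <= f al})" proof -
 have "f al = (SUM j=1..L. if j <= f al then 1 else 0)" if "al : A" for al proof -
 have "(SUM j=1..L. if j <= f al then 1 else 0) = card ({1..L} Int {j. j <= f al})" by(simp add:sum.If_cases)
 also have "{1..L} Int {j. j <= f al} = {1..f al}" using assms(2)[OF that] by auto
 finally show ?thesis by simp
 qed
 hence "(SUM al:A. f al) = (SUM al:A. SUM j=1..L. if j <= f al then 1 else 0)" by(rule sum.cong[OF refl])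
 also have "... = (SUM j=1..L. SUM al:A. if j <= f al then 1 else 0)" by(rule sum.swap)
 also have "... = (SUM j=1..L. card {al:A. j <= f al})" using assms(1) by(simp add:sum.If_cases Int_def)
 finally show ?thesis .
qed

context local_type
begin

definition mult_ge :: "'a set => nat => bool" where
 "mult_ge Z e <-> (EX C. ALL n. enat (e * n ^ 2) <= 2 * len U U (mpow n + Z) + enat (C * n))"

lemma mult_ge_le:"mult_ge Z e ==> mult_le Z m e' ==> e <= e'" proof -
 assume "mult_ge Z e" "mult_le Z m e'"
 then obtain C C' where C:"!!n. enat (e * n ^ 2) <= 2 * len U U (mpow n + Z) + enat (C * n)"
 "!!n. 2 * len U U (mpow n + Z) <= enat (e' * n ^ 2 + C' * n)" by(auto simp:mult_ge_def mult_le_def)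
 have "e * n ^ 2 <= e' * n ^ 2 + (C' + C) * n" for n proof -
 have "enat (e * n ^ 2) <= enat (e' * n ^ 2 + C' * n) + enat (C * n)" using C(1)[of n] add_right_mono[OF C(2)[of n]] by(rule order_trans)
 thus ?thesis by(simp add:distrib_right)
 qed
 thus ?thesis by(rule quad_le)
qed

lemma len_le_if_sup:"smod U Z ==> len U U (J + Z) <= len U U J" by(intro len_mono plus_ge1)

end

lemma (in local_type) enat_len:"mpow M <= J ==> EX l. len U U J = enat l"
 using len_finite[of M J] by(cases "len U U J") auto

context local_type2
begin

lemma growth:"EX a. ALL Z n. smod U Z --> len U U (mpow n + Z) <= enat (a * n ^ 2)" proof -
 obtain a where a:"!!n. len U U (mpow n) <= enat (a * n ^ 2)" using quadratic_growth[OF dim] by blast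
 show ?thesis by(intro exI[of _ a] allI impI) (rule order_trans[OF len_le_if_sup a])
qed

lemma quot_length_ipow: assumes I:"smod U I" "mpow M <= I"
 shows "enat (quot_length (ideal_pow I n)) = len U U (ipow U I U n)" unfolding ideal_pow_eq_ipow
proof(rule quot_length_eq_len)
 show "is_ideal (ipow U I U n)" by(simp add:ideal_iff sm_ipow)
 show "len U U (ipow U I U n) < \<infinity>" by(rule len_finite[OF mpow_ipow_subset[OF I(2)]])
qed

text \<open>\<open>hs_mult\<close> is a \<open>lim\<close> and says something only if the sequence
  converges. The length of R / I^n is the sum of f over the exponents of degree < n, where f is
  antitone and bounded by l(R / I). Each level set of f is \<open>planar\<close>, so the limit
  exists as a number of planes.\<close>

lemma hs_mult_tendsto: assumes I:"smod U I" "mpow M <= I"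
 shows "(%n. 2 * real (quot_length (ideal_pow I n)) / real n ^ 2) \<longlonglongrightarrow> hs_mult 2 I" proof -
 obtain x :: "nat => 'a" and r where x:"I = span U (x ` {..<r})" using gens_ex[OF I(1)] by blast
 interpret G: gens x r I by unfold_locales (rule x)
 obtain L where L:"len U U I = enat L" using enat_len[OF I(2)] by blast
 obtain a where a:"!!n. len U U (mpow n) <= enat (a * n ^ 2)" using quadratic_growth[OF dim] by blast
 define f where "f al = the_enat (len U U (G.coeffs {0} al))" for al
 have sz:"smod U {0 :: 'a}" by simp
 have le:"len U U (G.coeffs {0} al) <= enat L" if "al : exps r" for al
 using len_mono[OF G.I_subset_coeffs[OF sz that]] L by metis
 have f:"len U U (G.coeffs {0} al) = enat (f al)" if "al : exps r" for al
 using le[OF that] unfolding f_def by(cases "len U U (G.coeffs {0} al)") auto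
 have fL:"f al <= L" if "al : exps r" for al using le[OF that] f[OF that] by simp
 let ?D = "%j. {al : exps r. j <= f al}"
 have len_eq:"quot_length (ideal_pow I n) = (SUM j=1..L. card {al:?D j. deg r al < n})" for n proof -
 let ?A = "{al : exps r. deg r al < n}"
 have "enat (quot_length (ideal_pow I n)) = len U U (G.pw n + {0})"
 using quot_length_ipow[OF I] by(simp add:add.commute[of _ "{0}"])
 also have "... = (SUM al:?A. len U U (G.coeffs {0} al))" by(rule G.len_eq_sum_coeffs[OF sz])
 also have "... = (SUM al:?A. of_nat (f al))" by(rule sum.cong) (auto simp:f of_nat_eq_enat)
 also have "... = of_nat (SUM al:?A. f al)" by(simp only:of_nat_sum)
 also have "... = enat (SUM al:?A. f al)" by(rule of_nat_eq_enat)
 finally have "quot_length (ideal_pow I n) = (SUM al:?A. f al)" by simp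
 also have "... = (SUM j=1..L. card {al:?A. j <= f al})" by(rule sum_layers[OF finite_deg_less]) (use fL in auto)
 also have "... = (SUM j=1..L. card {al:?D j. deg r al < n})" by(intro sum.cong arg_cong[of _ _ card]) auto
 finally show ?thesis .
 qed
 have pl:"planar r (?D j) (a * M ^ 2)" if j:"j : {1..L}" for j proof
 show "?D j <= exps r" by auto
 show "down_closed (?D j)" unfolding down_closed_def proof(intro ballI allI impI)
 fix al be assume al:"al : ?D j" "be <= al"
 hence be:"be : exps r" using exps_le by blast
 have "len U U (G.coeffs {0} al) <= len U U (G.coeffs {0} be)"
 by(rule len_mono[OF G.coeffs_mono[OF sz al(2)]]) (use al in auto)
 hence "f al <= f be" using f al be by simp
 thus "be : ?D j" using al be by simp
 qed
 fix n
 have "card {al:?D j. deg r al < n} <= quot_length (ideal_pow I n)"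
 unfolding len_eq by(rule member_le_sum[OF j]) auto
 moreover have "enat (quot_length (ideal_pow I n)) <= enat (a * (n * M) ^ 2)"
 unfolding quot_length_ipow[OF I] using len_mono[OF mpow_ipow_subset[OF I(2)]] a order_trans by blast
 ultimately show "card {al:?D j. deg r al < n} <= a * M ^ 2 * n ^ 2" by(simp add:power_mult_distrib mult_ac)
 qed
 have "(%n. SUM j=1..L. 2 * real (card {al:?D j. deg r al < n}) / real n ^ 2) \<longlonglongrightarrow> (SUM j=1..L. real (card (planes r (?D j))))"
 by(rule tendsto_sum) (rule planar.count_tendsto[OF pl])
 hence "(%n. 2 * real (quot_length (ideal_pow I n)) / real n ^ 2) \<longlonglongrightarrow> (SUM j=1..L. real (card (planes r (?D j))))"
 unfolding len_eq of_nat_sum sum_distrib_left sum_divide_distrib .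
 moreover from this have "hs_mult 2 I = (SUM j=1..L. real (card (planes r (?D j))))"
 unfolding hs_mult_def by(intro limI) (simp add:fact_2)
 ultimately show ?thesis by simp
qed

lemma hs_mult_le: assumes I:"smod U I" "mpow M <= I" and X:"mult_le {0} I X" shows "hs_mult 2 I <= real X" proof -
 obtain C where C:"!!n. 2 * len U U (ipow U I U n + {0}) <= enat (X * n ^ 2 + C * n)" using X by(auto simp:mult_le_def)
 have u:"2 * real (quot_length (ideal_pow I n)) / real n ^ 2 <= real X + real C / real n" if n:"n >= 1" for n proof -
 have "2 * len U U (ipow U I U n) <= enat (X * n ^ 2 + C * n)" using C[of n] by(simp add:add.commute[of _ "{0}"])
 hence "2 * quot_length (ideal_pow I n) <= X * n ^ 2 + C * n"
 unfolding quot_length_ipow[OF I, symmetric] by(simp add:numeral_eq_enat)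
 hence "real (2 * quot_length (ideal_pow I n)) <= real (X * n ^ 2 + C * n)" by(simp only:of_nat_le_iff)
 thus ?thesis by(intro quad_div_le[OF n]) simp
 qed
 have "(%n. real X + real C / real n) \<longlonglongrightarrow> real X + 0" by(intro tendsto_add tendsto_const lim_const_over_n)
 thus ?thesis using hs_mult_tendsto[OF I] u by(intro LIMSEQ_le[of _ "hs_mult 2 I" _ "real X"]) auto
qed

lemma hs_mult_ge_m: assumes e:"mult_ge {0} e" shows "real e <= hs_mult 2 m" proof -
 obtain C where C:"!!n. enat (e * n ^ 2) <= 2 * len U U (mpow n + {0}) + enat (C * n)" using e by(auto simp:mult_ge_def)
 have I:"smod U m" "mpow (Suc 0) <= m" by(rule sm_m, rule eq_refl[OF mpow_1])
 have u:"real e - real C / real n <= 2 * real (quot_length (ideal_pow m n)) / real n ^ 2" if n:"n >= 1" for n proof -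
 have "enat (e * n ^ 2) <= 2 * len U U (mpow n) + enat (C * n)" using C[of n] by(simp add:add.commute[of _ "{0}"])
 hence "e * n ^ 2 <= 2 * quot_length (ideal_pow m n) + C * n"
 unfolding quot_length_ipow[OF I, symmetric] by(simp add:numeral_eq_enat)
 hence "real (e * n ^ 2) <= real (2 * quot_length (ideal_pow m n) + C * n)" by(simp only:of_nat_le_iff)
 thus ?thesis by(intro quad_div_ge[OF n]) simp
 qed
 have "(%n. real e - real C / real n) \<longlonglongrightarrow> real e - 0" by(intro tendsto_diff tendsto_const lim_const_over_n)
 thus ?thesis using hs_mult_tendsto[OF I] u by(intro LIMSEQ_le[of _ "real e" _ "hs_mult 2 m"]) auto
qed

lemma lech_ex: assumes Z:"smod U Z" shows "EX e. mult_le Z m e & mult_ge Z e &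
 (ALL I M. smod U I --> mpow M <= I --> (EX X l. mult_le Z I X & len U U (I + Z) = enat l & X <= 2 * e * l))" proof -
 obtain a where a:"!!n. len U U (mpow n + Z) <= enat (a * n ^ 2)" using growth Z by blast
 obtain x :: "nat => 'a" and r where x:"m = span U (x ` {..<r})" using gens_ex[OF sm_m] by blast
 interpret G: local_gens m x r by unfold_locales (rule x)
 show ?thesis using G.mult_le_m[OF Z a] G.mult_ge_m[OF Z a] G.lech[OF Z a] unfolding mult_ge_def
 by(intro exI[of _ "card (planes r (G.sd Z))"]) blast
qed

section \<open>Reduction to a single prime, and elimination of the error term\<close>

text \<open>If the planes are not all parallel, at most e - 1 share a direction and
  \<open>lech_not_parallel\<close> gives the gain. If they are, two generic generators have
  multiplicity at most e modulo P, which is the input of \<open>dom\<close>.\<close>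

lemma one_prime: assumes P:"prime_in U P" "P ~= m" and e:"mult_le P m e" "mult_ge P e" "e >= 2"
 and dom:"!!x y N. x : m ==> y : m ==> mpow N <= (P + x *o U) + y *o U ==> mult_le P ((P + x *o U) + y *o U) e ==>
 EX C. ALL I M. smod U I --> mpow M <= I --> (EX X l. mult_le P I X & len U U (I + P) = enat l & X <= 2 * (e - 1) * (l + C * M))"
 shows "EX C. ALL I M. smod U I --> mpow M <= I --> (EX X l. mult_le P I X & len U U (I + P) = enat l & X <= 2 * (e - 1) * (l + C * M))"
proof -
 have sP:"smod U P" using P by(simp add:prime_in_def)
 obtain a where a:"!!n. len U U (mpow n + P) <= enat (a * n ^ 2)" using growth sP by blast
 obtain x :: "nat => 'a" and r where x:"m = span U (x ` {..<r})" "!!i. i < r ==> x i : m"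
 "!!i j. i < r ==> j < r ==> i < j ==> EX n. mpow n <= (P + x i *o U) + x j *o U" using generic_gens[OF P] by blast
 interpret G: local_gens m x r by unfold_locales (rule x)
 let ?pl = "planes r (G.sd P)"
 have fin:"finite ?pl" by(rule G.finite_planes_sd[OF sP a])
 have ce:"card ?pl = e" proof(rule antisym)
 have "mult_ge P (card ?pl)" unfolding mult_ge_def by(rule G.mult_ge_m[OF sP a])
 thus "card ?pl <= e" using mult_ge_le e by blast
 show "e <= card ?pl" by(rule mult_ge_le[OF e(2) G.mult_le_m[OF sP a]])
 qed
 show ?thesis proof(cases "EX i0 j0. ALL i j ga. (i, j, ga) : ?pl --> i = i0 & j = j0")
 case True
 then obtain i0 j0 where par:"!!i j ga. (i, j, ga) : ?pl ==> i = i0 & j = j0" by blast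
 have "?pl ~= {}" using ce e(3) by auto
 then obtain ga where "(i0, j0, ga) : ?pl" using par by auto
 hence ij:"i0 < r" "j0 < r" "i0 < j0" by(auto simp:planes_def)
 then obtain N where N:"mpow N <= (P + x i0 *o U) + x j0 *o U" using x(3) by blast
 let ?I = "(P + x i0 *o U) + x j0 *o U"
 have s:"smod U (P + x i0 *o U)" "smod U ?I" by(intro sm_plus sm_scaled sP sm_U)+
 have in1:"x l : x l *o U" for l using scaledI[of 1 U "x l"] by simp
 have "P + x i0 *o U <= ?I" by(rule plus_ge1[OF sm_scaled[OF sm_U]])
 hence "x i0 : ?I" using in1[of i0] plus_ge2[OF sP, of "x i0 *o U"] by blast
 moreover have "x j0 : ?I" using in1[of j0] plus_ge2[OF s(1), of "x j0 *o U"] by blast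
 ultimately have "mult_le P ?I e" using G.lech_parallel[OF sP a s(2) N par] ce by simp
 thus ?thesis by(rule dom[OF x(2)[OF ij(1)] x(2)[OF ij(2)] N])
 next
 case False
 have t:"card {ga. (i, j, ga) : ?pl} <= e - 1" for i j proof -
 obtain i' j' ga' where ne:"(i', j', ga') : ?pl" "(i', j') ~= (i, j)" using False by blast
 have "(%ga. (i, j, ga)) ` {ga. (i, j, ga) : ?pl} < ?pl" proof(rule psubsetI)
 have "(i', j', ga') ~: (%ga. (i, j, ga)) ` {ga. (i, j, ga) : ?pl}" using ne(2) by blast
 thus "(%ga. (i, j, ga)) ` {ga. (i, j, ga) : ?pl} ~= ?pl" using ne(1) by metis
 qed auto
 hence "card ((%ga. (i, j, ga)) ` {ga. (i, j, ga) : ?pl}) < card ?pl" by(rule psubset_card_mono[OF fin])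
 thus ?thesis using ce by(simp add:card_image inj_on_def)
 qed
 show ?thesis using G.lech_not_parallel[OF sP a _ _ t] by blast
 qed
qed

definition lech_below :: "'a set => nat => bool" where
 "lech_below P t <-> (EX C. ALL I M. smod U I --> mpow M <= I -->
 (EX X l. mult_le P I X & len U U (I + P) = enat l & X <= 2 * t * (l + C * M)))"

text \<open>A prime without \<open>lin\<close> is minimal, because primes strictly above another one
  have linear growth. By (R0) its localization is a field, and there p becomes 0.\<close>

lemma generic_killed: assumes R0:"serre_R0 TYPE('a)" and P:"prime_in U P" "~ lin P" and p:"p : P"
 shows "EX u. u ~: P & u * p : {0}" proof -
 have pI:"0 : P" "1 ~: P" "!!a b. a * b : P ==> a : P | b : P" using P(1) by(auto simp:prime_in_def)
 have "minimal_prime P" unfolding minimal_prime_def prime_ideal_iff proof(intro conjI allI impI)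
 fix Q assume "prime_in U Q & Q <= P"
 thus "Q = P" using lin_prime[of Q P] P by auto
 qed (rule P(1))
 hence f:"localization_is_field P" using R0 by(auto simp:serre_R0_def)
 show ?thesis proof(cases "loc_eq P (p, 1) (0, 1)")
 case False
 then obtain b t where b:"t ~: P" "loc_eq P (p * b, 1 * t) (1, 1)" using f pI(2) unfolding localization_is_field_def by blast
 then obtain u where u:"u ~: P" "u * (p * b - t) = 0" by(auto simp:loc_eq_def)
 hence 1:"p * b - t : P" using pI(3)[of u "p * b - t"] pI(1) by auto
 have sP:"smod U P" using P(1) by(simp add:prime_in_def)
 have "b * p - (p * b - t) : P" by(rule sm_diff[OF sr_U sP sm_mult[OF sP UNIV_I p] 1])
 thus ?thesis using b(1) by(simp add:mult.commute)
 qed (auto simp:loc_eq_def)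
qed

text \<open>The multiplicities E P add up to e: one inequality comes from the filtration, the other
  from superadditivity of lengths. With several primes each has at most e - 1 and plain Lech
  suffices; a single prime is treated by \<open>one_prime\<close>.\<close>

theorem mult_le_below: assumes R0:"serre_R0 TYPE('a)" and e:"mult_ge {0} e" "mult_le {0} m e" "e >= 2"
 and dom:"!!P x y N. prime_in U P ==> ~ lin P ==> x : m ==> y : m ==> mult_ge P e ==> mpow N <= (P + x *o U) + y *o U ==>
 mult_le P ((P + x *o U) + y *o U) e ==> lech_below P (e - 1)"
 shows "EX C. ALL I M l. smod U I --> mpow M <= I --> len U U I = enat l --> mult_le {0} I (2 * (e - 1) * (l + C * M))"
proof -
 obtain ps where ps:"pfilt (U :: 'a set) {0} U ps" using pfilt_ex[OF sr_U noeth_ring, of "{0}"] by auto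
 define B where "B = {P : set ps. ~ lin P}"
 have finB:"finite B" by(simp add:B_def)
 have prB:"prime_in U P" if "P : B" for P using pfilt_primes[OF ps sr_U] that by(auto simp:B_def)
 have count:"count_list ps P <= 1" if "P : set ps" "~ lin P" for P
 using count_generic[OF ps prB generic_killed[OF R0 prB]] that by(auto simp:B_def)
 have "ALL P:B. EX eP. mult_le P m eP & mult_ge P eP &
 (ALL I M. smod U I --> mpow M <= I --> (EX X l. mult_le P I X & len U U (I + P) = enat l & X <= 2 * eP * l))"
 using lech_ex prB by(auto simp:prime_in_def)
 then obtain E where E0:"ALL P:B. mult_le P m (E P) & mult_ge P (E P) &
 (ALL I M. smod U I --> mpow M <= I --> (EX X l. mult_le P I X & len U U (I + P) = enat l & X <= 2 * E P * l))"
 by(rule bchoice[THEN exE])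
 have E:"mult_le P m (E P)" "mult_ge P (E P)" if "P : B" for P using E0 that by auto
 have lechE:"EX X l. mult_le P I X & len U U (I + P) = enat l & X <= 2 * E P * l"
 if "P : B" "smod U I" "mpow M <= I" for P I M using E0 that by blast
 have E1:"E P >= 1" if "P : B" for P proof(rule ccontr)
 assume "~ E P >= 1"
 hence "mult_le P m 0" using E(1)[OF that] by(simp add:not_less_eq_eq)
 then obtain C where C:"!!n. 2 * len U U (mpow n + P) <= enat (C * n)" by(auto simp:mult_le_def)
 have "len U U (mpow n + P) <= enat (C * n)" for n
 using C[of n] by(cases "len U U (mpow n + P)") (auto simp:numeral_eq_enat)
 thus False using that by(auto simp:B_def lin_def)
 qed
 have I1:"smod U m" "mpow (Suc 0) <= m" by(rule sm_m, rule eq_refl[OF mpow_1])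
 have incB:"Q = Q'" if "Q : B" "Q' : B" "Q <= Q'" for Q Q'
 using lin_prime[OF prB[OF that(1)] prB[OF that(2)]] that by(auto simp:B_def)
 obtain J where J0:"(ALL Q:B. smod U (J Q) & Q < J Q & J Q <= U) &
 (ALL I. smod U I --> I <= U --> (SUM Q:B. len U U (I + Q)) <= len U U (I + (U Int \<Inter>B)) + (SUM Q:B. len U U (I + J Q)))"
 using sum_len_primes_le[OF sr_U order.refl sr_U finB prB incB] by(rule exE)
 have "ALL Q:B. EX C. ALL n. len U U (mpow n + J Q) <= enat (C * n)" proof
 fix Q assume Q:"Q : B"
 have "lin (J Q)" by(rule lin_above[OF prB[OF Q]]) (use J0 Q in auto)
 thus "EX C. ALL n. len U U (mpow n + J Q) <= enat (C * n)" by(simp add:lin_def)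
 qed
 then obtain D where D:"ALL Q:B. ALL n. len U U (mpow n + J Q) <= enat (D Q * n)" by(rule bchoice[THEN exE])
 have sumB:"(SUM Q:B. len U U (I + Q)) <= len U U I + enat ((SUM Q:B. D Q) * M)" if I:"smod U I" "mpow M <= I" for I M
 proof -
 have sInt:"smod U (U Int \<Inter>B)" using prB by(intro sm_Int sm_U sm_Inter) (auto simp:prime_in_def)
 have "(SUM Q:B. len U U (I + Q)) <= len U U (I + (U Int \<Inter>B)) + (SUM Q:B. len U U (I + J Q))"
 using J0 I by blast
 also have "... <= len U U I + (SUM Q:B. enat (D Q * M))" proof(intro add_mono len_le_if_sup[OF sInt] sum_mono)
 fix Q assume "Q : B"
 have "len U U (I + J Q) <= len U U (mpow M + J Q)" by(intro len_mono plus_mono I order.refl)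
 also have "... <= enat (D Q * M)" using D `Q : B` by blast
 finally show "len U U (I + J Q) <= enat (D Q * M)" .
 qed
 also have "(SUM Q:B. enat (D Q * M)) = enat ((SUM Q:B. D Q) * M)"
 unfolding sum_distrib_right of_nat_eq_enat[symmetric] by simp
 finally show ?thesis .
 qed
 have up:"e <= (SUM P:B. E P)" proof(rule mult_ge_le[OF e(1)])
 show "mult_le {0} m (SUM P:B. E P)" unfolding B_def
 by(rule mult_le_filt[OF ps I1]) (use E count in \<open>auto simp:B_def\<close>)
 qed
 have "ALL Q:B. EX C. ALL n. enat (E Q * n ^ 2) <= 2 * len U U (mpow n + Q) + enat (C * n)"
 using E(2) by(auto simp:mult_ge_def)
 then obtain G where G:"ALL Q:B. ALL n. enat (E Q * n ^ 2) <= 2 * len U U (mpow n + Q) + enat (G Q * n)" by(rule bchoice[THEN exE])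
 have down:"(SUM P:B. E P) <= e" proof -
 obtain C where C:"!!n. 2 * len U U (mpow n + {0}) <= enat (e * n ^ 2 + C * n)" using e(2) by(auto simp:mult_le_def)
 have "(SUM P:B. E P) * n ^ 2 <= e * n ^ 2 + (C + 2 * (SUM Q:B. D Q) + (SUM Q:B. G Q)) * n" for n proof -
 have "enat ((SUM P:B. E P) * n ^ 2) = (SUM P:B. enat (E P * n ^ 2))"
 unfolding sum_distrib_right of_nat_eq_enat[symmetric] by simp
 also have "... <= (SUM P:B. 2 * len U U (mpow n + P) + enat (G P * n))" by(rule sum_mono) (use G in blast)
 also have "... = 2 * (SUM P:B. len U U (mpow n + P)) + enat ((SUM P:B. G P) * n)"
 unfolding sum.distrib sum_distrib_left sum_distrib_right of_nat_eq_enat[symmetric] by simp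
 also have "... <= 2 * (len U U (mpow n) + enat ((SUM Q:B. D Q) * n)) + enat ((SUM P:B. G P) * n)"
 by(intro add_right_mono mult_left_mono sumB) simp_all
 also have "... = 2 * len U U (mpow n) + enat (2 * (SUM Q:B. D Q) * n + (SUM P:B. G P) * n)"
 by(simp add:distrib_left numeral_eq_enat add.assoc)
 also have "... <= enat (e * n ^ 2 + C * n) + enat (2 * (SUM Q:B. D Q) * n + (SUM P:B. G P) * n)"
 using C[of n] by(intro add_right_mono) (simp add:add.commute[of _ "{0}"])
 finally show ?thesis by(simp add:distrib_right)
 qed
 thus ?thesis by(rule quad_le)
 qed
 have "EX C. ALL P:B. ALL I M. smod U I --> mpow M <= I -->
 (EX X l. mult_le P I X & len U U (I + P) = enat l & X <= 2 * (e - 1) * (l + C * M))" proof(cases "EX P. B = {P}")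
 case True
 then obtain P where P:"B = {P}" by blast
 hence eP:"E P = e" using up down by simp
 have PB:"P : B" using P by simp
 have nl:"~ lin P" using PB by(simp add:B_def)
 have g:"mult_ge P e" "mult_le P m e" using E[OF PB] eP by auto
 have "lech_below P (e - 1)" unfolding lech_below_def
 by(rule one_prime[OF prB[OF PB] _ g(2) g(1) e(3) dom[OF prB[OF PB] nl _ _ g(1), unfolded lech_below_def]])
 (use nl lin_m in auto)
 thus ?thesis unfolding lech_below_def P by blast
 next
 case False
 have Ele:"E P <= e - 1" if P:"P : B" for P proof -
 obtain P' where P': "P' : B" "P' ~= P" using False P by blast
 have "E P + E P' = (SUM Q:{P, P'}. E Q)" using P' by simp
 also have "... <= (SUM Q:B. E Q)" by(rule sum_mono2[OF finB]) (use P P' in auto)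
 finally show ?thesis using down E1[OF P'(1)] by linarith
 qed
 show ?thesis proof(rule exI[of _ 0], intro ballI allI impI)
 fix P I M assume P:"P : B" and I:"smod U I" "mpow M <= I"
 obtain X l where X:"mult_le P I X" "len U U (I + P) = enat l" "X <= 2 * E P * l" using lechE[OF P I] by blast
 have "2 * E P * l <= 2 * (e - 1) * (l + 0 * M)" using Ele[OF P] by simp
 thus "EX X l. mult_le P I X & len U U (I + P) = enat l & X <= 2 * (e - 1) * (l + 0 * M)"
 using X order_trans by blast
 qed
 qed
 then obtain C where C:"!!P I M. P : B ==> smod U I ==> mpow M <= I ==>
 EX X l. mult_le P I X & len U U (I + P) = enat l & X <= 2 * (e - 1) * (l + C * M)" by blast
 show ?thesis proof(intro exI[of _ "(SUM Q:B. D Q) + card B * C"] allI impI)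
 fix I M l assume I:"smod U I" "mpow M <= I" and l:"len U U I = enat l"
 have "ALL P:B. EX X. EX l. mult_le P I X & len U U (I + P) = enat l & X <= 2 * (e - 1) * (l + C * M)" using C I by blast
 then obtain X where "ALL P:B. EX l. mult_le P I (X P) & len U U (I + P) = enat l & X P <= 2 * (e - 1) * (l + C * M)"
 by(rule bchoice[THEN exE])
 then obtain L where XL:"ALL P:B. mult_le P I (X P) & len U U (I + P) = enat (L P) & X P <= 2 * (e - 1) * (L P + C * M)"
 by(rule bchoice[THEN exE])
 have "mult_le {0} I (SUM P:B. X P)" unfolding B_def
 by(rule mult_le_filt[OF ps I]) (use XL count in \<open>auto simp:B_def\<close>)
 moreover have "(SUM P:B. X P) <= 2 * (e - 1) * (l + ((SUM Q:B. D Q) + card B * C) * M)" proof -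
 have "enat (SUM P:B. L P) = (SUM P:B. enat (L P))" unfolding of_nat_eq_enat[symmetric] by simp
 also have "... = (SUM P:B. len U U (I + P))" by(rule sum.cong) (use XL in auto)
 also have "... <= enat l + enat ((SUM Q:B. D Q) * M)" using sumB[OF I] l by simp
 finally have "(SUM P:B. L P) <= l + (SUM Q:B. D Q) * M" by simp
 hence "(SUM P:B. L P + C * M) <= l + ((SUM Q:B. D Q) + card B * C) * M" by(simp add:sum.distrib distrib_right)
 moreover have "(SUM P:B. X P) <= (SUM P:B. 2 * (e - 1) * (L P + C * M))" by(rule sum_mono) (use XL in auto)
 ultimately show ?thesis using mult_left_mono[of "SUM P:B. L P + C * M" _ "2 * (e - 1)"]
 unfolding sum_distrib_left[symmetric] by(meson order_trans zero_le)
 qed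
 ultimately show "mult_le {0} I (2 * (e - 1) * (l + ((SUM Q:B. D Q) + card B * C) * M))" by(rule mult_le_mono)
 qed
qed

theorem hs_mult_below: assumes R0:"serre_R0 TYPE('a)" and big:"hs_mult 2 m > 1"
 and dom:"!!P x y e N. e >= 2 ==> prime_in U P ==> ~ lin P ==> x : m ==> y : m ==> mult_ge P e ==> mpow N <= (P + x *o U) + y *o U ==>
 mult_le P ((P + x *o U) + y *o U) e ==> lech_below P (e - 1)"
 shows "EX \<epsilon>>0. ALL I. m_primary m I --> hs_mult 2 I <= 2 * (hs_mult 2 m - \<epsilon>) * real (quot_length I)"
proof -
 have Z:"smod U {0 :: 'a}" by simp
 obtain a where a:"!!n. len U U (mpow n + {0}) <= enat (a * n ^ 2)" using growth Z by blast
 obtain x :: "nat => 'a" and r where x:"m = span U (x ` {..<r})" using gens_ex[OF sm_m] by blast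
 interpret G: local_gens m x r by unfold_locales (rule x)
 define e where "e = card (planes r (G.sd {0}))"
 have I1:"smod U m" "mpow (Suc 0) <= m" by(rule sm_m, rule eq_refl[OF mpow_1])
 have ge:"mult_ge {0} e" unfolding mult_ge_def e_def by(rule G.mult_ge_m[OF Z a])
 have le:"mult_le {0} m e" unfolding e_def by(rule G.mult_le_m[OF Z a])
 have hm:"hs_mult 2 m = real e" using hs_mult_le[OF I1 le] hs_mult_ge_m[OF ge] by simp
 hence e2:"e >= 2" using big by simp
 hence ne:"planes r (G.sd {0}) ~= {}" by(auto simp:e_def)
 obtain C where C:"!!I M l. smod U I ==> mpow M <= I ==> len U U I = enat l ==> mult_le {0} I (2 * (e - 1) * (l + C * M))"
 proof -
 have "EX C. ALL I M l. smod U I --> mpow M <= I --> len U U I = enat l --> mult_le {0} I (2 * (e - 1) * (l + C * M))"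
 proof(rule mult_le_below[OF R0 ge le e2])
 fix P x y N
 assume "prime_in U P" "~ lin P" "x : m" "y : m" "mult_ge P e" "mpow N <= (P + x *o U) + y *o U"
 "mult_le P ((P + x *o U) + y *o U) e"
 thus "lech_below P (e - 1)" by(rule dom[OF e2])
 qed
 thus ?thesis using that by blast
 qed
 \<comment> \<open>Substituting K \<le> 2 r e l - r h into the bound by e - 1 puts the factor 1 + D
   in front of h.\<close>
 define D where "D = 2 * real (e - 1) * real C * real r"
 have D:"D >= 0" by(simp add:D_def)
 show ?thesis proof(intro exI[of _ "1 / (1 + D)"] conjI allI impI)
 show "1 / (1 + D) > 0" using D by simp
 fix I assume I:"m_primary m I"
 have sI:"smod U I" using I by(simp add:m_primary_def ideal_iff)
 obtain M where M:"mpow M <= I" using mpow_subset_if_m_primary[OF I] by blast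
 have IZ:"I + {0} = I" by(rule plus_abs2[OF sI Z]) (use sI in auto)
 obtain X l K where X:"mult_le {0} I X" "len U U I = enat l" "mpow K <= I" "r * X + K <= 2 * r * e * l"
 using G.lech_gain[OF Z a sI M ne] unfolding IZ e_def by blast
 have ql:"quot_length I = l" using quot_length_eq_len[of I] sI X(2) by(simp add:ideal_iff)
 have h1:"hs_mult 2 I <= real X" by(rule hs_mult_le[OF sI M X(1)])
 have h2:"hs_mult 2 I <= real (2 * (e - 1) * (l + C * K))" by(rule hs_mult_le[OF sI X(3) C[OF sI X(3) X(2)]])
 define h where "h = hs_mult 2 I"
 have "real (r * X + K) <= real (2 * r * e * l)" using X(4) by(simp only:of_nat_le_iff)
 hence k:"real K <= 2 * real r * real e * real l - real r * h"
 using mult_left_mono[OF h1, of "real r"] unfolding h_def by simp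
 have e1:"real (e - 1) = real e - 1" using e2 by simp
 have "h <= 2 * real (e - 1) * real l + 2 * real (e - 1) * real C * real K" 
 using h2 unfolding h_def of_nat_mult of_nat_add by(simp add:distrib_left mult_ac)
 also have "... <= 2 * real (e - 1) * real l + 2 * real (e - 1) * real C * (2 * real r * real e * real l - real r * h)"
 by(intro add_left_mono mult_left_mono k) simp
 also have "... = 2 * real (e - 1) * real l + D * (2 * real e * real l - h)" by(simp add:D_def algebra_simps)
 finally have "(1 + D) * h <= 2 * real l * (real (e - 1) + D * real e)" by(simp add:algebra_simps)
 also have "... = (1 + D) * (2 * (real e - 1 / (1 + D)) * real l)" unfolding e1 using D by(simp add:field_simps)
 finally have "h <= 2 * (real e - 1 / (1 + D)) * real l" using D by(simp add:mult_le_cancel_left)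
 thus "hs_mult 2 I <= 2 * (hs_mult 2 m - 1 / (1 + D)) * real (quot_length I)" by(simp add:h_def hm ql)
 qed
qed

end

section \<open>A fraction field as a type\<close>

text \<open>Supplies the default for \<open>chosen\<close> when there is no counterexample.\<close>

lemma prime_ex:"EX P :: 'a::comm_ring_1 set. prime_in U P" proof -
 let ?AA = "{I :: 'a set. smod U I & 1 ~: I}"
 have "EX M:?AA. ALL X:?AA. M <= X --> X = M" proof(rule subset_Zorn_nonempty)
 show "?AA ~= {}" using sm_zero[of U] by(metis (mono_tags, lifting) empty_Collect_eq singletonD zero_neq_one)
 fix CC assume C:"CC ~= {}" "subset.chain ?AA CC"
 have "smod U (\<Union>CC)" unfolding smod_def proof(intro conjI ballI)
 obtain I where "I : CC" using C(1) by blast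
 moreover from this have "smod U I" using C(2) by(auto simp:subset.chain_def)
 ultimately show "0 : \<Union>CC" using sm_0 by blast
 fix u v assume "u : \<Union>CC" "v : \<Union>CC"
 then obtain I J where IJ:"I : CC" "J : CC" "u : I" "v : J" by blast
 hence "I <= J | J <= I" using C(2) by(auto simp:subset.chain_def)
 moreover have "smod U I" "smod U J" using IJ C(2) by(auto simp:subset.chain_def)
 ultimately show "u + v : \<Union>CC" using IJ sm_add by blast
 next
 fix a u assume "u : \<Union>CC"
 then obtain I where I:"I : CC" "u : I" by blast
 moreover have "smod U I" using I C(2) by(auto simp:subset.chain_def)
 ultimately show "a * u : \<Union>CC" using sm_mult by blast
 qed
 moreover have "1 ~: \<Union>CC" using C(2) by(auto simp:subset.chain_def)
 ultimately show "\<Union>CC : ?AA" by simp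
 qed
 then obtain M where M0:"M : ?AA" "ALL X:?AA. M <= X --> X = M" by(rule bexE)
 hence M:"smod U M" "1 ~: M" "!!X. smod U X ==> 1 ~: X ==> M <= X ==> X = M" by simp_all
 have inv:"EX b. 1 - a * b : M" if a:"a ~: M" for a proof -
 let ?X = "M + a *o U"
 have s:"smod U ?X" by(intro sm_plus M(1) sm_scaled sm_U)
 have "M <= ?X" by(rule plus_ge1[OF sm_scaled[OF sm_U]])
 moreover have "a : ?X" using plus_ge2[OF M(1), of "a *o U"] scaledI[of 1 U a] by auto
 ultimately have "1 : ?X" using M(3)[OF s] a by blast
 then obtain u v where "1 = u + v" "u : M" "v : a *o U" by(rule set_plus_elim)
 moreover from this obtain w where "v = a * w" by(auto simp:in_scaled)
 ultimately have "1 - a * w = u" "u : M" by(simp_all add:diff_eq_eq)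
 hence "1 - a * w : M" by simp
 thus ?thesis by blast
 qed
 have "prime_in U M" unfolding prime_in_def proof(intro conjI ballI impI)
 fix a b assume ab:"a * b : M"
 show "a : M | b : M" proof(rule ccontr)
 assume "~ (a : M | b : M)"
 then obtain c where c:"1 - a * c : M" "b ~: M" using inv by blast
 have "b * (1 - a * c) + c * (a * b) : M" 
 by(rule sm_add[OF M(1) sm_mult[OF M(1) UNIV_I c(1)] sm_mult[OF M(1) UNIV_I ab]])
 thus False using c by(simp add:algebra_simps)
 qed
 qed (use M in auto)
 thus ?thesis by blast
qed

text \<open>The two situations in which we need a fraction field. As a type cannot depend on a prime,
  the prime is chosen to be a counterexample to the statement in question, if there is one.\<close>

definition escape :: "'b::comm_ring_1 set => 'b set => 'b => bool" where
 "escape A P y <-> (EX c. ALL g:A. g ~: P + y *o A --> y ^ c : P + g *o A) & (ALL s:A. s ~: P --> (EX k. y ^ k : P + s *o A))"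

definition bad_one :: "'b::comm_ring_1 set => 'b set => bool" where "bad_one A P <-> sring A & prime_in A P &
 (EX R m y N. complete_local_ring R m & R <= A & fg R A & y : m & y ~: P & ipow R m A N <= P + y *o A & ~ escape A P y)"

definition bad_two :: "'b::comm_ring_1 set => bool" where "bad_two P <-> prime_in U P &
 (EX m x y N e. complete_local_ring U m & local_type2 m & ~ local_type.lin m P & e >= 2 & x : m & y : m & local_type.mult_ge m P e
 & ipow U m U N <= (P + x *o U) + y *o U
 & mult_le P ((P + x *o U) + y *o U) e & ~ local_type2.lech_below m P (e - 1))"

text \<open>\<open>bad_one\<close> has precedence. The field is first used to show that it never
  occurs (\<open>escape_general\<close>); from then on the choice is governed by
  \<open>bad_two\<close>.\<close>

definition chosen :: "'b::comm_ring_1 set => 'b set => bool" where "chosen A P <-> sring A & prime_in A P &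
 (if EX A P :: 'b set. bad_one A P then bad_one A P else (EX P :: 'b set. bad_two P) --> A = U & bad_two P)"

definition A0 :: "'b::comm_ring_1 set" where "A0 = (SOME A. EX P. chosen A P)"
definition P0 :: "'b::comm_ring_1 set" where "P0 = (SOME P. chosen A0 P)"

lemma chosen:"chosen A0 (P0 :: 'b::comm_ring_1 set)" proof -
 have "EX A. EX P :: 'b set. chosen A P" proof(cases "EX A P :: 'b set. bad_one A P")
 case True
 then obtain A P :: "'b set" where b:"bad_one A P" by blast
 hence "sring A" "prime_in A P" by(simp_all add:bad_one_def)
 hence "chosen A P" unfolding chosen_def using True b by simp
 thus ?thesis by blast
 next
 case False
 show ?thesis proof(cases "EX P :: 'b set. bad_two P")
 case True
 then obtain P :: "'b set" where "bad_two P" by blast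
 hence "chosen U P" unfolding chosen_def using False by(auto simp:bad_two_def)
 thus ?thesis by blast
 next
 case F2: False
 obtain P :: "'b set" where "prime_in U P" using prime_ex by blast
 hence "chosen U P" unfolding chosen_def using False F2 by auto
 thus ?thesis by blast
 qed
 qed
 hence "EX P :: 'b set. chosen A0 P" unfolding A0_def by(rule someI_ex)
 thus ?thesis unfolding P0_def by(rule someI_ex)
qed

lemma sr_A0 [simp]:"sring A0" and prime_P0:"prime_in A0 P0" using chosen by(auto simp:chosen_def)

lemma A0_mult:"a : A0 ==> b : A0 ==> a * b : A0" and A0_add:"a : A0 ==> b : A0 ==> a + b : A0"
 and A0_uminus:"a : A0 ==> - a : A0" and A0_1 [simp]:"1 : A0" and A0_0 [simp]:"0 : A0"
 by(auto intro:sr_mult sr_add sr_uminus)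

lemma sm_P0:"smod A0 P0" and P0_A0:"a : P0 ==> a : A0" and one_P0 [simp]:"1 ~: P0" and zero_P0 [simp]:"0 : P0"
 and P0_mult:"a : A0 ==> b : A0 ==> a ~: P0 ==> b ~: P0 ==> a * b ~: P0"
 using prime_P0 unfolding prime_in_def by(auto dest:sm_0)

lemma P0_combine:"p : P0 ==> q : P0 ==> a : A0 ==> b : A0 ==> a * p + b * q : P0"
 by(intro sm_add[OF sm_P0] sm_mult[OF sm_P0])

text \<open>Equality of fractions modulo P0. The relation is partial: pairs outside A0 or with a
  denominator in P0 are left out, so its classes form the fraction field of A0 / P0.\<close>

definition rfrel :: "'b::comm_ring_1 \<times> 'b => 'b \<times> 'b => bool" where
 "rfrel x y <-> fst x : A0 & snd x : A0 & snd x ~: P0 & fst y : A0 & snd y : A0 & snd y ~: P0 & fst x * snd y - fst y * snd x : P0"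

lemma rfrel_sym:"rfrel x y ==> rfrel y x" proof -
 assume h:"rfrel x y"
 hence "(- 1) * (fst x * snd y - fst y * snd x) : P0" by(intro sm_mult[OF sm_P0]) (auto simp:rfrel_def A0_uminus)
 thus "rfrel y x" using h by(simp add:rfrel_def)
qed

lemma rfrel_trans:  assumes "rfrel x y" "rfrel y z" shows "rfrel x z" proof -
 obtain a b c d e f where xyz:"x = (a, b)" "y = (c, d)" "z = (e, f)" by(metis surj_pair)
 have h:"a : A0" "b : A0" "c : A0" "d : A0" "e : A0" "f : A0" "b ~: P0" "d ~: P0" "f ~: P0"
 "a * d - c * b : P0" "c * f - e * d : P0" using assms by(auto simp:rfrel_def xyz)
 have "f * (a * d - c * b) + b * (c * f - e * d) : P0" using h by(intro P0_combine)
 hence "d * (a * f - e * b) : P0" by(simp add:algebra_simps)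
 moreover have "a * f - e * b : A0" using h by(intro sr_diff[OF sr_A0] A0_mult)
 ultimately have "a * f - e * b : P0" using P0_mult h by blast
 thus ?thesis using h by(simp add:rfrel_def xyz)
qed

quotient_type (overloaded) 'b rf = "'b::comm_ring_1 \<times> 'b" / partial: rfrel proof(rule part_equivpI)
 show "EX x. rfrel x x" by(rule exI[of _ "(0, 1)"]) (simp add:rfrel_def)
 show "symp rfrel" by(rule sympI) (rule rfrel_sym)
 show "transp rfrel" by(rule transpI) (rule rfrel_trans)
qed

instantiation rf :: (comm_ring_1) field
begin

lift_definition zero_rf :: "'a rf" is "(0, 1)" by(simp add:rfrel_def)
lift_definition one_rf :: "'a rf" is "(1, 1)" by(simp add:rfrel_def)

lift_definition plus_rf :: "'a rf => 'a rf => 'a rf" is "%x y. (fst x * snd y + fst y * snd x, snd x * snd y)" proof -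
 fix x x' y y' :: "'a \<times> 'a" assume h:"rfrel x x'" "rfrel y y'"
 hence "(snd y * snd y') * (fst x * snd x' - fst x' * snd x) + (snd x * snd x') * (fst y * snd y' - fst y' * snd y) : P0"
 by(intro P0_combine) (auto simp:rfrel_def intro:A0_mult)
 hence k:"(fst x * snd y + fst y * snd x) * (snd x' * snd y') - (fst x' * snd y' + fst y' * snd x') * (snd x * snd y) : P0"
 by(simp add:algebra_simps)
 show "rfrel (fst x * snd y + fst y * snd x, snd x * snd y) (fst x' * snd y' + fst y' * snd x', snd x' * snd y')"
 proof -
 have "fst x : A0" "snd x : A0" "snd x ~: P0" "fst x' : A0" "snd x' : A0" "snd x' ~: P0"
 "fst y : A0" "snd y : A0" "snd y ~: P0" "fst y' : A0" "snd y' : A0" "snd y' ~: P0"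
 using h by(simp_all add:rfrel_def)
 thus ?thesis using k by(simp add:rfrel_def A0_mult A0_add P0_mult)
 qed
qed

lift_definition uminus_rf :: "'a rf => 'a rf" is "%x. (- fst x, snd x)" proof -
 fix x y :: "'a \<times> 'a" assume h:"rfrel x y"
 hence "(- 1) * (fst x * snd y - fst y * snd x) : P0" by(intro sm_mult[OF sm_P0]) (auto simp:rfrel_def A0_uminus)
 thus "rfrel (- fst x, snd x) (- fst y, snd y)" using h by(simp add:rfrel_def A0_uminus)
qed

lift_definition times_rf :: "'a rf => 'a rf => 'a rf" is "%x y. (fst x * fst y, snd x * snd y)" proof -
 fix x x' y y' :: "'a \<times> 'a" assume h:"rfrel x x'" "rfrel y y'"
 hence "(fst y * snd y') * (fst x * snd x' - fst x' * snd x) + (fst x' * snd x) * (fst y * snd y' - fst y' * snd y) : P0"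
 by(intro P0_combine) (auto simp:rfrel_def intro:A0_mult)
 hence k:"(fst x * fst y) * (snd x' * snd y') - (fst x' * fst y') * (snd x * snd y) : P0" by(simp add:algebra_simps)
 show "rfrel (fst x * fst y, snd x * snd y) (fst x' * fst y', snd x' * snd y')" proof -
 have "fst x : A0" "snd x : A0" "snd x ~: P0" "fst x' : A0" "snd x' : A0" "snd x' ~: P0"
 "fst y : A0" "snd y : A0" "snd y ~: P0" "fst y' : A0" "snd y' : A0" "snd y' ~: P0"
 using h by(simp_all add:rfrel_def)
 thus ?thesis using k by(simp add:rfrel_def A0_mult A0_add P0_mult)
 qed
qed

lift_definition inverse_rf :: "'a rf => 'a rf" is "%x. if fst x : P0 then (0, 1) else (snd x, fst x)" proof -
 fix x y :: "'a \<times> 'a" assume h:"rfrel x y"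
 have iff:"fst v : P0" if "rfrel u v" "fst u : P0" for u v :: "'a \<times> 'a" proof -
 have "snd v * fst u + (- 1) * (fst u * snd v - fst v * snd u) : P0"
 using that by(intro P0_combine) (auto simp:rfrel_def A0_uminus)
 hence "fst v * snd u : P0" by(simp add:algebra_simps)
 thus ?thesis using that P0_mult[of "fst v" "snd u"] by(auto simp:rfrel_def)
 qed
 have "(- 1) * (fst x * snd y - fst y * snd x) : P0"
 using h by(intro sm_mult[OF sm_P0]) (auto simp:rfrel_def A0_uminus)
 hence s:"rfrel y x" and t:"snd x * fst y - snd y * fst x : P0" using h by(auto simp:rfrel_def mult.commute)
 show "rfrel (if fst x : P0 then (0, 1) else (snd x, fst x)) (if fst y : P0 then (0, 1) else (snd y, fst y))"
 using iff[OF h] iff[OF s] h t by(auto simp:rfrel_def)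
qed

definition minus_rf :: "'a rf => 'a rf => 'a rf" where "minus_rf x y = x + - y"
definition divide_rf :: "'a rf => 'a rf => 'a rf" where "divide_rf x y = x * inverse y"

instance proof
 have eq:"rfrel u v" if "fst u * snd v = fst v * snd u" "fst u : A0" "snd u : A0" "snd u ~: P0" "fst v : A0" "snd v : A0" "snd v ~: P0"
 for u v :: "'a \<times> 'a" using that by(simp add:rfrel_def)
 have d:"fst u : A0" "snd u : A0" "snd u ~: P0" if "rfrel u u" for u :: "'a \<times> 'a" using that by(auto simp:rfrel_def)
 note rls = eq d A0_mult A0_add A0_uminus P0_mult
 fix a b c :: "'a rf"
 show "a + b + c = a + (b + c)" by(transfer, rule eq, simp_all only:fst_conv snd_conv, simp add:algebra_simps, (intro A0_mult A0_add A0_uminus P0_mult A0_1 A0_0 one_P0 d, (assumption)+)+)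
 show "a + b = b + a" by(transfer, rule eq, simp_all only:fst_conv snd_conv, simp add:algebra_simps, (intro A0_mult A0_add A0_uminus P0_mult A0_1 A0_0 one_P0 d, (assumption)+)+)
 show "0 + a = a" by(transfer, rule eq, simp_all only:fst_conv snd_conv, simp add:algebra_simps, (intro A0_mult A0_add A0_uminus P0_mult A0_1 A0_0 one_P0 d, (assumption)+)+)
 show "- a + a = 0" by(transfer, rule eq, simp_all add:algebra_simps d A0_mult A0_uminus P0_mult)
 show "a - b = a + - b" by(rule minus_rf_def)
 show "a * b * c = a * (b * c)" by(transfer, rule eq, simp_all only:fst_conv snd_conv, simp add:algebra_simps, (intro A0_mult A0_add A0_uminus P0_mult A0_1 A0_0 one_P0 d, (assumption)+)+)
 show "a * b = b * a" by(transfer, rule eq, simp_all only:fst_conv snd_conv, simp add:algebra_simps, (intro A0_mult A0_add A0_uminus P0_mult A0_1 A0_0 one_P0 d, (assumption)+)+)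
 show "1 * a = a" by(transfer, rule eq, simp_all only:fst_conv snd_conv, simp add:algebra_simps, (intro A0_mult A0_add A0_uminus P0_mult A0_1 A0_0 one_P0 d, (assumption)+)+)
 show "(a + b) * c = a * c + b * c" by(transfer, rule eq, simp_all only:fst_conv snd_conv, simp add:algebra_simps, (intro A0_mult A0_add A0_uminus P0_mult A0_1 A0_0 one_P0 d, (assumption)+)+)
 have m1:"(- 1 :: 'a) ~: P0" using sm_mult[OF sm_P0, of "- 1" "- 1 :: 'a"] by(auto simp:A0_uminus)
 show "(0 :: 'a rf) ~= 1" using m1 by transfer (simp add:rfrel_def)
 have inv:"rfrel (fst (if fst u : P0 then (0, 1) else (snd u, fst u)) * fst u, snd (if fst u : P0 then (0, 1) else (snd u, fst u)) * snd u) (1, 1)"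
 if u:"rfrel u u" "~ rfrel u (0, 1)" for u :: "'a \<times> 'a" proof -
 have n:"fst u ~: P0" using u by(auto simp:rfrel_def)
 thus ?thesis using d[OF u(1)] P0_mult[of "fst u" "snd u"] by(simp add:rfrel_def A0_mult mult.commute)
 qed
 show "a ~= 0 ==> inverse a * a = 1" by transfer (rule inv)
 show "a div b = a * inverse b" by(rule divide_rf_def)
 show "inverse (0 :: 'a rf) = 0" by transfer (simp add:rfrel_def)
qed

end

text \<open>Elements outside A0 get the default value 0; only on A0 is this a ring homomorphism,
  with kernel P0.\<close>

lift_definition frc :: "'b::comm_ring_1 => 'b rf" is "%a. if a : A0 then (a, 1) else (0, 1)" by(simp add:rfrel_def)

lemma frc_add:"a : A0 ==> b : A0 ==> frc (a + b) = frc a + frc b" by transfer (simp add:rfrel_def A0_add)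

lemma frc_mult:"a : A0 ==> b : A0 ==> frc (a * b) = frc a * frc b" by transfer (simp add:rfrel_def A0_mult)

lemma frc_1 [simp]:"frc 1 = 1" by transfer (simp add:rfrel_def)

lemma frc_eq_0_iff:"a : A0 ==> frc a = 0 <-> a : P0" by transfer (simp add:rfrel_def)

lemma frc_0 [simp]:"frc 0 = 0" by(simp add:frc_eq_0_iff)

lemma frc_uminus:"a : A0 ==> frc (- a) = - frc a" by transfer (simp add:rfrel_def A0_uminus)

lemma frc_diff:"a : A0 ==> b : A0 ==> frc (a - b) = frc a - frc b"
 using frc_add[of a "- b"] by(simp add:A0_uminus frc_uminus)

lemma frc_power:"a : A0 ==> frc (a ^ n) = frc a ^ n" by(induction n) (simp_all add:frc_mult sr_power)

lemma frc_eq_iff:"a : A0 ==> b : A0 ==> frc a = frc b <-> a - b : P0"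
 using frc_eq_0_iff[of "a - b"] by(simp add:frc_diff sr_diff)

lemma sr_frac:"sring B ==> B <= A0 ==> sring (frc ` B)" proof -
 assume B:"sring B" "B <= A0"
 have "frc a - frc b = frc (a - b)" "frc a * frc b = frc (a * b)" if "a : B" "b : B" for a b
 using B that by(simp_all add:frc_diff frc_mult subsetD)
 thus ?thesis using B sr_diff[OF B(1)] sr_mult[OF B(1)] unfolding sring_def by(auto intro!: image_eqI[of 1 frc 1])
qed

lemma sm_frac:"smod B M ==> B <= A0 ==> M <= A0 ==> smod (frc ` B) (frc ` M)" proof -
 assume M:"smod B M" "B <= A0" "M <= A0"
 have "frc a + frc b = frc (a + b)" if "a : M" "b : M" for a b using M that by(simp add:frc_add subsetD)
 moreover have "frc a * frc b = frc (a * b)" if "a : B" "b : M" for a b using M that by(simp add:frc_mult subsetD)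
 ultimately show ?thesis using sm_add[OF M(1)] sm_mult[OF M(1)] sm_0[OF M(1)] unfolding smod_def
 by(auto intro!: image_eqI[of 0 frc 0])
qed

lemma sm_frac_vimage:"smod (frc ` B) M' ==> smod B M ==> B <= A0 ==> M <= A0 ==> smod B {a:M. frc a : M'}" proof -
 assume M:"smod (frc ` B) M'" "smod B M" "B <= A0" "M <= A0"
 have "frc (a + b) = frc a + frc b" if "a : M" "b : M" for a b using M that by(simp add:frc_add subsetD)
 moreover have "frc (a * b) = frc a * frc b" if "a : B" "b : M" for a b using M that by(simp add:frc_mult subsetD)
 ultimately show ?thesis
 using sm_add[OF M(2)] sm_mult[OF M(2)] sm_0[OF M(2)] sm_add[OF M(1)] sm_mult[OF M(1)] sm_0[OF M(1)]
 unfolding smod_def[of B "{a:M. frc a : M'}"] by auto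
qed

lemma span_subset_A0:"B <= A0 ==> G <= A0 ==> span B G <= A0" by(rule span_least[OF sm_sub[OF sm_self[OF sr_A0]]])

lemma frac_span:  assumes "B <= A0" "G <= A0" shows "frc ` span B G = span (frc ` B) (frc ` G)" proof
 have s:"smod B (span B G)" by(rule sm_span)
 have sA:"span B G <= A0" by(rule span_subset_A0[OF assms])
 have "smod B {a:span B G. frc a : span (frc ` B) (frc ` G)}" by(rule sm_frac_vimage[OF sm_span s assms(1) sA])
 moreover have "G <= {a:span B G. frc a : span (frc ` B) (frc ` G)}"
 using span_inc[of G B] span_inc[of "frc ` G" "frc ` B"] by blast
 ultimately have "span B G <= {a:span B G. frc a : span (frc ` B) (frc ` G)}" by(rule span_least)
 thus "frc ` span B G <= span (frc ` B) (frc ` G)" by blast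
 show "span (frc ` B) (frc ` G) <= frc ` span B G"
 by(rule span_least[OF sm_frac[OF s assms(1) sA]]) (rule image_mono[OF span_inc])
qed

lemma fg_frac:"fg B M ==> B <= A0 ==> M <= A0 ==> fg (frc ` B) (frc ` M)" proof -
 assume h:"fg B M" "B <= A0" "M <= A0"
 then obtain G where G:"finite G" "M = span B G" by(auto simp:fg_def)
 hence "G <= A0" using h(3) span_inc[of G B] by blast
 hence "frc ` M = span (frc ` B) (frc ` G)" using G h by(simp add:frac_span)
 thus ?thesis unfolding fg_def using G(1) by blast
qed

lemma mul_subset_A0:"B <= A0 ==> I <= A0 ==> M <= A0 ==> mul B I M <= A0"
 unfolding mul_def by(rule span_subset_A0) (auto intro:A0_mult)

lemma ipow_subset_A0:"B <= A0 ==> I <= A0 ==> M <= A0 ==> ipow B I M n <= A0"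
 by(induction n) (simp_all add:mul_subset_A0)

lemma frac_mprod: assumes "B <= A0" "I <= A0" "M <= A0" shows "frc ` mul B I M = mul (frc ` B) (frc ` I) (frc ` M)"
proof -
 let ?G = "{i * u | i u. i : I & u : M}"
 have G:"?G <= A0" using assms by(auto intro:A0_mult)
 have "frc ` ?G = {i * u | i u. i : frc ` I & u : frc ` M}" proof(intro equalityI subsetI)
 fix v assume "v : frc ` ?G"
 then obtain i u where iu:"i : I" "u : M" "v = frc (i * u)" by auto
 moreover from this have "i : A0" "u : A0" using assms by auto
 ultimately have "v = frc i * frc u" by(simp add:frc_mult)
 thus "v : {i * u | i u. i : frc ` I & u : frc ` M}" using iu by blast
 next
 fix v assume "v : {i * u | i u. i : frc ` I & u : frc ` M}"
 then obtain i u where iu:"i : I" "u : M" "v = frc i * frc u" by auto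
 moreover from this have "i : A0" "u : A0" using assms by auto
 ultimately have "v = frc (i * u)" by(simp add:frc_mult)
 thus "v : frc ` ?G" using iu by blast
 qed
 thus ?thesis unfolding mul_def frac_span[OF assms(1) G] by simp
qed

lemma frac_ipow:"B <= A0 ==> I <= A0 ==> M <= A0 ==> frc ` ipow B I M n = ipow (frc ` B) (frc ` I) (frc ` M) n"
 by(induction n) (simp_all add:frac_mprod ipow_subset_A0)

lemma noeth_frac: assumes n:"noeth B M" and B:"B <= A0" "smod B M" "M <= A0" shows "noeth (frc ` B) (frc ` M)"
 unfolding noeth_def proof(intro allI impI)
 fix f :: "nat => 'a rf set"
 assume f:"(ALL n. smod (frc ` B) (f n) & f n <= frc ` M) & (ALL n. f n <= f (Suc n))"
 let ?g = "%n. {a:M. frc a : f n}"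
 have "EX N. ALL n>=N. ?g n = ?g N" by(rule noethD[OF n]) (use f in \<open>auto intro!: sm_frac_vimage B\<close>)
 then obtain N where N:"ALL n>=N. ?g n = ?g N" by blast
 have fg:"f n = frc ` ?g n" for n using f by blast
 have "f n = f N" if "n >= N" for n proof -
 have "frc ` ?g n = frc ` ?g N" by(rule arg_cong[OF N[rule_format, OF that]])
 thus ?thesis unfolding fg[symmetric] .
 qed
 thus "EX N. ALL n>=N. f n = f N" by blast
qed

lemma local_ring_frac: assumes "local_ring B m" "B <= A0" shows "local_ring (frc ` B) (frc ` m)" proof -
 interpret local_ring B m by fact
 have mA:"m <= A0" using m_le assms(2) by blast
 show ?thesis proof
 show "sring (frc ` B)" by(rule sr_frac[OF sring assms(2)])
 show "noeth (frc ` B) (frc ` B)" by(rule noeth_frac[OF noeth_ring assms(2) sm_self[OF sring] assms(2)])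
 show "smod (frc ` B) (frc ` m)" by(rule sm_frac[OF sm_m assms(2) mA])
 show "frc ` m <= frc ` B" using m_le by blast
 show "1 ~: frc ` m" proof
 assume "1 : frc ` m"
 then obtain u where u:"u : m" "frc u = 1" by force
 have "1 - u ~: m" proof
 assume "1 - u : m"
 hence "(1 - u) + u : m" using u by(intro sm_add[OF sm_m])
 thus False using one_notin_m by simp
 qed
 moreover have "1 - u : B" using u m_le by(intro sr_diff[OF sring]) (auto simp:sring)
 ultimately obtain b where b:"b : B" "(1 - u) * b = 1" using unit by blast
 have uA:"u : A0" "b : A0" "1 - u : A0" using u b mA assms(2) `1 - u : B` by auto
 have "frc (1 - u) = 0" using u(2) uA by(simp add:frc_diff)
 hence "frc ((1 - u) * b) = 0" using uA by(simp add:frc_mult)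
 thus False using b(2) by simp
 qed
 fix a assume "a : frc ` B" "a ~: frc ` m"
 then obtain c where c:"c : B" "a = frc c" "c ~: m" by blast
 then obtain b where b:"b : B" "c * b = 1" using unit by blast
 hence "a * frc b = 1" using c assms(2) frc_mult[of c b] by(auto simp:subsetD)
 thus "EX b:frc ` B. a * b = 1" using b(1) by blast
 qed
qed

lemma complete_local_ring_frac:
 assumes "complete_local_ring B m" "B <= A0" shows "complete_local_ring (frc ` B) (frc ` m)" proof -
 interpret complete_local_ring B m by fact
 have mA:"m <= A0" using m_le assms(2) by blast
 have sI:"smod B (ipow B m B j)" for j by(rule sm_ipow[OF sm_self[OF sring]])
 have IB:"ipow B m B j <= B" for j by(rule ipow_subset[OF sm_self[OF sring] m_le])
 have "complete_at (frc ` B) (frc ` m) (frc ` B)" unfolding complete_at_def proof(intro allI impI)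
 fix t :: "nat => 'a rf"
 assume t:"ALL j. t j : frc ` B & t (Suc j) - t j : ipow (frc ` B) (frc ` m) (frc ` B) j"
 have img:"ipow (frc ` B) (frc ` m) (frc ` B) j = frc ` ipow B m B j" for j by(simp add:frac_ipow assms(2) mA)
 have "ALL j. EX v. v : ipow B m B j & frc v = t (Suc j) - t j" using t unfolding img by(metis imageE)
 then obtain v where v:"!!j. v j : ipow B m B j" "!!j. frc (v j) = t (Suc j) - t j" by metis
 obtain u0 where u0:"u0 : B" "frc u0 = t 0" using t by(metis imageE)
 define u where "u j = u0 + (SUM i<j. v i)" for j
 have uS:"u (Suc j) = u j + v j" for j by(simp add:u_def add.assoc)
 have uB:"u j : B" for j proof(induction j)
 case (Suc j)
 have "v j : B" using v(1) IB by blast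
 thus ?case unfolding uS using Suc by(intro sr_add[OF sring])
 qed (simp add:u_def u0)
 have ft:"frc (u j) = t j" for j proof(induction j)
 case (Suc j)
 have "u j : A0" "v j : A0" using uB v(1) IB assms(2) by blast+
 thus ?case unfolding uS using Suc v(2)[of j] by(simp add:frc_add)
 qed (simp add:u_def u0)
 have "EX w:B. ALL j. w - u j : ipow B m B j" using complete uB v(1) unfolding complete_at_def by(auto simp:uS)
 then obtain w where w:"w : B" "!!j. w - u j : ipow B m B j" by blast
 have "frc w - t j = frc (w - u j)" for j using w(1) uB assms(2) by(simp add:frc_diff ft subsetD)
 hence "ALL j. frc w - t j : frc ` ipow B m B j" using w(2) by simp
 thus "EX u:frc ` B. ALL j. u - t j : ipow (frc ` B) (frc ` m) (frc ` B) j" unfolding img using w(1) by blast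
 qed
 thus ?thesis
 by(intro complete_local_ring.intro local_ring_frac[OF local_ring_axioms assms(2)] complete_local_ring_axioms.intro)
qed

lemma len_frac: assumes B:"sring B" "B <= A0" and M:"smod B M" "M <= A0" and N:"smod B N" "N <= M"
 shows "len (frc ` B) (frc ` M) (frc ` N) = len B M (N + (M Int P0))" proof -
 have NA:"N <= A0" using M N by blast
 have sN:"smod (frc ` B) (frc ` N)" by(rule sm_frac[OF N(1) B(2) NA])
 have sM:"smod (frc ` B) (frc ` M)" by(rule sm_frac[OF M(1) B(2) M(2)])
 have "len (frc ` B) (frc ` M + frc ` N) (frc ` N) = len B M {u:M. frc u : frc ` N}"
 proof(rule len_image[OF B(1) M(1) sN sr_frac[OF B]])
 show "frc (u + v) = frc u + frc v" if "u : M" "v : M" for u v using that M by(simp add:frc_add subsetD)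
 show "frc (a * u) = frc a * frc u" if "a : B" "u : M" for a u using that M B by(simp add:frc_mult subsetD)
 qed
 moreover have "frc ` M + frc ` N = frc ` M" by(rule plus_abs2[OF sM sN image_mono[OF N(2)]])
 moreover have "{u:M. frc u : frc ` N} = N + (M Int P0)" proof(intro equalityI subsetI)
 fix u assume "u : {u:M. frc u : frc ` N}"
 then obtain n where n:"u : M" "n : N" "frc u = frc n" by blast
 hence "u - n : P0" using frc_eq_iff[of u n] M NA by auto
 moreover have "u - n : M" using n N by(intro sm_diff[OF B(1) M(1)]) auto
 ultimately have "n + (u - n) : N + (M Int P0)" using n(2) by(intro set_plus_intro) auto
 thus "u : N + (M Int P0)" by simp
 next
 fix u assume "u : N + (M Int P0)"
 then obtain n p where np:"u = n + p" "n : N" "p : M" "p : P0" by(auto elim!: set_plus_elim)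
 hence "frc u = frc n" using frc_add[of n p] frc_eq_0_iff[of p] M NA by auto
 moreover have "u : M" unfolding np(1) using np N by(intro sm_add[OF M(1)]) auto
 ultimately show "u : {u:M. frc u : frc ` N}" using np(2) by auto
 qed
 ultimately show ?thesis by simp
qed

section \<open>Almost integral elements over one-dimensional complete domains\<close>

lemma sm_sum:"smod A M ==> (!!i. i : J ==> f i : M) ==> sum f J : M"
 by(induction J rule:infinite_finite_induct) (auto intro:sm_add)

lemma sr_of_nat:"sring A ==> of_nat n : A" by(induction n) (auto intro:sr_add)

lemma fg_span_trans: assumes A:"sring A" "noeth A A" and D:"sring D" "A <= D" "fg A D" and G:"finite G"
 shows "fg A (span D G)" using G proof(induction G rule:finite_induct)
 case empty
 have "fg A (span A {})" unfolding fg_def by blast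
 thus ?case by simp
next
 case (insert g G)
 obtain H where H:"finite H" "D = span A H" using D(3) by(auto simp:fg_def)
 have "g *o D = span A ((*) g ` H)" unfolding H(2) by(rule span_image_scale[symmetric])
 hence "fg A (g *o D)" unfolding fg_def using H(1) by blast
 thus ?case unfolding span_insert[OF D(1)] using insert.IH by(rule fg_plus)
qed

text \<open>Compute the length of M / y D once through D and once through y M; multiplication by y
  identifies M / D with y M / y D.\<close>

lemma len_rank_one: fixes y :: "'k::idom"
 assumes A:"sring A" and M:"smod A M" "smod A D" "D <= M" and fin:"len A M D < \<infinity>"
 and y:"y ~= 0" "y *o M <= M" "y *o D <= D" shows "len A M (y *o M) = len A D (y *o D)" proof -
 have s:"smod A (y *o M)" "smod A (y *o D)" by(rule sm_scaled[OF M(1)], rule sm_scaled[OF M(2)])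
 have DM:"y *o D <= y *o M" by(rule scaled_mono[OF M(3)])
 have "len A M (y *o D) = len A M D + len A D (y *o D)" by(rule len_add[OF A M(2) y(3) M(3) M(1) s(2)])
 moreover have "len A M (y *o D) = len A M (y *o M) + len A (y *o M) (y *o D)"
 by(rule len_add[OF A s(1) DM y(2) M(1) s(2)])
 moreover have "len A (y *o M) (y *o D) = len A M D" by(rule len_scaled_inj[OF A M y(1)])
 ultimately have "len A M D + len A D (y *o D) = len A M D + len A M (y *o M)" by(metis add.commute)
 thus ?thesis using fin by(cases "len A M D") auto
qed

lemma len_power_scaled: fixes y :: "'k::idom" assumes A:"sring A" and D:"smod A D" and y:"y ~= 0" "y *o D <= D"
 shows "len A D ((y ^ n) *o D) = of_nat n * len A D (y *o D)" proof(induction n)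
 case (Suc n)
 have s:"smod A (z *o D)" for z by(rule sm_scaled[OF D])
 have e:"(y ^ Suc n) *o D = (y ^ n) *o (y *o D)" by(simp add:scaled2 mult.commute)
 have sub:"(y ^ n) *o D <= D" for n proof(induction n)
 case (Suc n)
 have "(y ^ Suc n) *o D = y *o ((y ^ n) *o D)" by(simp add:scaled2)
 also have "... <= y *o D" by(rule scaled_mono[OF Suc])
 finally show ?case using y(2) by blast
 qed simp
 have "len A D ((y ^ Suc n) *o D) = len A D ((y ^ n) *o D) + len A ((y ^ n) *o D) ((y ^ Suc n) *o D)"
 by(rule len_add[OF A s _ sub D s]) (simp only:e scaled_mono[OF y(2)])
 also have "len A ((y ^ n) *o D) ((y ^ Suc n) *o D) = len A D (y *o D)"
 unfolding e by(rule len_scaled_inj[OF A D s y(2)]) (use y in simp)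
 finally show ?case using Suc by(simp add:distrib_right add.commute)
qed simp

text \<open>The complete integral closure. Asking for one denominator for all powers, instead of an
  integral equation, matches what length arguments deliver.\<close>

definition almost :: "'k::field set => 'k set" where "almost D = {tau. EX a:D. a ~= 0 & (ALL j. a * tau ^ j : D)}"

lemma subset_almost:"sring D ==> D <= almost D" unfolding almost_def by(auto intro!: bexI[of _ 1] sr_power)

lemma almost_mult:"sring D ==> \<sigma> : almost D ==> tau : almost D ==> \<sigma> * tau : almost D" proof -
 assume D:"sring D" and "\<sigma> : almost D" "tau : almost D"
 then obtain a b where ab:"a : D" "b : D" "a ~= 0" "b ~= 0" "!!j. a * \<sigma> ^ j : D" "!!j. b * tau ^ j : D"
 by(auto simp:almost_def)
 have "(a * b) * (\<sigma> * tau) ^ j : D" for j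
 using sr_mult[OF D ab(5)[of j] ab(6)[of j]] by(simp add:power_mult_distrib mult_ac)
 moreover have "a * b : D" "a * b ~= 0" using ab D by(auto intro:sr_mult)
 ultimately show ?thesis unfolding almost_def by blast
qed

lemma almost_add:"sring D ==> \<sigma> : almost D ==> tau : almost D ==> \<sigma> + tau : almost D" proof -
 assume D:"sring D" and "\<sigma> : almost D" "tau : almost D"
 then obtain a b where ab:"a : D" "b : D" "a ~= 0" "b ~= 0" "!!j. a * \<sigma> ^ j : D" "!!j. b * tau ^ j : D"
 by(auto simp:almost_def)
 have "(a * b) * (\<sigma> + tau) ^ j : D" for j proof -
 have "(a * b) * (\<sigma> + tau) ^ j = (SUM k<=j. of_nat (j choose k) * ((a * \<sigma> ^ k) * (b * tau ^ (j - k))))"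
 unfolding binomial_ring sum_distrib_left by(rule sum.cong) (simp_all add:mult_ac)
 also have "... : D" by(rule sm_sum[OF sm_self[OF D]]) (intro sr_mult[OF D] sr_of_nat[OF D] ab)
 finally show ?thesis .
 qed
 moreover have "a * b : D" "a * b ~= 0" using ab D by(auto intro:sr_mult)
 ultimately show ?thesis unfolding almost_def by blast
qed

locale one_dim = complete_local_ring R m for R m :: "'k::field set" + fixes D :: "'k set" and y :: 'k and N :: nat
 assumes D:"sring D" "R <= D" "fg R D" and y:"y : m" "y ~= 0" and prim:"ipow R m D N <= y *o D"
begin

lemma yR:"y : R" and yD:"y : D" using y m_le D by auto

lemma sm_D:"smod R D" by(rule sm_sub[OF sm_self[OF D(1)] D(2)])

lemma yDD:"y *o D <= D" by(rule scaled_le[OF sm_self[OF D(1)] yD])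

lemma sm_sc:"smod R (z *o D)" by(rule sm_scaled[OF sm_D])

lemma len_yD:"len R D (y *o D) < \<infinity>"
 using len_mono[OF prim, of R D] len_ipow_finite[OF D(3), of N] by(rule le_less_trans)

text \<open>Let T j be the y-saturation of s^j D. Since T (j + 1) meets y T j exactly in y T (j +
  1), the length of T j / y T j drops whenever T j shrinks. If no power of y were in s D, it would
  drop forever.\<close>

lemma power_in_ideal: assumes s:"s : D" "s ~= 0" shows "EX k. y ^ k : s *o D" proof(rule ccontr)
 assume no:"\<nexists>k. y ^ k : s *o D"
 define T where "T j = {t:D. EX k. y ^ k * t : (s ^ j) *o D}" for j
 have sD:"smod D ((s ^ j) *o D)" for j by(rule sm_scaled[OF sm_self[OF D(1)]])
 have yk:"y ^ k : D" for k by(rule sr_power[OF D(1) yD])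
 have subm:"smod R (T j)" for j unfolding T_def by(rule sm_sub[OF sm_saturation[OF D(1) yD sD] D(2)])
 have TD:"T j <= D" for j by(auto simp:T_def)
 have yT:"y *o T j <= T j" for j by(rule scaled_le[OF subm yR])
 have dec:"T (Suc j) <= T j" for j proof -
 have "(s ^ Suc j) *o D = (s ^ j) *o (s *o D)" by(simp add:scaled2 mult.commute)
 also have "... <= (s ^ j) *o D" by(rule scaled_mono[OF scaled_le[OF sm_self[OF D(1)] s(1)]])
 finally show ?thesis by(auto simp:T_def)
 qed
 have sat:"T (Suc j) Int y *o T j = y *o T (Suc j)" for j proof
 show "y *o T (Suc j) <= T (Suc j) Int y *o T j" using yT[of "Suc j"] scaled_mono[OF dec, of y j] by blast
 show "T (Suc j) Int y *o T j <= y *o T (Suc j)" proof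
 fix u assume u:"u : T (Suc j) Int y *o T j"
 then obtain t where t:"t : T j" "u = y * t" by(auto simp:in_scaled)
 obtain k where "y ^ k * (y * t) : (s ^ Suc j) *o D" using u t by(auto simp:T_def)
 hence "y ^ (Suc k) * t : (s ^ Suc j) *o D" by(simp add:mult_ac)
 hence "t : T (Suc j)" using t TD[of j] unfolding T_def by blast
 thus "u : y *o T (Suc j)" unfolding t(2) by(rule scaledI)
 qed
 qed
 have ne:"~ T j <= T (Suc j)" for j proof
 assume sub:"T j <= T (Suc j)"
 have "s ^ j : T j" unfolding T_def using sr_power[OF D(1) s(1), of j] scaledI[of 1 D "s ^ j"] sr_1[OF D(1)]
 by(auto intro!: exI[of _ 0])
 then obtain k where "y ^ k * s ^ j : (s ^ Suc j) *o D" using sub by(auto simp:T_def)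
 then obtain d where d:"d : D" "y ^ k * s ^ j = s ^ Suc j * d" by(auto simp:in_scaled)
 hence "s ^ j * (y ^ k) = s ^ j * (s * d)" by(simp add:mult_ac)
 hence "y ^ k = s * d" using s(2) by simp
 hence "y ^ k : s *o D" using scaledI[OF d(1), of s] by(simp only:)
 thus False using no by blast
 qed
 have step:"1 + len R (T (Suc j)) (y *o T (Suc j)) <= len R (T j) (y *o T j)" for j proof -
 have sy:"smod R (y *o T j)" by(rule sm_scaled[OF subm])
 have sp:"smod R (T (Suc j) + y *o T j)" by(rule sm_plus[OF subm sy])
 have sub:"T (Suc j) + y *o T j <= T j" by(rule plus_le[OF subm dec yT])
 have "T (Suc j) + y *o T j ~= T j" proof
 assume "T (Suc j) + y *o T j = T j"
 hence "T j <= T (Suc j) + y *o T j" by simp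
 hence "T j <= T (Suc j)" by(rule nakayama_elem[OF fg_sub[OF D(3) subm TD] subm y(1)])
 thus False using ne by blast
 qed
 hence 1:"1 <= len R (T j) (T (Suc j) + y *o T j)" using sub by(intro len_ge_1[OF subm sp]) blast
 have "len R (T j) (y *o T j) = len R (T j) (T (Suc j) + y *o T j) + len R (T (Suc j) + y *o T j) (y *o T j)"
 by(rule len_add[OF sring sp plus_ge2[OF subm] sub subm sy])
 also have "len R (T (Suc j) + y *o T j) (y *o T j) = len R (T (Suc j)) (y *o T (Suc j))"
 unfolding len_plus_Int[OF sring subm sy] sat ..
 finally show ?thesis using add_right_mono[OF 1] by simp
 qed
 have "enat j + len R (T j) (y *o T j) <= len R (T 0) (y *o T 0)" for j proof(induction j)
 case (Suc j)
 have "enat (Suc j) + len R (T (Suc j)) (y *o T (Suc j)) = enat j + (1 + len R (T (Suc j)) (y *o T (Suc j)))" proof -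
 have "enat (Suc j) = enat j + 1" by(simp add:one_enat_def)
 thus ?thesis by(simp only:add.assoc)
 qed
 also have "... <= enat j + len R (T j) (y *o T j)" by(rule add_left_mono[OF step])
 finally show ?case using Suc by(rule order_trans)
 qed (simp add:zero_enat_def[symmetric])
 moreover have "T 0 = D" using D by(auto simp:T_def intro!: exI[of _ 0])
 ultimately have le:"enat j <= len R D (y *o D)" for j by(metis le_iff_add order_trans)
 obtain w where "len R D (y *o D) = enat w" using len_yD by(cases "len R D (y *o D)") auto
 thus False using le[of "Suc w"] by simp
qed

lemma Inter_powers: assumes "!!k. u : (y ^ k) *o D" shows "u = 0" proof -
 have "u : {0}" by(rule krull_elem[OF D(3) _ _ y(1)]) (use assms D in auto)
 thus ?thesis by simp
qed

definition bb :: "nat => 'k set" where "bb n = {g:D. g / y ^ n : almost D}"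

text \<open>By Chevalley it suffices that no g \<noteq> 0 lies in all \<open>bb n\<close>. As g
  divides a power of y, such a g would make 1 / y almost integral, with a denominator divisible by
  all powers of y.\<close>

lemma bb_bound:"EX n. bb n <= y *o D" proof -
 have subm:"smod R (bb n)" for n unfolding smod_def proof(intro conjI ballI)
 show "0 : bb n" using subset_almost[OF D(1)] D by(auto simp:bb_def)
 fix g h assume "g : bb n" "h : bb n"
 thus "g + h : bb n" using almost_add[OF D(1)] D by(auto simp:bb_def add_divide_distrib intro:sr_add)
 next
 fix a g assume a:"a : R" "g : bb n"
 hence "a * (g / y ^ n) : almost D" using subset_almost[OF D(1)] D by(intro almost_mult) (auto simp:bb_def)
 thus "a * g : bb n" using a D by(auto simp:bb_def intro:sr_mult)
 qed
 have "EX n. bb n <= (\<Inter>n. bb n) + ipow R m D N" proof(rule chevalley[OF D(3) subm])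
 show "bb n <= D" for n by(auto simp:bb_def)
 show "bb (Suc n) <= bb n" for n proof
 fix g assume g:"g : bb (Suc n)"
 hence "y * (g / y ^ Suc n) : almost D" using subset_almost[OF D(1)] yD D by(intro almost_mult) (auto simp:bb_def)
 thus "g : bb n" using g y by(auto simp:bb_def)
 qed
 qed
 moreover have "(\<Inter>n. bb n) <= {0}" proof
 fix g assume g:"g : (\<Inter>n. bb n)"
 show "g : {0}" proof(rule ccontr)
 assume "g ~: {0}"
 hence g0:"g : D" "g ~= 0" using g by(auto simp:bb_def)
 obtain k where "y ^ k : g *o D" using power_in_ideal[OF g0] by blast
 then obtain s where s:"s : D" "y ^ k = g * s" by(auto simp:in_scaled)
 have "g : bb (Suc k)" using g by blast
 hence "(g / y ^ Suc k) * s : almost D" using s subset_almost[OF D(1)] D by(intro almost_mult) (auto simp:bb_def)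
 moreover have "(g / y ^ Suc k) * s = 1 / y" proof -
 have "(g / y ^ Suc k) * s = (g * s) / (y * y ^ k)" by simp
 also have "... = 1 / y" unfolding s(2)[symmetric] using y by simp
 finally show ?thesis .
 qed
 ultimately obtain a where a:"a : D" "a ~= 0" "!!j. a * (1 / y) ^ j : D" by(auto simp:almost_def)
 have "a : (y ^ j) *o D" for j proof -
 have "a = y ^ j * (a * (1 / y) ^ j)" using y by(simp add:power_one_over field_simps)
 thus ?thesis using a(3)[of j] scaledI by metis
 qed
 thus False using Inter_powers a(2) by blast
 qed
 qed
 ultimately obtain n where "bb n <= {0} + ipow R m D N" using plus_mono[OF _ order.refl] by(metis order_trans)
 hence "bb n <= y *o D" using prim by simp
 thus ?thesis by blast
qed

text \<open>One power of y clears the denominators of all almost integral elements. Take the least i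
  with y^i tau in D: for i > n0 this element lies in \<open>bb n0\<close>, hence in y D, and one
  factor y can be cancelled.\<close>

lemma almost_bound:"EX n0. bb n0 <= y *o D & (ALL tau:almost D. y ^ n0 * tau : D)" proof -
 obtain n0 where n0:"bb n0 <= y *o D" using bb_bound by blast
 have "y ^ n0 * tau : D" if t:"tau : almost D" for tau proof -
 obtain a where a:"a : D" "a ~= 0" "a * tau ^ 1 : D" using t unfolding almost_def by blast
 obtain k s where ks:"s : D" "y ^ k = a * s" using power_in_ideal[OF a(1,2)] by(auto simp:in_scaled)
 have "s * (a * tau) : D" using ks a D by(auto intro:sr_mult)
 hence ex:"y ^ k * tau : D" using ks(2) by(simp add:mult_ac)
 define i where "i = (LEAST i. y ^ i * tau : D)"
 have i:"y ^ i * tau : D" unfolding i_def by(rule LeastI[of "%i. y ^ i * tau : D"]) (rule ex)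
 have "i <= n0" proof(rule ccontr)
 assume ni:"~ i <= n0"
 have "(y ^ i * tau) / y ^ n0 = y ^ (i - n0) * tau" using ni y by(simp add:power_diff field_simps)
 moreover have "y ^ (i - n0) * tau : almost D"
 by(rule almost_mult[OF D(1) _ t]) (use subset_almost[OF D(1)] sr_power[OF D(1) yD] in blast)
 ultimately have "y ^ i * tau : y *o D" using n0 i by(auto simp:bb_def)
 then obtain d where d:"d : D" "y ^ i * tau = y * d" by(auto simp:in_scaled)
 obtain i' where i': "i = Suc i'" using ni by(cases i) auto
 hence "y ^ i' * tau : D" using d y by simp
 hence "i <= i'" unfolding i_def by(rule Least_le)
 thus False using i' by simp
 qed
 hence e:"y ^ n0 * tau = y ^ (n0 - i) * (y ^ i * tau)" by(simp add:mult.assoc[symmetric] flip: power_add)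
 show ?thesis unfolding e by(rule sr_mult[OF D(1) sr_power[OF D(1) yD] i])
 qed
 thus ?thesis using n0 by blast
qed

definition pws :: "'k => nat => 'k set" where "pws tau n = span D ((%i. tau ^ i) ` {..n})"

lemma pwsD:"smod D (pws tau n)" "smod R (pws tau n)" "fg R (pws tau n)" "i <= n ==> tau ^ i : pws tau n"
 "n <= k ==> pws tau n <= pws tau k" "D <= pws tau n" proof -
 show s:"smod D (pws tau n)" unfolding pws_def by(rule sm_span)
 thus "smod R (pws tau n)" by(rule sm_sub[OF _ D(2)])
 show "fg R (pws tau n)" unfolding pws_def by(rule fg_span_trans[OF sring noeth_ring D]) simp
 show i:"i <= n ==> tau ^ i : pws tau n" for i unfolding pws_def by(rule subsetD[OF span_inc]) simp
 show "n <= k ==> pws tau n <= pws tau k" unfolding pws_def by(rule span_mono) auto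
 have "d * tau ^ 0 : pws tau n" if "d : D" for d by(rule sm_mult[OF s that i]) simp
 thus "D <= pws tau n" by auto
qed

lemma pws_bound:"y ^ k * tau : D ==> u : pws tau n ==> y ^ (k * n) * u : D" proof -
 assume k:"y ^ k * tau : D" and u:"u : pws tau n"
 have "pws tau n <= {u. y ^ (k * n) * u : D}" unfolding pws_def proof(rule span_least)
 show "smod D {u. y ^ (k * n) * u : D}"
 using D by(auto simp:smod_def distrib_left mult.left_commute intro:sr_add sr_mult)
 have "y ^ (k * n) * tau ^ i : D" if "i <= n" for i proof -
 have "y ^ (k * n) * tau ^ i = y ^ (k * (n - i)) * (y ^ k * tau) ^ i"
 using that by(simp add:power_mult_distrib mult.assoc[symmetric] diff_mult_distrib2 flip: power_mult power_add)
 thus ?thesis using D yD k by(auto intro:sr_mult sr_power)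
 qed
 thus "(%i. tau ^ i) ` {..n} <= {u. y ^ (k * n) * u : D}" by auto
 qed
 thus ?thesis using u by blast
qed

text \<open>Let E = D[tau]. Every \<open>pws tau n\<close> has the same length modulo y as D, so E /
  y E has finite length and E = \<open>pws tau n\<close> + y E for some n. Chevalley and Nakayama
  then stop the ascending chain at n, and one power of y is a denominator for all powers of
  tau.\<close>

lemma almost_if_proper: assumes k:"y ^ k * tau : D" and no:"!!n. 1 ~: y *o pws tau n" shows "tau : almost D" proof -
 define E where "E = (\<Union>n. pws tau n)"
 have sE:"smod D E" unfolding smod_def proof(intro conjI ballI)
 show "0 : E" using sm_0[OF pwsD(1)] by(auto simp:E_def)
 fix u v assume "u : E" "v : E"
 then obtain n k where nk:"u : pws tau n" "v : pws tau k" by(auto simp:E_def)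
 have "u + v : pws tau (max n k)"
 by(rule sm_add[OF pwsD(1)]) (use nk pwsD(5)[of n "max n k" tau] pwsD(5)[of k "max n k" tau] in auto)
 thus "u + v : E" by(auto simp:E_def)
 next
 fix a u assume a:"a : D" and "u : E"
 then obtain n where "u : pws tau n" by(auto simp:E_def)
 hence "a * u : pws tau n" by(rule sm_mult[OF pwsD(1) a])
 thus "a * u : E" by(auto simp:E_def)
 qed
 have sER:"smod R E" by(rule sm_sub[OF sE D(2)])
 have DE:"D <= E" using pwsD(6)[of tau 0] by(auto simp:E_def)
 have pE:"pws tau n <= E" for n by(auto simp:E_def)
 have yE:"smod R ((y ^ k) *o E)" for k by(rule sm_scaled[OF sER])
 have no': "1 ~: y *o E" using no by(auto simp:E_def in_scaled)
 have lenb:"len R (pws tau n + y *o E) (y *o E) <= len R D (y *o D)" for n proof -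
 let ?M = "pws tau n"
 have sM:"smod R ?M" by(rule pwsD)
 have yM:"y *o ?M <= ?M" by(rule scaled_le[OF sM yR])
 have "(y ^ (k * n)) *o ?M <= D" using pws_bound[OF k] by(auto simp:in_scaled)
 hence "len R ((y ^ (k * n)) *o ?M) ((y ^ (k * n)) *o D) <= len R D ((y ^ (k * n)) *o D)" by(rule len_mono_left)
 also have "... < \<infinity>" unfolding len_power_scaled[OF sring sm_D y(2) yDD]
 using len_yD by(cases "len R D (y *o D)") (auto simp:of_nat_eq_enat)
 finally have "len R ?M D < \<infinity>" using len_scaled_inj[OF sring sM sm_D pwsD(6)] y(2) by simp
 hence "len R ?M (y *o ?M) = len R D (y *o D)" by(rule len_rank_one[OF sring sM sm_D pwsD(6) _ y(2) yM yDD])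
 moreover have "len R (?M + y *o E) (y *o E) = len R ?M (?M Int y *o E)"
 by(rule len_plus_Int[OF sring sM sm_scaled[OF sER]])
 moreover have "len R ?M (?M Int y *o E) <= len R ?M (y *o ?M)" using yM scaled_mono[OF pE] by(intro len_mono) blast
 ultimately show ?thesis by simp
 qed
 obtain w where w:"len R D (y *o D) = enat w" using len_yD by(cases "len R D (y *o D)") auto
 define l where "l n = the_enat (len R (pws tau n + y *o E) (y *o E))" for n
 have l:"len R (pws tau n + y *o E) (y *o E) = enat (l n)" for n
 using lenb[of n] unfolding w l_def by(cases "len R (pws tau n + y *o E) (y *o E)") auto
 have "ALL n. l n <= w" using lenb l w by simp
 hence "ALL n. True --> l n < Suc w" by(simp add:less_Suc_eq_le)
 then obtain n where n:"!!i. l i <= l n" using ex_has_greatest_nat[of "%_. True" 0 l "Suc w"] by auto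
 have Esub:"E <= pws tau n + y *o E" proof
 fix u assume "u : E"
 then obtain i where i:"u : pws tau i" by(auto simp:E_def)
 let ?j = "max n i"
 have sj:"smod R (pws tau j + y *o E)" for j by(rule sm_plus[OF pwsD(2) sm_scaled[OF sER]])
 have 1:"pws tau n + y *o E <= pws tau ?j + y *o E" by(rule plus_mono[OF pwsD(5)]) auto
 have "len R (pws tau ?j + y *o E) (y *o E) = len R (pws tau ?j + y *o E) (pws tau n + y *o E) + len R (pws tau n + y *o E) (y *o E)"
 by(rule len_add[OF sring sj plus_ge2[OF pwsD(2)] 1 sj sm_scaled[OF sER]])
 hence "len R (pws tau ?j + y *o E) (pws tau n + y *o E) = 0"
 using n[of ?j] unfolding l by(cases "len R (pws tau ?j + y *o E) (pws tau n + y *o E)") (auto simp:zero_enat_def)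
 hence "pws tau ?j + y *o E = pws tau n + y *o E" using len_eq_0_iff[OF sj sj 1] by simp
 moreover have "u : pws tau ?j" using i pwsD(5)[of i ?j tau] by auto
 hence "u : pws tau ?j + y *o E" by(rule subsetD[OF plus_ge1[OF sm_scaled[OF sER]]])
 ultimately show "u : pws tau n + y *o E" by simp
 qed
 have Ek:"E <= pws tau n + (y ^ k) *o E" for k proof(induction k)
 case 0
 show ?case using plus_ge2[OF pwsD(2), of E tau n] by simp
 next
 case (Suc k)
 have "(y ^ k) *o E <= (y ^ k) *o (pws tau n + y *o E)" by(rule scaled_mono[OF Esub])
 also have "... = (y ^ k) *o pws tau n + (y ^ Suc k) *o E" by(simp add:scaled_plus scaled2 mult.commute)
 also have "... <= pws tau n + (y ^ Suc k) *o E"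
 by(rule plus_mono[OF scaled_le[OF pwsD(2) sr_power[OF sring yR]] order.refl])
 finally have "pws tau n + (y ^ k) *o E <= pws tau n + (pws tau n + (y ^ Suc k) *o E)" by(rule plus_mono[OF order.refl])
 also have "... = (pws tau n + pws tau n) + (y ^ Suc k) *o E" by(simp only:add.assoc)
 also have "... = pws tau n + (y ^ Suc k) *o E" by(simp only:plus_abs[OF pwsD(2) pwsD(2) order.refl])
 finally show ?case using Suc by blast
 qed
 let ?M = "pws tau (Suc n)"
 let ?F = "%k. ?M Int (y ^ k) *o E"
 have "EX K. ?F K <= (\<Inter>k. ?F k) + ipow R m ?M 1" proof(rule chevalley[OF pwsD(3)])
 show "smod R (?F k)" for k by(rule sm_Int[OF pwsD(2) yE])
 show "?F k <= ?M" for k by blast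
 show "?F (Suc k) <= ?F k" for k proof -
 have "(y ^ Suc k) *o E = (y ^ k) *o (y *o E)" by(simp add:scaled2 mult.commute)
 also have "... <= (y ^ k) *o E" by(rule scaled_mono[OF scaled_le[OF sE yD]])
 finally show ?thesis by blast
 qed
 qed
 then obtain K where K:"?F K <= (\<Inter>k. ?F k) + ipow R m ?M 1" by blast
 have "(\<Inter>k. ?F k) <= {0}" proof
 fix f assume f:"f : (\<Inter>k. ?F k)"
 show "f : {0}" proof(rule ccontr)
 assume "f ~: {0}"
 hence f0:"f ~= 0" by simp
 let ?g = "y ^ (k * Suc n) * f"
 have g:"?g : D" "?g ~= 0" using f f0 y pws_bound[OF k, of f "Suc n"] by auto
 obtain j s where js:"s : D" "y ^ j = ?g * s" using power_in_ideal[OF g] by(auto simp:in_scaled)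
 have "f : (y ^ Suc j) *o E" using f by blast
 then obtain e where e:"e : E" "f = y ^ Suc j * e" by(auto simp:in_scaled)
 have "y ^ j * 1 = y ^ j * (y * ((y ^ (k * Suc n) * s) * e))" using js(2) unfolding e(2) by(simp add:mult_ac)
 hence "1 = y * ((y ^ (k * Suc n) * s) * e)" using y(2) by(metis mult_cancel_left power_not_zero)
 moreover have "(y ^ (k * Suc n) * s) * e : E"
 by(rule sm_mult[OF sE sr_mult[OF D(1) sr_power[OF D(1) yD] js(1)] e(1)])
 ultimately show False using no' scaledI by metis
 qed
 qed
 hence FK:"?F K <= mul R m ?M" using K plus_mono[of "\<Inter>k. ?F k" "{0}" "ipow R m ?M 1" "mul R m ?M"] by auto
 have "?M <= pws tau n + mul R m ?M" proof
 fix u assume u:"u : ?M"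
 hence "u : pws tau n + (y ^ K) *o E" using pE Ek by blast
 then obtain v e where ve:"u = v + e" "v : pws tau n" "e : (y ^ K) *o E" by(rule set_plus_elim)
 have "v : ?M" using ve(2) pwsD(5)[of n "Suc n" tau] by auto
 hence "u - v : ?M" by(rule sm_diff[OF sring pwsD(2) u])
 hence "e : ?F K" using ve by simp
 thus "u : pws tau n + mul R m ?M" unfolding ve(1) using FK ve(2) `e : ?F K` by(intro set_plus_intro) blast+
 qed
 hence MM:"?M <= pws tau n" by(rule nakayama[OF pwsD(3,2)])
 have "tau * u : pws tau n" if "u : pws tau n" for u proof -
 have "pws tau n <= {u. tau * u : ?M}" unfolding pws_def[of _ n] proof(rule span_least)
 show "smod D {u. tau * u : ?M}" using pwsD(1)[of tau "Suc n"] by(auto simp:smod_def distrib_left mult.left_commute)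
 have "tau ^ Suc i : ?M" if "i <= n" for i by(rule pwsD(4)) (use that in simp)
 thus "(%i. tau ^ i) ` {..n} <= {u. tau * u : ?M}" by auto
 qed
 thus ?thesis using that MM by blast
 qed
 hence "tau ^ j : pws tau n" for j using pwsD(4)[of 0 n tau] by(induction j) auto
 hence "y ^ (k * n) * tau ^ j : D" for j using pws_bound[OF k] by blast
 thus ?thesis unfolding almost_def using sr_power[OF D(1) yD] y(2) by(auto intro!: bexI[of _ "y ^ (k * n)"])
qed

text \<open>As for valuation rings: if 1 were in both y D[tau] and y D[1/tau], all powers of tau up
  to p + q could be rewritten with coefficients divisible by y, so M = y M for M =
  \<open>pws tau (p + q)\<close>, against Nakayama.\<close>

lemma almost_or_inverse: assumes k:"y ^ k * tau : D" and tau:"tau ~= 0"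
 shows "tau : almost D | inverse tau : almost D" proof(rule ccontr)
 assume no:"~ (tau : almost D | inverse tau : almost D)"
 have "y ^ k * tau ~= 0" using y tau by simp
 then obtain j s where js:"s : D" "y ^ j = (y ^ k * tau) * s" using power_in_ideal[OF k] by(auto simp:in_scaled)
 have "y ^ j * inverse tau = y ^ k * s" using js(2) tau by(simp add:field_simps)
 hence "y ^ j * inverse tau : D" using js(1) D yD by(auto intro:sr_mult sr_power)
 then obtain q where q:"1 : y *o pws (inverse tau) q" using almost_if_proper[of j "inverse tau"] no by blast
 obtain p where p:"1 : y *o pws tau p" using almost_if_proper[OF k] no by blast
 let ?M = "pws tau (p + q)"
 have sM:"smod D ?M" by(rule pwsD)
 have sy:"smod D (y *o ?M)" by(rule sm_scaled[OF sM])
 have up:"tau ^ i : y *o ?M" if i:"i <= q" for i proof -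
 have "pws tau p <= {u. tau ^ i * u : ?M}" unfolding pws_def[of _ p] proof(rule span_least)
 show "smod D {u. tau ^ i * u : ?M}" using sM by(auto simp:smod_def distrib_left mult.left_commute)
 have "tau ^ i * tau ^ l : ?M" if "l <= p" for l using pwsD(4)[of "i + l" "p + q" tau] that i by(simp add:power_add)
 thus "(%i. tau ^ i) ` {..p} <= {u. tau ^ i * u : ?M}" by auto
 qed
 moreover obtain u where u:"u : pws tau p" "1 = y * u" using p by(auto simp:in_scaled)
 ultimately have "y * (tau ^ i * u) : y *o ?M" by blast
 moreover have "y * (tau ^ i * u) = tau ^ i * (y * u)" by(simp only:mult_ac)
 ultimately show ?thesis unfolding u(2)[symmetric] by simp
 qed
 have dn:"tau ^ i : y *o ?M" if i:"q <= i" "i <= p + q" for i proof -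
 have "pws (inverse tau) q <= {u. tau ^ i * u : ?M}" unfolding pws_def[of _ q] proof(rule span_least)
 show "smod D {u. tau ^ i * u : ?M}" using sM by(auto simp:smod_def distrib_left mult.left_commute)
 have "tau ^ i * inverse tau ^ l : ?M" if "l <= q" for l proof -
 have "tau ^ i * inverse tau ^ l = tau ^ (i - l)" using that i tau by(simp add:power_diff power_inverse field_simps)
 thus ?thesis using pwsD(4)[of "i - l" "p + q" tau] i by simp
 qed
 thus "(%i. inverse tau ^ i) ` {..q} <= {u. tau ^ i * u : ?M}" by auto
 qed
 moreover obtain u where u:"u : pws (inverse tau) q" "1 = y * u" using q by(auto simp:in_scaled)
 ultimately have "y * (tau ^ i * u) : y *o ?M" by blast
 moreover have "y * (tau ^ i * u) = tau ^ i * (y * u)" by(simp only:mult_ac)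
 ultimately show ?thesis unfolding u(2)[symmetric] by simp
 qed
 have "?M <= y *o ?M" unfolding pws_def[of _ "p + q", THEN arg_cong[of _ _ "%X. X <= y *o ?M"]]
 proof(rule span_least[OF sy])
 have "tau ^ i : y *o ?M" if "i <= p + q" for i using up[of i] dn[of i] that by linarith
 thus "(%i. tau ^ i) ` {..p + q} <= y *o ?M" by auto
 qed
 hence "?M <= {0} + y *o ?M" by simp
 hence "?M <= {0}" by(rule nakayama_elem[OF pwsD(3) sm_zero y(1)])
 thus False using pwsD(4)[of 0 "p + q" tau] by auto
qed

text \<open>Apply the alternative to g / y^n0. It is not almost integral, since g is outside y D and
  so outside \<open>bb n0\<close>; hence y^n0 / g is, and another y^n0 clears its denominator. The
  point is that the exponent 2 n0 does not depend on g.\<close>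

theorem escape:"escape D {0} y" proof -
 obtain n0 where n0:"bb n0 <= y *o D" "!!tau. tau : almost D ==> y ^ n0 * tau : D" using almost_bound by blast
 have "y ^ (n0 + n0) : g *o D" if g:"g : D" "g ~: y *o D" for g proof -
 have g0:"g ~= 0" using g(2) sm_0[OF sm_sc[of y]] by auto
 let ?tau = "g / y ^ n0"
 have "y ^ n0 * ?tau : D" "?tau ~= 0" using g(1) g0 y by auto
 hence "?tau : almost D | inverse ?tau : almost D" by(rule almost_or_inverse)
 moreover have "?tau ~: almost D" using n0(1) g by(auto simp:bb_def)
 ultimately have d:"y ^ n0 * inverse ?tau : D" using n0(2) by blast
 have "y ^ (n0 + n0) = g * (y ^ n0 * inverse ?tau)" using g0 by(simp add:power_add)
 thus ?thesis using d scaledI by metis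
 qed
 thus ?thesis unfolding escape_def using power_in_ideal by(auto simp del:scaled_one)
qed

end

text \<open>If it failed anywhere, A0 and P0 would be a counterexample, and this one is refuted by
  \<open>one_dim.escape\<close> in the field \<open>rf\<close>.\<close>

theorem escape_general: fixes A P :: "'b::comm_ring_1 set"
 assumes "sring A" "prime_in A P" "complete_local_ring R m" "R <= A" "fg R A" "y : m" "y ~: P" "ipow R m A N <= P + y *o A"
 shows "escape A P y" proof(rule ccontr)
 assume "~ escape A P y"
 hence "bad_one A P" unfolding bad_one_def using assms by blast
 hence "bad_one A0 (P0 :: 'b set)" using chosen by(auto simp:chosen_def split:if_splits)
 then obtain R m N and y :: 'b where h:"complete_local_ring R m" "R <= A0" "fg R A0" "y : m" "y ~: P0" "ipow R m A0 N <= P0 + y *o A0" "~ escape A0 P0 y"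
 unfolding bad_one_def by blast
 interpret I: complete_local_ring R m by fact
 have mA:"m <= A0" using I.m_le h(2) by blast
 have yA:"y : A0" using mA h(4) by blast
 interpret complete_local_ring "frc ` R" "frc ` m" by(rule complete_local_ring_frac[OF h(1,2)])
 interpret one_dim "frc ` R" "frc ` m" "frc ` A0" "frc y" N proof
 show "sring (frc ` A0)" by(rule sr_frac) simp_all
 show "frc ` R <= frc ` A0" using h(2) by blast
 show "fg (frc ` R) (frc ` A0)" by(rule fg_frac[OF h(3,2)]) simp
 show "frc y : frc ` m" using h(4) by blast
 show "frc y ~= 0" using h(5) yA by(simp add:frc_eq_0_iff)
 show "ipow (frc ` R) (frc ` m) (frc ` A0) N <= frc y *o frc ` A0" proof
 fix v assume "v : ipow (frc ` R) (frc ` m) (frc ` A0) N"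
 then obtain u where u:"u : ipow R m A0 N" "v = frc u" using frac_ipow[OF h(2) mA order.refl, of N] by blast
 have "u : P0 + y *o A0" using h(6) u(1) by blast
 then obtain p q where pq:"u = p + q" "p : P0" "q : y *o A0" by(rule set_plus_elim)
 then obtain a where pa:"u = p + y * a" "p : P0" "a : A0" by(auto simp:in_scaled)
 hence "v = frc y * frc a" using u(2) yA by(simp add:frc_add frc_mult A0_mult P0_A0 frc_eq_0_iff)
 thus "v : frc y *o frc ` A0" using pa(3) by blast
 qed
 qed
 have lift:"u : P0 + w *o A0" if uw:"frc u : frc w *o frc ` A0" "u : A0" "w : A0" for u w proof -
 obtain b where b:"b : frc ` A0" "frc u = frc w * b" using uw(1) unfolding in_scaled by(rule bexE)
 then obtain a where a:"a : A0" "frc u = frc w * frc a" by blast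
 hence "u - w * a : P0" using frc_eq_iff[of u "w * a"] uw by(simp add:frc_mult A0_mult)
 moreover have "u = (u - w * a) + w * a" by simp
 ultimately show ?thesis using a(1) by(metis scaledI set_plus_intro)
 qed
 have yp:"y ^ k : A0" for k by(rule sr_power[OF sr_A0 yA])
 have e:"EX c. ALL g:frc ` A0. g ~: frc y *o frc ` A0 --> frc y ^ c : g *o frc ` A0"
 "ALL s:frc ` A0. s ~= 0 --> (EX k. frc y ^ k : s *o frc ` A0)" using escape unfolding escape_def by auto
 obtain c where c:"ALL g:frc ` A0. g ~: frc y *o frc ` A0 --> frc y ^ c : g *o frc ` A0" using e(1) by blast
 have "y ^ c : P0 + g *o A0" if g:"g : A0" "g ~: P0 + y *o A0" for g proof -
 have "frc g ~: frc y *o frc ` A0" using lift[OF _ g(1) yA] g(2) by blast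
 hence "frc (y ^ c) : frc g *o frc ` A0" using c g(1) yA by(simp add:frc_power)
 thus ?thesis by(rule lift[OF _ yp g(1)])
 qed
 moreover have "EX k. y ^ k : P0 + s *o A0" if s:"s : A0" "s ~: P0" for s proof -
 have "frc s ~= 0" using s by(simp add:frc_eq_0_iff)
 then obtain k where "frc (y ^ k) : frc s *o frc ` A0" using e(2) s(1) yA by(auto simp:frc_power)
 thus ?thesis using lift[OF _ yp s(1)] by blast
 qed
 ultimately show False using h(7) unfolding escape_def by blast
qed

section \<open>Finite birational extensions of a two-dimensional complete domain\<close>

lemma sm_mprod_ext: assumes "smod S M" shows "smod S (mul R I M)" unfolding smod_def proof(intro conjI ballI)
 show "0 : mul R I M" by(rule sm_0[OF sm_mprod])
 show "u + v : mul R I M" if "u : mul R I M" "v : mul R I M" for u v using that by(rule sm_add[OF sm_mprod])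
 fix s u assume s:"s : S" and u:"u : mul R I M"
 have "mul R I M <= {u. s * u : mul R I M}" proof(rule mul_least)
 show "smod R {u. s * u : mul R I M}" using sm_mprod[of R I M] by(auto simp:smod_def distrib_left mult.left_commute)
 fix i v assume "i : I" "v : M"
 hence "i * (s * v) : mul R I M" using sm_mult[OF assms s] by(intro mul_in)
 thus "i * v : {u. s * u : mul R I M}" by(simp add:mult.left_commute)
 qed
 thus "s * u : mul R I M" using u by blast
qed

lemma sm_ipow_ext:"smod S M ==> smod S (ipow R I M n)" by(induction n) (simp_all add:sm_mprod_ext)

lemma ipow_mono_scalars: assumes "R <= S" "I <= J" "M <= N" shows "ipow R I M n <= ipow S J N n" proof(induction n)
 case (Suc n)
 have "mul R I (ipow R I M n) <= mul S J (ipow S J N n)"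
 by(rule mul_least[OF sm_sub[OF sm_mprod assms(1)]]) (use Suc assms in \<open>auto intro:mul_in\<close>)
 thus ?case by simp
qed (use assms in simp)

lemma ipow_subset_ext:"smod S S ==> R <= S ==> I <= R ==> ipow R I S n <= S" by(rule ipow_subset[OF sm_sub])

text \<open>\<open>upper\<close> and \<open>lower\<close> together say that (x, y) has the same
  multiplicity e as m, and \<open>quot\<close> that proper quotients have dimension at most
  one.\<close>

locale surf = complete_local_ring R m for R m :: "'k::field set" + fixes x y :: 'k and e N0 C0 :: nat
 assumes xm:"x : m" and ym:"y : m" and prim:"ipow R m R N0 <= x *o R + y *o R"
 and upper:"!!n. 2 * len R R (ipow R (x *o R + y *o R) R n) <= enat (e * n ^ 2 + C0 * n)"
 and quot:"!!d. d : R ==> d ~= 0 ==> EX C. ALL n. len R R (d *o R + ipow R m R n) <= enat (C * n)"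
 and lower:"EX C. ALL n. enat (e * n ^ 2) <= 2 * len R R (ipow R m R n) + enat (C * n)" and e2:"e >= 2"
begin

abbreviation mR :: "nat => 'k set" where "mR n == ipow R m R n"
abbreviation Q :: "'k set" where "Q == x *o R + y *o R"

lemma xR:"x : R" and yR:"y : R" using xm ym m_le by auto

lemma sm_R:"smod R R" by(rule sm_self[OF sring])
lemma sm_mR:"smod R (mR n)" by(rule sm_ipow[OF sm_R])
lemma sm_Q:"smod R Q" by(intro sm_plus sm_scaled sm_R)
lemma Q_R:"Q <= R" by(rule plus_le[OF sm_R scaled_le[OF sm_R xR] scaled_le[OF sm_R yR]])
lemma Q_m:"Q <= m" using sm_mult[OF sm_m _ xm] sm_mult[OF sm_m _ ym]
 by(intro plus_le[OF sm_m]) (auto simp:in_scaled mult.commute)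

lemma mR_Q:"mR (n * N0) <= ipow R Q R n" by(rule ipow_ipow_subset[OF sring m_le prim])

lemma not_linear: assumes k:"k >= 1" and le:"!!n. len R R (mR (k * n)) <= enat (C * n)" shows False proof -
 obtain C' where C': "!!n. enat (e * n ^ 2) <= 2 * len R R (mR n) + enat (C' * n)" using lower by blast
 have "(e * k ^ 2) * n ^ 2 <= 0 * n ^ 2 + (2 * C + C' * k) * n" for n proof -
 have "enat (e * (k * n) ^ 2) <= 2 * len R R (mR (k * n)) + enat (C' * (k * n))" by(rule C')
 also have "... <= 2 * enat (C * n) + enat (C' * (k * n))" by(intro add_right_mono mult_left_mono le) simp
 finally show ?thesis by(simp add:numeral_eq_enat power_mult_distrib algebra_simps)
 qed
 hence "e * k ^ 2 <= 0" by(rule quad_le)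
 thus False using k e2 by simp
qed

text \<open>The rings S finite over R with the same fraction field; the common denominator d is what
  makes them finite modules (\<open>fin_fg\<close>).\<close>

definition fin :: "'k set => bool" where "fin S <-> sring S & R <= S & (EX d:R. d ~= 0 & d *o S <= R)"

lemma finD:"fin S ==> sring S" "fin S ==> R <= S" "fin S ==> smod S S" "fin S ==> smod R S" "fin S ==> x : S" "fin S ==> y : S"
 using sm_sub[OF sm_self, of S R] xR yR by(auto simp:fin_def sm_self)

lemma ipow_fin:"fin S ==> I <= R ==> ipow R I S n <= S" by(rule ipow_subset_ext[OF finD(3) finD(2)])

lemma fg_if_denominator: assumes S:"smod R S" and d:"d ~= 0" "d *o S <= R" shows "fg R S" proof -
 have "fg R (d *o S)" by(rule noeth_fg[OF sring noeth_ring sm_scaled[OF S] d(2)])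
 then obtain G where G:"finite G" "d *o S = span R G" by(auto simp:fg_def)
 have "S = inverse d *o (d *o S)" using d(1) by(simp add:scaled2)
 also have "... = span R ((*) (inverse d) ` G)" unfolding G(2) by(rule span_image_scale[symmetric])
 finally show ?thesis unfolding fg_def using G(1) by blast
qed

lemma fin_fg:"fin S ==> fg R S" using fg_if_denominator[OF finD(4)] by(auto simp:fin_def)

lemma fin_R:"fin R" proof -
 have "1 *o R <= R" by simp
 thus ?thesis unfolding fin_def using sring by(auto intro!: bexI[of _ 1])
qed

lemma x_pow:"x ^ n : R" and y_pow:"y ^ n : R" by(rule sr_power[OF sring xR], rule sr_power[OF sring yR])

text \<open>d kills S / R, so a colength in S exceeds the one in R by at most a multiple of the
  length of R / (d R + J), which \<open>quot\<close> makes linear.\<close>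

lemma len_ext: assumes S:"fin S"
 shows "EX g d. d : R & d ~= 0 & (ALL J J'. smod R J --> J <= R --> smod R J' --> J' <= S --> (ALL c:J. ALL s:S. c * s : J') -->
 len R S J' <= len R R J + of_nat g * len R R (d *o R + J))" proof -
 obtain d where d:"d : R" "d ~= 0" "d *o S <= R" using S by(auto simp:fin_def)
 obtain G where G:"finite G" "S = span R G" using fin_fg[OF S] by(auto simp:fg_def)
 have "len R S J' <= len R R J + of_nat (card G) * len R R (d *o R + J)"
 if J:"smod R J" "J <= R" "smod R J'" "J' <= S" "ALL c:J. ALL s:S. c * s : J'" for J J' proof -
 have sRJ:"smod R (R + J')" by(rule sm_plus[OF sm_R J(3)])
 have sub:"R + J' <= S" by(rule plus_le[OF finD(4)[OF S] finD(2)[OF S] J(4)])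
 have JJ': "J <= J'" using J(5) sr_1[OF finD(1)[OF S]] by fastforce
 have s1:"smod R (d *o R + J)" by(intro sm_plus sm_scaled sm_R J)
 have "len R (span R G + (R + J')) (R + J') <= of_nat (card G) * len R R (d *o R + J)"
 proof(rule len_span_le[OF sring G(1) sRJ s1])
 show "d *o R + J <= R" by(rule plus_le[OF sm_R scaled_le[OF sm_R d(1)] J(2)])
 fix c g assume "c : d *o R + J" and g:"g : G"
 then obtain u v where uv:"c = u + v" "u : d *o R" "v : J" by(blast elim:set_plus_elim)
 obtain w where w:"u = d * w" "w : R" using uv(2) by(auto simp:in_scaled)
 have gS:"g : S" unfolding G(2) using g span_inc[of G R] by blast
 have "w * (d * g) : R" by(rule sr_mult[OF sring w(2)]) (use d(3) gS in blast)
 hence "u * g : R" by(simp add:w(1) mult_ac)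
 thus "c * g : R + J'" unfolding uv(1) distrib_right using J(5) uv(3) gS by(intro set_plus_intro) blast+
 qed
 moreover have "span R G + (R + J') = S" unfolding G(2)[symmetric] by(rule plus_abs2[OF finD(4)[OF S] sRJ sub])
 ultimately have 1:"len R S (R + J') <= of_nat (card G) * len R R (d *o R + J)" by simp
 have "len R (R + J') J' = len R R (R Int J')" by(rule len_plus_Int[OF sring sm_R J(3)])
 also have "... <= len R R J" by(rule len_mono) (use JJ' J(2) in blast)
 finally have 2:"len R (R + J') J' <= len R R J" .
 have "len R S J' = len R S (R + J') + len R (R + J') J'"
 by(rule len_add[OF sring sRJ plus_ge2[OF sm_R] sub finD(4)[OF S] J(3)])
 thus ?thesis using add_mono[OF 1 2] by(simp add:add.commute)
 qed
 thus ?thesis using d by blast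
qed

text \<open>The converse comparison: d carries I^n S into I^n.\<close>

lemma len_res: assumes S:"fin S" shows "EX d. d : R & d ~= 0 & (ALL I n. smod R I --> I <= R -->
 len R R (ipow R I R n) <= len R S (ipow R I S n) + len R R (d *o R + ipow R I R n))" proof -
 obtain d where d:"d : R" "d ~= 0" "d *o S <= R" using S by(auto simp:fin_def)
 have "len R R (ipow R I R n) <= len R S (ipow R I S n) + len R R (d *o R + ipow R I R n)"
 if I:"smod R I" "I <= R" for I n proof -
 let ?I = "ipow R I R n" and ?J = "ipow R I S n"
 have sI:"smod R ?I" by(rule sm_ipow[OF sm_R])
 have sJ:"smod R ?J" by(rule sm_ipow[OF finD(4)[OF S]])
 have sd:"smod R (d *o R)" by(rule sm_scaled[OF sm_R])
 have IR:"?I <= R" by(rule ipow_subset[OF sm_R I(2)])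
 have JS:"?J <= S" by(rule ipow_fin[OF S I(2)])
 have "len R R ?I = len R R (d *o R + ?I) + len R (d *o R + ?I) ?I"
 by(rule len_add[OF sring sm_plus[OF sd sI] plus_ge2[OF sd] plus_le[OF sm_R scaled_le[OF sm_R d(1)] IR] sm_R sI])
 also have "len R (d *o R + ?I) ?I = len R R {r:R. d * r : ?I}" by(rule len_scaled[OF sring sm_R sI])
 also have "... <= len R R (R Int ?J)" proof(rule len_mono)
 have "d *o ?J = ipow R I (d *o S) n" by(rule ipow_scaled[symmetric])
 also have "... <= ?I" by(rule ipow_mono[OF order.refl d(3)])
 finally show "R Int ?J <= {r:R. d * r : ?I}" by blast
 qed
 also have "len R R (R Int ?J) = len R (R + ?J) ?J" by(rule len_plus_Int[OF sring sm_R sJ, symmetric])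
 also have "... <= len R S ?J" by(rule len_mono_left) (rule plus_le[OF finD(4)[OF S] finD(2)[OF S] JS])
 finally show ?thesis by(simp add:add.commute add_left_mono)
 qed
 thus ?thesis using d by blast
qed

text \<open>The gain to be proved, with S in place of R. By \<open>gd_descends\<close> its failure
  for R entails failure for every finite birational extension.\<close>

definition gd :: "'k set => bool" where "gd S <-> (EX C. ALL I M. smod R I --> I <= R --> mR M <= I -->
 (EX X l. (EX C'. ALL n. 2 * len R S (ipow R I S n) <= enat (X * n ^ 2 + C' * n)) &
 len R S (mul R I S) = enat l & X <= 2 * (e - 1) * (l + C * M)))"

lemma mul_R:"smod R I ==> mul R I R = I" using mul_cyclic_right[OF _ sring, of I 1] by simp

lemma gd_descends: assumes S:"fin S" "gd S" shows "gd R" proof -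
 obtain C where C:"!!I M. smod R I ==> I <= R ==> mR M <= I ==>
 EX X l. (EX C'. ALL n. 2 * len R S (ipow R I S n) <= enat (X * n ^ 2 + C' * n)) &
 len R S (mul R I S) = enat l & X <= 2 * (e - 1) * (l + C * M)" using S(2) unfolding gd_def by blast
 obtain g d where gd:"d : R" "d ~= 0" "!!J J'. smod R J ==> J <= R ==> smod R J' ==> J' <= S ==> (ALL c:J. ALL s:S. c * s : J') ==>
 len R S J' <= len R R J + of_nat g * len R R (d *o R + J)" using len_ext[OF S(1)] by blast
 obtain d' where d': "d' : R" "d' ~= 0" "!!I n. smod R I ==> I <= R ==>
 len R R (ipow R I R n) <= len R S (ipow R I S n) + len R R (d' *o R + ipow R I R n)" using len_res[OF S(1)] by blast
 obtain c where c:"!!n. len R R (d *o R + mR n) <= enat (c * n)" using quot[OF gd(1,2)] by blast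
 obtain c' where c': "!!n. len R R (d' *o R + mR n) <= enat (c' * n)" using quot[OF d'(1,2)] by blast
 show ?thesis unfolding gd_def proof(rule exI[of _ "C + g * c"], intro allI impI)
 fix I M assume I:"smod R I" "I <= R" "mR M <= I"
 obtain X l C' where X:"!!n. 2 * len R S (ipow R I S n) <= enat (X * n ^ 2 + C' * n)" "len R S (mul R I S) = enat l" "X <= 2 * (e - 1) * (l + C * M)"
 using C[OF I] by blast
 have "len R R I <= len R R (mR M)" by(rule len_mono[OF I(3)])
 hence "len R R I < \<infinity>" using len_ipow_finite[OF fg_self[OF sring], of M] by(rule le_less_trans)
 then obtain l0 where l0:"len R R I = enat l0" by(cases "len R R I") auto
 have "len R S (mul R I S) <= len R R I + of_nat g * len R R (d *o R + I)" proof(rule gd(3)[OF I(1,2) sm_mprod])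
 show "mul R I S <= S" using ipow_fin[OF S(1) I(2), of 1] by simp
 show "ALL c:I. ALL s:S. c * s : mul R I S" by(auto intro:mul_in)
 qed
 also have "... <= enat l0 + of_nat g * enat (c * M)" proof(rule add_mono[OF _ mult_left_mono])
 have "len R R (d *o R + I) <= len R R (d *o R + mR M)" by(intro len_mono plus_mono order.refl I(3))
 thus "len R R (d *o R + I) <= enat (c * M)" using c order_trans by blast
 qed (simp_all add:l0)
 finally have l:"l <= l0 + g * (c * M)" unfolding X(2) by(simp add:of_nat_eq_enat)
 have "2 * len R R (ipow R I R n) <= enat (X * n ^ 2 + (C' + 2 * c' * M) * n)" for n proof -
 have "len R R (d' *o R + ipow R I R n) <= len R R (d' *o R + mR (n * M))"
 by(intro len_mono plus_mono order.refl ipow_ipow_subset[OF sring m_le I(3)])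
 also have "... <= enat (c' * (n * M))" by(rule c')
 finally have "len R R (ipow R I R n) <= len R S (ipow R I S n) + enat (c' * (n * M))"
 using d'(3)[OF I(1,2), of n] by(meson add_left_mono order_trans)
 hence "2 * len R R (ipow R I R n) <= 2 * (len R S (ipow R I S n) + enat (c' * (n * M)))" by(rule mult_left_mono) simp
 also have "... <= enat (X * n ^ 2 + C' * n) + enat (2 * c' * M * n)"
 unfolding distrib_left by(rule add_mono[OF X(1)]) (simp add:numeral_eq_enat mult_ac)
 finally show ?thesis by(simp add:distrib_right add.assoc)
 qed
 moreover have "X <= 2 * (e - 1) * (l0 + (C + g * c) * M)" proof -
 have "l + C * M <= l0 + (C + g * c) * M" using l by(simp add:algebra_simps)
 hence "2 * (e - 1) * (l + C * M) <= 2 * (e - 1) * (l0 + (C + g * c) * M)" by(rule mult_left_mono) simp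
 thus ?thesis using X(3) by(rule order_trans[rotated])
 qed
 ultimately show "EX X l. (EX C'. ALL n. 2 * len R R (ipow R I R n) <= enat (X * n ^ 2 + C' * n)) &
 len R R (mul R I R) = enat l & X <= 2 * (e - 1) * (l + (C + g * c) * M)"
 unfolding mul_R[OF I(1)] using l0 by blast
 qed
qed

text \<open>Otherwise S / z^n S has linear length; as d carries z^n S into m^n, so would R / m^n,
  against \<open>lower\<close>.\<close>

lemma not_one_generated: assumes S:"fin S" and in1:"mR k <= z *o S" and z:"z : m" shows False proof -
 have zR:"z : R" using z m_le by blast
 have zSS:"z *o S <= S" by(rule scaled_le[OF finD(4)[OF S] zR])
 have fin1:"len R S (z *o S) < \<infinity>"
 proof(rule len_finite_if_killed[OF sring fin_fg[OF S] sm_scaled[OF finD(4)[OF S]] zSS sm_mR[of k]])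
 show "mR k <= R" by(rule ipow_subset[OF sm_R m_le])
 show "len R R (mR k) < \<infinity>" by(rule len_ipow_finite[OF fg_self[OF sring]])
 show "c * g : z *o S" if "c : mR k" "g : S" for c g
 using in1 that sm_mult[OF sm_scaled[OF finD(3)[OF S]], of g c z] by(auto simp:mult.commute)
 qed
 then obtain w where w:"len R S (z *o S) = enat w" by(cases "len R S (z *o S)") auto
 obtain d where d:"d : R" "d ~= 0" "d *o S <= R" using S by(auto simp:fin_def)
 obtain c where c:"!!n. len R R (d *o R + mR n) <= enat (c * n)" using quot[OF d(1,2)] by blast
 have "len R R (mR (1 * n)) <= enat ((c + w) * n)" for n proof -
 have sd:"smod R (d *o R)" by(rule sm_scaled[OF sm_R])
 have sz:"smod R ((z ^ n) *o S)" by(rule sm_scaled[OF finD(4)[OF S]])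
 have zn:"z ^ n * r : mR n" if "r : R" for r using ipow_power_in[OF z that] .
 have znS:"(z ^ n) *o S <= S" by(rule scaled_le[OF finD(4)[OF S] sr_power[OF sring zR]])
 have "len R R (mR n) = len R R (d *o R + mR n) + len R (d *o R + mR n) (mR n)"
 by(rule len_add[OF sring sm_plus[OF sd sm_mR] plus_ge2[OF sd]
 plus_le[OF sm_R scaled_le[OF sm_R d(1)] ipow_subset[OF sm_R m_le]] sm_R sm_mR])
 also have "len R (d *o R + mR n) (mR n) = len R R {r:R. d * r : mR n}" by(rule len_scaled[OF sring sm_R sm_mR])
 also have "... <= len R R (R Int (z ^ n) *o S)" proof(rule len_mono, rule subsetI)
 fix r assume r:"r : R Int (z ^ n) *o S"
 then obtain s where s:"s : S" "r = z ^ n * s" by(auto simp:in_scaled)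
 hence "d * s : R" using d(3) by blast
 hence "z ^ n * (d * s) : mR n" by(rule zn)
 thus "r : {r:R. d * r : mR n}" using r s by(simp add:mult_ac)
 qed
 also have "len R R (R Int (z ^ n) *o S) = len R (R + (z ^ n) *o S) ((z ^ n) *o S)"
 by(rule len_plus_Int[OF sring sm_R sz, symmetric])
 also have "... <= len R S ((z ^ n) *o S)" by(rule len_mono_left) (rule plus_le[OF finD(4)[OF S] finD(2)[OF S] znS])
 also have "... = len R S ((z ^ n) *o S + {0})" by(simp add:add.commute[of _ "{0}"])
 also have "... <= of_nat n * len R S (z *o S + {0})"
 by(rule len_power_le[OF sring finD(4)[OF S] sm_zero _ zSS]) (use sm_0[OF finD(4)[OF S]] in \<open>auto simp:in_scaled\<close>)
 also have "... = enat (n * w)" by(simp add:add.commute[of _ "{0}"] w of_nat_eq_enat)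
 finally have "len R R (mR n) <= len R R (d *o R + mR n) + enat (n * w)" by(simp add:add_left_mono)
 also have "... <= enat (c * n) + enat (n * w)" by(rule add_right_mono[OF c])
 finally show ?thesis by(simp add:algebra_simps)
 qed
 thus False by(intro not_linear[of 1]) auto
qed

lemma x_nonzero:"x ~= 0" proof
 assume "x = 0"
 hence "mR N0 <= {0} + y *o R" using prim by(auto simp:in_scaled elim!: set_plus_elim)
 thus False using not_one_generated[OF fin_R _ ym, of N0] by simp
qed

text \<open>By the pigeonhole principle a power of m would lie in x S.\<close>

lemma y_power_notin: assumes S:"fin S" shows "y ^ N ~: x *o S" proof
 assume yN:"y ^ N : x *o S"
 have sx:"smod S (x *o S)" by(rule sm_scaled[OF finD(3)[OF S]])
 have xS:"x *o S <= S" by(rule scaled_le[OF finD(3)[OF S] finD(5)[OF S]])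
 have "mR ((1 + N) * N0) <= ipow R Q R (1 + N)" by(rule mR_Q)
 also have "... <= ipow S (y *o S + x *o S) S (1 + N)"
 using ipow_mono_scalars[OF finD(2)[OF S] plus_mono[OF scaled_mono[OF finD(2)[OF S]] scaled_mono[OF finD(2)[OF S]]] finD(2)[OF S], of y x "1 + N"]
 by(simp add:add.commute)
 also have "... <= ipow S (x *o S) S 1 + (y ^ N) *o S"
 by(rule ipow_pigeonhole[OF finD(1)[OF S] sx finD(3)[OF S] xS finD(6)[OF S]])
 also have "ipow S (x *o S) S 1 = x *o S" by(simp add:mul_cyclic finD[OF S])
 also have "x *o S + (y ^ N) *o S <= x *o S" proof(rule plus_le[OF sx order.refl])
 show "(y ^ N) *o S <= x *o S" using sm_mult[OF sx _ yN] by(auto simp:in_scaled mult.commute)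
 qed
 finally show False by(rule not_one_generated[OF S _ xm])
qed

text \<open>y is a nonzerodivisor modulo x S, so x, y is a regular sequence on S.\<close>

definition adm :: "'k set => bool" where "adm S <-> fin S & (ALL s:S. y * s : x *o S --> s : x *o S)"

lemma adm_power:"adm S ==> s : S ==> y ^ n * s : x *o S ==> s : x *o S" proof(induction n)
 case (Suc n)
 have f:"fin S" using Suc.prems by(simp add:adm_def)
 have "y ^ n * s : S" using Suc.prems finD[OF f] by(auto intro:sr_mult sr_power)
 moreover have "y * (y ^ n * s) : x *o S" using Suc.prems by(simp add:mult_ac)
 ultimately have "y ^ n * s : x *o S" using Suc.prems(1) unfolding adm_def by blast
 thus ?case by(rule Suc.IH[OF Suc.prems(1,2)])
qed simp

text \<open>The sections of S over the complement of the closed point; passing to them produces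
  depth two.\<close>

definition star :: "'k set => 'k set" where "star S = {s. EX n. x ^ n * s : S & y ^ n * s : S}"

text \<open>Finiteness of \<open>star S\<close>. Let a n be the y-saturation of x^n S. Once a n lies
  in x S for all large n, surplus powers of x can be divided off. The a n intersect in 0, so
  Chevalley makes them small, and small elements of a 1 lie in x S because a 1 / x S has finite
  length.\<close>

lemma star_bound: assumes S:"fin S" shows "EX n. ALL s:star S. x ^ n * s : S" proof -
 define a where "a n = {s:S. EX N. y ^ N * s : (x ^ n) *o S}" for n
 note sr = finD(1)[OF S]
 have sx:"smod S ((x ^ n) *o S)" for n by(rule sm_scaled[OF finD(3)[OF S]])
 have yS:"y ^ n : S" and xS:"x ^ n : S" for n using sr_power[OF sr] finD[OF S] by auto
 have sa:"smod S (a n)" for n unfolding a_def using sm_saturation[OF sr _ sx] yS[of 1] by simp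
 have saR:"smod R (a n)" for n by(rule sm_sub[OF sa finD(2)[OF S]])
 have aS:"a n <= S" for n by(auto simp:a_def)
 have xdec:"(x ^ Suc n) *o S <= (x ^ n) *o S" for n proof -
 have "(x ^ Suc n) *o S = (x ^ n) *o (x *o S)" by(simp add:scaled2 mult.commute)
 also have "... <= (x ^ n) *o S" by(rule scaled_mono[OF scaled_le[OF finD(3)[OF S] finD(5)[OF S]]])
 finally show ?thesis .
 qed
 have adec:"a (Suc n) <= a n" for n using xdec[of n] by(auto simp:a_def)
 have Int:"(\<Inter>n. a n) <= {0}" proof
 fix s assume s:"s : (\<Inter>n. a n)"
 show "s : {0}" proof(rule ccontr)
 assume "s ~: {0}"
 hence s0:"s ~= 0" "s : S" using s aS by auto
 \<comment> \<open>For s in all a n, stability of this ascending chain yields a power of y times s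
   equal to x b s, so that power of y would lie in x S.\<close>
 define C where "C n = {t:S. EX N. EX b:S. y ^ N * (x ^ n * t) = b * s}" for n
 have "EX N. ALL n>=N. C n = C N" proof(rule noethD[OF fg_noeth[OF sring noeth_ring fin_fg[OF S]]])
 show "smod R (C n)" for n unfolding smod_def proof(intro conjI ballI)
 show "0 : C n" using sm_0[OF finD(3)[OF S]] by(auto simp:C_def)
 fix t u assume "t : C n" "u : C n"
 then obtain k l b c where h:"y ^ k * (x ^ n * t) = b * s" "y ^ l * (x ^ n * u) = c * s" "b : S" "c : S" "t : S" "u : S"
 by(auto simp:C_def)
 have "y ^ (k + l) * (x ^ n * (t + u)) = y ^ l * (y ^ k * (x ^ n * t)) + y ^ k * (y ^ l * (x ^ n * u))"
 by(simp add:power_add algebra_simps)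
 also have "... = (y ^ l * b + y ^ k * c) * s" unfolding h by(simp add:algebra_simps)
 finally have "y ^ (k + l) * (x ^ n * (t + u)) = (y ^ l * b + y ^ k * c) * s" .
 moreover have "y ^ l * b + y ^ k * c : S" using h yS by(intro sr_add[OF sr] sr_mult[OF sr])
 ultimately show "t + u : C n" using h sr_add[OF sr] unfolding C_def by blast
 next
 fix r t assume r:"r : R" "t : C n"
 then obtain k b where h:"y ^ k * (x ^ n * t) = b * s" "b : S" "t : S" by(auto simp:C_def)
 have "y ^ k * (x ^ n * (r * t)) = (r * b) * s" using h(1) by(metis mult.assoc mult.left_commute)
 thus "r * t : C n" using h r finD(2)[OF S] sr_mult[OF sr] unfolding C_def by blast
 qed
 show "C n <= S" for n by(auto simp:C_def)
 show "C n <= C (Suc n)" for n proof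
 fix t assume "t : C n"
 then obtain k b where h:"y ^ k * (x ^ n * t) = b * s" "b : S" "t : S" by(auto simp:C_def)
 have "y ^ k * (x ^ Suc n * t) = x * (y ^ k * (x ^ n * t))" by(simp add:mult_ac)
 also have "... = (x * b) * s" unfolding h by(simp add:mult_ac)
 finally show "t : C (Suc n)" using h finD(5)[OF S] sr_mult[OF sr] unfolding C_def by blast
 qed
 qed
 then obtain n where "C (Suc n) = C n" by(metis le_SucI order.refl)
 moreover have "s : a (Suc n)" using s by blast
 then obtain N t where t:"t : S" "y ^ N * s = x ^ Suc n * t" unfolding a_def in_scaled by blast
 moreover have "t : C (Suc n)" unfolding C_def using t yS by(auto intro!: exI[of _ 0] bexI[of _ "y ^ N"])
 ultimately obtain k b where kb:"y ^ k * (x ^ n * t) = b * s" "b : S" by(auto simp:C_def)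
 have "y ^ (k + N) * s = y ^ k * (x ^ Suc n * t)" using t(2) by(simp add:power_add mult.assoc)
 also have "... = x * (y ^ k * (x ^ n * t))" by(simp add:mult_ac)
 also have "... = (x * b) * s" unfolding kb by(simp add:mult_ac)
 finally have "y ^ (k + N) = x * b" using s0 by simp
 hence "y ^ (k + N) : x *o S" using scaledI[OF kb(2), of x] by(simp only:)
 thus False using y_power_notin[OF S] by blast
 qed
 qed
 \<comment> \<open>This chain descends to x S by Krull's theorem and is stationary by finite
   length.\<close>
 define F where "F k = a 1 Int (x *o S + ipow R m S k)" for k
 have sm:"smod R (ipow R m S k)" for k by(rule sm_ipow[OF finD(4)[OF S]])
 have sxR:"smod R (x *o S)" by(rule sm_scaled[OF finD(4)[OF S]])
 have sF:"smod R (F k)" for k unfolding F_def by(intro sm_Int saR sm_plus sxR sm)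
 have xa:"x *o S <= a 1" proof
 fix u assume u:"u : x *o S"
 moreover have "u : S" using u scaled_le[OF finD(3)[OF S] finD(5)[OF S]] by blast
 ultimately show "u : a 1" by(auto simp:a_def intro!: exI[of _ 0])
 qed
 have FxS:"x *o S <= F k" for k unfolding F_def using xa plus_ge1[OF sm] by blast
 have lena:"len R (a 1) (x *o S) < \<infinity>" proof -
 have fga:"fg R (a 1)" by(rule fg_sub[OF fin_fg[OF S] saR aS])
 then obtain G where G:"finite G" "a 1 = span R G" by(auto simp:fg_def)
 have "EX N. ALL s:a 1. y ^ N * s : x *o S" proof -
 have "ALL g:G. EX N. y ^ N * g : x *o S" using span_inc[of G R] G(2) by(auto simp:a_def)
 then obtain f where f:"ALL g:G. y ^ (f g) * g : x *o S" by(rule bchoice[THEN exE])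
 have "span R G <= {s. y ^ (SUM g:G. f g) * s : x *o S}" proof(rule span_least)
 show "smod R {s. y ^ (SUM g:G. f g) * s : x *o S}" using sxR by(auto simp:smod_def distrib_left mult.left_commute)
 show "G <= {s. y ^ (SUM g:G. f g) * s : x *o S}" proof
 fix g assume g:"g : G"
 have e1:"y ^ (SUM g:G. f g) * g = y ^ (SUM g:G - {g}. f g) * (y ^ f g * g)"
 using sum.remove[OF G(1) g, of f] by(simp add:power_add mult_ac)
 have "y ^ (SUM g:G - {g}. f g) * (y ^ f g * g) : x *o S" by(rule sm_mult[OF sxR y_pow]) (use f g in blast)
 thus "g : {s. y ^ (SUM g:G. f g) * s : x *o S}" unfolding mem_Collect_eq e1 .
 qed
 qed
 thus ?thesis using G(2) by blast
 qed
 then obtain N where N:"!!s. s : a 1 ==> y ^ N * s : x *o S" by blast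
 let ?c = "ipow R Q R (1 + N)"
 show ?thesis proof(rule len_finite_if_killed[OF sring fga sxR xa])
 show "smod R ?c" by(rule sm_ipow[OF sm_R])
 show "?c <= R" by(rule ipow_subset[OF sm_R Q_R])
 show "len R R ?c < \<infinity>"
 using len_mono[OF mR_Q] len_ipow_finite[OF fg_self[OF sring]] by(rule le_less_trans)
 fix c s assume c:"c : ?c" and s:"s : a 1"
 have "ipow R (y *o R + x *o R) R (1 + N) <= ipow R (x *o R) R 1 + (y ^ N) *o R"
 by(rule ipow_pigeonhole[OF sring sm_scaled[OF sm_R] sm_R scaled_le[OF sm_R xR] yR])
 moreover have "ipow R (x *o R) R 1 = x *o R" by(simp add:mul_cyclic sm_R sring)
 ultimately have "c : x *o R + (y ^ N) *o R" using c by(auto simp:add.commute)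
 then obtain u v where uv:"c = x * u + y ^ N * v" "u : R" "v : R" by(auto elim!: set_plus_elim simp:in_scaled)
 have "u * s : S" using uv s aS finD(2)[OF S] by(intro sr_mult[OF sr]) auto
 hence "x * (u * s) + v * (y ^ N * s) : x *o S" by(intro sm_add[OF sxR] sm_mult[OF sxR uv(3)] N s scaledI)
 thus "c * s : x *o S" by(simp add:uv(1) algebra_simps)
 qed
 qed
 have "EX N. ALL n>=N. F n = F N" proof(rule descending_stable[OF sring saR sxR xa lena sF FxS])
 show "F n <= a 1" for n by(auto simp:F_def)
 show "F (Suc n) <= F n" for n
 unfolding F_def using plus_mono[OF order.refl ipow_antimono[OF finD(4)[OF S] m_le, of n "Suc n"], of "x *o S"] by auto
 qed
 then obtain K where K:"!!n. n >= K ==> F n = F K" by blast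
 have FK:"F K <= x *o S" proof
 fix u assume u:"u : F K"
 have "u : x *o S + ipow R m S k" for k proof -
 have "u : F (max k K)" using u K[of "max k K"] by simp
 hence "u : x *o S + ipow R m S (max k K)" by(simp add:F_def)
 thus ?thesis using plus_mono[OF order.refl ipow_antimono[OF finD(4)[OF S] m_le, of k "max k K"], of "x *o S"] by auto
 qed
 thus "u : x *o S" by(rule krull_mem[OF fin_fg[OF S] sxR scaled_le[OF finD(3)[OF S] finD(5)[OF S]]])
 qed
 have "EX n. a n <= (\<Inter>n. a n) + ipow R m S K" by(rule chevalley[where F = a, OF fin_fg[OF S] saR aS adec])
 then obtain n0 where n0:"a n0 <= (\<Inter>n. a n) + ipow R m S K" by blast
 hence "a n0 <= {0} + ipow R m S K" using plus_mono[OF Int order.refl, of "ipow R m S K"] by blast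
 hence n1:"a (Suc n0) <= ipow R m S K" using adec[of n0] by simp
 have a1:"a (Suc n) <= a 1" for n proof(induction n)
 case (Suc n) thus ?case using adec[of "Suc n"] by blast
 qed simp
 have ax:"a (Suc n0) <= x *o S" using n1 a1[of n0] FK plus_ge2[OF sxR, of "ipow R m S K"] unfolding F_def by blast
 have an:"a n <= x *o S" if "n >= Suc n0" for n using that by(induction n rule:dec_induct) (use ax adec in blast)+
 have "x ^ Suc n0 * s : S" if s:"s : star S" for s proof -
 obtain n where n:"x ^ n * s : S" "y ^ n * s : S" using s by(auto simp:star_def)
 define i where "i = (LEAST i. x ^ i * s : S)"
 have i:"x ^ i * s : S" unfolding i_def by(rule LeastI[of "%i. x ^ i * s : S"]) (rule n)
 have "i <= Suc n0" proof(rule ccontr)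
 assume ni:"~ i <= Suc n0"
 have e:"y ^ n * (x ^ i * s) = x ^ i * (y ^ n * s)" by(simp add:mult_ac)
 have "y ^ n * (x ^ i * s) : (x ^ i) *o S" unfolding e by(rule scaledI[OF n(2)])
 hence "x ^ i * s : a i" unfolding a_def using i by blast
 hence "x ^ i * s : x *o S" using an[of i] ni by auto
 then obtain t where t:"t : S" "x ^ i * s = x * t" by(auto simp:in_scaled)
 obtain i' where i': "i = Suc i'" using ni by(cases i) auto
 hence "x ^ i' * s : S" using t x_nonzero by simp
 hence "i <= i'" unfolding i_def by(rule Least_le)
 thus False using i' by simp
 qed
 hence e:"x ^ Suc n0 * s = x ^ (Suc n0 - i) * (x ^ i * s)" by(simp add:mult.assoc[symmetric] del:power_Suc flip: power_add)
 show ?thesis unfolding e by(rule sr_mult[OF sr xS i])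
 qed
 thus ?thesis by blast
qed

lemma adm_star: assumes S:"fin S" shows "adm (star S)" "S <= star S" proof -
 note sr = finD(1)[OF S]
 have yS:"y ^ n : S" and xS:"x ^ n : S" for n using sr_power[OF sr] finD[OF S] by auto
 show sub:"S <= star S" unfolding star_def by(auto intro!: exI[of _ 0])
 have up:"x ^ (n + k) * s : S & y ^ (n + k) * s : S" if "x ^ n * s : S" "y ^ n * s : S" for n k s
 using sr_mult[OF sr xS[of k] that(1)] sr_mult[OF sr yS[of k] that(2)] by(simp add:power_add mult_ac)
 obtain n0 where n0:"!!s. s : star S ==> x ^ n0 * s : S" using star_bound[OF S] by blast
 obtain d where d:"d : R" "d ~= 0" "d *o S <= R" using S by(auto simp:fin_def)
 have "sring (star S)" unfolding sring_def proof(intro conjI ballI)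
 show "1 : star S" using sub sr_1[OF sr] by blast
 fix s t assume "s : star S" "t : star S"
 then obtain n k where nk:"x ^ n * s : S" "y ^ n * s : S" "x ^ k * t : S" "y ^ k * t : S" by(auto simp:star_def)
 have "x ^ (n + k) * (s - t) : S" "y ^ (n + k) * (s - t) : S"
 using up[OF nk(1,2), of k] up[OF nk(3,4), of n] sr_diff[OF sr] by(simp_all add:right_diff_distrib add.commute)
 thus "s - t : star S" unfolding star_def by blast
 have "x ^ (n + k) * (s * t) : S" "y ^ (n + k) * (s * t) : S"
 using sr_mult[OF sr nk(1,3)] sr_mult[OF sr nk(2,4)] by(simp_all add:power_add mult_ac)
 thus "s * t : star S" unfolding star_def by blast
 qed
 moreover have "(d * x ^ n0) *o star S <= R" proof
 fix u assume "u : (d * x ^ n0) *o star S"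
 then obtain s where s:"s : star S" "u = d * (x ^ n0 * s)" by(auto simp:in_scaled mult.assoc)
 thus "u : R" using d(3) n0 by blast
 qed
 moreover have "d * x ^ n0 : R" "d * x ^ n0 ~= 0" using d x_pow x_nonzero by(auto intro:sr_mult[OF sring])
 ultimately have fs:"fin (star S)" unfolding fin_def using sub finD(2)[OF S] by blast
 have "s : x *o star S" if s:"s : star S" "y * s : x *o star S" for s proof -
 obtain t where t:"t : star S" "y * s = x * t" using s(2) by(auto simp:in_scaled)
 obtain n k where nk:"x ^ n * s : S" "y ^ n * s : S" "x ^ k * t : S" "y ^ k * t : S" using s(1) t(1) by(auto simp:star_def)
 let ?w = "s / x"
 have "x ^ Suc (n + k) * ?w = x ^ (n + k) * s" using x_nonzero by simp
 hence 1:"x ^ Suc (n + k) * ?w : S" using up[OF nk(1,2), of k] by simp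
 have yt:"y * s / x = t" using t(2) x_nonzero by simp
 have "y ^ Suc (n + k) * ?w = y ^ (k + n) * (y * s / x)" by(simp add:mult_ac add.commute)
 hence "y ^ Suc (n + k) * ?w = y ^ (k + n) * t" unfolding yt .
 hence 2:"y ^ Suc (n + k) * ?w : S" using up[OF nk(3,4), of n] by simp
 have "?w : star S" unfolding star_def using 1 2 by blast
 moreover have "s = x * ?w" using x_nonzero by simp
 ultimately show ?thesis by(metis scaledI)
 qed
 thus "adm (star S)" unfolding adm_def using fs by blast
qed

text \<open>For a regular sequence the graded ring of Q S is a polynomial ring in two variables over
  S / Q S. Its n-th piece has length at least (n + 1) L, so twice the length of S / Q^n S is at
  least n (n + 1) L; compare with \<open>upper\<close>.\<close>

theorem len_parameters_le: assumes S:"adm S" shows "len R S (x *o S + y *o S) <= enat e" proof -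
 have f:"fin S" using S by(simp add:adm_def)
 have sS:"smod R S" by(rule finD(4)[OF f])
 let ?q = "%n. ipow R Q S n"
 have sq:"smod R (?q n)" for n by(rule sm_ipow[OF sS])
 have qS:"?q n <= S" for n by(rule ipow_fin[OF f Q_R])
 have qSuc:"?q (Suc n) = x *o ?q n + y *o ?q n" for n by(simp add:mul_plus_left sm_scaled sm_R mul_cyclic sq sring)
 have qdec:"?q (Suc n) <= ?q n" for n by(rule ipow_antimono[OF sS]) (use Q_R finD(2)[OF f] in auto)
 have sc:"smod R (z *o ?q n)" "smod R (z *o S)" for z n by(rule sm_scaled[OF sq], rule sm_scaled[OF sS])
 have q2:"?q (Suc n) = x *o ?q n + (y ^ Suc n) *o S" for n proof(induction n)
 case 0
 show ?case using qSuc[of 0] by simp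
 next
 case (Suc n)
 have "?q (Suc (Suc n)) = x *o ?q (Suc n) + y *o (x *o ?q n + (y ^ Suc n) *o S)" using qSuc[of "Suc n"] Suc by simp
 also have "... = (x *o ?q (Suc n) + x *o (y *o ?q n)) + (y ^ Suc (Suc n)) *o S"
 by(simp add:scaled_plus scaled2 add.assoc mult_ac)
 also have "x *o ?q (Suc n) + x *o (y *o ?q n) = x *o ?q (Suc n)" proof(rule plus_abs2[OF sc(1)])
 show "smod R (x *o (y *o ?q n))" by(rule sm_scaled[OF sc(1)])
 show "x *o (y *o ?q n) <= x *o ?q (Suc n)" unfolding qSuc by(rule scaled_mono[OF plus_ge2[OF sc(1)]])
 qed
 finally show ?case .
 qed
 define L where "L = len R S (x *o S + y *o S)"
 have q1:"?q 1 = x *o S + y *o S" using qSuc[of 0] by simp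
 \<comment> \<open>Split the graded piece by the multiples of x: modulo \<open>?W\<close> the powers
   of y contribute at least S / Q S, and inside \<open>?W\<close> multiplication by x reproduces at
   least the previous piece.\<close>
 have step:"L + len R (?q n) (?q (Suc n)) <= len R (?q (Suc n)) (?q (Suc (Suc n)))" for n proof -
 let ?W = "x *o ?q n + ?q (Suc (Suc n))"
 have sW:"smod R ?W" by(rule sm_plus[OF sc(1) sq])
 have xq:"x *o ?q n <= ?q (Suc n)" unfolding qSuc[of n] by(rule plus_ge1[OF sc(1)])
 have Wq:"?W <= ?q (Suc n)" by(rule plus_le[OF sq xq qdec])
 have W:"?W = x *o ?q n + (y ^ Suc (Suc n)) *o S" proof -
 have "?W = (x *o ?q n + x *o ?q (Suc n)) + (y ^ Suc (Suc n)) *o S" by(simp only:q2[of "Suc n"] add.assoc)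
 also have "x *o ?q n + x *o ?q (Suc n) = x *o ?q n" by(rule plus_abs2[OF sc(1) sc(1) scaled_mono[OF qdec]])
 finally show ?thesis .
 qed
 have "len R (?q (Suc n)) (?q (Suc (Suc n))) = len R (?q (Suc n)) ?W + len R ?W (?q (Suc (Suc n)))"
 by(rule len_add[OF sring sW plus_ge2[OF sc(1)] Wq sq sq])
 moreover have "L <= len R (?q (Suc n)) ?W" proof -
 have "(y ^ Suc n) *o S <= ?q (Suc n)" unfolding q2[of n] by(rule plus_ge2[OF sc(1)])
 hence "(y ^ Suc n) *o S + ?W <= ?q (Suc n)" by(rule plus_le[OF sq _ Wq])
 hence "len R ((y ^ Suc n) *o S + ?W) ?W <= len R (?q (Suc n)) ?W" by(rule len_mono_left)
 moreover have "len R ((y ^ Suc n) *o S + ?W) ?W = len R S {s:S. y ^ Suc n * s : ?W}" by(rule len_scaled[OF sring sS sW])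
 moreover have "L <= len R S {s:S. y ^ Suc n * s : ?W}" unfolding L_def proof(rule len_mono, rule subsetI)
 fix s assume "s : {s:S. y ^ Suc n * s : ?W}"
 hence s:"s : S" "y ^ Suc n * s : x *o ?q n + (y ^ Suc (Suc n)) *o S" by(simp_all only:W mem_Collect_eq)
 from s(2) obtain u v where uv:"y ^ Suc n * s = u + v" "u : x *o ?q n" "v : (y ^ Suc (Suc n)) *o S" by(rule set_plus_elim)
 obtain q t where qt:"u = x * q" "q : ?q n" "v = y ^ Suc (Suc n) * t" "t : S" using uv by(auto simp:in_scaled)
 have "y ^ Suc n * (s - y * t) = x * q" using uv(1) qt by(simp add:algebra_simps)
 hence "y ^ Suc n * (s - y * t) : x *o S" using qt(2) qS[of n] scaledI[of q S x] by auto
 moreover have "s - y * t : S" using s(1) qt(4) finD[OF f] by(intro sr_diff sr_mult) auto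
 ultimately have "s - y * t : x *o S" by(rule adm_power[OF S, rotated])
 hence "(s - y * t) + y * t : x *o S + y *o S" using qt(4) by(intro set_plus_intro scaledI)
 thus "s : x *o S + y *o S" by simp
 qed
 ultimately show ?thesis by simp
 qed
 moreover have "len R (?q n) (?q (Suc n)) <= len R ?W (?q (Suc (Suc n)))" proof -
 have "len R ?W (?q (Suc (Suc n))) = len R (?q n) {q:?q n. x * q : ?q (Suc (Suc n))}" by(rule len_scaled[OF sring sq sq])
 moreover have "len R (?q n) (?q (Suc n)) <= len R (?q n) {q:?q n. x * q : ?q (Suc (Suc n))}"
 proof(rule len_mono, rule subsetI)
 fix q assume "q : {q:?q n. x * q : ?q (Suc (Suc n))}"
 hence q:"q : ?q n" "x * q : x *o ?q (Suc n) + (y ^ Suc (Suc n)) *o S" by(simp_all only:q2[of "Suc n"] mem_Collect_eq)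
 from q(2) obtain u v where uv:"x * q = u + v" "u : x *o ?q (Suc n)" "v : (y ^ Suc (Suc n)) *o S" by(rule set_plus_elim)
 obtain q' t where qt:"u = x * q'" "q' : ?q (Suc n)" "v = y ^ Suc (Suc n) * t" "t : S" using uv by(auto simp:in_scaled)
 have e1:"y ^ Suc (Suc n) * t = x * (q - q')" using uv(1) qt by(simp add:algebra_simps)
 moreover have "q - q' : S" using q(1) qt(2) qS by(intro sr_diff[OF finD(1)[OF f]]) blast+
 ultimately have "y ^ Suc (Suc n) * t : x *o S" using scaledI by metis
 hence "t : x *o S" by(rule adm_power[OF S qt(4)])
 then obtain t' where t': "t' : S" "t = x * t'" by(auto simp:in_scaled)
 have "x * (q - q') = y ^ Suc (Suc n) * t" using e1 by(rule sym)
 also have "... = x * (y ^ Suc (Suc n) * t')" unfolding t'(2) by(simp add:mult_ac)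
 finally have "x * (q - q') = x * (y ^ Suc (Suc n) * t')" .
 hence "q - q' = y ^ Suc (Suc n) * t'" unfolding mult_left_cancel[OF x_nonzero] .
 hence "q = q' + y ^ Suc (Suc n) * t'" by(simp only:diff_eq_eq add.commute)
 hence "q = q' + y * (y ^ Suc n * t')" by(simp only:power_Suc mult.assoc)
 moreover have "y ^ Suc n * t' : ?q (Suc n)"
 unfolding q2[of n] using scaledI[OF t'(1), of "y ^ Suc n"] plus_ge2[OF sc(1), of "(y ^ Suc n) *o S" x n] by blast
 ultimately show "q : ?q (Suc n)" using sm_add[OF sq qt(2) sm_mult[OF sq yR, of "y ^ Suc n * t'" "Suc n"]] by(simp only:)
 qed
 ultimately show ?thesis by simp
 qed
 ultimately show ?thesis using add_mono by metis
 qed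
 have grad:"of_nat (Suc n) * L <= len R (?q n) (?q (Suc n))" for n proof(induction n)
 case 0
 show ?case using q1 by(simp add:L_def)
 next
 case (Suc n)
 have "of_nat (Suc (Suc n)) * L = L + of_nat (Suc n) * L" by(simp add:distrib_right)
 also have "... <= L + len R (?q n) (?q (Suc n))" by(rule add_left_mono[OF Suc])
 finally show ?case using step[of n] by(rule order_trans)
 qed
 have tot:"of_nat (n * (n + 1)) * L <= 2 * len R S (?q n)" for n proof(induction n)
 case (Suc n)
 have "len R S (?q (Suc n)) = len R S (?q n) + len R (?q n) (?q (Suc n))" by(rule len_add[OF sring sq qdec qS sS sq])
 hence "2 * len R S (?q (Suc n)) = 2 * len R S (?q n) + 2 * len R (?q n) (?q (Suc n))" by(simp only:distrib_left)
 moreover have "of_nat (Suc n * (Suc n + 1)) * L = of_nat (n * (n + 1)) * L + 2 * (of_nat (Suc n) * L)" proof -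
 have "Suc n * (Suc n + 1) = n * (n + 1) + 2 * Suc n" by simp
 thus ?thesis by(simp only:of_nat_add of_nat_mult distrib_right mult.assoc of_nat_numeral)
 qed
 ultimately show ?case using add_mono[OF Suc mult_left_mono[OF grad, of 2 n]] by simp
 qed simp
 obtain g d where gd:"d : R" "d ~= 0" "!!J J'. smod R J ==> J <= R ==> smod R J' ==> J' <= S ==> (ALL c:J. ALL s:S. c * s : J') ==>
 len R S J' <= len R R J + of_nat g * len R R (d *o R + J)" using len_ext[OF f] by blast
 obtain c where c:"!!n. len R R (d *o R + mR n) <= enat (c * n)" using quot[OF gd(1,2)] by blast
 have up:"2 * len R S (?q n) <= enat (e * n ^ 2 + (C0 + 2 * g * c * N0) * n)" for n proof -
 let ?J = "ipow R Q R n"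
 have "len R S (?q n) <= len R R ?J + of_nat g * len R R (d *o R + ?J)"
 proof(rule gd(3)[OF sm_ipow[OF sm_R] ipow_subset[OF sm_R Q_R] sq qS])
 show "ALL c:?J. ALL s:S. c * s : ?q n" using ipow_mult_in[OF sS] by blast
 qed
 also have "... <= len R R ?J + of_nat g * enat (c * (n * N0))" proof(intro add_left_mono mult_left_mono)
 have "len R R (d *o R + ?J) <= len R R (d *o R + mR (n * N0))" by(intro len_mono plus_mono order.refl mR_Q)
 thus "len R R (d *o R + ?J) <= enat (c * (n * N0))" using c order_trans by blast
 qed simp
 finally have "2 * len R S (?q n) <= 2 * (len R R ?J + of_nat g * enat (c * (n * N0)))" by(rule mult_left_mono) simp
 also have "... <= enat (e * n ^ 2 + C0 * n) + enat (2 * g * c * N0 * n)"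
 unfolding distrib_left by(rule add_mono[OF upper]) (simp add:numeral_eq_enat of_nat_eq_enat mult_ac)
 finally show ?thesis by(simp add:distrib_right add.assoc)
 qed
 have b1:"of_nat (n * (n + 1)) * L <= enat (e * n ^ 2 + (C0 + 2 * g * c * N0) * n)" for n using tot up by(rule order_trans)
 then obtain l where l:"L = enat l" using b1[of 1] by(cases L) (auto simp:of_nat_eq_enat)
 have "l * n ^ 2 <= e * n ^ 2 + (C0 + 2 * g * c * N0) * n" for n proof -
 have "n * (n + 1) * l <= e * n ^ 2 + (C0 + 2 * g * c * N0) * n" using b1[of n] unfolding l of_nat_eq_enat by simp
 thus ?thesis by(simp add:power2_eq_square algebra_simps)
 qed
 hence "l <= e" by(rule quad_le)
 thus ?thesis using l by(simp add:L_def)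
qed

end

section \<open>Slicing along z = x + y h\<close>

context surf
begin

context fixes S :: "'k set" and h z :: 'k assumes S:"adm S" and h:"h : S" and z:"z = x + y * h"
begin

lemma fS:"fin S" using S by(simp add:adm_def)

lemma sr:"sring S" by(rule finD(1)[OF fS])
lemma sSS:"smod S S" by(rule finD(3)[OF fS])
lemma sRS:"smod R S" by(rule finD(4)[OF fS])
lemma yS:"y : S" and xS:"x : S" using finD[OF fS] by auto
lemma zS:"z : S" unfolding z by(intro sr_add[OF sr] sr_mult[OF sr] xS yS h)
lemma RS:"R <= S" by(rule finD(2)[OF fS])
lemma toR:"smod S A ==> smod R A" by(rule sm_sub[OF _ RS])
lemma sc:"smod S (u *o S)" by(rule sm_scaled[OF sSS])
lemma scS:"u : S ==> u *o S <= S" by(rule scaled_le[OF sSS])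

lemma zy_eq:"z *o S + y *o S = x *o S + y *o S" proof
 have yz:"y *o S <= y *o S" by simp
 have in1:"u : u *o S" for u using scaledI[of 1 S u] sr_1[OF sr] by simp
 have zin:"z : x *o S + y *o S" unfolding z using h in1[of x] by(intro set_plus_intro scaledI)
 have "x = z + y * (- h)" by(simp add:z)
 hence xin:"x : z *o S + y *o S" using sr_uminus[OF sr h] in1[of z] by(metis scaledI set_plus_intro)
 have sub:"u *o S <= K" if "smod S K" "u : K" for u K
 using sm_mult[OF that(1) _ that(2)] by(auto simp:in_scaled mult.commute)
 show "z *o S + y *o S <= x *o S + y *o S"
 by(rule plus_le[OF sm_plus[OF sc sc] sub[OF sm_plus[OF sc sc] zin] plus_ge2[OF sc]])
 show "x *o S + y *o S <= z *o S + y *o S"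
 by(rule plus_le[OF sm_plus[OF sc sc] sub[OF sm_plus[OF sc sc] xin] plus_ge2[OF sc]])
qed

lemma len_zy:"len R S (z *o S + y *o S) <= enat e" unfolding zy_eq by(rule len_parameters_le[OF S])

lemma m_zy:"ipow R m S N0 <= z *o S + y *o S" proof -
 have "ipow R m S N0 <= mul R (mR N0) S" by(rule ipow_subset_mprod[OF sring sRS m_le])
 also have "... <= x *o S + y *o S" proof(rule mul_least[OF toR[OF sm_plus[OF sc sc]]])
 fix i u assume "i : mR N0" and u:"u : S"
 hence "i : x *o R + y *o R" using prim by blast
 then obtain a b where "i = a + b" "a : x *o R" "b : y *o R" by(rule set_plus_elim)
 then obtain a b where ab:"i = x * a + y * b" "a : R" "b : R" by(auto simp:in_scaled)
 have "i * u = x * (a * u) + y * (b * u)" by(simp add:ab(1) algebra_simps)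
 moreover have "a * u : S" "b * u : S" using ab RS u sr_mult[OF sr] by auto
 ultimately show "i * u : x *o S + y *o S" by(metis scaledI set_plus_intro)
 qed
 finally show ?thesis unfolding zy_eq .
qed

lemma escapeS: assumes P:"prime_in S P" "z : P" "y ~: P" shows "escape S P y"
proof(rule escape_general[OF sr P(1) complete_local_ring_axioms RS fin_fg[OF fS] ym P(3)])
 have sP:"smod S P" using P by(simp add:prime_in_def)
 have "z *o S <= P" using sm_mult[OF sP _ P(2)] by(auto simp:in_scaled mult.commute)
 hence "z *o S + y *o S <= P + y *o S" by(rule plus_mono[OF _ order.refl])
 thus "ipow R m S N0 <= P + y *o S" using m_zy by blast
qed

lemma zpow:"(z ^ n) *o S <= ipow R m S n" proof(induction n)
 case (Suc n)
 have si:"smod S (ipow R m S n)" by(rule sm_ipow_ext[OF sSS])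
 have "z * u : mul R m (ipow R m S n)" if u:"u : ipow R m S n" for u proof -
 have "x * u + y * (h * u) : mul R m (ipow R m S n)" by(intro sm_add[OF sm_mprod] mul_in xm ym u sm_mult[OF si h u])
 thus ?thesis by(simp add:z algebra_simps)
 qed
 hence "z *o ipow R m S n <= mul R m (ipow R m S n)" by(auto simp:in_scaled)
 hence "z *o ((z ^ n) *o S) <= mul R m (ipow R m S n)" using scaled_mono[OF Suc, of z] by blast
 thus ?case by(simp add:scaled2)
qed simp

lemma ipow_m_I:"mR M <= I ==> ipow R m S (k * M) <= ipow R I S k" proof -
 assume MI:"mR M <= I"
 have "ipow R m S (k * M) <= mul R (mR (k * M)) S" by(rule ipow_subset_mprod[OF sring sRS m_le])
 also have "... <= mul R (ipow R I R k) S" by(rule mul_mono[OF ipow_ipow_subset[OF sring m_le MI] order.refl])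
 also have "... <= ipow R I S k" by(rule ipow_mult_subset[OF sRS])
 finally show ?thesis .
qed

text \<open>S modulo the a-th layer is the a-th factor of the z-adic filtration of S / J. Layers
  contain z, which brings lengths down to the one-dimensional ring S / z S.\<close>

definition layer :: "'k set => nat => 'k set" where "layer J a = {s:S. z ^ a * s : J + (z ^ Suc a) *o S}"

lemma sm_layer:"smod S J ==> smod S (layer J a)"
 using sm_plus[OF _ sc, of J "z ^ Suc a"] sSS by(auto simp:layer_def smod_def distrib_left mult.left_commute)

lemma layer_S:"layer J a <= S" by(auto simp:layer_def)

lemma J_layer:"smod S J ==> J <= S ==> J <= layer J a" proof
 fix j assume J:"smod S J" "J <= S" "j : J"
 have "z ^ a * j : J" by(rule sm_mult[OF J(1) sr_power[OF sr zS] J(3)])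
 hence "z ^ a * j : J + (z ^ Suc a) *o S" by(rule subsetD[OF plus_ge1[OF sc]])
 thus "j : layer J a" unfolding layer_def using J by blast
qed

lemma z_layer:"smod S J ==> z *o S <= layer J a" proof
 fix u assume J:"smod S J" and "u : z *o S"
 then obtain s where s:"s : S" "u = z * s" by(auto simp:in_scaled)
 have e:"z ^ a * u = z ^ Suc a * s" by(simp add:s(2) mult_ac)
 have "z ^ a * u : J + (z ^ Suc a) *o S" unfolding e by(rule subsetD[OF plus_ge2[OF J] scaledI[OF s(1)]])
 thus "u : layer J a" unfolding layer_def using s zS sr_mult[OF sr] by simp
qed

lemma len_layers: assumes J:"smod S J" "J <= S" shows "len R S (J + (z ^ n) *o S) = (SUM a<n. len R S (layer J a))"
proof(induction n)
 case 0
 have "J + S = S" by(rule plus_abs[OF sSS J])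
 thus ?case by simp
next
 case (Suc n)
 have s:"smod R (J + (z ^ k) *o S)" for k by(rule toR[OF sm_plus[OF J(1) sc]])
 have sub:"J + (z ^ k) *o S <= S" for k by(rule plus_le[OF sSS J(2) scS[OF sr_power[OF sr zS]]])
 have dec:"J + (z ^ Suc n) *o S <= J + (z ^ n) *o S" proof(rule plus_mono[OF order.refl])
 have "(z ^ Suc n) *o S = (z ^ n) *o (z *o S)" by(simp add:scaled2 mult.commute)
 also have "... <= (z ^ n) *o S" by(rule scaled_mono[OF scS[OF zS]])
 finally show "(z ^ Suc n) *o S <= (z ^ n) *o S" .
 qed
 have e:"J + (z ^ n) *o S = (z ^ n) *o S + (J + (z ^ Suc n) *o S)" proof -
 have "(z ^ n) *o S + (J + (z ^ Suc n) *o S) = (J + (z ^ n) *o S) + (J + (z ^ Suc n) *o S)" proof -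
 have "(J + (z ^ n) *o S) + (J + (z ^ Suc n) *o S) = (z ^ n) *o S + ((J + J) + (z ^ Suc n) *o S)" by(simp only:add_ac)
 thus ?thesis by(simp only:plus_abs[OF J(1) J(1) order.refl])
 qed
 also have "... = J + (z ^ n) *o S" by(rule plus_abs2[OF s s dec])
 finally show ?thesis by simp
 qed
 have "len R S (J + (z ^ Suc n) *o S) = len R S (J + (z ^ n) *o S) + len R (J + (z ^ n) *o S) (J + (z ^ Suc n) *o S)"
 by(rule len_add[OF sring s dec sub sRS s])
 also have "len R (J + (z ^ n) *o S) (J + (z ^ Suc n) *o S) = len R S (layer J n)"
 unfolding layer_def by(subst e) (rule len_scaled[OF sring sRS s])
 finally show ?case using Suc by simp
qed

text \<open>Layers multiply like initial forms: leading coefficients with respect to z are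
  multiplied and exponents are added.\<close>

lemma layer_power: assumes J:"smod R I" "I <= R"
 shows "u : ipow S (layer (mul R I S) a) S k ==> z ^ (a * k) * u : ipow R I S k + (z ^ Suc (a * k)) *o S"
proof(induction k arbitrary: u)
 case 0
 hence "u : S + z *o S" using plus_ge1[OF sc] by auto
 thus ?case by simp
next
 case (Suc k)
 let ?J = "mul R I S" and ?Jk = "%k. ipow R I S k"
 let ?T = "?Jk (Suc k) + (z ^ Suc (a * Suc k)) *o S"
 have sJk:"smod S (?Jk k)" for k by(rule sm_ipow_ext[OF sSS])
 have sT:"smod S ?T" by(rule sm_plus[OF sJk sc])
 have JJ:"w * v : ?Jk (Suc k)" if "w : ?J" "v : ?Jk k" for w v proof -
 have "?J <= {w. w * v : ?Jk (Suc k)}" proof(rule mul_least)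
 show "smod R {w. w * v : ?Jk (Suc k)}" using toR[OF sJk[of "Suc k"]] by(auto simp:smod_def distrib_right mult.assoc)
 fix i s assume "i : I" "s : S"
 hence "i * (s * v) : ?Jk (Suc k)" using sm_mult[OF sJk _ that(2)] by(simp add:mul_in)
 thus "i * s : {w. w * v : ?Jk (Suc k)}" by(simp add:mult.assoc)
 qed
 thus ?thesis using that by blast
 qed
 have "mul S (layer ?J a) (ipow S (layer ?J a) S k) <= {u. z ^ (a * Suc k) * u : ?T}" proof(rule mul_least)
 show "smod S {u. z ^ (a * Suc k) * u : ?T}" using sT by(auto simp:smod_def distrib_left mult.left_commute)
 fix j u assume j:"j : layer ?J a" and u:"u : ipow S (layer ?J a) S k"
 have "z ^ (a * k) * u : ?Jk k + (z ^ Suc (a * k)) *o S" by(rule Suc.IH[OF u])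
 then obtain v t0 where v:"z ^ (a * k) * u = v + t0" "v : ?Jk k" "t0 : (z ^ Suc (a * k)) *o S" by(rule set_plus_elim)
 then obtain t where t:"t0 = z ^ Suc (a * k) * t" "t : S" by(auto simp:in_scaled)
 have "z ^ a * j : ?J + (z ^ Suc a) *o S" using j by(simp add:layer_def)
 then obtain w t1 where w:"z ^ a * j = w + t1" "w : ?J" "t1 : (z ^ Suc a) *o S" by(rule set_plus_elim)
 then obtain t' where t': "t1 = z ^ Suc a * t'" "t' : S" by(auto simp:in_scaled)
 have jS:"j : S" using j layer_S by blast
 have uS:"u : S" using u ipow_subset[OF sSS layer_S] by blast
 have "z ^ (a * Suc k) * (j * u) = (z ^ a * j) * (z ^ (a * k) * u)" by(simp add:power_add mult_ac)
 also have "... = w * v + w * t0 + t1 * (z ^ (a * k) * u)" unfolding w(1) v(1) by(simp add:algebra_simps)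
 also have "w * t0 = z ^ Suc (a * Suc k) * (t * j - z * t * t')" proof -
 have "w * t0 = (z ^ a * j - z ^ Suc a * t') * (z ^ Suc (a * k) * t)" using w(1) t'(1) t(1) by simp
 also have "... = z ^ Suc (a * Suc k) * (t * j - z * t * t')" by(simp add:algebra_simps power_add)
 finally show ?thesis .
 qed
 also have "t1 * (z ^ (a * k) * u) = z ^ Suc (a * Suc k) * (t' * u)" unfolding t'(1) by(simp add:power_add mult_ac)
 finally have "z ^ (a * Suc k) * (j * u) = w * v + (z ^ Suc (a * Suc k) * (t * j - z * t * t' + t' * u))" by(simp add:distrib_left)
 moreover have "t * j - z * t * t' + t' * u : S" by(intro sr_add[OF sr] sr_diff[OF sr] sr_mult[OF sr] t t' jS uS zS)
 ultimately show "j * u : {u. z ^ (a * Suc k) * u : ?T}" using JJ[OF w(2) v(2)] by(simp add:set_plus_intro scaledI)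
 qed
 thus ?case using Suc.prems by auto
qed

text \<open>The summand c bridges consecutive multiples of k: a whole block of k layers of I^k S is
  controlled by the single layer a of I S.\<close>

lemma layer_power_subset: assumes J:"smod R I" "I <= R"
 shows "ipow S (layer (mul R I S) a) S k + z *o S <= layer (ipow R I S k) (a * k + c)"
proof(rule plus_le[OF sm_layer _ z_layer])
 have sJk:"smod S (ipow R I S k)" by(rule sm_ipow_ext[OF sSS])
 show "smod S (ipow R I S k)" "smod S (ipow R I S k)" by(rule sJk)+
 show "ipow S (layer (mul R I S) a) S k <= layer (ipow R I S k) (a * k + c)" proof
 fix u assume u:"u : ipow S (layer (mul R I S) a) S k"
 have "z ^ (a * k) * u : ipow R I S k + (z ^ Suc (a * k)) *o S" by(rule layer_power[OF J u])
 then obtain v t where v:"z ^ (a * k) * u = v + t" "v : ipow R I S k" "t : (z ^ Suc (a * k)) *o S" by(rule set_plus_elim)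
 then obtain s where s:"t = z ^ Suc (a * k) * s" "s : S" by(auto simp:in_scaled)
 have "z ^ (a * k + c) * u = z ^ c * v + z ^ Suc (a * k + c) * s" proof -
 have "z ^ (a * k + c) * u = z ^ c * (z ^ (a * k) * u)" by(simp add:power_add mult_ac)
 thus ?thesis unfolding v(1) s(1) by(simp add:power_add algebra_simps)
 qed
 moreover have "z ^ c * v : ipow R I S k" by(rule sm_mult[OF sJk sr_power[OF sr zS] v(2)])
 moreover have "u : S" using u ipow_subset[OF sSS layer_S] by blast
 ultimately show "u : layer (ipow R I S k) (a * k + c)" unfolding layer_def using s(2)
 by(simp add:set_plus_intro scaledI del:power_Suc)
 qed
qed

context fixes P assumes P:"prime_in S P" "z *o S <= P" "y ~: P"
begin

lemma sP:"smod S P" and PS:"P <= S" using P by(auto simp:prime_in_def)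

lemma zP:"z : P" using P(2) scaledI[of 1 S z] sr_1[OF sr] by auto

lemma power_cancel:"s : S ==> y ^ n * s : P ==> s : P" proof -
 assume "s : S" "y ^ n * s : P"
 hence "y ^ n : P | s : P" using prime_inD[OF P(1)] sr_power[OF sr yS] by blast
 thus ?thesis using prime_in_power[OF sr P(1) yS] P(3) by blast
qed

lemma len_Py:"len R S (P + y *o S) <= enat e"
 using len_mono[OF plus_mono[OF P(2) order.refl], of R S "y *o S"] len_zy by(rule order_trans)

lemma len_Py_le:"len R S ((y ^ n) *o S + P) <= of_nat n * len R S (P + y *o S)" proof -
 have "y *o P <= P" by(rule scaled_le[OF sP yS])
 thus ?thesis using len_power_le[OF sring sRS toR[OF sP] PS scS[OF yS], of n] by(simp add:add.commute)
qed

lemma len_Py_ge:"of_nat n * len R S (P + y *o S) <= len R S ((y ^ n) *o S + P)" proof(induction n)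
 case (Suc n)
 have s:"smod R ((y ^ k) *o S + P)" for k by(rule toR[OF sm_plus[OF sc sP]])
 have sub:"(y ^ k) *o S + P <= S" for k by(rule plus_le[OF sSS scS[OF sr_power[OF sr yS]] PS])
 have dec:"(y ^ Suc n) *o S + P <= (y ^ n) *o S + P" proof(rule plus_mono[OF _ order.refl])
 have "(y ^ Suc n) *o S = (y ^ n) *o (y *o S)" by(simp add:scaled2 mult.commute)
 also have "... <= (y ^ n) *o S" by(rule scaled_mono[OF scS[OF yS]])
 finally show "(y ^ Suc n) *o S <= (y ^ n) *o S" .
 qed
 have "(y ^ n) *o S + ((y ^ Suc n) *o S + P) <= (y ^ n) *o S + P" by(rule plus_le[OF s plus_ge1[OF sP] dec])
 hence "len R ((y ^ n) *o S + ((y ^ Suc n) *o S + P)) ((y ^ Suc n) *o S + P) <= len R ((y ^ n) *o S + P) ((y ^ Suc n) *o S + P)"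
 by(rule len_mono_left)
 moreover have "len R ((y ^ n) *o S + ((y ^ Suc n) *o S + P)) ((y ^ Suc n) *o S + P) = len R S {s:S. y ^ n * s : (y ^ Suc n) *o S + P}"
 by(rule len_scaled[OF sring sRS s])
 moreover have "len R S (P + y *o S) <= len R S {s:S. y ^ n * s : (y ^ Suc n) *o S + P}"
 proof(rule len_mono, rule subsetI)
 fix s assume "s : {s:S. y ^ n * s : (y ^ Suc n) *o S + P}"
 hence s:"s : S" "y ^ n * s : (y ^ Suc n) *o S + P" by auto
 from s(2) obtain u p where up:"y ^ n * s = u + p" "u : (y ^ Suc n) *o S" "p : P" by(rule set_plus_elim)
 then obtain t where t:"u = y ^ Suc n * t" "t : S" by(auto simp:in_scaled)
 have "y ^ n * (s - y * t) = p" using up(1) t(1) by(simp add:algebra_simps)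
 hence "y ^ n * (s - y * t) : P" using up(3) by simp
 moreover have "s - y * t : S" by(intro sr_diff[OF sr] sr_mult[OF sr] s(1) yS t(2))
 ultimately have "s - y * t : P" by(rule power_cancel[rotated])
 hence "(s - y * t) + y * t : P + y *o S" using t(2) by(intro set_plus_intro scaledI)
 thus "s : P + y *o S" by simp
 qed
 ultimately have 1:"len R S (P + y *o S) <= len R ((y ^ n) *o S + P) ((y ^ Suc n) *o S + P)" by simp
 have "len R S ((y ^ Suc n) *o S + P) = len R S ((y ^ n) *o S + P) + len R ((y ^ n) *o S + P) ((y ^ Suc n) *o S + P)"
 by(rule len_add[OF sring s dec sub sRS s])
 thus ?case using add_mono[OF Suc 1] by(simp add:distrib_right add.commute)
qed simp

lemma y_not_absorbed:"1 ~: P + y *o S" proof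
 assume o:"1 : P + y *o S"
 have "S <= P + y *o S" using sm_mult[OF sm_plus[OF sP sc] _ o] by fastforce
 hence "S <= P" by(rule nakayama_elem[OF fin_fg[OF fS] toR[OF sP] ym])
 thus False using P(1) sr_1[OF sr] by(auto simp:prime_in_def)
qed

text \<open>kp is the y-adic order of A in S / P. An element of that order is y^kp g modulo P with g
  outside P + y S, and the escape exponent c turns it into y^(kp + c) in P + A. So A is squeezed
  between two powers of y at a distance independent of A.\<close>

lemma order_ex: assumes A:"smod S A" "A <= S" "y ^ M : A"
 and c:"!!g. g : S ==> g ~: P + y *o S ==> y ^ c : P + g *o S"
 shows "EX kp. of_nat kp * len R S (P + y *o S) <= len R S (A + P) & y ^ (kp + c) : P + A" proof -
 let ?ok = "%kp. A <= (y ^ kp) *o S + P"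
 have "?ok 0" using A(2) plus_ge1[OF sP, of S] by auto
 have "EX kp. ?ok kp & ~ ?ok (Suc kp)" proof(rule ccontr)
 assume "~ ?thesis"
 hence "?ok kp" for kp using `?ok 0` by(induction kp) auto
 hence "y ^ M : (y ^ Suc M) *o S + P" using A(3) by blast
 then obtain u p where up:"y ^ M = u + p" "u : (y ^ Suc M) *o S" "p : P" by(rule set_plus_elim)
 then obtain t where t:"u = y ^ Suc M * t" "t : S" by(auto simp:in_scaled)
 have "y ^ M * (1 - y * t) = p" using up(1) t(1) by(simp add:algebra_simps)
 hence "y ^ M * (1 - y * t) : P" using up(3) by simp
 moreover have "1 - y * t : S" by(intro sr_diff[OF sr] sr_mult[OF sr] yS t(2) sr_1[OF sr])
 ultimately have "1 - y * t : P" by(rule power_cancel[rotated])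
 hence "(1 - y * t) + y * t : P + y *o S" using t(2) by(intro set_plus_intro scaledI)
 thus False using y_not_absorbed by simp
 qed
 then obtain kp j where k:"?ok kp" "j : A" "j ~: (y ^ Suc kp) *o S + P" by blast
 have "j : (y ^ kp) *o S + P" using k by blast
 then obtain u p where up:"j = u + p" "u : (y ^ kp) *o S" "p : P" by(rule set_plus_elim)
 then obtain g where g:"u = y ^ kp * g" "g : S" by(auto simp:in_scaled)
 have yk:"y ^ kp : S" by(rule sr_power[OF sr yS])
 have "g ~: P + y *o S" proof
 assume "g : P + y *o S"
 then obtain q v where qv:"g = q + v" "q : P" "v : y *o S" by(rule set_plus_elim)
 then obtain t where t:"v = y * t" "t : S" by(auto simp:in_scaled)
 have "j = y ^ Suc kp * t + (y ^ kp * q + p)" unfolding up(1) g(1) qv(1) t(1) by(simp add:algebra_simps)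
 moreover have "y ^ kp * q + p : P" by(intro sm_add[OF sP] sm_mult[OF sP yk] qv up)
 ultimately have "j : (y ^ Suc kp) *o S + P" using t(2) by(metis scaledI set_plus_intro)
 thus False using k by blast
 qed
 hence "y ^ c : P + g *o S" by(rule c[OF g(2)])
 then obtain q v where qv:"y ^ c = q + v" "q : P" "v : g *o S" by(rule set_plus_elim)
 then obtain s where s:"v = g * s" "s : S" by(auto simp:in_scaled)
 have "y ^ (kp + c) = (y ^ kp * q - s * p) + s * j"
 unfolding power_add qv(1) s(1) up(1) g(1) by(simp add:algebra_simps)
 moreover have "y ^ kp * q - s * p : P" by(intro sm_diff[OF sr sP] sm_mult[OF sP] yk s qv up)
 moreover have "s * j : A" by(rule sm_mult[OF A(1) s(2) k(2)])
 ultimately have 1:"y ^ (kp + c) : P + A" by(metis set_plus_intro)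
 have "A + P <= (y ^ kp) *o S + P" by(rule plus_le[OF sm_plus[OF sc sP] k(1) plus_ge2[OF sc]])
 hence "len R S ((y ^ kp) *o S + P) <= len R S (A + P)" by(rule len_mono)
 thus ?thesis using 1 len_Py_ge[of kp] order_trans by blast
qed

lemma len_power_ideal: assumes A:"smod S A" "A <= S" and K:"y ^ K : P + A"
 shows "len R S (P + ipow S A S k) <= of_nat (K * k) * len R S (P + y *o S)" proof -
 have sA:"smod S (ipow S A S k)" for k by(rule sm_ipow[OF sSS])
 have AS:"ipow S A S k <= S" for k by(rule ipow_subset[OF sSS A(2)])
 have "(y ^ K) ^ k : P + ipow S A S k" proof(induction k)
 case 0
 show ?case using plus_ge2[OF sP, of S] sr_1[OF sr] by auto
 next
 case (Suc k)
 obtain p i where pi:"y ^ K = p + i" "p : P" "i : A" using K by(rule set_plus_elim)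
 obtain q u where qu:"(y ^ K) ^ k = q + u" "q : P" "u : ipow S A S k" using Suc by(rule set_plus_elim)
 have "(y ^ K) ^ Suc k = y ^ K * (q + u)" by(simp only:power_Suc qu(1))
 also have "... = (p + i) * (q + u)" by(simp only:pi(1))
 also have "... = (i * q + (q + u) * p) + i * u" by(simp add:algebra_simps)
 finally have "(y ^ K) ^ Suc k = (i * q + (q + u) * p) + i * u" .
 moreover have "i * q + (q + u) * p : P"
 using A(2) pi qu AS PS by(intro sm_add[OF sP] sm_mult[OF sP] sr_add[OF sr]) auto
 moreover have "i * u : ipow S A S (Suc k)" using pi(3) qu(3) by(simp add:mul_in)
 ultimately show ?case by(metis set_plus_intro)
 qed
 hence yk:"y ^ (K * k) : P + ipow S A S k" by(simp add:power_mult)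
 have s:"smod S (P + ipow S A S k)" by(rule sm_plus[OF sP sA])
 have "(y ^ (K * k)) *o S <= P + ipow S A S k" using sm_mult[OF s _ yk] by(auto simp:in_scaled mult.commute)
 hence "(y ^ (K * k)) *o S + P <= P + ipow S A S k" by(rule plus_le[OF s _ plus_ge1[OF sA]])
 hence "len R S (P + ipow S A S k) <= len R S ((y ^ (K * k)) *o S + P)" by(rule len_mono)
 thus ?thesis using len_Py_le[of "K * k"] by(rule order_trans)
qed

end

text \<open>Put w P = l(S / (P + y S)). In each layer, l(S / I^k S) costs at most (kp + c) k w P for
  each of the at most e - 1 occurrences of P, while l(S / I S) is, by superadditivity over the
  distinct primes, at least the sum of all kp w P up to a constant. The constants go into C
  M.\<close>

theorem gd_if_few:
 assumes ps:"pfilt S (z *o S) S ps" and few:"!!P. P : set ps ==> y ~: P ==> count_list ps P <= e - 1" shows "gd S"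
proof -
 have pr:"prime_in S P & z *o S <= P" if "P : set ps" for P by(rule pfilt_primes[OF ps sr sc scS[OF zS] that])
 define QQ where "QQ = {P : set ps. y ~: P}"
 have finQ:"finite QQ" by(simp add:QQ_def)
 have Q:"prime_in S P" "z *o S <= P" "y ~: P" if "P : QQ" for P using that pr by(auto simp:QQ_def)
 have Qz:"z : P" if "P : QQ" for P using zP[OF Q[OF that]] .
 have esc:"escape S P y" if "P : QQ" for P by(rule escapeS[OF Q(1)[OF that] Qz[OF that] Q(3)[OF that]])
 have "ALL P:QQ. EX c. ALL g:S. g ~: P + y *o S --> y ^ c : P + g *o S" using esc by(auto simp:escape_def)
 then obtain c where c:"ALL P:QQ. ALL g:S. g ~: P + y *o S --> y ^ c P : P + g *o S" by(rule bchoice[THEN exE])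
 have inc:"P = P'" if P:"P : QQ" "P' : QQ" "P <= P'" for P P' proof(rule ccontr)
 assume "P ~= P'"
 then obtain s where s:"s : P'" "s ~: P" using P by blast
 have sP': "smod S P'" "P' <= S" using Q(1)[OF P(2)] by(auto simp:prime_in_def)
 obtain k where k:"y ^ k : P + s *o S" using esc[OF P(1)] s sP' unfolding escape_def by blast
 have "P + s *o S <= P'"
 by(rule plus_le[OF sP'(1) P(3)]) (use sm_mult[OF sP'(1) _ s(1)] in \<open>auto simp:in_scaled mult.commute\<close>)
 hence "y : P'" using k prime_in_power[OF sr Q(1)[OF P(2)] yS] by blast
 thus False using Q(3)[OF P(2)] by blast
 qed
 obtain B where B:"(ALL P:QQ. smod S (B P) & P < B P & B P <= S) &
 (ALL J. smod S J --> J <= S --> (SUM P:QQ. len R S (J + P)) <= len R S (J + (S Int \<Inter>QQ)) + (SUM P:QQ. len R S (J + B P)))"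
 using sum_len_primes_le[OF sring RS sr finQ Q(1) inc] by(rule exE)
 have "ALL P:QQ. EX b. len R S (B P) <= enat b" proof
 fix P assume P:"P : QQ"
 have BP:"smod S (B P)" "P < B P" "B P <= S" using B P by auto
 then obtain s where s:"s : B P" "s ~: P" by blast
 then obtain k where k:"y ^ k : P + s *o S" using esc[OF P] BP unfolding escape_def by blast
 have "P + s *o S <= B P"
 by(rule plus_le[OF BP(1)]) (use BP sm_mult[OF BP(1) _ s(1)] in \<open>auto simp:in_scaled mult.commute\<close>)
 hence yk:"y ^ k : B P" using k by blast
 have "(y ^ k) *o S + P <= B P"
 by(rule plus_le[OF BP(1)]) (use BP sm_mult[OF BP(1) _ yk] in \<open>auto simp:in_scaled mult.commute\<close>)
 hence "len R S (B P) <= len R S ((y ^ k) *o S + P)" by(rule len_mono)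
 also have "... <= of_nat k * len R S (P + y *o S)" by(rule len_Py_le[OF Q[OF P]])
 also have "... <= of_nat k * enat e" by(rule mult_left_mono[OF len_Py[OF Q[OF P]]]) simp
 finally show "EX b. len R S (B P) <= enat b" by(auto simp:of_nat_eq_enat)
 qed
 then obtain b where b:"ALL P:QQ. len R S (B P) <= enat (b P)" by(rule bchoice[THEN exE])
 define w where "w P = the_enat (len R S (P + y *o S))" for P
 have w:"len R S (P + y *o S) = enat (w P)" if "P : QQ" for P
 using len_Py[OF Q[OF that]] unfolding w_def by(cases "len R S (P + y *o S)") auto
 have sumQ:"(SUM P:QQ. len R S (J + P)) <= len R S J + enat (SUM P:QQ. b P)" if J:"smod S J" "J <= S" for J proof -
 have sI:"smod S (S Int \<Inter>QQ)" using Q(1) by(intro sm_Int sSS sm_Inter) (auto simp:prime_in_def)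
 have "(SUM P:QQ. len R S (J + P)) <= len R S (J + (S Int \<Inter>QQ)) + (SUM P:QQ. len R S (J + B P))" using B J by blast
 also have "... <= len R S J + (SUM P:QQ. enat (b P))" proof(intro add_mono sum_mono len_mono plus_ge1[OF sI])
 fix P assume P:"P : QQ"
 have "len R S (J + B P) <= len R S (B P)" by(intro len_mono plus_ge2[OF J(1)])
 thus "len R S (J + B P) <= enat (b P)" using b P order_trans by blast
 qed
 also have "(SUM P:QQ. enat (b P)) = enat (SUM P:QQ. b P)" unfolding of_nat_eq_enat[symmetric] by simp
 finally show ?thesis .
 qed
 define C where "C = (SUM P:QQ. b P) + (SUM P:QQ. c P * w P)"
 show ?thesis unfolding gd_def proof(rule exI[of _ C], intro allI impI)
 fix I M assume I:"smod R I" "I <= R" "mR M <= I"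
 let ?J = "mul R I S"
 have J1:"?J = ipow R I S 1" by simp
 have sJ:"smod S ?J" by(rule sm_mprod_ext[OF sSS])
 have JS:"?J <= S" using ipow_fin[OF fS I(2), of 1] by simp
 have mJ:"ipow R m S M <= ?J" using ipow_m_I[OF I(3), of 1] by simp
 have zJ:"?J + (z ^ M) *o S = ?J" by(rule plus_abs2[OF sJ sc]) (use zpow mJ in blast)
 have yJ:"y ^ M : ?J" using ipow_power_in[OF ym sr_1[OF sr], where n = M and A = R] mJ by auto
 have "len R S ?J <= len R S (ipow R m S M)" by(rule len_mono[OF mJ])
 hence "len R S ?J < \<infinity>" using len_ipow_finite[OF fin_fg[OF fS], of M] by(rule le_less_trans)
 then obtain l where l:"len R S ?J = enat l" by(cases "len R S ?J") auto
 let ?I = "%a. layer ?J a"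
 have sI:"smod S (?I a)" for a by(rule sm_layer[OF sJ])
 have JI:"?J <= ?I a" for a by(rule J_layer[OF sJ JS])
 have "len R S (?I a) <= enat l" for a unfolding l[symmetric] by(rule len_mono[OF JI])
 define L where "L a = the_enat (len R S (?I a))" for a
 have L:"len R S (?I a) = enat (L a)" for a
 using `!!a. len R S (?I a) <= enat l`[of a] unfolding L_def by(cases "len R S (?I a)") auto
 have "enat l = enat (SUM a<M. L a)"
 using len_layers[OF sJ JS, of M] unfolding zJ l L unfolding of_nat_eq_enat[symmetric] by simp
 hence lL:"l = (SUM a<M. L a)" by simp
 have "ALL P:QQ. EX kp. ALL a. of_nat (kp a) * len R S (P + y *o S) <= len R S (?I a + P) & y ^ (kp a + c P) : P + ?I a"
 proof
 fix P assume P:"P : QQ"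
 have "EX kp. of_nat kp * len R S (P + y *o S) <= len R S (?I a + P) & y ^ (kp + c P) : P + ?I a" for a
 by(rule order_ex[OF Q[OF P] sI layer_S]) (use yJ JI c P in auto)
 thus "EX kp. ALL a. of_nat (kp a) * len R S (P + y *o S) <= len R S (?I a + P) & y ^ (kp a + c P) : P + ?I a" by metis
 qed
 then obtain kp where kp:"ALL P:QQ. ALL a. of_nat (kp P a) * len R S (P + y *o S) <= len R S (?I a + P) & y ^ (kp P a + c P) : P + ?I a"
 by(rule bchoice[THEN exE])
 \<comment> \<open>Primes containing y get weight 0: modulo them a layer has length at most e, which
   only enters the linear term.\<close>
 define G where "G a P = (if y : P then 0 else (kp P a + c P) * w P)" for a P
 define X where "X = 2 * (SUM a<M. SUM P<-ps. G a P)"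
 have one:"len R S (layer (ipow R I S k) (a * k + i)) <= enat ((SUM P<-ps. G a P) * k + e * length ps)" for a k i
 proof -
 let ?b = "ipow S (?I a) S k"
 have sb:"smod S ?b" "?b <= S" by(rule sm_ipow[OF sSS], rule ipow_subset[OF sSS layer_S])
 have "len R S (layer (ipow R I S k) (a * k + i)) <= len R S (?b + z *o S)"
 by(rule len_mono[OF layer_power_subset[OF I(1,2)]])
 also have "... = len R (S + ?b) (z *o S + ?b)" by(simp only:plus_abs2[OF sSS sb(1) sb(2)] add.commute[of "z *o S"])
 also have "... <= (SUM P<-ps. len R S (P + ?b))" by(rule pfilt_len_le[OF ps sr sring RS sc scS[OF zS] sb])
 also have "... <= (SUM P<-ps. enat (G a P * k + e))" proof(rule sum_list_mono)
 fix P assume P:"P : set ps"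
 show "len R S (P + ?b) <= enat (G a P * k + e)" proof(cases "y : P")
 case True
 have sP:"smod S P" using pr[OF P] by(simp add:prime_in_def)
 have "z *o S + y *o S <= P"
 by(rule plus_le[OF sP]) (use pr[OF P] sm_mult[OF sP _ True] in \<open>auto simp:in_scaled mult.commute\<close>)
 also have "P <= P + ?b" by(rule plus_ge1[OF sb(1)])
 finally have "len R S (P + ?b) <= len R S (z *o S + y *o S)" by(rule len_mono)
 also have "... <= enat e" by(rule len_zy)
 also have "... <= enat (G a P * k + e)" by simp
 finally show ?thesis .
 next
 case False
 hence PQ:"P : QQ" using P by(simp add:QQ_def)
 have "len R S (P + ?b) <= of_nat ((kp P a + c P) * k) * len R S (P + y *o S)"
 by(rule len_power_ideal[OF Q[OF PQ] sI layer_S]) (use kp PQ in blast)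
 also have "... = enat (G a P * k)" using False by(simp add:G_def w[OF PQ] of_nat_eq_enat mult_ac)
 also have "... <= enat (G a P * k + e)" by simp
 finally show ?thesis .
 qed
 qed
 also have "... = enat ((SUM P<-ps. G a P) * k + e * length ps)"
 by(induction ps) (auto simp:zero_enat_def algebra_simps)
 finally show ?thesis .
 qed
 have "2 * len R S (ipow R I S k) <= enat (X * k ^ 2 + (2 * M * e * length ps) * k)" for k proof -
 have sJk:"smod S (ipow R I S k)" by(rule sm_ipow_ext[OF sSS])
 have zk:"ipow R I S k + (z ^ (M * k)) *o S = ipow R I S k"
 by(rule plus_abs2[OF sJk sc]) (use zpow[of "M * k"] ipow_m_I[OF I(3), of k] in \<open>auto simp:mult.commute\<close>)
 have "len R S (ipow R I S k) = (SUM b<M * k. len R S (layer (ipow R I S k) b))"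
 using len_layers[OF sJk ipow_fin[OF fS I(2)], of "M * k"] unfolding zk .
 \<comment> \<open>The M k layers of I^k S are grouped into M blocks of k, one for each layer of I
   S.\<close>
 also have "... = (SUM a<M. SUM b=a * k..<a * k + k. len R S (layer (ipow R I S k) b))" by(rule sum.nat_group[symmetric])
 also have "... <= (SUM a<M. SUM b=a * k..<a * k + k. enat ((SUM P<-ps. G a P) * k + e * length ps))"
 proof(intro sum_mono)
 fix a b assume "b : {a * k..<a * k + k}"
 hence "b = a * k + (b - a * k)" by simp
 thus "len R S (layer (ipow R I S k) b) <= enat ((SUM P<-ps. G a P) * k + e * length ps)" using one[of k a "b - a * k"] by simp
 qed
 also have "... = enat (SUM a<M. k * ((SUM P<-ps. G a P) * k + e * length ps))"
 unfolding of_nat_eq_enat[symmetric] by simp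
 also have "(SUM a<M. k * ((SUM P<-ps. G a P) * k + e * length ps)) = (SUM a<M. SUM P<-ps. G a P) * k ^ 2 + (M * e * length ps) * k"
 by(simp add:sum.distrib distrib_left sum_distrib_right sum_distrib_left power2_eq_square mult_ac)
 finally have "2 * len R S (ipow R I S k) <= 2 * enat ((SUM a<M. SUM P<-ps. G a P) * k ^ 2 + (M * e * length ps) * k)" by(rule mult_left_mono) simp
 thus ?thesis by(simp add:X_def numeral_eq_enat algebra_simps)
 qed
 moreover have "X <= 2 * (e - 1) * (l + C * M)" proof -
 have a1:"(SUM P<-ps. G a P) <= (e - 1) * (L a + C)" for a proof -
 have "(SUM P<-ps. G a P) = (SUM P:set ps. count_list ps P * G a P)" by(simp add:sum_list_map_eq_sum_count)
 also have "... = (SUM P:QQ. count_list ps P * G a P)" by(rule sum.mono_neutral_right) (auto simp:QQ_def G_def)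
 also have "... <= (SUM P:QQ. (e - 1) * ((kp P a + c P) * w P))"
 by(rule sum_mono) (use few in \<open>auto simp:QQ_def G_def intro!: mult_right_mono\<close>)
 also have "... = (e - 1) * ((SUM P:QQ. kp P a * w P) + (SUM P:QQ. c P * w P))"
 by(simp add:sum_distrib_left[symmetric] distrib_right sum.distrib)
 finally have 1:"(SUM P<-ps. G a P) <= (e - 1) * ((SUM P:QQ. kp P a * w P) + (SUM P:QQ. c P * w P))" .
 have "enat (SUM P:QQ. kp P a * w P) = (SUM P:QQ. enat (kp P a * w P))" unfolding of_nat_eq_enat[symmetric] by simp
 also have "... <= (SUM P:QQ. len R S (?I a + P))" proof(rule sum_mono)
 fix P assume P:"P : QQ"
 hence "of_nat (kp P a) * len R S (P + y *o S) <= len R S (?I a + P)" using kp by blast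
 thus "enat (kp P a * w P) <= len R S (?I a + P)" by(simp add:w[OF P] of_nat_eq_enat)
 qed
 also have "... <= enat (L a) + enat (SUM P:QQ. b P)" using sumQ[OF sI layer_S, of a] unfolding L .
 finally have "(SUM P:QQ. kp P a * w P) <= L a + (SUM P:QQ. b P)" by simp
 hence "(SUM P:QQ. kp P a * w P) + (SUM P:QQ. c P * w P) <= L a + C" by(simp add:C_def)
 hence "(e - 1) * ((SUM P:QQ. kp P a * w P) + (SUM P:QQ. c P * w P)) <= (e - 1) * (L a + C)" by(rule mult_left_mono) simp
 thus ?thesis by(rule order_trans[OF 1])
 qed
 have "(SUM a<M. SUM P<-ps. G a P) <= (SUM a<M. (e - 1) * (L a + C))" by(rule sum_mono[OF a1])
 also have "... = (e - 1) * (l + C * M)" unfolding lL by(simp add:sum_distrib_left[symmetric] sum.distrib mult.commute)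
 finally show ?thesis by(simp add:X_def)
 qed
 ultimately show "EX X l. (EX C'. ALL n. 2 * len R S (ipow R I S n) <= enat (X * n ^ 2 + C' * n)) &
 len R S (mul R I S) = enat l & X <= 2 * (e - 1) * (l + C * M)" using l by blast
 qed
qed

end

end

section \<open>Localization inside the field, and reductions\<close>

locale loc_at = fixes S P :: "'k::field set" assumes S:"sring S" and noethS:"noeth S S" and P:"prime_in S P"
begin

definition loc :: "'k set => 'k set" where "loc M = {v / t | v t. v : M & t : S & t ~: P}"

abbreviation B :: "'k set" where "B == loc S"

lemma SS:"smod S S" by(rule sm_self[OF S])
lemma P_facts:"smod S P" "P <= S" "1 ~: P" "0 : P" using P by(auto simp:prime_in_def intro:sm_0)

lemma denom_mult:"t : S ==> t ~: P ==> u : S ==> u ~: P ==> t * u : S & t * u ~: P"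
 using prime_inD[OF P] sr_mult[OF S] by blast

lemma denom_nz:"t ~: P ==> t ~= 0" using P_facts by auto

lemma locI:"v : M ==> t : S ==> t ~: P ==> v / t : loc M" unfolding loc_def by blast

lemma locE:"u : loc M ==> (!!v t. u = v / t ==> v : M ==> t : S ==> t ~: P ==> thesis) ==> thesis"
 unfolding loc_def by blast

lemma loc_mono:"M <= N ==> loc M <= loc N" unfolding loc_def by blast

lemma subset_loc:"M <= loc M" proof
 fix v assume "v : M"
 hence "v / 1 : loc M" by(rule locI) (use P_facts sr_1[OF S] in auto)
 thus "v : loc M" by simp
qed

lemma sm_loc:"smod S M ==> smod B (loc M)" proof -
 assume M:"smod S M"
 show ?thesis unfolding smod_def proof(intro conjI ballI)
 show "0 : loc M" using subset_loc sm_0[OF M] by blast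
 fix u u' assume "u : loc M" "u' : loc M"
 obtain v t where v:"u = v / t" "v : M" "t : S" "t ~: P" using `u : loc M` by(rule locE)
 obtain v' t' where v': "u' = v' / t'" "v' : M" "t' : S" "t' ~: P" using `u' : loc M` by(rule locE)
 have "u + u' = (t' * v + t * v') / (t * t')" using v v' denom_nz by(simp add:field_simps)
 moreover have "t' * v + t * v' : M" by(intro sm_add[OF M] sm_mult[OF M] v v')
 ultimately show "u + u' : loc M" using denom_mult v v' locI by metis
 next
 fix b u assume "b : B" "u : loc M"
 obtain v t where v:"b = v / t" "v : S" "t : S" "t ~: P" using `b : B` by(rule locE)
 obtain v' t' where v': "u = v' / t'" "v' : M" "t' : S" "t' ~: P" using `u : loc M` by(rule locE)
 have "b * u = (v * v') / (t * t')" using v v' by simp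
 moreover have "v * v' : M" by(rule sm_mult[OF M v(2) v'(2)])
 ultimately show "b * u : loc M" using denom_mult v v' locI by metis
 qed
qed

lemma SB:"S <= B" by(rule subset_loc)

lemma sr_B:"sring B" unfolding sring_def proof(intro conjI ballI)
 show "1 : B" using SB sr_1[OF S] by blast
 fix a b assume ab:"a : B" "b : B"
 have "- 1 : B" using SB sr_uminus[OF S sr_1[OF S]] by blast
 hence "(- 1) * b : B" by(rule sm_mult[OF sm_loc[OF SS] _ ab(2)])
 hence "a + (- 1) * b : B" by(rule sm_add[OF sm_loc[OF SS] ab(1)])
 thus "a - b : B" by simp
 show "a * b : B" by(rule sm_mult[OF sm_loc[OF SS] ab])
qed

lemma BB:"smod B B" by(rule sm_self[OF sr_B])

lemma contract:"smod B A ==> A <= B ==> b : A ==> EX s:A Int S. EX t:S. t ~: P & b = s / t" proof -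
 assume A:"smod B A" "A <= B" "b : A"
 hence "b : B" by blast
 then obtain v t where v:"b = v / t" "v : S" "t : S" "t ~: P" by(rule locE)
 have "t * b : A" using sm_mult[OF A(1) _ A(3)] SB v by blast
 moreover have "t * b = v" using v denom_nz by simp
 ultimately show ?thesis using v by auto
qed

lemma noeth_B:"noeth B B" unfolding noeth_def proof(intro allI impI)
 fix f :: "nat => 'k set"
 assume f:"(ALL n. smod B (f n) & f n <= B) & (ALL n. f n <= f (Suc n))"
 have "EX N. ALL n>=N. f n Int S = f N Int S"
 by(rule noethD[OF noethS]) (use f sm_sub[OF _ SB] in \<open>auto intro!: sm_Int SS\<close>)
 then obtain N where N:"!!n. n >= N ==> f n Int S = f N Int S" by blast
 have "f n = f N" if n:"n >= N" for n proof
 show "f N <= f n" using lift_Suc_mono_le[of f N n] f n by blast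
 show "f n <= f N" proof
 fix b assume b:"b : f n"
 have fn:"smod B (f n)" "f n <= B" using f by auto
 obtain s t where s:"s : f n Int S" "t : S" "t ~: P" "b = s / t" using contract[OF fn b] by blast
 have "s : f N" using s(1) N[OF n] by blast
 moreover have "1 / t : B" using s sr_1[OF S] by(intro locI)
 ultimately have "(1 / t) * s : f N" using f by(intro sm_mult[of B]) auto
 thus "b : f N" using s by simp
 qed
 qed
 thus "EX N. ALL n>=N. f n = f N" by blast
qed

lemma local_B:"local_ring B (loc P)" proof
 show "sring B" "noeth B B" by(rule sr_B, rule noeth_B)
 show "smod B (loc P)" by(rule sm_loc[OF P_facts(1)])
 show "loc P <= B" by(rule loc_mono[OF P_facts(2)])
 show "1 ~: loc P" proof
 assume "1 : loc P"
 then obtain v t where v:"1 = v / t" "v : P" "t : S" "t ~: P" by(rule locE)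
 hence "v = t" using denom_nz by(simp add:field_simps)
 thus False using v by simp
 qed
 fix a assume a:"a : B" "a ~: loc P"
 then obtain v t where v:"a = v / t" "v : S" "t : S" "t ~: P" by(auto elim:locE)
 hence vP:"v ~: P" using a(2) locI by blast
 have "t / v : B" by(rule locI[OF v(3) v(2) vP])
 moreover have "a * (t / v) = 1" using v(1) denom_nz[OF vP] denom_nz[OF v(4)] by simp
 ultimately show "EX b:B. a * b = 1" by blast
qed

sublocale B: local_ring B "loc P" by(rule local_B)

lemma loc_scaled:"loc (z *o M) = z *o loc M" proof(intro equalityI subsetI)
 fix u assume "u : loc (z *o M)"
 then obtain v t where v:"u = v / t" "v : z *o M" "t : S" "t ~: P" by(rule locE)
 then obtain w where w:"v = z * w" "w : M" by(auto simp:in_scaled)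
 have "u = z * (w / t)" by(simp add:v(1) w(1))
 thus "u : z *o loc M" using locI[OF w(2) v(3,4)] scaledI by metis
next
 fix u assume "u : z *o loc M"
 then obtain w where w:"w : loc M" "u = z * w" by(auto simp:in_scaled)
 from w(1) obtain v t where v:"w = v / t" "v : M" "t : S" "t ~: P" by(rule locE)
 have "u = (z * v) / t" by(simp add:v(1) w(2))
 thus "u : loc (z *o M)" using locI[OF scaledI[OF v(2)] v(3,4)] by metis
qed

lemma loc_plus:"smod S M ==> smod S N ==> loc (M + N) = loc M + loc N" proof(intro equalityI)
 assume M:"smod S M" "smod S N"
 show "loc (M + N) <= loc M + loc N" proof
 fix u assume "u : loc (M + N)"
 then obtain v t where v:"u = v / t" "v : M + N" "t : S" "t ~: P" by(rule locE)
 then obtain a b where ab:"v = a + b" "a : M" "b : N" by(auto elim:set_plus_elim)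
 have "u = a / t + b / t" by(simp add:v(1) ab(1) add_divide_distrib)
 thus "u : loc M + loc N" using locI[OF ab(2) v(3,4)] locI[OF ab(3) v(3,4)] by(metis set_plus_intro)
 qed
 show "loc M + loc N <= loc (M + N)"
 by(rule plus_le[OF sm_loc[OF sm_plus[OF M]] loc_mono[OF plus_ge1[OF M(2)]] loc_mono[OF plus_ge2[OF M(1)]]])
qed

text \<open>A prime not contained in P localizes to the whole ring and contributes nothing; P itself
  contributes the residue field.\<close>

lemma len_pfilt:
 assumes "pfilt S Z Z' ps" and Z:"smod S Z" "Z <= S" and other:"!!P'. P' : set ps ==> P' ~= P ==> ~ P' <= P"
 shows "len B (loc Z') (loc Z) = of_nat (count_list ps P)" using assms(1) other proof(induction rule:pfilt.induct)
 case base
 show ?case by simp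
next
 case (step Z' ps a P')
 have f:"smod S Z'" "Z <= Z'" "Z' <= S" using pfilt_facts[OF step.hyps(1) S Z] by auto
 have sa:"smod S (a *o S)" by(rule sm_scaled[OF SS])
 have e:"loc (Z' + a *o S) = a *o B + loc Z'" by(simp add:loc_plus[OF f(1) sa] loc_scaled add.commute)
 have sub:"loc Z' <= a *o B + loc Z'" by(rule plus_ge2[OF sm_scaled[OF BB]])
 have sB:"smod B (loc Z')" by(rule sm_loc[OF f(1)])
 have "len B (a *o B + loc Z') (loc Z) = len B (a *o B + loc Z') (loc Z') + len B (loc Z') (loc Z)"
 by(rule len_add[OF sr_B sB loc_mono[OF f(2)] sub sm_plus[OF sm_scaled[OF BB] sB] sm_loc[OF Z(1)]])
 moreover have "len B (a *o B + loc Z') (loc Z') = len B B {b:B. a * b : loc Z'}" by(rule len_scaled[OF sr_B BB sB])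
 moreover have "{b:B. a * b : loc Z'} = loc P'" proof(intro equalityI subsetI)
 fix b assume b:"b : {b:B. a * b : loc Z'}"
 then obtain s t where s:"b = s / t" "s : S" "t : S" "t ~: P" by(auto elim:locE)
 obtain v u where v:"a * b = v / u" "v : Z'" "u : S" "u ~: P" using b by(auto elim:locE)
 have s': "s = b * t" using s(1) denom_nz[OF s(4)] by simp
 have v': "v = a * b * u" using v(1) denom_nz[OF v(4)] by simp
 have "(s * u) * a = t * v" by(simp only:s' v' mult_ac)
 hence "(s * u) * a : Z'" using sm_mult[OF f(1) s(3) v(2)] by simp
 hence "s * u : P'" using step.hyps(3) sr_mult[OF S s(2) v(3)] by blast
 hence "(s * u) / (t * u) : loc P'" using denom_mult s v by(intro locI) auto
 thus "b : loc P'" using s(1) denom_nz[OF v(4)] by simp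
 next
 fix b assume "b : loc P'"
 then obtain s t where s:"b = s / t" "s : P'" "t : S" "t ~: P" by(rule locE)
 have s2:"s : S" "s * a : Z'" using s(2) step.hyps(3) by auto
 have "(s * a) / t : loc Z'" by(rule locI[OF s2(2) s(3,4)])
 moreover have "s / t : B" by(rule locI[OF s2(1) s(3,4)])
 ultimately show "b : {b:B. a * b : loc Z'}" using s(1) by(simp add:mult.commute)
 qed
 moreover have "len B B (loc P') = (if P' = P then 1 else 0)" proof(cases "P' = P")
 case False
 then obtain p where p:"p : P'" "p ~: P" using step.prems[of P'] by auto
 have pS:"p : S" using p(1) step.hyps(3) by blast
 have sP': "smod S P'" using step.hyps(4) by(simp add:prime_in_def)
 have "p / p : loc P'" by(rule locI[OF p(1) pS p(2)])
 hence one:"1 : loc P'" using denom_nz[OF p(2)] by simp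
 have "B <= loc P'" using sm_mult[OF sm_loc[OF sP'] _ one] by fastforce
 moreover have "loc P' <= B" using step.hyps(4) by(intro loc_mono) (simp add:prime_in_def)
 ultimately have "loc P' = B" by blast
 thus ?thesis using False by simp
 qed (use B.len_residue in simp)
 moreover have "len B (loc Z') (loc Z) = of_nat (count_list ps P)" by(rule step.IH) (use step.prems in auto)
 ultimately show ?case unfolding e by(simp add:add.commute)
qed

end

text \<open>If all the elements \<open>z\<^sub>i = x + u\<^sub>i h\<close> have the same colength \<open>e\<close> as \<open>x\<close> in a one-dimensional local domain, one of
  them generates a reduction of \<open>(x, h)\<close>; comparing lengths, so does \<open>x\<close>.\<close>

locale reduction_setting = local_ring A q for A q :: "'k::field set" +
 fixes x h :: 'k and u :: "nat => 'k" and e :: nat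
 assumes xq:"x : q" and hq:"h : q" and uA:"!!i. u i : A" and udiff:"!!i j. i ~= j ==> u i - u j : A - q"
 and x0:"x ~= 0" and lenx:"len A A (x *o A) = of_nat e" and lenz:"!!i. len A A ((x + u i * h) *o A) = of_nat e" and e:"e >= 1"
begin

abbreviation z :: "nat => 'k" where "z i == x + u i * h"
abbreviation J :: "'k set" where "J == x *o A + h *o A"
abbreviation Jp :: "nat => 'k set" where "Jp n == ipow A J A n"

lemma AA:"smod A A" by(rule sm_self[OF sring])
lemma sJ:"smod A J" by(intro sm_plus sm_scaled AA)
lemma sJp:"smod A (Jp n)" by(rule sm_ipow[OF AA])
lemma xA:"x : A" and hA:"h : A" using xq hq m_le by auto
lemma JA:"J <= A" by(rule plus_le[OF AA scaled_le[OF AA xA] scaled_le[OF AA hA]])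
lemma JpA:"Jp n <= A" by(rule ipow_subset[OF AA JA])
lemma in_cyc:"a : a *o A" using scaledI[of 1 A a] sr_1[OF sring] by simp
lemma xJ:"x : J" by(rule subsetD[OF plus_ge1[OF sm_scaled[OF AA]] in_cyc])
lemma hJ:"h : J" by(rule subsetD[OF plus_ge2[OF sm_scaled[OF AA]] in_cyc])
lemma zJ:"z i : J" by(rule sm_add[OF sJ xJ sm_mult[OF sJ uA hJ]])
lemma zA:"z i : A" using zJ JA by blast
lemma J_step:"a : J ==> a *o Jp n <= Jp (Suc n)" by(auto simp:in_scaled intro:mul_in)

lemma cyc_sub:"smod A K ==> a : K ==> a *o A <= K" using sm_mult[of A K] by(auto simp:in_scaled mult.commute)

lemma J_two:"i ~= k ==> J = z k *o A + z i *o A" proof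
 assume ik:"i ~= k"
 let ?K = "z k *o A + z i *o A"
 have sK:"smod A ?K" by(intro sm_plus sm_scaled AA)
 have zk:"z k : ?K" by(rule subsetD[OF plus_ge1[OF sm_scaled[OF AA]] in_cyc])
 have zi:"z i : ?K" by(rule subsetD[OF plus_ge2[OF sm_scaled[OF AA]] in_cyc])
 obtain v where v:"v : A" "(u i - u k) * v = 1" using unit udiff[OF ik] by blast
 have "v * (z i - z k) : ?K" by(rule sm_mult[OF sK v(1) sm_diff[OF sring sK zi zk]])
 moreover have "v * (z i - z k) = h * ((u i - u k) * v)" by(simp add:algebra_simps)
 ultimately have hK:"h : ?K" using v(2) by simp
 have "z k - u k * h : ?K" by(rule sm_diff[OF sring sK zk sm_mult[OF sK uA hK]])
 hence xK:"x : ?K" by simp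
 show "J <= ?K" by(rule plus_le[OF sK cyc_sub[OF sK xK] cyc_sub[OF sK hK]])
 show "?K <= J" by(rule plus_le[OF sJ cyc_sub[OF sJ zJ] cyc_sub[OF sJ zJ]])
qed

text \<open>Any two of the z i generate J, since their difference is a unit times h. So modulo z k
  one factor J after the other can be replaced by a single z a.\<close>

lemma Jp_prod: assumes "finite I" "k ~: I" shows "Jp (card I) <= (PROD i:I. z i) *o A + z k *o Jp (card I - 1)"
 using assms proof(induction I rule:finite_induct)
 case empty
 show ?case by(simp, rule plus_ge1[OF sm_scaled[OF AA]])
next
 case (insert a I)
 let ?w = "PROD i:I. z i"
 let ?n = "card I"
 have IH:"Jp ?n <= ?w *o A + z k *o Jp (?n - 1)" using insert by auto
 have ne:"a ~= k" using insert.prems by auto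
 have "Jp (Suc ?n) = z k *o Jp ?n + z a *o Jp ?n" proof -
 have "Jp (Suc ?n) = mul A (z k *o A + z a *o A) (Jp ?n)"
 using arg_cong[OF J_two[OF ne], of "%K. mul A K (Jp ?n)"] by simp
 also have "... = z k *o Jp ?n + z a *o Jp ?n" by(simp add:mul_plus_left sm_scaled AA mul_cyclic sJp sring)
 finally show ?thesis .
 qed
 also have "... <= z k *o Jp ?n + z a *o (?w *o A + z k *o Jp (?n - 1))" by(rule plus_mono[OF order.refl scaled_mono[OF IH]])
 also have "... = (z k *o Jp ?n + z k *o (z a *o Jp (?n - 1))) + (z a * ?w) *o A"
 by(simp add:scaled_plus scaled2 mult.commute add_ac)
 also have "z k *o Jp ?n + z k *o (z a *o Jp (?n - 1)) = z k *o Jp ?n"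
 proof(rule plus_abs2[OF sm_scaled[OF sJp] sm_scaled[OF sm_scaled[OF sJp]] scaled_mono])
 show "z a *o Jp (?n - 1) <= Jp ?n" proof(cases "?n = 0")
 case True
 thus ?thesis using scaled_le[OF AA zA] by simp
 next
 case False
 thus ?thesis using J_step[OF zJ, of a "?n - 1"] by simp
 qed
 qed
 finally show ?case using insert by(simp add:add.commute)
qed

lemma len_Jp_fin:"len A A (Jp n) < \<infinity>" proof -
 have "x ^ n * 1 : Jp n" by(rule ipow_power_in[OF xJ sr_1[OF sring]])
 hence "(x ^ n) *o A <= Jp n" by(intro cyc_sub[OF sJp]) simp
 hence "len A A (Jp n) <= len A A ((x ^ n) *o A)" by(rule len_mono)
 also have "... = of_nat n * len A A (x *o A)" by(rule len_power_scaled[OF sring AA x0 scaled_le[OF AA xA]])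
 also have "... < \<infinity>" by(simp add:lenx of_nat_eq_enat)
 finally show ?thesis .
qed

lemma len_rank:"c : A ==> c ~= 0 ==> len A (Jp n) (c *o Jp n) = len A A (c *o A)"
 by(rule len_rank_one[OF sring AA sJp JpA len_Jp_fin _ scaled_le[OF AA] scaled_le[OF sJp], symmetric])

lemma z0:"z i ~= 0" proof
 assume "z i = 0"
 hence "z i *o A = {0}" using sm_0[OF AA] by(auto simp:in_scaled)
 hence l:"len A A {0} = of_nat e" using lenz[of i] by simp
 have "len A A ((x ^ Suc e) *o A) <= len A A {0}" by(rule len_mono) (use sm_0[OF sm_scaled[OF AA]] in auto)
 moreover have "len A A ((x ^ Suc e) *o A) = of_nat (Suc e) * len A A (x *o A)"
 by(rule len_power_scaled[OF sring AA x0 scaled_le[OF AA xA]])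
 ultimately have "Suc e * e <= e" unfolding l lenx by(simp add:of_nat_eq_enat)
 thus False using e by simp
qed

text \<open>J^e / q J^e has length at most l(J^e / x J^e) = e, so among the e + 1 products w k of e
  of the elements one is dependent on earlier ones modulo q J^e. Those are divisible by z k, and
  Nakayama gives J^e = z k J^(e-1). As x has the same colength e, also J^e = x J^(e-1).\<close>

theorem reduction:"h *o Jp (e - 1) <= x *o Jp (e - 1)" proof -
 define w where "w k = (PROD i:{..e} - {k}. z i)" for k
 have card:"card ({..e} - {k}) = e" if "k <= e" for k using that by simp
 have wJ:"w k : Jp e" if k:"k <= e" for k proof -
 have "(PROD i:I. z i) : Jp (card I)" if "finite I" for I using that proof(induction I rule:finite_induct)
 case empty show ?case using sr_1[OF sring] by simp
 next
 case (insert a I) thus ?case by(simp add:mul_in[OF zJ])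
 qed
 from this[of "{..e} - {k}"] show ?thesis unfolding w_def using card[OF k] by simp
 qed
 let ?N0 = "mul A q (Jp e)"
 define N where "N k = span A (w ` {..<k}) + ?N0" for k
 have sN0:"smod A ?N0" by(rule sm_mprod)
 have sN:"smod A (N k)" for k unfolding N_def by(rule sm_plus[OF sm_span sN0])
 have N0J:"?N0 <= Jp e" by(rule mul_subset[OF sJp m_le])
 have NJ:"N k <= Jp e" if "k <= Suc e" for k
 unfolding N_def by(rule plus_le[OF sJp span_least[OF sJp] N0J]) (use wJ that in auto)
 have Ninc:"N k <= N (Suc k)" for k unfolding N_def by(rule plus_mono[OF span_mono order.refl]) auto
 have "EX k<=e. w k : N k" proof(rule ccontr)
 assume no:"~ (EX k<=e. w k : N k)"
 have "N k ~= N (Suc k)" if "k < Suc e" for k proof -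
 have "w k : span A (w ` {..<Suc k})" by(rule subsetD[OF span_inc]) auto
 hence "w k : N (Suc k)" unfolding N_def by(rule subsetD[OF plus_ge1[OF sN0]])
 thus ?thesis using no that by(auto simp:less_Suc_eq_le)
 qed
 hence "{k. k < Suc e & N k ~= N (Suc k)} = {..<Suc e}" by auto
 moreover have "enat (card {k. k < Suc e & N k ~= N (Suc k)}) <= len A (Jp e) ?N0" proof(rule weak_chain_le_len)
 show "smod A (N k) & ?N0 <= N k & N k <= Jp e" if "k <= Suc e" for k
 using sN NJ[OF that] plus_ge2[OF sm_span] unfolding N_def by blast
 qed (rule Ninc)
 ultimately have "enat (Suc e) <= len A (Jp e) ?N0" by simp
 also have "... <= len A (Jp e) (x *o Jp e)" by(rule len_mono[OF scaled_subset_mprod[OF xq]])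
 also have "... = enat e" using len_rank[OF xA x0] lenx by(simp add:of_nat_eq_enat)
 finally show False by simp
 qed
 then obtain k where k:"k <= e" "w k : N k" by blast
 let ?K = "z k *o Jp (e - 1)"
 have sK:"smod A ?K" by(rule sm_scaled[OF sJp])
 have "w i : ?K" if i:"i < k" for i proof -
 have "k : {..e} - {i}" using k i by simp
 hence "w i = z k * (PROD j:{..e} - {i} - {k}. z j)" unfolding w_def by(intro prod.remove) auto
 moreover have "(PROD j:{..e} - {i} - {k}. z j) : Jp (e - 1)" proof -
 have "(PROD i:I. z i) : Jp (card I)" if "finite I" for I using that proof(induction I rule:finite_induct)
 case empty show ?case using sr_1[OF sring] by simp
 next
 case (insert a I) thus ?case by(simp add:mul_in[OF zJ])
 qed
 from this[of "{..e} - {i} - {k}"] show ?thesis using k i by(simp add:card_Diff_singleton)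
 qed
 ultimately show ?thesis by(metis scaledI)
 qed
 hence "N k <= ?K + ?N0" unfolding N_def by(intro plus_mono span_least[OF sK] order.refl) auto
 hence wk:"w k : ?K + ?N0" using k by blast
 have sKN:"smod A (?K + ?N0)" by(rule sm_plus[OF sK sN0])
 have "Jp e <= w k *o A + ?K" using Jp_prod[of "{..e} - {k}" k] card[OF k(1)] by(simp add:w_def)
 also have "... <= ?K + ?N0" by(rule plus_le[OF sKN cyc_sub[OF sKN wk] plus_ge1[OF sN0]])
 finally have JK:"Jp e <= ?K" by(rule nakayama[OF fg_ipow[OF fg_self[OF sring] JA] sK])
 have e1:"Suc (e - 1) = e" using e by simp
 have KJ:"?K <= Jp e" using J_step[OF zJ, of k "e - 1"] unfolding e1 .
 have eq:"Jp e = ?K" using JK KJ by blast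
 have xJ': "x *o Jp (e - 1) <= Jp e" using J_step[OF xJ, of "e - 1"] unfolding e1 .
 have Jd:"Jp e <= Jp (e - 1)" by(rule ipow_antimono[OF AA JA]) simp
 have sx:"smod A (x *o Jp (e - 1))" by(rule sm_scaled[OF sJp])
 have l1:"len A (Jp (e - 1)) (Jp e) = enat e" unfolding eq using len_rank[OF zA z0] lenz by(simp add:of_nat_eq_enat)
 have l2:"len A (Jp (e - 1)) (x *o Jp (e - 1)) = enat e" using len_rank[OF xA x0] lenx by(simp add:of_nat_eq_enat)
 have "len A (Jp (e - 1)) (x *o Jp (e - 1)) = len A (Jp (e - 1)) (Jp e) + len A (Jp e) (x *o Jp (e - 1))"
 by(rule len_add[OF sring sJp xJ' Jd sJp sx])
 hence l3:"enat e = enat e + len A (Jp e) (x *o Jp (e - 1))" unfolding l1 l2 .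
 have "len A (Jp e) (x *o Jp (e - 1)) = 0" proof(cases "len A (Jp e) (x *o Jp (e - 1))")
 case (enat c)
 thus ?thesis using l3 by(simp add:zero_enat_def)
 next
 case infinity
 thus ?thesis using l3 by simp
 qed
 hence "Jp e = x *o Jp (e - 1)" using len_eq_0_iff[OF sJp sx xJ'] by blast
 thus ?thesis using J_step[OF hJ, of "e - 1"] unfolding e1 by blast
qed

end

section \<open>The structure of slices without a gain\<close>

lemma count_list_filter:"Q a ==> count_list (filter Q xs) a = count_list xs a" by(induction xs) auto

lemma count_list_full:"length xs <= count_list xs a ==> b : set xs ==> b = a" proof(induction xs)
 case (Cons c xs)
 have "count_list xs a <= length xs" by(rule count_le_length)
 thus ?case using Cons by(auto split:if_splits)
qed simp

context surf
begin

context fixes S :: "'k set" and h z :: 'k assumes S:"adm S" and h:"h : S" and z:"z = x + y * h"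
begin

lemmas facts = fS[OF S h z] sr[OF S h z] sSS[OF S h z] sRS[OF S h z] yS[OF S h z] xS[OF S h z] zS[OF S h z] RS[OF S h z]
lemmas toR1 = toR[OF S h z] and sc1 = sc[OF S h z] and scS1 = scS[OF S h z]

definition sat :: "'k set => 'k set" where "sat Z = {s:S. EX k. y ^ k * s : Z}"

lemma ypS:"y ^ k : S" by(rule sr_power[OF facts(2,5)])

lemma sm_sat:"smod S Z ==> smod S (sat Z)" unfolding sat_def by(rule sm_saturation[OF facts(2,5)])

lemma sat_S:"sat Z <= S" by(auto simp:sat_def)

lemma sat_saturated:"s : S ==> y * s : sat Z ==> s : sat Z" proof -
 assume s:"s : S" "y * s : sat Z"
 then obtain k where "y ^ k * (y * s) : Z" by(auto simp:sat_def)
 hence "y ^ Suc k * s : Z" by(simp add:mult_ac)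
 thus ?thesis unfolding sat_def using s(1) by blast
qed

lemma sat_superset:"Z <= S ==> Z <= sat Z" by(auto simp:sat_def intro!: exI[of _ 0])

lemma sat_mono:"Z <= Z' ==> sat Z <= sat Z'" by(auto simp:sat_def)

text \<open>For T = S this is the length of S / (y, z) S, at most e. Along a filtration of S / z S
  it grows by at least one with every prime not containing y.\<close>

definition mu :: "'k set => enat" where "mu T = len R T (y *o T + z *o S)"

text \<open>Saturation makes the lengths additive: an element y t of \<open>sat Z\<close> with t in
  \<open>sat Z'\<close> has t in \<open>sat Z\<close>. The increment is positive by
  Nakayama.\<close>

lemma mu_step: assumes Z:"smod S Z" "smod S Z'" "Z <= Z'" "z *o S <= Z" "Z' <= S"
 shows "mu (sat Z') = len R (sat Z') (sat Z + y *o sat Z') + mu (sat Z)"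
 and "sat Z ~= sat Z' ==> 1 <= len R (sat Z') (sat Z + y *o sat Z')" proof -
 let ?T = "sat Z" and ?T' = "sat Z'"
 have sT:"smod S ?T" "smod S ?T'" by(rule sm_sat[OF Z(1)], rule sm_sat[OF Z(2)])
 have TT:"?T <= ?T'" by(rule sat_mono[OF Z(3)])
 have zT:"z *o S <= ?T" using Z(4) sat_superset[of Z] Z(3,5) by blast
 have sy:"smod S (y *o ?T')" "smod S (y *o ?T)" by(rule sm_scaled[OF sT(2)], rule sm_scaled[OF sT(1)])
 have yT': "y *o ?T' <= ?T'" by(rule scaled_le[OF sT(2) facts(5)])
 let ?N = "y *o ?T' + z *o S"
 have sN:"smod S ?N" by(rule sm_plus[OF sy(1) sc1])
 have e:"?T + y *o ?T' = ?T + ?N" proof -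
 have "?T + ?N = (?T + z *o S) + y *o ?T'" by(simp only:add_ac)
 thus ?thesis by(simp only:plus_abs2[OF sT(1) sc1 zT])
 qed
 have sub:"?T + y *o ?T' <= ?T'" by(rule plus_le[OF sT(2) TT yT'])
 have sTy:"smod S (?T + y *o ?T')" by(rule sm_plus[OF sT(1) sy(1)])
 have NT:"?N <= ?T + y *o ?T'" unfolding e by(rule plus_ge2[OF sT(1)])
 have "mu ?T' = len R ?T' (?T + y *o ?T') + len R (?T + y *o ?T') ?N"
 unfolding mu_def by(rule len_add[OF sring toR1[OF sTy] NT sub toR1[OF sT(2)] toR1[OF sN]])
 also have "len R (?T + y *o ?T') ?N = len R ?T (?T Int ?N)"
 unfolding e by(rule len_plus_Int[OF sring toR1[OF sT(1)] toR1[OF sN]])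
 also have "?T Int ?N = y *o ?T + z *o S" proof
 show "y *o ?T + z *o S <= ?T Int ?N"
 using plus_le[OF sT(1) scaled_le[OF sT(1) facts(5)] zT] plus_mono[OF scaled_mono[OF TT, of y] order.refl, of "z *o S"] by blast
 show "?T Int ?N <= y *o ?T + z *o S" proof
 fix w assume w:"w : ?T Int ?N"
 hence "w : ?N" by blast
 then obtain u v where uv:"w = u + v" "u : y *o ?T'" "v : z *o S" by(rule set_plus_elim)
 obtain t where t:"u = y * t" "t : ?T'" using uv(2) by(auto simp:in_scaled)
 have "w - v : ?T" using w uv(3) zT by(intro sm_diff[OF facts(2) sT(1)]) auto
 hence "y * t : ?T" using uv(1) t(1) by simp
 moreover have "t : S" using t(2) sat_S by blast
 ultimately have "t : ?T" by(rule sat_saturated[rotated])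
 thus "w : y *o ?T + z *o S" unfolding uv(1) t(1) using uv(3) by(intro set_plus_intro scaledI)
 qed
 qed
 finally show "mu ?T' = len R ?T' (?T + y *o ?T') + mu ?T" by(simp add:mu_def)
 assume ne:"?T ~= ?T'"
 have "?T + y *o ?T' ~= ?T'" proof
 assume "?T + y *o ?T' = ?T'"
 hence "?T' <= ?T + y *o ?T'" by simp
 hence "?T' <= ?T" by(rule nakayama_elem[OF fg_sub[OF fin_fg[OF facts(1)] toR1[OF sT(2)] sat_S] toR1[OF sT(1)] ym])
 thus False using ne TT by blast
 qed
 thus "1 <= len R ?T' (?T + y *o ?T')" using sub by(intro len_ge_1[OF toR1[OF sT(2)] toR1[OF sTy]]) blast
qed

text \<open>The second clause sharpens the count. When the last prime P without y is added, the
  saturation before it equals P, so this step contributes the whole length of S / (P + y S) instead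
  of just 1.\<close>

lemma filtration_count: assumes "pfilt S (z *o S) Z' ps"
 shows "enat (length (filter (%P. y ~: P) ps)) <= mu (sat Z') &
 (sat Z' = S --> (ALL P rest. filter (%P. y ~: P) ps = P # rest --> enat (length rest) + len R S (P + y *o S) <= mu S))"
 using assms proof(induction rule:pfilt.induct)
 case base
 show ?case by(simp add:zero_enat_def[symmetric])
next
 case (step Z' ps a P)
 have f:"smod S Z'" "z *o S <= Z'" "Z' <= S" using pfilt_facts[OF step.hyps(1) facts(2) sc1 scS1[OF facts(7)]] by auto
 let ?Z = "Z' + a *o S"
 have sZ:"smod S ?Z" by(rule sm_plus[OF f(1) sc1])
 have ZZ:"Z' <= ?Z" by(rule plus_ge1[OF sc1])
 have ZS:"?Z <= S" by(rule plus_le[OF facts(3) f(3) scS1[OF step.hyps(2)]])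
 have P:"smod S P" "P <= S" using step.hyps(4) by(auto simp:prime_in_def)
 show ?case proof(cases "y : P")
 case True
 have "sat ?Z <= sat Z'" proof
 fix s assume "s : sat ?Z"
 then obtain k where k:"y ^ k * s : ?Z" "s : S" by(auto simp:sat_def)
 from k(1) obtain u v where uv:"y ^ k * s = u + v" "u : Z'" "v : a *o S" by(rule set_plus_elim)
 then obtain b where b:"v = a * b" "b : S" by(auto simp:in_scaled)
 have "y ^ Suc k * s = y * (y ^ k * s)" by simp
 also have "... = y * u + b * (y * a)" unfolding uv(1) b(1) by(simp add:algebra_simps)
 finally have e:"y ^ Suc k * s = y * u + b * (y * a)" .
 have ya:"y * a : Z'" using True step.hyps(3) by simp
 have "y ^ Suc k * s : Z'" unfolding e
 by(rule sm_add[OF f(1) sm_mult[OF f(1) facts(5) uv(2)] sm_mult[OF f(1) b(2) ya]])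
 thus "s : sat Z'" unfolding sat_def using k(2) by blast
 qed
 hence "sat ?Z = sat Z'" using sat_mono[OF ZZ] by blast
 thus ?thesis using step.IH True by simp
 next
 case False
 have ne:"sat Z' ~= sat ?Z" proof
 assume eq:"sat Z' = sat ?Z"
 have "a : ?Z" using plus_ge2[OF f(1), of "a *o S"] scaledI[of 1 S a] sr_1[OF facts(2)] by auto
 hence "a : sat Z'" unfolding eq using sat_superset[OF ZS] by blast
 then obtain k where "y ^ k * a : Z'" by(auto simp:sat_def)
 hence "y ^ k : P" using step.hyps(3) ypS by simp
 thus False using prime_in_power[OF facts(2) step.hyps(4) facts(5)] False by blast
 qed
 note st = mu_step(1)[OF f(1) sZ ZZ f(2) ZS] mu_step(2)[OF f(1) sZ ZZ f(2) ZS ne]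
 have "enat (Suc (length (filter (%P. y ~: P) ps))) = 1 + enat (length (filter (%P. y ~: P) ps))" by(simp add:one_enat_def)
 also have "... <= mu (sat ?Z)" unfolding st(1) using step.IH by(intro add_mono st(2)) blast
 finally have 1:"enat (length (filter (%P. y ~: P) (P # ps))) <= mu (sat ?Z)" using False by simp
 have 2:"enat (length rest) + len R S (Q + y *o S) <= mu S" if full:"sat ?Z = S" and fl:"filter (%P. y ~: P) (P # ps) = Q # rest" for Q rest
 proof -
 have Q:"Q = P" "rest = filter (%P. y ~: P) ps" using fl False by auto
 have "sat Z' = P" proof(intro equalityI subsetI)
 fix u assume "u : sat Z'"
 then obtain k where k:"y ^ k * u : Z'" "u : S" by(auto simp:sat_def)
 have "a * (y ^ k * u) : Z'" by(rule sm_mult[OF f(1) step.hyps(2) k(1)])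
 hence "(y ^ k * u) * a : Z'" by(simp add:mult.commute)
 hence "y ^ k * u : P" using step.hyps(3) sr_mult[OF facts(2) ypS k(2)] by simp
 hence "y ^ k : P | u : P" using prime_inD[OF step.hyps(4)] ypS k(2) by blast
 thus "u : P" using prime_in_power[OF facts(2) step.hyps(4) facts(5)] False by blast
 next
 fix p assume p:"p : P"
 have "1 : sat ?Z" unfolding full by(rule sr_1[OF facts(2)])
 then obtain k where "y ^ k : ?Z" by(auto simp:sat_def)
 then obtain u v where uv:"y ^ k = u + v" "u : Z'" "v : a *o S" by(rule set_plus_elim)
 then obtain b where b:"v = a * b" "b : S" by(auto simp:in_scaled)
 have pa:"p * a : Z'" using p step.hyps(3) by simp
 have pS:"p : S" using p P by blast
 have "p * u + b * (p * a) : Z'" by(rule sm_add[OF f(1) sm_mult[OF f(1) pS uv(2)] sm_mult[OF f(1) b(2) pa]])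
 moreover have "y ^ k * p = p * u + b * (p * a)" unfolding uv(1) b(1) by(simp add:algebra_simps)
 ultimately have "y ^ k * p : Z'" by(simp only:)
 thus "p : sat Z'" unfolding sat_def using pS by blast
 qed
 hence "mu S = len R S (P + y *o S) + mu (sat Z')" using st(1) full by simp
 moreover have "enat (length rest) <= mu (sat Z')" using step.IH Q by simp
 ultimately show ?thesis using Q(1) by(simp add:add.commute add_left_mono)
 qed
 show ?thesis using 1 2 by blast
 qed
qed

text \<open>e occurrences of P use up the whole of mu S \<le> e. This leaves no room for another
  prime without y, nor for a length of S / (P + y S) above 1.\<close>

lemma filtration_structure: assumes ps:"pfilt S (z *o S) S ps" and P:"P : set ps" "y ~: P" "e <= count_list ps P"
 shows "count_list ps P = e" "!!P'. P' : set ps ==> y ~: P' ==> P' = P" "len R S (P + y *o S) = 1" proof -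
 let ?f = "filter (%P. y ~: P) ps"
 have satS:"sat S = S" using sat_S sat_superset[of S] by blast
 obtain P1 rest where fl:"?f = P1 # rest" using P by(cases ?f) (auto simp:filter_empty_conv)
 have P1:"P1 : set ps" "y ~: P1" proof -
 have "P1 : set ?f" unfolding fl by simp
 thus "P1 : set ps" "y ~: P1" by auto
 qed
 have pr:"prime_in S P1" "z *o S <= P1" using pfilt_primes[OF ps facts(2) sc1 scS1[OF facts(7)] P1(1)] by auto
 have muS:"mu S <= enat e" unfolding mu_def using len_zy[OF S h z] by(simp add:add.commute)
 have b:"enat (length rest) + len R S (P1 + y *o S) <= enat e"
 using filtration_count[OF ps] fl satS muS order_trans by metis
 have sP1:"smod S (P1 + y *o S)" using pr(1) by(intro sm_plus sc1) (simp add:prime_in_def)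
 have ge1:"1 <= len R S (P1 + y *o S)" proof(rule len_ge_1[OF facts(4) toR1[OF sP1]])
 have "P1 + y *o S <= S" using pr(1) by(intro plus_le[OF facts(3)] scS1[OF facts(5)]) (simp add:prime_in_def)
 moreover have "1 ~: P1 + y *o S" by(rule y_not_absorbed[OF S h z pr P1(2)])
 ultimately show "P1 + y *o S < S" using sr_1[OF facts(2)] by blast
 qed
 obtain w where w:"len R S (P1 + y *o S) = enat w" using b by(cases "len R S (P1 + y *o S)") auto
 have w1:"w >= 1" "length rest + w <= e" using ge1 b unfolding w by(auto simp:one_enat_def)
 have lf:"length ?f <= e" using w1 fl by simp
 have cf:"count_list ?f P = count_list ps P" by(rule count_list_filter) (rule P(2))
 have "count_list ?f P <= length ?f" by(rule count_le_length)
 thus c:"count_list ps P = e" using lf cf P(3) by linarith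
 have full:"b = P" if "b : set ?f" for b by(rule count_list_full[OF _ that]) (use lf cf P(3) in linarith)
 thus "P' = P" if "P' : set ps" "y ~: P'" for P' using that by auto
 have "P1 = P" by(rule full) (simp add:fl)
 moreover have "w = 1" using w1 fl lf cf c `count_list ?f P <= length ?f` by simp
 ultimately show "len R S (P + y *o S) = 1" using w by(simp add:one_enat_def)
qed

text \<open>Length one makes P + y S a maximal R-submodule of S. It does not contain 1, so S = R + P
  + y S, and Nakayama removes y S.\<close>

lemma uniformizer: assumes P:"prime_in S P" "z *o S <= P" "y ~: P" "len R S (P + y *o S) = 1"
 shows "S <= R + P" "mul R m S <= P + y *o S" proof -
 have sP:"smod S P" "P <= S" using P by(auto simp:prime_in_def)
 let ?K = "P + y *o S"
 have sK:"smod R ?K" by(rule toR1[OF sm_plus[OF sP(1) sc1]])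
 have KS:"?K <= S" by(rule plus_le[OF facts(3) sP(2) scS1[OF facts(5)]])
 have max:"A = ?K | A = S" if A:"smod R A" "?K <= A" "A <= S" for A proof(rule ccontr)
 assume no:"~ ?thesis"
 have "len R S ?K = len R S A + len R A ?K" by(rule len_add[OF sring A facts(4) sK])
 moreover have "1 <= len R S A" using no A by(intro len_ge_1[OF facts(4) A(1)]) blast
 moreover have "1 <= len R A ?K" using no A by(intro len_ge_1[OF A(1) sK]) blast
 ultimately have "1 + 1 <= (1 :: enat)" using P(4) add_mono by metis
 thus False by(simp add:one_enat_def)
 qed
 have sRK:"smod R (R + ?K)" by(rule sm_plus[OF sm_R sK])
 have "R + ?K = S" proof -
 have "R + ?K = ?K | R + ?K = S" by(rule max[OF sRK plus_ge2[OF sm_R] plus_le[OF facts(4) facts(8) KS]])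
 moreover have "1 : R + ?K" using plus_ge1[OF sK, of R] sr_1[OF sring] by blast
 moreover have "1 ~: ?K" by(rule y_not_absorbed[OF S h z P(1-3)])
 ultimately show ?thesis by metis
 qed
 hence "S <= (R + P) + y *o S" by(simp add:add.assoc)
 thus "S <= R + P" by(rule nakayama_elem[OF fin_fg[OF facts(1)] sm_plus[OF sm_R toR1[OF sP(1)]] ym])
 have mS:"mul R m S <= S" using ipow_fin[OF facts(1) m_le, of 1] by simp
 have sA:"smod R (?K + mul R m S)" by(rule sm_plus[OF sK sm_mprod])
 have "?K + mul R m S = ?K | ?K + mul R m S = S" by(rule max[OF sA plus_ge1[OF sm_mprod] plus_le[OF facts(4) KS mS]])
 moreover have "?K + mul R m S ~= S" proof
 assume "?K + mul R m S = S"
 hence "S <= ?K" using nakayama[OF fin_fg[OF facts(1)] sK] by blast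
 thus False using y_not_absorbed[OF S h z P(1-3)] sr_1[OF facts(2)] by blast
 qed
 ultimately show "mul R m S <= ?K" using plus_ge2[OF sK, of "mul R m S"] by blast
qed

end

lemma noeth_fin:"fin S ==> noeth S S" proof -
 assume f:"fin S"
 have "noeth R S" by(rule fg_noeth[OF sring noeth_ring fin_fg[OF f]])
 thus ?thesis unfolding noeth_def using sm_sub[OF _ finD(2)[OF f]] by blast
qed

lemma fin_almost:"fin S ==> S <= almost R" proof
 fix s assume f:"fin S" and s:"s : S"
 obtain d where d:"d : R" "d ~= 0" "d *o S <= R" using f by(auto simp:fin_def)
 have "d * s ^ j : R" for j using d(3) sr_power[OF finD(1)[OF f] s, of j] by blast
 thus "s : almost R" unfolding almost_def using d by blast
qed

text \<open>The span of all f^i g^j has the product of the two denominators as common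
  denominator.\<close>

lemma fin_of_powers: assumes "f : almost R" "g : almost R" shows "EX S'. fin S' & f : S' & g : S'" proof -
 obtain a b where ab:"a : R" "b : R" "a ~= 0" "b ~= 0" "!!j. a * f ^ j : R" "!!j. b * g ^ j : R"
 using assms by(auto simp:almost_def)
 let ?G = "{f ^ i * g ^ j | i j. True}"
 let ?S = "span R ?G"
 have sS:"smod R ?S" by(rule sm_span)
 have G:"f ^ i * g ^ j : ?S" for i j by(rule subsetD[OF span_inc]) blast
 have 1:"?S <= {u. u * v : ?S}" if "v : ?S" for v proof(rule span_least)
 show "smod R {u. u * v : ?S}" using sS by(auto simp:smod_def distrib_right mult.assoc)
 show "?G <= {u. u * v : ?S}" proof
 fix u assume "u : ?G"
 then obtain i j where u:"u = f ^ i * g ^ j" by blast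
 have "?S <= {v. u * v : ?S}" proof(rule span_least)
 show "smod R {v. u * v : ?S}" using sS by(auto simp:smod_def distrib_left mult.left_commute)
 have "u * (f ^ k * g ^ l) : ?S" for k l using G[of "i + k" "j + l"] by(simp add:u power_add mult_ac)
 thus "?G <= {v. u * v : ?S}" by blast
 qed
 thus "u : {u. u * v : ?S}" using that by blast
 qed
 qed
 have one:"1 : ?S" using G[of 0 0] by simp
 have "sring ?S" unfolding sring_def using one 1 sm_diff[OF sring sS] by blast
 moreover have "R <= ?S" using sm_mult[OF sS _ one] by auto
 moreover have "(a * b) *o ?S <= R" proof -
 have "?S <= {u. (a * b) * u : R}" proof(rule span_least)
 show "smod R {u. (a * b) * u : R}" using sm_R by(auto simp:smod_def distrib_left mult.left_commute)
 have "(a * b) * (f ^ i * g ^ j) : R" for i j using sr_mult[OF sring ab(5)[of i] ab(6)[of j]] by(simp add:mult_ac)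
 thus "?G <= {u. (a * b) * u : R}" by blast
 qed
 thus ?thesis by(auto simp:in_scaled)
 qed
 moreover have "a * b : R" "a * b ~= 0" using ab sr_mult[OF sring] by auto
 ultimately have "fin ?S" unfolding fin_def by blast
 moreover have "f : ?S" "g : ?S" using G[of 1 0] G[of 0 1] by simp_all
 ultimately show ?thesis by blast
qed

text \<open>Some finite extension S' contains x f and y^L f. Then f lies in \<open>star S'\<close>,
  which is finite again.\<close>

lemma almost_if_parameters: assumes "x * f : almost R" "y ^ L * f : almost R" shows "f : almost R" proof -
 obtain S' where S': "fin S'" "x * f : S'" "y ^ L * f : S'" using fin_of_powers[OF assms] by blast
 have sr:"sring S'" "x : S'" "y : S'" using finD[OF S'(1)] by auto
 have "x ^ Suc L * f : S'" using sr_mult[OF sr(1) sr_power[OF sr(1,2), of L] S'(2)] by(simp add:mult_ac)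
 moreover have "y ^ Suc L * f : S'" using sr_mult[OF sr(1) sr(3) S'(3)] by(simp add:mult_ac)
 ultimately have "f : star S'" unfolding star_def by blast
 moreover have "fin (star S')" using adm_star(1)[OF S'(1)] by(simp add:adm_def)
 ultimately show ?thesis using fin_almost by blast
qed

text \<open>Without a gain \<open>gd_if_few\<close> cannot apply, so some prime not containing y
  occurs at least e times, and \<open>filtration_structure\<close> does the rest.\<close>

lemma special: assumes ng:"~ gd R" and S:"adm S" and h:"h : S" and z:"z = x + y * h"
 shows "EX ps P. pfilt S (z *o S) S ps & prime_in S P & z *o S <= P & y ~: P & count_list ps P = e &
 (ALL P':set ps. y ~: P' --> P' = P) & len R S (P + y *o S) = 1" proof -
 note f = facts[OF S h z]
 obtain ps where ps:"pfilt S (z *o S) S ps" using pfilt_ex[OF f(2) noeth_fin[OF f(1)] sc1[OF S h z] scS1[OF S h z f(7)]] by blast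
 have "~ gd S" using gd_descends[OF f(1)] ng by blast
 then obtain P where P:"P : set ps" "y ~: P" "e <= count_list ps P"
 using gd_if_few[OF S h z ps] e2 by(metis Suc_leI Suc_pred' less_le_trans not_le not_less_eq_eq one_less_numeral_iff pos2 semiring_norm(76))
 show ?thesis
 using ps filtration_structure[OF S h z ps P] pfilt_primes[OF ps f(2) sc1[OF S h z] scS1[OF S h z f(7)] P(1)] P(2) by blast
qed

end

section \<open>Without a gain, x and y generate m\<close>

context surf
begin

text \<open>Slice along x + y^(i+1) h for h in P. The exceptional prime of such a slice lies in P
  and so equals P by \<open>escape\<close>; hence all these elements have colength e in the
  localization at P. By \<open>reduction\<close>, g = h / x stabilizes a power of (x, h) there.
  Clearing denominators by some T outside P makes T g almost integral, and (x, T) contains a power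
  of y, so \<open>almost_if_parameters\<close> applies to g.\<close>

lemma quotient_almost: assumes ng:"~ gd R" and S:"adm S"
 shows "EX P. prime_in S P & S <= R + P & mul R m S <= P + y *o S & (ALL h:P. h / x : almost R)" proof -
 have f:"fin S" using S by(simp add:adm_def)
 note sr = finD(1)[OF f] and sS = finD(3)[OF f] and sRS = finD(4)[OF f] and RS = finD(2)[OF f]
 have z0:"x = x + y * 0" by simp
 have zero:"0 : S" using sm_0[OF sS] .
 obtain ps P where ps:"pfilt S (x *o S) S ps" and P:"prime_in S P" "x *o S <= P" "y ~: P"
 and cnt:"count_list ps P = e" and oth:"!!P'. P' : set ps ==> y ~: P' ==> P' = P" and w:"len R S (P + y *o S) = 1"
 using special[OF ng S zero z0] by blast
 have sP:"smod S P" "P <= S" using P by(auto simp:prime_in_def)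
 have sx:"smod S (z *o S)" for z by(rule sm_scaled[OF sS])
 have xP:"x : P" using P(2) scaledI[of 1 S x] sr_1[OF sr] by auto
 have ypS:"y ^ k : S" for k by(rule sr_power[OF sr finD(6)[OF f]])
 interpret L: loc_at S P by unfold_locales (rule sr, rule noeth_fin[OF f], rule P(1))
 have B_S:"s : P" if sl:"s : S" "s : L.loc P" for s proof -
 obtain v t where v:"s = v / t" "v : P" "t : S" "t ~: P" using sl(2) by(rule L.locE)
 have "s * t = v" using v(1) L.denom_nz[OF v(4)] by simp
 hence "s * t : P" using v(2) by simp
 thus ?thesis using prime_inD[OF P(1) _ sl(1) v(3)] v(4) by blast
 qed
 have lenx:"len L.B L.B (x *o L.B) = of_nat e"
 using L.len_pfilt[OF ps sx scaled_le[OF sS finD(5)[OF f]]] oth P(3) unfolding cnt L.loc_scaled by blast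
 have almost:"h / x : almost R" if h:"h : P" for h proof -
 have hS:"h : S" using h sP by blast
 have lenz:"len L.B L.B ((x + y ^ Suc i * h) *o L.B) = of_nat e" for i proof -
 let ?z = "x + y ^ Suc i * h"
 have z:"?z = x + y * (y ^ i * h)" by(simp add:mult.assoc)
 have hi:"y ^ i * h : S" by(rule sr_mult[OF sr ypS hS])
 obtain qs P1 where qs:"pfilt S (?z *o S) S qs" and P1:"prime_in S P1" "?z *o S <= P1" "y ~: P1"
 and cnt1:"count_list qs P1 = e" and oth1:"!!P'. P' : set qs ==> y ~: P' ==> P' = P1"
 using special[OF ng S hi z] by blast
 have zP:"?z : P" by(rule sm_add[OF sP(1) xP sm_mult[OF sP(1) ypS h]])
 have zPS:"?z *o S <= P" using sm_mult[OF sP(1) _ zP] by(auto simp:in_scaled mult.commute)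
 have zS:"?z : S" using zP sP by blast
 have "~ S <= P" using P(1) sr_1[OF sr] by(auto simp:prime_in_def)
 then obtain P2 where P2:"P2 : set qs" "P2 <= P" using pfilt_below[OF qs P(1) zPS sr sx scaled_le[OF sS zS]] by blast
 hence P12:"P1 <= P" using oth1[OF P2(1)] P(3) by blast
 have "P1 = P" proof(rule ccontr)
 assume "P1 ~= P"
 then obtain s where s:"s : P" "s ~: P1" using P12 by blast
 have "?z : P1" using P1(2) scaledI[of 1 S ?z] sr_1[OF sr] by auto
 hence "escape S P1 y" by(rule escapeS[OF S hi z P1(1) _ P1(3)])
 then obtain k where k:"y ^ k : P1 + s *o S" using s sP unfolding escape_def by blast
 have "P1 + s *o S <= P"
 by(rule plus_le[OF sP(1) P12]) (use sm_mult[OF sP(1) _ s(1)] in \<open>auto simp:in_scaled mult.commute\<close>)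
 thus False using k prime_in_power[OF sr P(1) finD(6)[OF f]] P(3) by blast
 qed
 have np:"~ P' <= P" if "P' : set qs" "P' ~= P" for P' using oth1[OF that(1)] that(2) P(3) `P1 = P` by blast
 have "len L.B (L.loc S) (L.loc (?z *o S)) = of_nat (count_list qs P)"
 by(rule L.len_pfilt[OF qs sx scaled_le[OF sS zS] np])
 thus ?thesis using cnt1 `P1 = P` unfolding L.loc_scaled by simp
 qed
 have ud:"y ^ Suc i - y ^ Suc j : L.B - L.loc P" if ij:"i < j" for i j proof -
 have S1:"y ^ Suc i - y ^ Suc j : S" by(rule sr_diff[OF sr ypS ypS])
 moreover have "y ^ Suc i - y ^ Suc j ~: P" proof
 assume a:"y ^ Suc i - y ^ Suc j : P"
 have "y ^ Suc i - y ^ Suc j = y ^ Suc i * (1 - y * y ^ (j - i - 1))"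
 using ij by(simp add:right_diff_distrib mult.assoc[symmetric] flip: power_add power_Suc)
 hence "y ^ Suc i * (1 - y * y ^ (j - i - 1)) : P" using a by simp
 moreover have yy:"1 - y * y ^ (j - i - 1) : S"
 by(intro sr_diff[OF sr] sr_mult[OF sr] sr_1[OF sr] ypS finD(6)[OF f])
 ultimately have "y ^ Suc i : P | 1 - y * y ^ (j - i - 1) : P" using prime_inD[OF P(1) _ ypS yy] by blast
 hence "1 - y * y ^ (j - i - 1) : P" using prime_in_power[OF sr P(1) finD(6)[OF f]] P(3) by blast
 hence "(1 - y * y ^ (j - i - 1)) + y * y ^ (j - i - 1) : P + y *o S" using ypS by(intro set_plus_intro scaledI)
 thus False using y_not_absorbed[OF S zero z0 P] by simp
 qed
 ultimately show ?thesis using B_S L.SB by blast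
 qed
 have ud2:"y ^ Suc i - y ^ Suc j : L.B - L.loc P" if "i ~= j" for i j proof(cases "i < j")
 case False
 define c where "c = y ^ Suc j - y ^ Suc i"
 have c:"c : L.B" "c ~: L.loc P" using ud[of j i] that False unfolding c_def by auto
 have e1:"y ^ Suc i - y ^ Suc j = - c" by(simp add:c_def)
 have "- c : L.B" by(rule sr_uminus[OF L.sr_B c(1)])
 moreover have "- c ~: L.loc P" using sm_uminus[OF L.sr_B L.B.sm_m, of "- c"] c(2) by auto
 ultimately show ?thesis unfolding e1 by blast
 qed (rule ud)
 interpret Rd: reduction_setting L.B "L.loc P" x h "%i. y ^ Suc i" e proof
 show "x : L.loc P" "h : L.loc P" using xP h L.subset_loc by blast+
 show "y ^ Suc i : L.B" for i using ypS L.SB by blast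
 show "i ~= j ==> y ^ Suc i - y ^ Suc j : L.B - L.loc P" for i j by(rule ud2)
 show "x ~= 0" by(rule x_nonzero)
 show "len L.B L.B (x *o L.B) = of_nat e" by(rule lenx)
 show "len L.B L.B ((x + y ^ Suc i * h) *o L.B) = of_nat e" for i by(rule lenz)
 show "e >= 1" using e2 by simp
 qed
 let ?J = "Rd.Jp (e - 1)"
 define g where "g = h / x"
 have gJ:"g * v : ?J" if v:"v : ?J" for v proof -
 have "h * v : x *o ?J" using Rd.reduction v by blast
 then obtain v' where v': "h * v = x * v'" "v' : ?J" by(auto simp:in_scaled)
 hence "g * v = v'" using x_nonzero by(simp add:g_def field_simps)
 thus ?thesis using v'(2) by simp
 qed
 let ?M = "S Int ?J"
 have sM:"smod R ?M" by(intro sm_Int sRS sm_sub[OF Rd.sJp]) (use RS L.SB in blast)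
 obtain G where G:"finite G" "?M = span R G" using fg_sub[OF fin_fg[OF f] sM] by(auto simp:fg_def)
 have GM:"G <= ?M" unfolding G(2) by(rule span_inc)
 have "ALL v:G. EX t. t : S & t ~: P & t * (g * v) : S" proof
 fix v assume "v : G"
 hence "g * v : L.B" using GM gJ Rd.JpA by blast
 then obtain s t where "g * v = s / t" "s : S" "t : S" "t ~: P" by(rule L.locE)
 thus "EX t. t : S & t ~: P & t * (g * v) : S" using L.denom_nz by(intro exI[of _ t]) simp
 qed
 then obtain t where t:"ALL v:G. t v : S & t v ~: P & t v * (g * v) : S" by(rule bchoice[THEN exE])
 define T where "T = (PROD v:G. t v)"
 have T:"T : S & T ~: P" proof -
 have "(PROD v:F. t v) : S & (PROD v:F. t v) ~: P" if "finite F" "F <= G" for F using that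
 proof(induction F rule:finite_induct)
 case empty
 show ?case using sr_1[OF sr] P(1) by(auto simp:prime_in_def)
 next
 case (insert a F)
 thus ?case using L.denom_mult t by simp
 qed
 thus ?thesis unfolding T_def using G(1) by blast
 qed
 have TM:"(T * g) * v : ?M" if v:"v : ?M" for v proof -
 have "span R G <= {v. (T * g) * v : ?M}" proof(rule span_least)
 show "smod R {v. (T * g) * v : ?M}" using sM by(auto simp:smod_def distrib_left mult.left_commute)
 show "G <= {v. (T * g) * v : ?M}" proof
 fix v assume v:"v : G"
 have "T = t v * (PROD v:G - {v}. t v)" unfolding T_def by(rule prod.remove[OF G(1) v])
 hence e1:"(T * g) * v = (PROD v:G - {v}. t v) * (t v * (g * v))" by(simp add:mult_ac)
 have "(PROD v:F. t v) : S" if "finite F" "F <= G" for F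
 using that by(induction F rule:finite_induct) (use t sr_1[OF sr] sr_mult[OF sr] in auto)
 hence pS:"(PROD v:G - {v}. t v) : S" using G(1) by blast
 have tS:"t v * (g * v) : S" using t v by blast
 have "(T * g) * v : S" unfolding e1 by(rule sr_mult[OF sr pS tS])
 have TB:"T : L.B" using T L.SB by blast
 have gv:"g * v : ?J" by(rule gJ) (use GM v in blast)
 have "T * (g * v) : ?J" by(rule sm_mult[OF Rd.sJp TB gv])
 thus "v : {v. (T * g) * v : ?M}" using `(T * g) * v : S` by(simp add:mult.assoc)
 qed
 qed
 thus ?thesis using v G(2) by blast
 qed
 \<comment> \<open>This nonzero element lies in the module stable under T g, so d x^(e-1) is one
   denominator for all powers of T g.\<close>
 have "x ^ (e - 1) * 1 : ?J" by(rule ipow_power_in[OF Rd.xJ sr_1[OF L.sr_B]])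
 hence xM:"x ^ (e - 1) : ?M" using sr_power[OF sr finD(5)[OF f]] by simp
 have pM:"(T * g) ^ j * x ^ (e - 1) : ?M" for j proof(induction j)
 case (Suc j)
 show ?case using TM[OF Suc] by(simp add:mult.assoc)
 qed (use xM in simp)
 obtain d where d:"d : R" "d ~= 0" "d *o S <= R" using f by(auto simp:fin_def)
 have "(d * x ^ (e - 1)) * (T * g) ^ j : R" for j proof -
 have "d * ((T * g) ^ j * x ^ (e - 1)) : R" using d(3) pM[of j] by blast
 thus ?thesis by(simp add:mult_ac)
 qed
 moreover have "d * x ^ (e - 1) : R" "d * x ^ (e - 1) ~= 0" using sr_mult[OF sring d(1) x_pow] d(2) x_nonzero by simp_all
 ultimately have Tg:"T * g : almost R" unfolding almost_def by blast
 \<comment> \<open>Powers of the set {y} let \<open>pfilt_ipow\<close> produce a power of y in x S +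
   T S: \<open>escape\<close> handles P, and the other primes contain y.\<close>
 have "EX n. ipow S {y} S n <= x *o S + T *o S"
 proof(rule pfilt_ipow[OF ps sr sx scaled_le[OF sS finD(5)[OF f]] sx scaled_le[OF sS]])
 show "T : S" using T by simp
 show "{y} <= S" using finD(6)[OF f] by simp
 fix P' assume P': "P' : set ps"
 have y_ipow:"ipow S {y} S n <= K" if K:"smod S K" "y ^ n : K" for n K proof -
 have "ipow S {y} S n <= (y ^ n) *o S" proof(induction n)
 case (Suc n)
 have "mul S {y} (ipow S {y} S n) <= (y ^ Suc n) *o S" proof(rule mul_least[OF sx])
 fix i v assume i:"i : {y}" and "v : ipow S {y} S n"
 hence "v : (y ^ n) *o S" using Suc by blast
 then obtain s where "v = y ^ n * s" "s : S" by(auto simp:in_scaled)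
 with i show "i * v : (y ^ Suc n) *o S" by(simp add:mult.assoc[symmetric] scaledI)
 qed
 thus ?case by simp
 qed simp
 also have "... <= K" using sm_mult[OF K(1) _ K(2)] by(auto simp:in_scaled mult.commute)
 finally show ?thesis .
 qed
 have sP': "smod S P'" using pfilt_primes[OF ps sr sx scaled_le[OF sS finD(5)[OF f]] P'] by(simp add:prime_in_def)
 have sK:"smod S (P' + T *o S)" by(rule sm_plus[OF sP' sx])
 show "EX n. ipow S {y} S n <= P' + T *o S" proof(cases "y : P'")
 case True
 hence "y ^ 1 : P' + T *o S" using plus_ge1[OF sx, of P' T] by auto
 thus ?thesis using y_ipow[OF sK] by blast
 next
 case False
 hence "P' = P" by(rule oth[OF P'])
 moreover have "escape S P y" by(rule escapeS[OF S zero z0 P(1) xP P(3)])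
 ultimately obtain k where "y ^ k : P' + T *o S" using T unfolding escape_def by blast
 thus ?thesis using y_ipow[OF sK] by blast
 qed
 qed
 then obtain n where n:"ipow S {y} S n <= x *o S + T *o S" by blast
 have "y ^ n * 1 : ipow S {y} S n" by(rule ipow_power_in[OF _ sr_1[OF sr]]) simp
 hence "y ^ n : x *o S + T *o S" using n by auto
 then obtain u v where "y ^ n = u + v" "u : x *o S" "v : T *o S" by(rule set_plus_elim)
 then obtain a b where ab:"y ^ n = x * a + T * b" "a : S" "b : S" by(auto simp:in_scaled)
 have xg:"x * g = h" using x_nonzero by(simp add:g_def)
 have "y ^ n * g = a * h + b * (T * g)" unfolding ab(1) xg[symmetric] by(simp add:algebra_simps)
 moreover have "a * h : almost R" "b : almost R" using fin_almost[OF f] ab sr_mult[OF sr ab(2) hS] by blast+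
 ultimately have "y ^ n * g : almost R" using almost_add[OF sring] almost_mult[OF sring _ Tg] by metis
 moreover have "x * g : almost R" unfolding xg using fin_almost[OF f] hS by blast
 ultimately have "g : almost R" by(rule almost_if_parameters[rotated])
 thus ?thesis by(simp add:g_def)
 qed
 show ?thesis using P(1) uniformizer[OF S zero z0 P w] almost by blast
qed

text \<open>If r = x^N f with f almost integral, then d r^a lies in m^(N a) for all a. So the length
  of R / m^(N a) is at most c N a^2 up to linear terms, with c depending only on r; against the
  multiplicity e this bounds N.\<close>

lemma Inter_almost: assumes r:"r : R" "!!N. r : (x ^ N) *o almost R" shows "r = 0" proof(rule ccontr)
 assume r0:"r ~= 0"
 obtain c where c:"!!n. len R R (r *o R + mR n) <= enat (c * n)" using quot[OF r(1) r0] by blast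
 obtain C' where C': "!!n. enat (e * n ^ 2) <= 2 * len R R (mR n) + enat (C' * n)" using lower by blast
 \<comment> \<open>Chosen so that the final inequality e N \<le> 2 c fails.\<close>
 define N where "N = Suc (2 * c)"
 obtain f where f:"f : almost R" "r = x ^ N * f" using r(2)[of N] by(auto simp:in_scaled)
 obtain d where d:"d : R" "d ~= 0" "!!j. d * f ^ j : R" using f(1) by(auto simp:almost_def)
 obtain c' where c': "!!n. len R R (d *o R + mR n) <= enat (c' * n)" using quot[OF d(1,2)] by blast
 have sc:"smod R (u *o R)" for u by(rule sm_scaled[OF sm_R])
 have "(e * N ^ 2) * a ^ 2 <= (2 * c * N) * a ^ 2 + (2 * c' * N + C' * N) * a" for a proof -
 let ?L = "N * a"
 have ra:"r ^ a : R" by(rule sr_power[OF sring r(1)])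
 have "len R R (mR ?L) = len R R (d *o R + mR ?L) + len R (d *o R + mR ?L) (mR ?L)"
 by(rule len_add[OF sring sm_plus[OF sc sm_mR] plus_ge2[OF sc]
 plus_le[OF sm_R scaled_le[OF sm_R d(1)] ipow_subset[OF sm_R m_le]] sm_R sm_mR])
 also have "len R (d *o R + mR ?L) (mR ?L) = len R R {s:R. d * s : mR ?L}" by(rule len_scaled[OF sring sm_R sm_mR])
 also have "... <= len R R ((r ^ a) *o R + mR ?L)" proof(rule len_mono, rule plus_le)
 show "smod R {s:R. d * s : mR ?L}" using sm_R sm_mR[of ?L] by(auto simp:smod_def distrib_left mult.left_commute)
 show "mR ?L <= {s:R. d * s : mR ?L}" using ipow_subset[OF sm_R m_le, of ?L] sm_mult[OF sm_mR d(1)] by blast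
 show "(r ^ a) *o R <= {s:R. d * s : mR ?L}" proof
 fix s assume "s : (r ^ a) *o R"
 then obtain b where b:"b : R" "s = r ^ a * b" by(auto simp:in_scaled)
 have "d * s = x ^ ?L * ((d * f ^ a) * b)" by(simp add:b(2) f(2) power_mult_distrib power_mult mult_ac)
 moreover have "x ^ ?L * ((d * f ^ a) * b) : mR ?L" by(rule ipow_power_in[OF xm sr_mult[OF sring d(3) b(1)]])
 ultimately have "d * s : mR ?L" by(simp only:)
 moreover have "s : R" unfolding b(2) by(rule sr_mult[OF sring ra b(1)])
 ultimately show "s : {s:R. d * s : mR ?L}" by blast
 qed
 qed
 also have "... <= of_nat a * len R R (r *o R + mR ?L)"
 by(rule len_power_le[OF sring sm_R sm_mR ipow_subset[OF sm_R m_le] scaled_le[OF sm_R r(1)] scaled_le[OF sm_mR r(1)]])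
 also have "... <= of_nat a * enat (c * ?L)" by(rule mult_left_mono[OF c]) simp
 finally have "len R R (mR ?L) <= len R R (d *o R + mR ?L) + of_nat a * enat (c * ?L)" by(simp add:add_left_mono)
 hence "len R R (mR ?L) <= enat (c' * ?L) + of_nat a * enat (c * ?L)"
 by(rule order_trans[OF _ add_right_mono[OF c']])
 hence "2 * len R R (mR ?L) <= 2 * enat (c' * ?L + a * (c * ?L))" by(intro mult_left_mono) (simp_all add:of_nat_eq_enat)
 hence "enat (e * ?L ^ 2) <= 2 * enat (c' * ?L + a * (c * ?L)) + enat (C' * ?L)"
 using C'[of ?L] by(meson add_right_mono order_trans)
 hence "e * ?L ^ 2 <= 2 * (c' * ?L + a * (c * ?L)) + C' * ?L" by(simp add:numeral_eq_enat)
 thus ?thesis by(simp add:power_mult_distrib power2_eq_square algebra_simps)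
 qed
 hence "e * N ^ 2 <= 2 * c * N" by(rule quad_le)
 hence "(e * N) * N <= (2 * c) * N" by(simp only:power2_eq_square mult.assoc)
 moreover have "N > 0" by(simp add:N_def)
 ultimately have "e * N <= 2 * c" by(simp only:mult_le_cancel2)
 moreover have "N <= e * N" using e2 by simp
 ultimately show False by(simp add:N_def)
qed

lemma regular_length: assumes m:"m <= Q" shows "2 * len R R (mR n) <= enat (n * (n + 1))" proof -
 have mQ:"m = Q" using m Q_m by blast
 let ?q = "%n. ipow R Q R n"
 have sq:"smod R (?q n)" for n by(rule sm_ipow[OF sm_R])
 have qSuc:"?q (Suc n) = x *o ?q n + y *o ?q n" for n by(simp add:mul_plus_left sm_scaled sm_R mul_cyclic sq sring)
 have qdec:"?q (Suc n) <= ?q n" for n by(rule ipow_antimono[OF sm_R Q_R]) simp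
 have sc:"smod R (z *o ?q n)" "smod R (z *o R)" for z n by(rule sm_scaled[OF sq], rule sm_scaled[OF sm_R])
 have q2:"?q (Suc n) <= x *o ?q n + (y ^ Suc n) *o R" for n proof(induction n)
 case 0
 show ?case using qSuc[of 0] by simp
 next
 case (Suc n)
 have "?q (Suc (Suc n)) = x *o ?q (Suc n) + y *o ?q (Suc n)" by(rule qSuc)
 also have "... <= x *o ?q (Suc n) + y *o (x *o ?q n + (y ^ Suc n) *o R)" by(rule plus_mono[OF order.refl scaled_mono[OF Suc]])
 also have "... = (x *o ?q (Suc n) + x *o (y *o ?q n)) + (y ^ Suc (Suc n)) *o R"
 by(simp add:scaled_plus scaled2 add.assoc mult_ac)
 also have "x *o ?q (Suc n) + x *o (y *o ?q n) = x *o ?q (Suc n)" proof(rule plus_abs2[OF sc(1)])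
 show "smod R (x *o (y *o ?q n))" by(rule sm_scaled[OF sc(1)])
 show "x *o (y *o ?q n) <= x *o ?q (Suc n)" unfolding qSuc by(rule scaled_mono[OF plus_ge2[OF sc(1)]])
 qed
 finally show ?case .
 qed
 have grad:"len R (?q n) (?q (Suc n)) <= enat (Suc n)" for n proof(induction n)
 case 0
 have "?q (Suc 0) = Q" using qSuc[of 0] by simp
 thus ?case using len_residue mQ by(simp add:one_enat_def)
 next
 case (Suc n)
 let ?W = "x *o ?q n + ?q (Suc (Suc n))"
 have sW:"smod R ?W" by(rule sm_plus[OF sc(1) sq])
 have xq:"x *o ?q n <= ?q (Suc n)" unfolding qSuc[of n] by(rule plus_ge1[OF sc(1)])
 have Wq:"?W <= ?q (Suc n)" by(rule plus_le[OF sq xq qdec])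
 have yq:"(y ^ k) *o R <= ?q k" for k proof -
 have "y : Q" using mQ ym by simp
 thus ?thesis using ipow_power_in[of y Q _ R k R] by(auto simp:in_scaled)
 qed
 have yW:"(y ^ Suc n) *o R + ?W = ?q (Suc n)" proof
 show "(y ^ Suc n) *o R + ?W <= ?q (Suc n)" by(rule plus_le[OF sq yq Wq])
 have "?q (Suc n) <= (y ^ Suc n) *o R + x *o ?q n" using q2[of n] by(simp add:add.commute)
 also have "... <= (y ^ Suc n) *o R + ?W" by(rule plus_mono[OF order.refl plus_ge1[OF sq]])
 finally show "?q (Suc n) <= (y ^ Suc n) *o R + ?W" .
 qed
 have "len R (?q (Suc n)) ?W = len R R {s:R. y ^ Suc n * s : ?W}"
 using len_scaled[OF sring sm_R sW, of "y ^ Suc n"] unfolding yW .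
 also have "... <= len R R m" proof(rule len_mono, rule subsetI)
 fix s assume s:"s : m"
 have "y ^ Suc n * 1 : ?q (Suc n)" using yq[of "Suc n"] sr_1[OF sring] by blast
 hence "s * (y ^ Suc n * 1) : ?q (Suc (Suc n))" using s mQ mul_in[of s Q "y ^ Suc n * 1" "?q (Suc n)" R] by simp
 hence "y ^ Suc n * s : ?W" using plus_ge2[OF sc(1), of "?q (Suc (Suc n))" x n] by(auto simp:mult.commute)
 thus "s : {s:R. y ^ Suc n * s : ?W}" using s m_le by blast
 qed
 finally have 1:"len R (?q (Suc n)) ?W <= 1" by(simp add:len_residue)
 have "len R ?W (?q (Suc (Suc n))) = len R (?q n) {q:?q n. x * q : ?q (Suc (Suc n))}" by(rule len_scaled[OF sring sq sq])
 also have "... <= len R (?q n) (?q (Suc n))" proof(rule len_mono, rule subsetI)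
 fix q assume q:"q : ?q (Suc n)"
 have "x * q : ?q (Suc (Suc n))" using q mQ xm mul_in[of x Q q "?q (Suc n)" R] by simp
 thus "q : {q:?q n. x * q : ?q (Suc (Suc n))}" using q qdec by blast
 qed
 finally have 2:"len R ?W (?q (Suc (Suc n))) <= enat (Suc n)" using Suc by(rule order_trans)
 have "len R (?q (Suc n)) (?q (Suc (Suc n))) = len R (?q (Suc n)) ?W + len R ?W (?q (Suc (Suc n)))"
 by(rule len_add[OF sring sW plus_ge2[OF sc(1)] Wq sq sq])
 also have "... <= 1 + enat (Suc n)" by(rule add_mono[OF 1 2])
 finally show ?case by(simp add:one_enat_def)
 qed
 have "2 * len R R (?q n) <= enat (n * (n + 1))" proof(induction n)
 case (Suc n)
 have "len R R (?q (Suc n)) = len R R (?q n) + len R (?q n) (?q (Suc n))"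
 by(rule len_add[OF sring sq qdec ipow_subset[OF sm_R Q_R] sm_R sq])
 hence "2 * len R R (?q (Suc n)) = 2 * len R R (?q n) + 2 * len R (?q n) (?q (Suc n))" by(simp only:distrib_left)
 also have "... <= enat (n * (n + 1)) + 2 * enat (Suc n)" by(rule add_mono[OF Suc mult_left_mono[OF grad]]) simp
 also have "... = enat (Suc n * (Suc n + 1))" by(simp add:numeral_eq_enat algebra_simps)
 finally show ?case .
 qed (simp add:zero_enat_def[symmetric])
 thus ?thesis using mQ by simp
qed

text \<open>Otherwise every almost integral element is r + x c with r in R and c almost integral,
  and every element of m has this form with r in Q. Iterating, m lies in Q + x^N times the closure,
  for every N. Chevalley and \<open>Inter_almost\<close> put the part of R divisible by a high power
  of x in the closure into m^2, so m = Q by Nakayama. Then R is regular and e \<le> 1.\<close>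

theorem gd_R:"gd R" proof(rule ccontr)
 assume ng:"~ gd R"
 have aR:"R <= almost R" by(rule fin_almost[OF fin_R])
 have aadd:"u + v : almost R" if "u : almost R" "v : almost R" for u v by(rule almost_add[OF sring that])
 have aS:"smod R (almost R)" unfolding smod_def proof(intro conjI ballI)
 show "0 : almost R" using aR sr_0[OF sring] by blast
 qed (use aadd almost_mult[OF sring] aR in blast)+
 have split:"EX r:R. EX c:almost R. f = r + x * c" if f:"f : almost R" for f proof -
 obtain S' where S': "fin S'" "f : S'" using fin_of_powers[OF f f] by blast
 have ad:"adm (star S')" "S' <= star S'" by(rule adm_star[OF S'(1)])+
 obtain P where P:"star S' <= R + P" "ALL h:P. h / x : almost R" using quotient_almost[OF ng ad(1)] by blast
 have "f : R + P" using P(1) ad(2) S'(2) by blast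
 then obtain r h where rh:"f = r + h" "r : R" "h : P" by(rule set_plus_elim)
 have "f = r + x * (h / x)" using rh(1) x_nonzero by simp
 thus ?thesis using rh P(2) by blast
 qed
 have in0:"EX q:Q. EX c:almost R. r = q + x * c" if r:"r : m" for r proof -
 have ad:"adm (star R)" "R <= star R" by(rule adm_star[OF fin_R])+
 have fs:"fin (star R)" using ad(1) by(simp add:adm_def)
 obtain P where P:"prime_in (star R) P" "star R <= R + P" "mul R m (star R) <= P + y *o star R" "ALL h:P. h / x : almost R"
 using quotient_almost[OF ng ad(1)] by blast
 have sP:"smod (star R) P" using P(1) by(simp add:prime_in_def)
 have "r * 1 : mul R m (star R)" by(rule mul_in[OF r sr_1[OF finD(1)[OF fs]]])
 hence "r : P + y *o star R" using P(3) by auto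
 then obtain p u where pu:"r = p + u" "p : P" "u : y *o star R" by(rule set_plus_elim)
 then obtain s where s:"u = y * s" "s : star R" by(auto simp:in_scaled)
 have "s : R + P" using s(2) P(2) by blast
 then obtain r1 p1 where rp:"s = r1 + p1" "r1 : R" "p1 : P" by(rule set_plus_elim)
 have hP:"p + y * p1 : P" by(intro sm_add[OF sP] sm_mult[OF sP] pu rp finD(6)[OF fs])
 have "x * ((p + y * p1) / x) = p + y * p1" using x_nonzero by simp
 hence "r = y * r1 + x * ((p + y * p1) / x)" unfolding pu(1) s(1) rp(1) by(simp add:algebra_simps)
 moreover have "y * r1 : Q" using rp(2) plus_ge2[OF sm_scaled[OF sm_R], of "y *o R" x] by blast
 ultimately show ?thesis using P(4) hP by blast
 qed
 have inN:"EX q:Q. EX c:almost R. r = q + x ^ Suc N * c" if r:"r : m" for r N proof(induction N)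
 case 0
 show ?case using in0[OF r] by simp
 next
 case (Suc N)
 then obtain q c where qc:"q : Q" "c : almost R" "r = q + x ^ Suc N * c" by blast
 obtain r' c' where c': "r' : R" "c' : almost R" "c = r' + x * c'" using split[OF qc(2)] by blast
 have "r = (q + x * (x ^ N * r')) + x ^ Suc (Suc N) * c'" unfolding qc(3) c'(3) by(simp add:algebra_simps)
 moreover have "x * (x ^ N * r') : Q"
 using plus_ge1[OF sm_scaled[OF sm_R], of "x *o R" y] sr_mult[OF sring x_pow c'(1)] by blast
 ultimately show ?case using sm_add[OF sm_Q qc(1)] c'(2) by blast
 qed
 define F where "F k = R Int (x ^ k) *o almost R" for k
 have "EX k. F k <= (\<Inter>k. F k) + ipow R m R 2" proof(rule chevalley[OF fg_self[OF sring]])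
 show "smod R (F k)" for k unfolding F_def by(intro sm_Int sm_R sm_scaled aS)
 show "F k <= R" for k by(auto simp:F_def)
 show "F (Suc k) <= F k" for k proof -
 have "(x ^ Suc k) *o almost R = (x ^ k) *o (x *o almost R)" by(simp add:scaled2 mult.commute)
 also have "... <= (x ^ k) *o almost R" by(rule scaled_mono[OF scaled_le[OF aS xR]])
 finally show ?thesis by(auto simp:F_def)
 qed
 qed
 then obtain k where "F k <= (\<Inter>k. F k) + ipow R m R 2" by blast
 moreover have "(\<Inter>k. F k) <= {0}" using Inter_almost unfolding F_def by blast
 ultimately have Fk:"F k <= mR 2" using plus_mono[of "\<Inter>k. F k" "{0}" "mR 2" "mR 2"] by auto
 have m1:"mul R m R = m" by(rule mul_R[OF sm_m])
 have mR2:"mR 2 = mul R m m" by(simp add:numeral_2_eq_2 m1)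
 have FSk:"F (Suc k) <= F k" proof -
 have "(x ^ Suc k) *o almost R = (x ^ k) *o (x *o almost R)" by(simp add:scaled2 mult.commute)
 also have "... <= (x ^ k) *o almost R" by(rule scaled_mono[OF scaled_le[OF aS xR]])
 finally show ?thesis by(auto simp:F_def)
 qed
 have "m <= Q + mul R m m" proof
 fix r assume r:"r : m"
 obtain q c where qc:"q : Q" "c : almost R" "r = q + x ^ Suc k * c" using inN[OF r] by blast
 have "r - q : R" using r qc(1) m_le Q_R by(intro sr_diff[OF sring]) auto
 hence "x ^ Suc k * c : R" using qc(3) by simp
 hence "x ^ Suc k * c : F (Suc k)" unfolding F_def using qc(2) by blast
 hence "x ^ Suc k * c : mul R m m" using FSk Fk mR2 by blast
 thus "r : Q + mul R m m" unfolding qc(3) by(rule set_plus_intro[OF qc(1)])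
 qed
 hence mQ:"m <= Q" by(rule nakayama[OF fg_sub[OF fg_self[OF sring] sm_m m_le] sm_Q])
 obtain C' where C': "!!n. enat (e * n ^ 2) <= 2 * len R R (mR n) + enat (C' * n)" using lower by blast
 have "e * n ^ 2 <= 1 * n ^ 2 + (1 + C') * n" for n proof -
 have "enat (e * n ^ 2) <= enat (n * (n + 1)) + enat (C' * n)"
 using C'[of n] add_right_mono[OF regular_length[OF mQ, of n]] by(rule order_trans)
 thus ?thesis by(simp add:power2_eq_square algebra_simps)
 qed
 hence "e <= 1" by(rule quad_le)
 thus False using e2 by simp
qed

end

text \<open>If the claim failed, P0 would be a counterexample with A0 the whole ring, since
  \<open>bad_one\<close> is excluded. Then \<open>rf\<close> is the fraction field of the ring
  modulo P0, and the image under \<open>frc\<close> is an instance of \<open>surf\<close>.\<close>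

lemma (in local_type2) lech_below_prime: fixes P :: "'a set"
 assumes comp:"complete_local_ring U m" and P:"prime_in U P" "~ lin P" and e:"e >= 2"
 and xy:"x : m" "y : m" "mpow N <= (P + x *o U) + y *o U"
 and mult:"mult_ge P e" "mult_le P ((P + x *o U) + y *o U) e" shows "lech_below P (e - 1)" proof(rule ccontr)
 assume "~ lech_below P (e - 1)"
 hence "bad_two P" unfolding bad_two_def using comp P e xy mult local_type2_axioms by blast
 hence ex:"EX P :: 'a set. bad_two P" by blast
 have "~ bad_one A P" for A P :: "'a set" using escape_general[of A P] unfolding bad_one_def by blast
 hence no:"~ (EX A P :: 'a set. bad_one A P)" by blast
 have "chosen A0 (P0 :: 'a set)" by(rule chosen)
 hence A0:"A0 = (U :: 'a set)" and bad:"bad_two (P0 :: 'a set)"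
 unfolding chosen_def if_not_P[OF no] using ex by blast+
 from bad obtain m :: "'a set" and x y N e where b:"complete_local_ring U m" "local_type2 m" "~ local_type.lin m P0" "e >= 2" "x : m" "y : m"
 "local_type.mult_ge m P0 e" "ipow U m U N <= (P0 + x *o U) + y *o U"
 "mult_le P0 ((P0 + x *o U) + y *o U) e" "~ local_type2.lech_below m P0 (e - 1)" "prime_in U (P0 :: 'a set)"
 unfolding bad_two_def by blast
 interpret T: local_type2 m by(rule b(2))
 let ?I = "(P0 + x *o U) + y *o U"
 have sP:"smod U (P0 :: 'a set)" using b(11) by(simp add:prime_in_def)
 have fadd:"frc ` (UU + V) = frc ` UU + frc ` V" for UU V :: "'a set"
 by(force simp:A0 frc_add elim!: set_plus_elim intro:set_plus_intro)
 have fsc:"frc ` (a *o U) = frc a *o frc ` U" for a :: 'a by(force simp:A0 frc_mult in_scaled)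
 have fP:"frc ` P0 = {0 :: 'a rf}"  proof -
 have "frc p = 0" if "p : P0" for p :: 'a using frc_eq_0_iff[of p] that by(simp add:A0)
 thus ?thesis using image_constant[of 0 P0 "%_. 0"] zero_P0 by(auto simp:image_iff intro!: bexI[of _ 0])
 qed
 have fpow:"ipow (frc ` U) (frc ` UU) (frc ` U) n = frc ` ipow U UU U n" for UU :: "'a set" and n
 by(rule frac_ipow[symmetric]) (simp_all add:A0)
 have flen:"len (frc ` U) (frc ` U) (frc ` UU) = len U U (UU + P0)" if "smod U UU" for UU :: "'a set"
 using len_frac[of U U UU] that by(simp add:A0)
 have fI:"frc ` ?I = frc x *o frc ` U + frc y *o frc ` U" by(simp add:fadd fsc fP)
 have comp': "complete_local_ring (frc ` (U :: 'a set)) (frc ` m)" by(rule complete_local_ring_frac[OF b(1)]) (simp add:A0)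
 interpret C: complete_local_ring "frc ` (U :: 'a set)" "frc ` m" by(rule comp')
 obtain C0 where C0:"!!n. 2 * len U U (ipow U ?I U n + P0) <= enat (e * n ^ 2 + C0 * n)"
 using b(9) unfolding mult_le_def by blast
 interpret surf "frc ` (U :: 'a set)" "frc ` m" "frc x" "frc y" e N C0 proof
 show "frc x : frc ` m" "frc y : frc ` m" using b by auto
 show "ipow (frc ` U) (frc ` m) (frc ` U) N <= frc x *o frc ` U + frc y *o frc ` U"
 unfolding fpow fI[symmetric] by(rule image_mono[OF b(8)])
 show "2 * len (frc ` U) (frc ` U) (ipow (frc ` U) (frc x *o frc ` U + frc y *o frc ` U) (frc ` U) n)
 <= enat (e * n ^ 2 + C0 * n)" for n unfolding fI[symmetric] fpow flen[OF sm_ipow[OF sm_U]] by(rule C0)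
 show "EX C. ALL n. len (frc ` U) (frc ` U) (d *o frc ` U + ipow (frc ` U) (frc ` m) (frc ` U) n) <= enat (C * n)"
 if d:"d : frc ` U" "d ~= 0" for d proof -
 obtain c :: 'a where c:"d = frc c" using d(1) by blast
 hence cP:"c ~: P0" using d(2) frc_eq_0_iff[of c] by(simp add:A0)
 have sc:"smod U (c *o U)" by(simp add:sm_scaled)
 have "c : P0 + c *o U" using plus_ge2[OF sP, of "c *o U"] scaledI[of 1 U c] by auto
 hence "P0 < P0 + c *o U" using cP plus_ge1[OF sc, of P0] by blast
 hence "T.lin (P0 + c *o U)" by(rule T.lin_above[OF b(11) sm_plus[OF sP sc]])
 then obtain C where C:"!!n. len U U (T.mpow n + (P0 + c *o U)) <= enat (C * n)" unfolding T.lin_def by blast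
 have "len (frc ` U) (frc ` U) (d *o frc ` U + ipow (frc ` U) (frc ` m) (frc ` U) n) <= enat (C * n)" for n proof -
 have "d *o frc ` U + ipow (frc ` U) (frc ` m) (frc ` U) n = frc ` (c *o U + T.mpow n)"
 unfolding c fpow fsc[symmetric] fadd ..
 thus ?thesis using C[of n] flen[OF sm_plus[OF sc T.sm_mpow], of n] by(simp add:add_ac)
 qed
 thus ?thesis by blast
 qed
 show "EX C. ALL n. enat (e * n ^ 2) <= 2 * len (frc ` U) (frc ` U) (ipow (frc ` U) (frc ` m) (frc ` U) n) + enat (C * n)"
 using b(7) unfolding fpow T.mult_ge_def flen[OF T.sm_mpow] .
 show "e >= 2" by(rule b(4))
 qed
 have "gd (frc ` U)" by(rule gd_R)
 then obtain C where C:"!!I M. smod (frc ` U) I ==> I <= frc ` U ==> mR M <= I ==>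
 EX X l. (EX C'. ALL n. 2 * len (frc ` U) (frc ` U) (ipow (frc ` U) I (frc ` U) n) <= enat (X * n ^ 2 + C' * n)) &
 len (frc ` U) (frc ` U) (mul (frc ` U) I (frc ` U)) = enat l & X <= 2 * (e - 1) * (l + C * M)"
 unfolding gd_def by blast
 have "T.lech_below P0 (e - 1)" unfolding T.lech_below_def proof(rule exI[of _ C], intro allI impI)
 fix I :: "'a set" and M assume I:"smod U I" "T.mpow M <= I"
 have sI:"smod (frc ` U) (frc ` I)" by(rule sm_frac[OF I(1)]) (simp_all add:A0)
 have MI:"mR M <= frc ` I" unfolding fpow by(rule image_mono[OF I(2)])
 obtain X l C' where X:"!!n. 2 * len (frc ` U) (frc ` U) (ipow (frc ` U) (frc ` I) (frc ` U) n) <= enat (X * n ^ 2 + C' * n)"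
 "len (frc ` U) (frc ` U) (mul (frc ` U) (frc ` I) (frc ` U)) = enat l" "X <= 2 * (e - 1) * (l + C * M)"
 using C[OF sI _ MI] by blast
 have "mult_le P0 I X" using X(1) unfolding mult_le_def fpow flen[OF sm_ipow[OF sm_U]] by blast
 moreover have "len U U (I + P0) = enat l" using X(2) unfolding mul_R[OF sI] flen[OF I(1)] .
 ultimately show "EX X l. mult_le P0 I X & len U U (I + P0) = enat l & X <= 2 * (e - 1) * (l + C * M)"
 using X(3) by blast
 qed
 thus False using b(10) by blast
qed

theorem theorem3p4:
  fixes m :: "'a::comm_ring_1 set"
  assumes "noetherian TYPE('a)"
    and "local_ring_max m"
    and "krull_dim_eq TYPE('a) 2"
    and "madic_complete m"
    and "serre_R0 TYPE('a)"
    and "hs_mult 2 m > 1"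
  shows "\<exists>\<epsilon>>0. \<forall>I. m_primary m I \<longrightarrow>
           hs_mult 2 I \<le> 2 * (hs_mult 2 m - \<epsilon>) * real (quot_length I)"
proof -
 have loc:"local_ring U m" by(rule local_ring_if_local_ring_max[OF assms(1,2)])
 interpret local_type2 m by(intro local_type2.intro local_type.intro local_type2_axioms.intro loc assms(3))
 have comp:"complete_local_ring U m"
 by(intro complete_local_ring.intro complete_local_ring_axioms.intro loc complete_at_if_madic_complete[OF assms(4) sm_m])
 show ?thesis by(rule hs_mult_below[OF assms(5,6)]) (rule lech_below_prime[OF comp])
qed
end
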